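(* Let $B$ be a unital algebra over $\mathbb{C}$ and let $(\mathcal{A}, E_{\mathcal{A}}, \varepsilon)$ be a $B$-$B$-non-commutative probability space. If $\{(A_k^\ell, A_k^r, C_k', D_k')\}_{k\in K}$ is a bi-free ffb $B$-system in $(\mathcal{A}, E_{\mathcal{A}}, \varepsilon)$, then the family $\Gamma=\{(A_k^\ell, A_k^r, \mathrm{alg}(C_k'D_k'))\}_{k\in K}$ is free-free-Boolean independent with amalgamation over $B$.
   Context: $B$ is a unital algebra over $\mathbb{C}$. For subsets $X,Y$ of an algebra, $XY=\{xy: x\in X,y\in Y\}$, powers of sets are defined likewise, and $\mathrm{alg}(\cdot)$ denotes the (not necessarily unital) subalgebra generated by the indicated set or sets. **$B$-$B$-non-commutative probability space.** A triple $(\mathcal{A},E_{\mathcal{A}},\varepsilon)$ where $\mathcal{A}$ is a unital algebra, $\varepsilon:B\otimes B^{\mathrm{op}}\to\mathcal{A}$ is a unital homomorphism whose restrictions to $B\otimes 1_B$ and $1_B\otimes B$ are injective, and $E_{\mathcal{A}}:\mathcal{A}\to B$ is linear with $E_{\mathcal{A}}(\varepsilon(b_1\otimes b_2)T)=b_1E_{\mathcal{A}}(T)b_2$ and $E_{\mathcal{A}}(T\varepsilon(b\otimes 1_B))=E_{\mathcal{A}}(T\varepsilon(1_B\otimes b))$ for all $b,b_1,b_2\in B$, $T\in\mathcal{A}$. Write $L_b=\varepsilon(b\otimes 1_B)$, $R_b=\varepsilon(1_B\otimes b)$, $\mathcal{A}_\ell=\{T: TR_b=R_bT\ \forall b\in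 B\}$, $\mathcal{A}_r=\{T: TL_b=L_bT\ \forall b\in B\}$. **Bimodules.** A $B$-$B$-bimodule with a specified $B$-projection is a triple $(\mathcal{X},\mathring{\mathcal{X}},p)$ with $\mathcal{X}=B\oplus\mathring{\mathcal{X}}$ a direct sum of $B$-$B$-bimodules and $p:\mathcal{X}\to B$, $p(b\oplus\eta)=b$. $\mathcal{L}(\mathcal{X})$ is the algebra of $\mathbb{C}$-linear maps on $\mathcal{X}$, $E_{\mathcal{L}(\mathcal{X})}(a)=p(a(1_B\oplus 0))$; $L_b,R_b\in\mathcal{L}(\mathcal{X})$ are left and right multiplication by $b$; $\mathcal{L}_\ell(\mathcal{X})=\{T:TR_b=R_bT\ \forall b\}$, $\mathcal{L}_r(\mathcal{X})=\{T:TL_b=L_bT\ \forall b\}$. **Reduced free product.** For a family $\{(\mathcal{X}_k,\mathring{\mathcal{X}}_k,p_k)\}_{k\in K}$ it is $(\mathcal{X},\mathring{\mathcal{X}},p)$ with $\mathring{\mathcal{X}}=\bigoplus_{n\ge1}\bigoplus_{k_1\ne k_2\ne\cdots\ne k_n}\mathring{\mathcal{X}}_{k_1}\otimes_B\cdots\otimes_B\mathring{\mathcal{X}}_{k_n}$ (consecutive indices distinct). Let $\mathcal{X}_\ell(k)$ (resp. $\mathcal{X}_r(k)$) be $B$ plus the sum of those summands with $k_1\neq k$ (resp. $k_n\ne k$), and let $V_k:\mathcal{X}\to\mathcal{X}_k\otimes_B\mathcal{X}_\ell(k)$ and $W_k:\mathcal{X}\to\mathcal{X}_r(k)\otimes_B\mathcal{X}_k$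 be the natural bimodule isomorphisms. The left and right regular representations are $\lambda_k(a)=V_k^{-1}(a\otimes\mathrm{Id})V_k$ (for $a\in\mathcal{L}_\ell(\mathcal{X}_k)$) and $\rho_k(a)=W_k^{-1}(\mathrm{Id}\otimes a)W_k$ (for $a\in\mathcal{L}_r(\mathcal{X}_k)$). The $k$-th Boolean projection $P_k:\mathcal{X}\to\mathcal{X}$ is the natural projection onto $B\oplus\mathring{\mathcal{X}}_k$. **Bi-freeness.** A pair of $B$-faces of $\mathcal{A}$ is a pair $(C,D)$ of unital subalgebras with $\varepsilon(B\otimes1_B)\subseteq C\subseteq\mathcal{A}_\ell$ and $\varepsilon(1_B\otimes B)\subseteq D\subseteq\mathcal{A}_r$. A family $\{(C_k,D_k)\}_{k\in K}$ of such pairs is bi-free over $B$ if there exist $B$-$B$-bimodules with specified $B$-projections $(\mathcal{X}_k,\mathring{\mathcal{X}}_k,p_k)$ and unital homomorphisms $\ell_k:C_k\to\mathcal{L}_\ell(\mathcal{X}_k)$, $r_k:D_k\to\mathcal{L}_r(\mathcal{X}_k)$ such that the joint distribution of $\{(C_k,D_k)\}$ under $E_{\mathcal{A}}$ equals that of $\{(\lambda_k(\ell_k(C_k)),\rho_k(r_k(D_k)))\}$ in $(\mathcal{L}(\mathcal{X}),E_{\mathcal{L}(\mathcal{X})})$, i.e. expectations of all words agree with those of the corresponding words of image operators. **Triples and free-free-Boolean independence.** A triple of $B$-faces is a triple $(A,C,D)$ of subalgebras of $\mathcal{A}$, $A$ and $C$ unital, with $\varepsilon(B\otimes1_B)\subseteq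 A\subseteq\mathcal{A}_\ell$, $\varepsilon(1_B\otimes B)\subseteq C\subseteq\mathcal{A}_r$, $\varepsilon(B\otimes1_B)D\,\varepsilon(B\otimes1_B)\subseteq D\subseteq\mathcal{A}_\ell$. A family $\{(A_k,C_k,D_k)\}_{k\in K}$ of such triples is free-free-Boolean independent with amalgamation over $B$ if there exist $B$-$B$-bimodules with specified $B$-projections $(\mathcal{X}_k,\mathring{\mathcal{X}}_k,p_k)$, unital homomorphisms $\ell_k:A_k\to\mathcal{L}_\ell(\mathcal{X}_k)$, $r_k:C_k\to\mathcal{L}_r(\mathcal{X}_k)$ and (not necessarily unital) homomorphisms $m_k:D_k\to\mathcal{L}_\ell(\mathcal{X}_k)$ such that the joint distribution of the family under $E_{\mathcal{A}}$ equals that of $\{(\lambda_k(\ell_k(A_k)),\rho_k(r_k(C_k)),P_k\lambda_k(m_k(D_k))P_k)\}_{k\in K}$ in $(\mathcal{L}(\mathcal{X}),E_{\mathcal{L}(\mathcal{X})})$, where $\mathcal{X}$ is the reduced free product: for every word $Z_1\cdots Z_n$ in elements of the algebras of the family, $E_{\mathcal{A}}(Z_1\cdots Z_n)$ equals $E_{\mathcal{L}(\mathcal{X})}$ of the word obtained by replacing each $Z\in A_k$, $C_k$, $D_k$ by $\lambda_k(\ell_k(Z))$, $\rho_k(r_k(Z))$, $P_k\lambda_k(m_k(Z))P_k$ respectively. **Bi-free ffb $B$-system.** Let $\{(A_k^\ell,A_k^r,C_k,D_k)\}_{k\in K}$ be quadruples of subalgebras of $\mathcal{A}$ such that each $(A_k^\ell,A_k^r)$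 is a pair of $B$-faces and $\{(\mathrm{alg}(A_k^\ell,C_k),\mathrm{alg}(A_k^r,D_k))\}_{k\in K}$ is a bi-free family of pairs of $B$-faces over $B$. Let $C_k'\subseteq C_k$ and $D_k'\subseteq D_k\cap\mathcal{A}_\ell$ be subsets with $L_bC_k'\subseteq C_k'$ and $C_k'L_b\subseteq C_k'$ for all $b\in B$. With $\mathbb{A}_k=\mathrm{alg}(A_k^\ell,A_k^r)$, the family $\{(A_k^\ell,A_k^r,C_k',D_k')\}_{k\in K}$ is a bi-free ffb $B$-system if for all $n\ge0$, $k\in K$: (1) $C_k'\mathbb{A}_kC_k'=\{0\}=D_k'\mathbb{A}_kD_k'$; (2) $E_{\mathcal{A}}(\mathbb{A}_kC_k'\mathbb{A}_k(D_k'\mathbb{A}_kC_k')^n\mathbb{A}_k)=0$; (3) $E_{\mathcal{A}}(\mathbb{A}_kD_k'\mathbb{A}_k(C_k'\mathbb{A}_kD_k')^n\mathbb{A}_k)=0$. In (2) and (3), products of sets are interpreted factor by factor, each occurrence of a set contributing an independently chosen element. *)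

theory Defs
  imports Complex_Main "HOL-Library.Set_Algebras" "HOL-Algebra.Free_Abelian_Groups"
    "HOL-Algebra.Module"
begin

section \<open>Unital algebras over the complex numbers\<close>

text \<open>\<open>ring + monoid_mult\<close> rather than \<open>ring_1\<close>: the latter would exclude the zero algebra.\<close>

class complex_algebra_1 = ring + monoid_mult +
  fixes scaleC :: "complex \<Rightarrow> 'a \<Rightarrow> 'a"  (infixr \<open>*\<^sub>C\<close> 75)
  assumes scaleC_add_right: "c *\<^sub>C (x + y) = c *\<^sub>C x + c *\<^sub>C y"
    and scaleC_add_left: "(c + d) *\<^sub>C x = c *\<^sub>C x + d *\<^sub>C x"
    and scaleC_scaleC: "c *\<^sub>C d *\<^sub>C x = (c * d) *\<^sub>C x"
    and scaleC_one: "1 *\<^sub>C x = x"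
    and mult_scaleC_left: "(c *\<^sub>C x) * y = c *\<^sub>C (x * y)"
    and mult_scaleC_right: "x * (c *\<^sub>C y) = c *\<^sub>C (x * y)"

lemma vector_space_scaleC: "vector_space (scaleC :: complex \<Rightarrow> 'a::complex_algebra_1 \<Rightarrow> 'a)"
  by unfold_locales (simp_all add: scaleC_add_right scaleC_add_left scaleC_scaleC scaleC_one)

definition subalg :: "'a::complex_algebra_1 set \<Rightarrow> bool" where
  "subalg S \<longleftrightarrow> 0 \<in> S \<and> (\<forall>x\<in>S. \<forall>y\<in>S. x + y \<in> S \<and> x * y \<in> S) \<and> (\<forall>c. \<forall>x\<in>S. c *\<^sub>C x \<in> S)"

definition alg :: "'a::complex_algebra_1 set \<Rightarrow> 'a set" where
  "alg X = subalg hull X"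


section \<open>Bimodules\<close>

text \<open>As in the record \<open>module\<close>, the ring fields \<open>mult\<close> and \<open>one\<close> carry no meaning for
  a bimodule.  The scalar \<open>c\<close> acts on a bimodule over a complex algebra as the element
  \<open>c *\<^sub>C 1\<close>.\<close>

record ('b, 'x) bimodule = "('b, 'x) module" +
  rsmult :: "'x \<Rightarrow> 'b \<Rightarrow> 'x"  (infixl \<open>\<lhd>\<index>\<close> 70)

locale bimodule = abelian_group M
  for M :: "('b::complex_algebra_1, 'x) bimodule" (structure) +
  assumes smult_closed: "x \<in> carrier M \<Longrightarrow> b \<odot> x \<in> carrier M"
    and rsmult_closed: "x \<in> carrier M \<Longrightarrow> x \<lhd> b \<in> carrier M"
    and smult_add: "x \<in> carrier M \<Longrightarrow> y \<in> carrier M \<Longrightarrow> b \<odot> (x \<oplus> y) = b \<odot> x \<oplus> b \<odot> y"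
    and rsmult_add: "x \<in> carrier M \<Longrightarrow> y \<in> carrier M \<Longrightarrow> (x \<oplus> y) \<lhd> b = x \<lhd> b \<oplus> y \<lhd> b"
    and add_smult: "x \<in> carrier M \<Longrightarrow> (a + b) \<odot> x = a \<odot> x \<oplus> b \<odot> x"
    and add_rsmult: "x \<in> carrier M \<Longrightarrow> x \<lhd> (a + b) = x \<lhd> a \<oplus> x \<lhd> b"
    and mult_smult: "x \<in> carrier M \<Longrightarrow> (a * b) \<odot> x = a \<odot> (b \<odot> x)"
    and mult_rsmult: "x \<in> carrier M \<Longrightarrow> x \<lhd> (a * b) = x \<lhd> a \<lhd> b"
    and one_smult: "x \<in> carrier M \<Longrightarrow> 1 \<odot> x = x"
    and one_rsmult: "x \<in> carrier M \<Longrightarrow> x \<lhd> 1 = x"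
    and smult_rsmult: "x \<in> carrier M \<Longrightarrow> (a \<odot> x) \<lhd> b = a \<odot> (x \<lhd> b)"
    and scalar_central: "x \<in> carrier M \<Longrightarrow> (c *\<^sub>C 1) \<odot> x = x \<lhd> (c *\<^sub>C 1)"

text \<open>The bimodule \<open>B \<oplus> M\<close>.  A bimodule with a specified \<open>B\<close>-projection is represented
  by its complement \<open>M\<close>; the projection onto \<open>B\<close> is then \<open>fst\<close>.\<close>

definition with_B :: "('b::complex_algebra_1, 'x) bimodule \<Rightarrow> ('b, 'b \<times> 'x) bimodule" where
  "with_B M = \<lparr>carrier = UNIV \<times> carrier M, mult = undefined, one = undefined,
     zero = (0, \<zero>\<^bsub>M\<^esub>),
     add = (\<lambda>(a, x) (b, y). (a + b, x \<oplus>\<^bsub>M\<^esub> y)),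
     smult = (\<lambda>b (a, x). (b * a, b \<odot>\<^bsub>M\<^esub> x)),
     rsmult = (\<lambda>(a, x) b. (a * b, x \<lhd>\<^bsub>M\<^esub> b))\<rparr>"

definition direct_sum :: "'i set \<Rightarrow> ('i \<Rightarrow> ('b, 'x) bimodule) \<Rightarrow> ('b, 'i \<Rightarrow> 'x) bimodule" where
  "direct_sum I M = (let G = sum_group I (\<lambda>i. add_monoid (M i)) in
     \<lparr>carrier = carrier G, mult = undefined, one = undefined,
      zero = \<one>\<^bsub>G\<^esub>, add = (\<otimes>\<^bsub>G\<^esub>),
      smult = (\<lambda>b f. \<lambda>i\<in>I. b \<odot>\<^bsub>M i\<^esub> f i),
      rsmult = (\<lambda>f b. \<lambda>i\<in>I. f i \<lhd>\<^bsub>M i\<^esub> b)\<rparr>)"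

definition linear_ops :: "('b::complex_algebra_1, 'x) bimodule \<Rightarrow> ('x \<Rightarrow> 'x) set" where
  "linear_ops M = {T \<in> hom (add_monoid M) (add_monoid M).
     \<forall>c. \<forall>x\<in>carrier M. T ((c *\<^sub>C 1) \<odot>\<^bsub>M\<^esub> x) = (c *\<^sub>C 1) \<odot>\<^bsub>M\<^esub> T x}"

definition left_ops :: "('b::complex_algebra_1, 'x) bimodule \<Rightarrow> ('x \<Rightarrow> 'x) set" where
  "left_ops M = {T \<in> linear_ops M. \<forall>b. \<forall>x\<in>carrier M. T (x \<lhd>\<^bsub>M\<^esub> b) = T x \<lhd>\<^bsub>M\<^esub> b}"

definition right_ops :: "('b::complex_algebra_1, 'x) bimodule \<Rightarrow> ('x \<Rightarrow> 'x) set" where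
  "right_ops M = {T \<in> linear_ops M. \<forall>b. \<forall>x\<in>carrier M. T (b \<odot>\<^bsub>M\<^esub> x) = b \<odot>\<^bsub>M\<^esub> T x}"

text \<open>Algebra homomorphisms from a subalgebra \<open>S\<close> into an algebra \<open>\<L>\<close> of operators on \<open>M\<close>.
  Operators are compared on the carrier only.\<close>

definition rep :: "'a::complex_algebra_1 set \<Rightarrow> ('b::complex_algebra_1, 'x) bimodule \<Rightarrow>
    ('x \<Rightarrow> 'x) set \<Rightarrow> ('a \<Rightarrow> 'x \<Rightarrow> 'x) \<Rightarrow> bool" where
  "rep S M \<L> \<phi> \<longleftrightarrow> \<phi> ` S \<subseteq> \<L> \<and>
     (\<forall>s\<in>S. \<forall>t\<in>S. \<forall>x\<in>carrier M. \<phi> (s + t) x = \<phi> s x \<oplus>\<^bsub>M\<^esub> \<phi> t x) \<and>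
     (\<forall>s\<in>S. \<forall>t\<in>S. \<forall>x\<in>carrier M. \<phi> (s * t) x = \<phi> s (\<phi> t x)) \<and>
     (\<forall>c. \<forall>s\<in>S. \<forall>x\<in>carrier M. \<phi> (c *\<^sub>C s) x = (c *\<^sub>C 1) \<odot>\<^bsub>M\<^esub> \<phi> s x)"

definition unital_rep :: "'a::complex_algebra_1 set \<Rightarrow> ('b::complex_algebra_1, 'x) bimodule \<Rightarrow>
    ('x \<Rightarrow> 'x) set \<Rightarrow> ('a \<Rightarrow> 'x \<Rightarrow> 'x) \<Rightarrow> bool" where
  "unital_rep S M \<L> \<phi> \<longleftrightarrow> rep S M \<L> \<phi> \<and> (\<forall>x\<in>carrier M. \<phi> 1 x = x)"


section \<open>Tensor products\<close>

text \<open>The abelian group with generators \<open>S\<close> and relators \<open>Q\<close>, written multiplicatively.\<close>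

definition pres_group :: "'g set \<Rightarrow> ('g \<Rightarrow>\<^sub>0 int) set \<Rightarrow> ('g \<Rightarrow>\<^sub>0 int) set monoid" where
  "pres_group S Q = free_Abelian_group S Mod generate (free_Abelian_group S) Q"

definition pres_gen :: "'g set \<Rightarrow> ('g \<Rightarrow>\<^sub>0 int) set \<Rightarrow> 'g \<Rightarrow> ('g \<Rightarrow>\<^sub>0 int) set" where
  "pres_gen S Q s =
     generate (free_Abelian_group S) Q #>\<^bsub>free_Abelian_group S\<^esub> frag_of s"

text \<open>The homomorphism with prescribed values on the generators; it is unique on the carrier
  and exists whenever the prescribed values respect the relators.\<close>

definition pres_lift :: "'g set \<Rightarrow> ('g \<Rightarrow>\<^sub>0 int) set \<Rightarrow> ('h, 'm) monoid_scheme \<Rightarrow>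
    ('g \<Rightarrow> 'h) \<Rightarrow> ('g \<Rightarrow>\<^sub>0 int) set \<Rightarrow> 'h" where
  "pres_lift S Q G g = (SOME h. h \<in> hom (pres_group S Q) G \<and> (\<forall>s\<in>S. h (pres_gen S Q s) = g s))"

definition tensor_rels :: "('b, 'x) bimodule \<Rightarrow> ('b, 'y) bimodule \<Rightarrow> ('x \<times> 'y \<Rightarrow>\<^sub>0 int) set" where
  "tensor_rels M N =
     {frag_of (x \<oplus>\<^bsub>M\<^esub> x', y) - frag_of (x, y) - frag_of (x', y) | x x' y.
        x \<in> carrier M \<and> x' \<in> carrier M \<and> y \<in> carrier N} \<union>
     {frag_of (x, y \<oplus>\<^bsub>N\<^esub> y') - frag_of (x, y) - frag_of (x, y') | x y y'.
        x \<in> carrier M \<and> y \<in> carrier N \<and> y' \<in> carrier N} \<union>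
     {frag_of (x \<lhd>\<^bsub>M\<^esub> b, y) - frag_of (x, b \<odot>\<^bsub>N\<^esub> y) | x b y.
        x \<in> carrier M \<and> y \<in> carrier N}"

definition pure_tensor :: "('b, 'x) bimodule \<Rightarrow> ('b, 'y) bimodule \<Rightarrow> 'x \<Rightarrow> 'y \<Rightarrow>
    ('x \<times> 'y \<Rightarrow>\<^sub>0 int) set" where
  "pure_tensor M N x y = pres_gen (carrier M \<times> carrier N) (tensor_rels M N) (x, y)"

definition tensor_lift :: "('b, 'x) bimodule \<Rightarrow> ('b, 'y) bimodule \<Rightarrow> ('h, 'm) monoid_scheme \<Rightarrow>
    ('x \<Rightarrow> 'y \<Rightarrow> 'h) \<Rightarrow> ('x \<times> 'y \<Rightarrow>\<^sub>0 int) set \<Rightarrow> 'h" where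
  "tensor_lift M N G g =
     pres_lift (carrier M \<times> carrier N) (tensor_rels M N) G (\<lambda>(x, y). g x y)"

definition tensor :: "('b, 'x) bimodule \<Rightarrow> ('b, 'y) bimodule \<Rightarrow>
    ('b, ('x \<times> 'y \<Rightarrow>\<^sub>0 int) set) bimodule" where
  "tensor M N = (let G = pres_group (carrier M \<times> carrier N) (tensor_rels M N) in
     \<lparr>carrier = carrier G, mult = undefined, one = undefined,
      zero = \<one>\<^bsub>G\<^esub>, add = (\<otimes>\<^bsub>G\<^esub>),
      smult = (\<lambda>b. tensor_lift M N G (\<lambda>x y. pure_tensor M N (b \<odot>\<^bsub>M\<^esub> x) y)),
      rsmult = (\<lambda>t b. tensor_lift M N G (\<lambda>x y. pure_tensor M N x (y \<lhd>\<^bsub>N\<^esub> b)) t)\<rparr>)"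

text \<open>The \<open>n\<close>-fold tensor product of a nonempty list of bimodules.  Iterating \<open>tensor\<close> would
  give a type depending on \<open>n\<close>.\<close>

definition list_rels :: "('b, 'x) bimodule list \<Rightarrow> ('x list \<Rightarrow>\<^sub>0 int) set" where
  "list_rels Ms =
     {frag_of (xs[i := x \<oplus>\<^bsub>Ms ! i\<^esub> y]) - frag_of (xs[i := x]) - frag_of (xs[i := y]) | xs i x y.
        xs \<in> listset (map carrier Ms) \<and> i < length Ms \<and>
        x \<in> carrier (Ms ! i) \<and> y \<in> carrier (Ms ! i)} \<union>
     {frag_of (xs[i := xs ! i \<lhd>\<^bsub>Ms ! i\<^esub> b]) - frag_of (xs[Suc i := b \<odot>\<^bsub>Ms ! Suc i\<^esub> xs ! Suc i])
        | xs i b. xs \<in> listset (map carrier Ms) \<and> Suc i < length Ms}"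

definition pure_list :: "('b, 'x) bimodule list \<Rightarrow> 'x list \<Rightarrow> ('x list \<Rightarrow>\<^sub>0 int) set" where
  "pure_list Ms xs = pres_gen (listset (map carrier Ms)) (list_rels Ms) xs"

definition tensor_list :: "('b, 'x) bimodule list \<Rightarrow> ('b, ('x list \<Rightarrow>\<^sub>0 int) set) bimodule" where
  "tensor_list Ms = (let S = listset (map carrier Ms); G = pres_group S (list_rels Ms);
       n = length Ms - 1 in
     \<lparr>carrier = carrier G, mult = undefined, one = undefined,
      zero = \<one>\<^bsub>G\<^esub>, add = (\<otimes>\<^bsub>G\<^esub>),
      smult = (\<lambda>b. pres_lift S (list_rels Ms) G
        (\<lambda>xs. pure_list Ms (xs[0 := b \<odot>\<^bsub>Ms ! 0\<^esub> xs ! 0]))),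
      rsmult = (\<lambda>t b. pres_lift S (list_rels Ms) G
        (\<lambda>xs. pure_list Ms (xs[n := xs ! n \<lhd>\<^bsub>Ms ! n\<^esub> b])) t)\<rparr>)"


section \<open>Non-commutative probability spaces over an algebra\<close>

text \<open>A complex algebra as a bimodule over the complex numbers; here the ring fields are
  meaningful.\<close>

definition alg_record :: "(complex, 'a::complex_algebra_1) bimodule" where
  "alg_record = \<lparr>carrier = UNIV, mult = (*), one = 1, zero = 0, add = (+),
     smult = (*\<^sub>C), rsmult = (\<lambda>x c. c *\<^sub>C x)\<rparr>"

abbreviation bbop_pure :: "'b::complex_algebra_1 \<Rightarrow> 'b \<Rightarrow> ('b \<times> 'b \<Rightarrow>\<^sub>0 int) set" where
  "bbop_pure \<equiv> pure_tensor alg_record alg_record"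

text \<open>The algebra \<open>B \<otimes> B\<^sup>o\<^sup>p\<close> (tensor product over the complex numbers).\<close>

definition bbop :: "(complex, ('b::complex_algebra_1 \<times> 'b \<Rightarrow>\<^sub>0 int) set) bimodule" where
  "bbop = (let T = tensor alg_record alg_record;
       lift = tensor_lift alg_record alg_record (add_monoid T) in
     T\<lparr>mult := (\<lambda>t u. lift (\<lambda>b1 b2. lift (\<lambda>c1 c2. bbop_pure (b1 * c1) (c2 * b2)) u) t),
       one := bbop_pure 1 1\<rparr>)"

type_synonym ('b, 'a) bbop_map = "('b \<times> 'b \<Rightarrow>\<^sub>0 int) set \<Rightarrow> 'a"

definition L_op :: "('b::complex_algebra_1, 'a) bbop_map \<Rightarrow> 'b \<Rightarrow> 'a" where
  "L_op \<epsilon> b = \<epsilon> (bbop_pure b 1)"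

definition R_op :: "('b::complex_algebra_1, 'a) bbop_map \<Rightarrow> 'b \<Rightarrow> 'a" where
  "R_op \<epsilon> b = \<epsilon> (bbop_pure 1 b)"

locale bb_prob_space =
  fixes E :: "'a::complex_algebra_1 \<Rightarrow> 'b::complex_algebra_1"
    and \<epsilon> :: "('b, 'a) bbop_map"
  assumes eps_hom: "\<epsilon> \<in> ring_hom bbop alg_record"
    and eps_scale: "t \<in> carrier bbop \<Longrightarrow> \<epsilon> (c \<odot>\<^bsub>bbop\<^esub> t) = c *\<^sub>C \<epsilon> t"
    and eps_inj_left: "inj_on \<epsilon> (range (\<lambda>b. bbop_pure b 1))"
    and eps_inj_right: "inj_on \<epsilon> (range (\<lambda>b. bbop_pure 1 b))"
    and E_linear: "Vector_Spaces.linear (*\<^sub>C) (*\<^sub>C) E"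
    and E_bimodule: "E (\<epsilon> (bbop_pure b1 b2) * T) = b1 * E T * b2"
    and E_left_right: "E (T * \<epsilon> (bbop_pure b 1)) = E (T * \<epsilon> (bbop_pure 1 b))"

definition left_alg :: "('b::complex_algebra_1, 'a::complex_algebra_1) bbop_map \<Rightarrow> 'a set" where
  "left_alg \<epsilon> = {T. \<forall>b. T * R_op \<epsilon> b = R_op \<epsilon> b * T}"

definition right_alg :: "('b::complex_algebra_1, 'a::complex_algebra_1) bbop_map \<Rightarrow> 'a set" where
  "right_alg \<epsilon> = {T. \<forall>b. T * L_op \<epsilon> b = L_op \<epsilon> b * T}"

definition face_pair :: "('b::complex_algebra_1, 'a::complex_algebra_1) bbop_map \<Rightarrow>
    'a set \<Rightarrow> 'a set \<Rightarrow> bool" where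
  "face_pair \<epsilon> C D \<longleftrightarrow> subalg C \<and> 1 \<in> C \<and> range (L_op \<epsilon>) \<subseteq> C \<and> C \<subseteq> left_alg \<epsilon> \<and>
     subalg D \<and> 1 \<in> D \<and> range (R_op \<epsilon>) \<subseteq> D \<and> D \<subseteq> right_alg \<epsilon>"

definition face_triple :: "('b::complex_algebra_1, 'a::complex_algebra_1) bbop_map \<Rightarrow>
    'a set \<Rightarrow> 'a set \<Rightarrow> 'a set \<Rightarrow> bool" where
  "face_triple \<epsilon> A C D \<longleftrightarrow> face_pair \<epsilon> A C \<and> subalg D \<and>
     range (L_op \<epsilon>) * D * range (L_op \<epsilon>) \<subseteq> D \<and> D \<subseteq> left_alg \<epsilon>"


section \<open>The reduced free product\<close>

text \<open>Throughout, \<open>X k\<close> is the complement \<open>\<X>\<^sub>k\<degree>\<close> in \<open>\<X>\<^sub>k = with_B (X k)\<close>.\<close>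

definition alt_words :: "'k set \<Rightarrow> 'k list set" where
  "alt_words K = {ks. ks \<noteq> [] \<and> set ks \<subseteq> K \<and> distinct_adj ks}"

type_synonym ('b, 'k, 'x) free_vec = "'b \<times> ('k list \<Rightarrow> ('x list \<Rightarrow>\<^sub>0 int) set)"

definition free_product :: "'k set \<Rightarrow> ('k \<Rightarrow> ('b::complex_algebra_1, 'x) bimodule) \<Rightarrow>
    ('b, ('b, 'k, 'x) free_vec) bimodule" where
  "free_product K X = with_B (direct_sum (alt_words K) (\<lambda>ks. tensor_list (map X ks)))"

text \<open>The vector \<open>x\<^sub>1 \<otimes> \<dots> \<otimes> x\<^sub>n\<close> of the summand indexed by \<open>ks\<close>.\<close>

definition free_pure :: "'k set \<Rightarrow> ('k \<Rightarrow> ('b::complex_algebra_1, 'x) bimodule) \<Rightarrow>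
    'k list \<Rightarrow> 'x list \<Rightarrow> ('b, 'k, 'x) free_vec" where
  "free_pure K X ks xs = (0, \<lambda>js\<in>alt_words K.
     if js = ks then pure_list (map X ks) xs else \<zero>\<^bsub>tensor_list (map X js)\<^esub>)"

definition free_scalar :: "'k set \<Rightarrow> ('k \<Rightarrow> ('b::complex_algebra_1, 'x) bimodule) \<Rightarrow>
    'b \<Rightarrow> ('b, 'k, 'x) free_vec" where
  "free_scalar K X c = (c, \<lambda>js\<in>alt_words K. \<zero>\<^bsub>tensor_list (map X js)\<^esub>)"

definition free_left :: "'k set \<Rightarrow> ('k \<Rightarrow> ('b::complex_algebra_1, 'x) bimodule) \<Rightarrow> 'k \<Rightarrow>
    ('b, ('b, 'k, 'x) free_vec) bimodule" where
  "free_left K X k = (free_product K X)\<lparr>carrier := {(b, f) \<in> carrier (free_product K X).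
     \<forall>ks\<in>alt_words K. hd ks = k \<longrightarrow> f ks = \<zero>\<^bsub>tensor_list (map X ks)\<^esub>}\<rparr>"

definition free_right :: "'k set \<Rightarrow> ('k \<Rightarrow> ('b::complex_algebra_1, 'x) bimodule) \<Rightarrow> 'k \<Rightarrow>
    ('b, ('b, 'k, 'x) free_vec) bimodule" where
  "free_right K X k = (free_product K X)\<lparr>carrier := {(b, f) \<in> carrier (free_product K X).
     \<forall>ks\<in>alt_words K. last ks = k \<longrightarrow> f ks = \<zero>\<^bsub>tensor_list (map X ks)\<^esub>}\<rparr>"

text \<open>The inverses of the natural isomorphisms \<open>V\<^sub>k\<close> and \<open>W\<^sub>k\<close>, given on the tensors that
  generate \<open>\<X>\<^sub>k \<otimes> \<X>\<^sub>l(k)\<close> and \<open>\<X>\<^sub>r(k) \<otimes> \<X>\<^sub>k\<close>: concatenation of tensors, with the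
  \<open>B\<close>-component acting through the bimodule structure.\<close>

definition V_inv :: "'k set \<Rightarrow> ('k \<Rightarrow> ('b::complex_algebra_1, 'x) bimodule) \<Rightarrow> 'k \<Rightarrow>
    (('b \<times> 'x) \<times> ('b, 'k, 'x) free_vec \<Rightarrow>\<^sub>0 int) set \<Rightarrow> ('b, 'k, 'x) free_vec" where
  "V_inv K X k = (let F = free_product K X; M = with_B (X k); N = free_left K X k in
     SOME h. h \<in> hom (add_monoid (tensor M N)) (add_monoid F) \<and>
       (\<forall>b. \<forall>x\<in>carrier (X k).
         (\<forall>c. h (pure_tensor M N (b, x) (free_scalar K X c)) =
            free_scalar K X (b * c) \<oplus>\<^bsub>F\<^esub> free_pure K X [k] [x \<lhd>\<^bsub>X k\<^esub> c]) \<and>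
         (\<forall>ks\<in>alt_words K. \<forall>xs\<in>listset (map (\<lambda>j. carrier (X j)) ks). hd ks \<noteq> k \<longrightarrow>
            h (pure_tensor M N (b, x) (free_pure K X ks xs)) =
              b \<odot>\<^bsub>F\<^esub> free_pure K X ks xs \<oplus>\<^bsub>F\<^esub> free_pure K X (k # ks) (x # xs))))"

definition W_inv :: "'k set \<Rightarrow> ('k \<Rightarrow> ('b::complex_algebra_1, 'x) bimodule) \<Rightarrow> 'k \<Rightarrow>
    (('b, 'k, 'x) free_vec \<times> ('b \<times> 'x) \<Rightarrow>\<^sub>0 int) set \<Rightarrow> ('b, 'k, 'x) free_vec" where
  "W_inv K X k = (let F = free_product K X; M = free_right K X k; N = with_B (X k) in
     SOME h. h \<in> hom (add_monoid (tensor M N)) (add_monoid F) \<and>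
       (\<forall>b. \<forall>x\<in>carrier (X k).
         (\<forall>c. h (pure_tensor M N (free_scalar K X c) (b, x)) =
            free_scalar K X (c * b) \<oplus>\<^bsub>F\<^esub> free_pure K X [k] [c \<odot>\<^bsub>X k\<^esub> x]) \<and>
         (\<forall>ks\<in>alt_words K. \<forall>xs\<in>listset (map (\<lambda>j. carrier (X j)) ks). last ks \<noteq> k \<longrightarrow>
            h (pure_tensor M N (free_pure K X ks xs) (b, x)) =
              free_pure K X ks xs \<lhd>\<^bsub>F\<^esub> b \<oplus>\<^bsub>F\<^esub> free_pure K X (ks @ [k]) (xs @ [x]))))"

definition V_map :: "'k set \<Rightarrow> ('k \<Rightarrow> ('b::complex_algebra_1, 'x) bimodule) \<Rightarrow> 'k \<Rightarrow>
    ('b, 'k, 'x) free_vec \<Rightarrow> (('b \<times> 'x) \<times> ('b, 'k, 'x) free_vec \<Rightarrow>\<^sub>0 int) set" where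
  "V_map K X k = inv_into (carrier (tensor (with_B (X k)) (free_left K X k))) (V_inv K X k)"

definition W_map :: "'k set \<Rightarrow> ('k \<Rightarrow> ('b::complex_algebra_1, 'x) bimodule) \<Rightarrow> 'k \<Rightarrow>
    ('b, 'k, 'x) free_vec \<Rightarrow> (('b, 'k, 'x) free_vec \<times> ('b \<times> 'x) \<Rightarrow>\<^sub>0 int) set" where
  "W_map K X k = inv_into (carrier (tensor (free_right K X k) (with_B (X k)))) (W_inv K X k)"

definition tensor_map :: "('b, 'x) bimodule \<Rightarrow> ('b, 'y) bimodule \<Rightarrow> ('x \<Rightarrow> 'x) \<Rightarrow> ('y \<Rightarrow> 'y) \<Rightarrow>
    ('x \<times> 'y \<Rightarrow>\<^sub>0 int) set \<Rightarrow> ('x \<times> 'y \<Rightarrow>\<^sub>0 int) set" where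
  "tensor_map M N a c =
     tensor_lift M N (add_monoid (tensor M N)) (\<lambda>x y. pure_tensor M N (a x) (c y))"

definition left_reg :: "'k set \<Rightarrow> ('k \<Rightarrow> ('b::complex_algebra_1, 'x) bimodule) \<Rightarrow> 'k \<Rightarrow>
    ('b \<times> 'x \<Rightarrow> 'b \<times> 'x) \<Rightarrow> ('b, 'k, 'x) free_vec \<Rightarrow> ('b, 'k, 'x) free_vec" where
  "left_reg K X k a =
     V_inv K X k \<circ> tensor_map (with_B (X k)) (free_left K X k) a id \<circ> V_map K X k"

definition right_reg :: "'k set \<Rightarrow> ('k \<Rightarrow> ('b::complex_algebra_1, 'x) bimodule) \<Rightarrow> 'k \<Rightarrow>
    ('b \<times> 'x \<Rightarrow> 'b \<times> 'x) \<Rightarrow> ('b, 'k, 'x) free_vec \<Rightarrow> ('b, 'k, 'x) free_vec" where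
  "right_reg K X k a =
     W_inv K X k \<circ> tensor_map (free_right K X k) (with_B (X k)) id a \<circ> W_map K X k"

definition boolean_proj :: "'k set \<Rightarrow> ('k \<Rightarrow> ('b::complex_algebra_1, 'x) bimodule) \<Rightarrow> 'k \<Rightarrow>
    ('b, 'k, 'x) free_vec \<Rightarrow> ('b, 'k, 'x) free_vec" where
  "boolean_proj K X k = (\<lambda>(b, f).
     (b, \<lambda>ks\<in>alt_words K. if ks = [k] then f ks else \<zero>\<^bsub>tensor_list (map X ks)\<^esub>))"

definition free_expectation :: "'k set \<Rightarrow> ('k \<Rightarrow> ('b::complex_algebra_1, 'x) bimodule) \<Rightarrow>
    (('b, 'k, 'x) free_vec \<Rightarrow> ('b, 'k, 'x) free_vec) \<Rightarrow> 'b" where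
  "free_expectation K X T = fst (T (free_scalar K X 1))"


section \<open>Bi-freeness and free-free-Boolean independence\<close>

text \<open>Equality of joint distributions for algebras \<open>S j\<close> (\<open>j \<in> J\<close>) and maps \<open>\<Phi> j\<close> from them
  to operators with expectation \<open>E'\<close>.  A letter \<open>(j, Z)\<close> is an element \<open>Z\<close> together with the
  algebra it is taken from.\<close>

definition same_distribution :: "('a::complex_algebra_1 \<Rightarrow> 'b) \<Rightarrow> (('v \<Rightarrow> 'v) \<Rightarrow> 'b) \<Rightarrow>
    'j set \<Rightarrow> ('j \<Rightarrow> 'a set) \<Rightarrow> ('j \<Rightarrow> 'a \<Rightarrow> 'v \<Rightarrow> 'v) \<Rightarrow> bool" where
  "same_distribution E E' J S \<Phi> \<longleftrightarrow>
     (\<forall>w. w \<noteq> [] \<and> set w \<subseteq> Sigma J S \<longrightarrow>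
       E (prod_list (map snd w)) = E' (foldr (\<lambda>(j, Z) T. \<Phi> j Z \<circ> T) w id))"

text \<open>In the next two definitions the argument \<open>TYPE('x)\<close> fixes the type in which the
  existentially quantified bimodules live, since HOL cannot quantify over types inside a formula.
  A type at least as large as the algebra \<open>'a\<close> loses no generality: a realization can be cut
  down to the subbimodules generated from \<open>1\<^sub>B\<close> by the represented operators.\<close>

definition bifree :: "'x itself \<Rightarrow> ('a::complex_algebra_1 \<Rightarrow> 'b::complex_algebra_1) \<Rightarrow>
    ('b, 'a) bbop_map \<Rightarrow> 'k set \<Rightarrow> ('k \<Rightarrow> 'a set) \<Rightarrow> ('k \<Rightarrow> 'a set) \<Rightarrow> bool" where
  "bifree _ E \<epsilon> K C D \<longleftrightarrow> (\<forall>k\<in>K. face_pair \<epsilon> (C k) (D k)) \<and>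
     (\<exists>(X :: 'k \<Rightarrow> ('b, 'x) bimodule) l r.
       (\<forall>k\<in>K. bimodule (X k) \<and>
          unital_rep (C k) (with_B (X k)) (left_ops (with_B (X k))) (l k) \<and>
          unital_rep (D k) (with_B (X k)) (right_ops (with_B (X k))) (r k)) \<and>
       same_distribution E (free_expectation K X) (K <+> K) (case_sum C D)
         (case_sum (\<lambda>k Z. left_reg K X k (l k Z)) (\<lambda>k Z. right_reg K X k (r k Z))))"

definition ffb_independent :: "'x itself \<Rightarrow> ('a::complex_algebra_1 \<Rightarrow> 'b::complex_algebra_1) \<Rightarrow>
    ('b, 'a) bbop_map \<Rightarrow> 'k set \<Rightarrow> ('k \<Rightarrow> 'a set) \<Rightarrow> ('k \<Rightarrow> 'a set) \<Rightarrow> ('k \<Rightarrow> 'a set) \<Rightarrow> bool" where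
  "ffb_independent _ E \<epsilon> K A C D \<longleftrightarrow> (\<forall>k\<in>K. face_triple \<epsilon> (A k) (C k) (D k)) \<and>
     (\<exists>(X :: 'k \<Rightarrow> ('b, 'x) bimodule) l r m.
       (\<forall>k\<in>K. bimodule (X k) \<and>
          unital_rep (A k) (with_B (X k)) (left_ops (with_B (X k))) (l k) \<and>
          unital_rep (C k) (with_B (X k)) (right_ops (with_B (X k))) (r k) \<and>
          rep (D k) (with_B (X k)) (left_ops (with_B (X k))) (m k)) \<and>
       same_distribution E (free_expectation K X) (K <+> (K <+> K)) (case_sum A (case_sum C D))
         (case_sum (\<lambda>k Z. left_reg K X k (l k Z))
         (case_sum (\<lambda>k Z. right_reg K X k (r k Z))
                   (\<lambda>k Z. boolean_proj K X k \<circ> left_reg K X k (m k Z) \<circ> boolean_proj K X k))))"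

text \<open>Products and powers of sets below are those of \<open>Set_Algebras\<close>.\<close>

definition bifree_ffb_system :: "'x itself \<Rightarrow> ('a::complex_algebra_1 \<Rightarrow> 'b::complex_algebra_1) \<Rightarrow>
    ('b, 'a) bbop_map \<Rightarrow> 'k set \<Rightarrow> ('k \<Rightarrow> 'a set) \<Rightarrow> ('k \<Rightarrow> 'a set) \<Rightarrow>
    ('k \<Rightarrow> 'a set) \<Rightarrow> ('k \<Rightarrow> 'a set) \<Rightarrow> bool" where
  "bifree_ffb_system tx E \<epsilon> K Al Ar C' D' \<longleftrightarrow>
     (\<exists>C D.
       (\<forall>k\<in>K. subalg (C k) \<and> subalg (D k) \<and> face_pair \<epsilon> (Al k) (Ar k)) \<and>
       bifree tx E \<epsilon> K (\<lambda>k. alg (Al k \<union> C k)) (\<lambda>k. alg (Ar k \<union> D k)) \<and>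
       (\<forall>k\<in>K. C' k \<subseteq> C k \<and> D' k \<subseteq> D k \<inter> left_alg \<epsilon> \<and>
          (\<forall>b. {L_op \<epsilon> b} * C' k \<subseteq> C' k \<and> C' k * {L_op \<epsilon> b} \<subseteq> C' k))) \<and>
     (\<forall>k\<in>K. let AA = alg (Al k \<union> Ar k) in
       C' k * AA * C' k = {0} \<and> D' k * AA * D' k = {0} \<and>
       (\<forall>n. \<forall>T \<in> AA * C' k * AA * (D' k * AA * C' k) ^ n * AA. E T = 0) \<and>
       (\<forall>n. \<forall>T \<in> AA * D' k * AA * (C' k * AA * D' k) ^ n * AA. E T = 0))"

end

theory Submission
  imports Defs
begin

text \<open>Let \<open>Q\<close> be the quotient of \<open>\<A>\<close> by the elements \<open>T\<close> with \<open>E (u * T) = 0\<close> for all \<open>u\<close>, with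
  \<open>B\<close>-projection \<open>E\<close>, on which \<open>\<A>\<close> acts by left multiplication.  This one bimodule serves as \<open>\<X>\<^sub>k\<close>
  for every \<open>k\<close>.  First, bi-freeness may be witnessed by \<open>Q\<close>: the free products of any given
  realization and of the copies of \<open>Q\<close> are related by a bimodule relation that is invariant under
  the regular representations and preserves the vacuum component.  Next, on the copies of \<open>Q\<close>,
  the operators \<open>\<lambda>\<^sub>k(c) \<rho>\<^sub>k(d)\<close> and \<open>P\<^sub>k \<lambda>\<^sub>k(c d) P\<^sub>k\<close> agree on \<open>B \<oplus> \<X>\<^sub>k\<degree>\<close>.  On a tensor of another kind the
  second one vanishes, while the first one creates a leg with an unmatched factor \<open>c\<close>; by the null
  and expectation conditions such a leg never disappears again, so the vector does not contribute
  to the vacuum component.  Hence replacing each \<open>c d\<close> by \<open>P\<^sub>k \<lambda>\<^sub>k(c d) P\<^sub>k\<close> does not change any moment.\<close>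


section \<open>Presented abelian groups\<close>

text \<open>The given realization cannot be kept. It represents an element \<open>d\<close> of
  \<open>D' k\<close> by an operator that is only known to commute with the left action of
  \<open>B\<close>, so composing it with the operator of \<open>c\<close> need not give a left
  operator, although \<open>c * d\<close> lies in \<open>left_alg \<epsilon>\<close>. On
  \<open>quot\<close> the product is left multiplication by \<open>c * d\<close> and is a left
  operator for that reason. The obstacle in passing to \<open>quot\<close> is that a realization is
  constrained through moments only: \<open>l k (L b)\<close> need not be the left action of
  \<open>b\<close> on \<open>X k\<close>, whereas legs of tensors do carry that action. Moments see
  it only through letters of another colour and up to an error, so the comparison is an induction on
  the number of letters, running through all colours simultaneously, and a family with one colour is
  treated apart. The equation \<open>E 1 = 1\<close> is not an axiom of the space; it is read off a
  realization and so presupposes some colour. In the last stage the pairs are replaced one at a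
  time, starting at the vacuum; for this an error, once made, has to stay harmless under all later
  letters, later pairs included.\<close>

definition rel_grp :: "'g set \<Rightarrow> ('g \<Rightarrow>\<^sub>0 int) set \<Rightarrow> bool" where
  "rel_grp S Q \<longleftrightarrow> Q \<subseteq> carrier (free_Abelian_group S)"

lemma rel_grp_normal:
  assumes "rel_grp S Q"
  shows "generate (free_Abelian_group S) Q \<lhd> free_Abelian_group S"
    and "subgroup (generate (free_Abelian_group S) Q) (free_Abelian_group S)"
proof -
  interpret comm_group "free_Abelian_group S" by (rule abelian_free_Abelian_group)
  show sg: "subgroup (generate (free_Abelian_group S) Q) (free_Abelian_group S)"
    using assms by (intro generate_is_subgroup) (simp add: rel_grp_def)
  show "generate (free_Abelian_group S) Q \<lhd> free_Abelian_group S"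
    using sg by (simp add: normal_iff_subgroup)
qed

lemma pres_comm_group: "rel_grp S Q \<Longrightarrow> comm_group (pres_group S Q)"
  unfolding pres_group_def
  by (intro comm_group.abelian_FactGroup abelian_free_Abelian_group rel_grp_normal)

lemma pres_quotient_hom:
  assumes "rel_grp S Q"
  shows "r_coset (free_Abelian_group S) (generate (free_Abelian_group S) Q)
    \<in> hom (free_Abelian_group S) (pres_group S Q)"
  unfolding pres_group_def by (intro normal.r_coset_hom_Mod rel_grp_normal assms)

text \<open>The free abelian group is handled through differences of formal sums, its targets are
  multiplicative groups; this is the dictionary between the two notations.\<close>

lemma hom_free_diff:
  assumes "group G" "h \<in> hom (free_Abelian_group S) G"
    and "Poly_Mapping.keys x \<subseteq> S" "Poly_Mapping.keys y \<subseteq> S"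
  shows "h (x - y) = h x \<otimes>\<^bsub>G\<^esub> inv\<^bsub>G\<^esub> h y"
proof -
  interpret h: group_hom "free_Abelian_group S" G h
    using assms by (simp add: group_hom_def group_hom_axioms_def)
  have x: "x \<in> carrier (free_Abelian_group S)" and y: "y \<in> carrier (free_Abelian_group S)"
    using assms by auto
  have "h (x \<otimes>\<^bsub>free_Abelian_group S\<^esub> inv\<^bsub>free_Abelian_group S\<^esub> y) = h x \<otimes>\<^bsub>G\<^esub> inv\<^bsub>G\<^esub> h y"
    by (simp only: h.hom_mult[OF x h.G.inv_closed[OF y]] h.hom_inv[OF y])
  then show ?thesis using assms by simp
qed

lemma pres_gen_closed: "rel_grp S Q \<Longrightarrow> s \<in> S \<Longrightarrow> pres_gen S Q s \<in> carrier (pres_group S Q)"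
  unfolding pres_gen_def by (rule hom_in_carrier[OF pres_quotient_hom]) auto

text \<open>The step forms \<open>t \<otimes> inv u\<close> because the induction rule for free
  abelian groups, which is transported along the coset map, builds elements by differences. A
  predicate that is closed under sums only must therefore be proved for an element and its inverse
  together.\<close>

lemma pres_induct:
  assumes Q: "rel_grp S Q" and t: "t \<in> carrier (pres_group S Q)"
    and one: "P \<one>\<^bsub>pres_group S Q\<^esub>"
    and gen: "\<And>s. s \<in> S \<Longrightarrow> P (pres_gen S Q s)"
    and diff: "\<And>t u. t \<in> carrier (pres_group S Q) \<Longrightarrow> u \<in> carrier (pres_group S Q) \<Longrightarrow>
      P t \<Longrightarrow> P u \<Longrightarrow> P (t \<otimes>\<^bsub>pres_group S Q\<^esub> inv\<^bsub>pres_group S Q\<^esub> u)"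
  shows "P t"
proof -
  let ?F = "free_Abelian_group S"
  let ?\<pi> = "r_coset ?F (generate ?F Q)"
  interpret PG: comm_group "pres_group S Q" by (rule pres_comm_group[OF Q])
  interpret group_hom ?F "pres_group S Q" ?\<pi>
    using pres_quotient_hom[OF Q] by (simp add: group_hom_def group_hom_axioms_def)
  obtain x where x: "Poly_Mapping.keys x \<subseteq> S" "t = ?\<pi> x"
    using t by (auto simp: pres_group_def carrier_FactGroup)
  have "P (?\<pi> x)"
  proof (rule free_Abelian_group_induct[OF x(1)])
    show "P (?\<pi> 0)" using hom_one one by simp
    show "P (?\<pi> (x - y))" if "Poly_Mapping.keys x \<subseteq> S" "Poly_Mapping.keys y \<subseteq> S" "P (?\<pi> x)" "P (?\<pi> y)" for x y
      using that diff[of "?\<pi> x" "?\<pi> y"] hom_closed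
      by (simp add: hom_free_diff[OF PG.is_group pres_quotient_hom[OF Q]])
    show "P (?\<pi> (frag_of a))" if "a \<in> S" for a
      using gen[OF that] by (simp add: pres_gen_def)
  qed
  with x show ?thesis by simp
qed

lemma pres_hom_eq:
  assumes Q: "rel_grp S Q" and G: "group G"
    and h: "h \<in> hom (pres_group S Q) G" "h' \<in> hom (pres_group S Q) G"
    and eq: "\<And>s. s \<in> S \<Longrightarrow> h (pres_gen S Q s) = h' (pres_gen S Q s)"
    and t: "t \<in> carrier (pres_group S Q)"
  shows "h t = h' t"
proof -
  interpret P: comm_group "pres_group S Q" by (rule pres_comm_group[OF Q])
  interpret h: group_hom "pres_group S Q" G h
    using h G by (simp add: group_hom_def group_hom_axioms_def P.is_group)
  interpret h': group_hom "pres_group S Q" G h'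
    using h G by (simp add: group_hom_def group_hom_axioms_def P.is_group)
  show ?thesis
    by (rule pres_induct[OF Q t]) (auto simp: eq)
qed

text \<open>Relators with two terms will express balancing in a tensor product; those with three
  terms, treated next, express additivity.\<close>

lemma pres_rel2:
  assumes Q: "rel_grp S Q" and "p \<in> S" "q \<in> S" "frag_of p - frag_of q \<in> Q"
  shows "pres_gen S Q p = pres_gen S Q q"
proof -
  let ?F = "free_Abelian_group S"
  let ?\<pi> = "r_coset ?F (generate ?F Q)"
  interpret F: group ?F by simp
  interpret G: comm_group "pres_group S Q" by (rule pres_comm_group[OF Q])
  note h = pres_quotient_hom[OF Q]
  have "?\<pi> (frag_of p - frag_of q) = \<one>\<^bsub>pres_group S Q\<^esub>"
    using assms rel_grp_normal[OF Q]
    by (metis F.coset_join2 F.generate_incl F.incl_subgroup generate.incl one_FactGroup pres_group_def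
        rel_grp_def subset_iff)
  then have "?\<pi> (frag_of p) \<otimes>\<^bsub>pres_group S Q\<^esub> inv\<^bsub>pres_group S Q\<^esub> ?\<pi> (frag_of q) = \<one>\<^bsub>pres_group S Q\<^esub>"
    using assms by (simp add: hom_free_diff[OF G.is_group h])
  then show ?thesis
    using pres_gen_closed[OF Q] assms unfolding pres_gen_def
    by (metis G.inv_equality G.inv_inv G.inv_closed)
qed

lemma pres_rel3:
  assumes Q: "rel_grp S Q" and "p \<in> S" "q \<in> S" "r \<in> S" "frag_of p - frag_of q - frag_of r \<in> Q"
  shows "pres_gen S Q p = pres_gen S Q q \<otimes>\<^bsub>pres_group S Q\<^esub> pres_gen S Q r"
proof -
  let ?F = "free_Abelian_group S"
  let ?\<pi> = "r_coset ?F (generate ?F Q)"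
  interpret F: group ?F by simp
  interpret G: comm_group "pres_group S Q" by (rule pres_comm_group[OF Q])
  note h = pres_quotient_hom[OF Q]
  have k: "Poly_Mapping.keys (frag_of p - frag_of q) \<subseteq> S"
    using assms keys_diff[of "frag_of p" "frag_of q"] by auto
  have "?\<pi> (frag_of p - frag_of q - frag_of r) = \<one>\<^bsub>pres_group S Q\<^esub>"
    using assms rel_grp_normal[OF Q]
    by (metis F.coset_join2 F.generate_incl F.incl_subgroup generate.incl one_FactGroup pres_group_def
        rel_grp_def subset_iff)
  then have "?\<pi> (frag_of p) \<otimes>\<^bsub>pres_group S Q\<^esub> inv\<^bsub>pres_group S Q\<^esub> ?\<pi> (frag_of q)
      \<otimes>\<^bsub>pres_group S Q\<^esub> inv\<^bsub>pres_group S Q\<^esub> ?\<pi> (frag_of r) = \<one>\<^bsub>pres_group S Q\<^esub>"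
    using assms k by (simp add: hom_free_diff[OF G.is_group h])
  moreover have "?\<pi> (frag_of p) \<in> carrier (pres_group S Q)" "?\<pi> (frag_of q) \<in> carrier (pres_group S Q)"
      "?\<pi> (frag_of r) \<in> carrier (pres_group S Q)"
    using assms pres_gen_closed[OF Q] by (auto simp: pres_gen_def)
  ultimately show ?thesis
    unfolding pres_gen_def
    by (metis G.inv_closed G.inv_solve_right G.m_closed G.m_comm G.inv_equality G.inv_inv)
qed

text \<open>Compatibility with the relators is asked of every homomorphism \<open>h\<close>
  extending \<open>g\<close>, because relators are formal sums, to which \<open>g\<close> itself
  does not apply. Such an \<open>h\<close> exists by freeness and then factors through the
  quotient.\<close>

lemma pres_lift:
  assumes Q: "rel_grp S Q" and G: "comm_group G" and g: "\<And>s. s \<in> S \<Longrightarrow> g s \<in> carrier G"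
    and rels: "\<And>h q. h \<in> hom (free_Abelian_group S) G \<Longrightarrow> (\<And>s. s \<in> S \<Longrightarrow> h (frag_of s) = g s) \<Longrightarrow>
      q \<in> Q \<Longrightarrow> h q = \<one>\<^bsub>G\<^esub>"
  shows pres_lift_hom: "pres_lift S Q G g \<in> hom (pres_group S Q) G"
    and pres_lift_gen: "s \<in> S \<Longrightarrow> pres_lift S Q G g (pres_gen S Q s) = g s"
proof -
  let ?F = "free_Abelian_group S"
  interpret G: comm_group G by (rule G)
  obtain h where h: "h \<in> hom ?F G" "\<And>s. s \<in> S \<Longrightarrow> h (frag_of s) = g s"
    using G.free_Abelian_group_universal[of g S] g by auto
  interpret h: group_hom ?F G h
    using h by (simp add: group_hom_def group_hom_axioms_def)
  have "Q \<subseteq> kernel ?F G h"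
    using rels[OF h(1) h(2)] Q by (auto simp: kernel_def rel_grp_def simp del: carrier_free_Abelian_group_iff)
  then have "generate ?F Q \<subseteq> kernel ?F G h"
    using h.subgroup_kernel by (simp add: h.G.generate_subgroup_incl)
  then obtain h' where h': "h' \<in> hom (pres_group S Q) G"
      "\<And>x. x \<in> carrier ?F \<Longrightarrow> h' (r_coset ?F (generate ?F Q) x) = h x"
    using h.FactGroup_universal_kernel[OF rel_grp_normal(1)[OF Q]] unfolding pres_group_def by metis
  have "h' (pres_gen S Q s) = g s" if "s \<in> S" for s
    using that h' h by (simp add: pres_gen_def)
  then have "\<exists>h'. h' \<in> hom (pres_group S Q) G \<and> (\<forall>s\<in>S. h' (pres_gen S Q s) = g s)"
    using h' by blast
  from someI_ex[OF this] show "pres_lift S Q G g \<in> hom (pres_group S Q) G"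
    "s \<in> S \<Longrightarrow> pres_lift S Q G g (pres_gen S Q s) = g s"
    unfolding pres_lift_def by blast+
qed


section \<open>Tensor products\<close>

text \<open>Closure without any module law: this is what puts the relators of a tensor product into
  the free group, and it holds for \<open>alg_record\<close> and for the subspaces
  \<open>free_left\<close> and \<open>free_right\<close> as well as for bimodules.\<close>

definition op_closed :: "('b, 'x) bimodule \<Rightarrow> bool" where
  "op_closed M \<longleftrightarrow> (\<forall>x\<in>carrier M. \<forall>y\<in>carrier M. x \<oplus>\<^bsub>M\<^esub> y \<in> carrier M) \<and>
     (\<forall>x\<in>carrier M. \<forall>b. b \<odot>\<^bsub>M\<^esub> x \<in> carrier M \<and> x \<lhd>\<^bsub>M\<^esub> b \<in> carrier M)"

lemma bimodule_op_closed: "bimodule M \<Longrightarrow> op_closed M"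
proof -
  assume "bimodule M"
  then interpret bimodule M .
  show ?thesis by (auto simp: op_closed_def smult_closed rsmult_closed)
qed

lemma keys_rel2: "p \<in> S \<Longrightarrow> q \<in> S \<Longrightarrow> Poly_Mapping.keys (frag_of p - frag_of q) \<subseteq> S"
  by (rule order_trans[OF keys_diff]) auto

lemma keys_rel3: "p \<in> S \<Longrightarrow> q \<in> S \<Longrightarrow> r \<in> S \<Longrightarrow>
    Poly_Mapping.keys (frag_of p - frag_of q - frag_of r) \<subseteq> S"
  by (rule order_trans[OF keys_diff]) (use keys_rel2[of p S q] in auto)

lemma hom_rel2:
  assumes G: "group G" "h \<in> hom (free_Abelian_group S) G" and eq: "\<And>s. s \<in> S \<Longrightarrow> h (frag_of s) = g s"
    and "p \<in> S" "q \<in> S" "g p = g q"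
  shows "h (frag_of p - frag_of q) = \<one>\<^bsub>G\<^esub>"
proof -
  interpret G: group G by fact
  have "g q \<in> carrier G" using assms hom_in_carrier[OF G(2), of "frag_of q"] by auto
  then show ?thesis using assms by (simp add: hom_free_diff[OF G])
qed

lemma hom_rel3:
  assumes G: "group G" "h \<in> hom (free_Abelian_group S) G" and eq: "\<And>s. s \<in> S \<Longrightarrow> h (frag_of s) = g s"
    and S: "p \<in> S" "q \<in> S" "r \<in> S" and "g p = g q \<otimes>\<^bsub>G\<^esub> g r" and "comm_group G"
  shows "h (frag_of p - frag_of q - frag_of r) = \<one>\<^bsub>G\<^esub>"
proof -
  interpret G: comm_group G by fact
  have c: "g q \<in> carrier G" "g r \<in> carrier G"
    using assms hom_in_carrier[OF G(2), of "frag_of q"] hom_in_carrier[OF G(2), of "frag_of r"] by auto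
  have "h (frag_of p - frag_of q - frag_of r) = g p \<otimes>\<^bsub>G\<^esub> inv\<^bsub>G\<^esub> g q \<otimes>\<^bsub>G\<^esub> inv\<^bsub>G\<^esub> g r"
    using S keys_rel2[OF S(1,2)] by (simp add: hom_free_diff[OF G] eq)
  also have "g p \<otimes>\<^bsub>G\<^esub> inv\<^bsub>G\<^esub> g q = g r"
    using assms c by (metis G.inv_closed G.m_assoc G.m_comm G.r_inv G.r_one)
  finally show ?thesis using c by simp
qed

lemma tensor_rel_grp:
  assumes "op_closed M" "op_closed N"
  shows "rel_grp (carrier M \<times> carrier N) (tensor_rels M N)"
  unfolding rel_grp_def
proof
  fix q assume "q \<in> tensor_rels M N"
  then show "q \<in> carrier (free_Abelian_group (carrier M \<times> carrier N))"
    unfolding tensor_rels_def using assms unfolding op_closed_def carrier_free_Abelian_group_iff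
    by (elim UnE CollectE exE conjE) (simp only:, intro keys_rel3 keys_rel2; simp)+
qed

lemma comm_group_cong:
  assumes "comm_group G" and "carrier H = carrier G" "(\<otimes>\<^bsub>H\<^esub>) = (\<otimes>\<^bsub>G\<^esub>)" "\<one>\<^bsub>H\<^esub> = \<one>\<^bsub>G\<^esub>"
  shows "comm_group H"
proof -
  interpret comm_group G by fact
  show ?thesis
    by (rule comm_groupI) (use assms l_inv_ex in \<open>auto simp: m_assoc m_comm m_lcomm\<close>)
qed

lemma hom_cong:
  assumes "carrier H = carrier G" "(\<otimes>\<^bsub>H\<^esub>) = (\<otimes>\<^bsub>G\<^esub>)"
  shows "hom H K = hom G K" "hom K H = hom K G"
  using assms by (simp_all add: hom_def)

text \<open>The additive group of \<open>tensor M N\<close> and the presented group are different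
  records with the same carrier and operation, hence with the same homomorphisms.\<close>

lemma add_monoid_tensor:
  "hom (add_monoid (tensor M N)) G = hom (pres_group (carrier M \<times> carrier N) (tensor_rels M N)) G"
  by (rule hom_cong) (simp_all add: tensor_def Let_def)

lemma carrier_tensor:
  "carrier (tensor M N) = carrier (pres_group (carrier M \<times> carrier N) (tensor_rels M N))"
  by (simp add: tensor_def Let_def)

lemma tensor_comm_group: "op_closed M \<Longrightarrow> op_closed N \<Longrightarrow> comm_group (add_monoid (tensor M N))"
  by (rule comm_group_cong[OF pres_comm_group[OF tensor_rel_grp]]) (simp_all add: tensor_def Let_def)

lemma pure_tensor_closed:
  "op_closed M \<Longrightarrow> op_closed N \<Longrightarrow> x \<in> carrier M \<Longrightarrow> y \<in> carrier N \<Longrightarrow>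
    pure_tensor M N x y \<in> carrier (tensor M N)"
  unfolding pure_tensor_def carrier_tensor by (rule pres_gen_closed[OF tensor_rel_grp]) auto

lemma tensor_add: "t \<oplus>\<^bsub>tensor M N\<^esub> u = t \<otimes>\<^bsub>pres_group (carrier M \<times> carrier N) (tensor_rels M N)\<^esub> u"
  by (simp add: tensor_def Let_def)

lemma pure_tensor_add_left:
  assumes "op_closed M" "op_closed N" "x \<in> carrier M" "x' \<in> carrier M" "y \<in> carrier N"
  shows "pure_tensor M N (x \<oplus>\<^bsub>M\<^esub> x') y = pure_tensor M N x y \<oplus>\<^bsub>tensor M N\<^esub> pure_tensor M N x' y"
  unfolding pure_tensor_def tensor_add
  using assms by (intro pres_rel3 tensor_rel_grp) (auto simp: tensor_rels_def op_closed_def)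

lemma pure_tensor_add_right:
  assumes "op_closed M" "op_closed N" "x \<in> carrier M" "y \<in> carrier N" "y' \<in> carrier N"
  shows "pure_tensor M N x (y \<oplus>\<^bsub>N\<^esub> y') = pure_tensor M N x y \<oplus>\<^bsub>tensor M N\<^esub> pure_tensor M N x y'"
  unfolding pure_tensor_def tensor_add
  using assms by (intro pres_rel3 tensor_rel_grp) (auto simp: tensor_rels_def op_closed_def)

lemma pure_tensor_balanced:
  assumes "op_closed M" "op_closed N" "x \<in> carrier M" "y \<in> carrier N"
  shows "pure_tensor M N (x \<lhd>\<^bsub>M\<^esub> b) y = pure_tensor M N x (b \<odot>\<^bsub>N\<^esub> y)"
  unfolding pure_tensor_def
  using assms by (intro pres_rel2 tensor_rel_grp) (auto simp: tensor_rels_def op_closed_def)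

text \<open>The three conditions on \<open>g\<close> say that its extension to formal sums kills the
  three families of relators in \<open>tensor_rels\<close>.\<close>

lemma tensor_lift:
  assumes M: "op_closed M" and N: "op_closed N" and G: "comm_group G"
    and g: "\<And>x y. x \<in> carrier M \<Longrightarrow> y \<in> carrier N \<Longrightarrow> g x y \<in> carrier G"
    and add_left: "\<And>x x' y. x \<in> carrier M \<Longrightarrow> x' \<in> carrier M \<Longrightarrow> y \<in> carrier N \<Longrightarrow>
      g (x \<oplus>\<^bsub>M\<^esub> x') y = g x y \<otimes>\<^bsub>G\<^esub> g x' y"
    and add_right: "\<And>x y y'. x \<in> carrier M \<Longrightarrow> y \<in> carrier N \<Longrightarrow> y' \<in> carrier N \<Longrightarrow>
      g x (y \<oplus>\<^bsub>N\<^esub> y') = g x y \<otimes>\<^bsub>G\<^esub> g x y'"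
    and balanced: "\<And>x b y. x \<in> carrier M \<Longrightarrow> y \<in> carrier N \<Longrightarrow> g (x \<lhd>\<^bsub>M\<^esub> b) y = g x (b \<odot>\<^bsub>N\<^esub> y)"
  shows tensor_lift_hom: "tensor_lift M N G g \<in> hom (add_monoid (tensor M N)) G"
    and tensor_lift_pure: "x \<in> carrier M \<Longrightarrow> y \<in> carrier N \<Longrightarrow>
      tensor_lift M N G g (pure_tensor M N x y) = g x y"
proof -
  interpret G: comm_group G by fact
  have rels: "h q = \<one>\<^bsub>G\<^esub>"
    if h: "h \<in> hom (free_Abelian_group (carrier M \<times> carrier N)) G"
      "\<And>s. s \<in> carrier M \<times> carrier N \<Longrightarrow> h (frag_of s) = (\<lambda>(x, y). g x y) s"
      and q: "q \<in> tensor_rels M N" for h q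
    using q unfolding tensor_rels_def
  proof (elim UnE CollectE exE conjE)
    fix x x' y assume "q = frag_of (x \<oplus>\<^bsub>M\<^esub> x', y) - frag_of (x, y) - frag_of (x', y)"
      "x \<in> carrier M" "x' \<in> carrier M" "y \<in> carrier N"
    then show ?thesis using M
      by (auto intro!: hom_rel3[OF G.is_group h(1) h(2)] simp: add_left op_closed_def G)
  next
    fix x y y' assume "q = frag_of (x, y \<oplus>\<^bsub>N\<^esub> y') - frag_of (x, y) - frag_of (x, y')"
      "x \<in> carrier M" "y \<in> carrier N" "y' \<in> carrier N"
    then show ?thesis using N
      by (auto intro!: hom_rel3[OF G.is_group h(1) h(2)] simp: add_right op_closed_def G)
  next
    fix x b y assume "q = frag_of (x \<lhd>\<^bsub>M\<^esub> b, y) - frag_of (x, b \<odot>\<^bsub>N\<^esub> y)"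
      "x \<in> carrier M" "y \<in> carrier N"
    then show ?thesis using M N
      by (auto intro!: hom_rel2[OF G.is_group h(1) h(2)] simp: balanced op_closed_def)
  qed
  let ?S = "carrier M \<times> carrier N"
  show "tensor_lift M N G g \<in> hom (add_monoid (tensor M N)) G"
    unfolding tensor_lift_def add_monoid_tensor
  proof (rule pres_lift_hom[OF tensor_rel_grp[OF M N] G])
    show "h q = \<one>\<^bsub>G\<^esub>" if "h \<in> hom (free_Abelian_group ?S) G"
      "\<And>s. s \<in> ?S \<Longrightarrow> h (frag_of s) = (\<lambda>(x, y). g x y) s" "q \<in> tensor_rels M N" for h q
      using that by (rule rels)
  qed (auto simp: g)
  show "tensor_lift M N G g (pure_tensor M N x y) = g x y" if xy: "x \<in> carrier M" "y \<in> carrier N"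
  proof -
    have "pres_lift ?S (tensor_rels M N) G (\<lambda>(x, y). g x y) (pres_gen ?S (tensor_rels M N) (x, y))
        = (\<lambda>(x, y). g x y) (x, y)"
    proof (rule pres_lift_gen[OF tensor_rel_grp[OF M N] G])
      show "h q = \<one>\<^bsub>G\<^esub>" if "h \<in> hom (free_Abelian_group ?S) G"
        "\<And>s. s \<in> ?S \<Longrightarrow> h (frag_of s) = (\<lambda>(x, y). g x y) s" "q \<in> tensor_rels M N" for h q
        using that by (rule rels)
    qed (auto simp: g xy)
    then show ?thesis by (simp add: tensor_lift_def pure_tensor_def)
  qed
qed

lemma tensor_hom_eq:
  assumes "op_closed M" "op_closed N" "group G"
    and "h \<in> hom (add_monoid (tensor M N)) G" "h' \<in> hom (add_monoid (tensor M N)) G"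
    and "\<And>x y. x \<in> carrier M \<Longrightarrow> y \<in> carrier N \<Longrightarrow> h (pure_tensor M N x y) = h' (pure_tensor M N x y)"
    and "t \<in> carrier (tensor M N)"
  shows "h t = h' t"
proof (rule pres_hom_eq[OF tensor_rel_grp[OF assms(1,2)] assms(3)])
  show "h \<in> hom (pres_group (carrier M \<times> carrier N) (tensor_rels M N)) G"
    "h' \<in> hom (pres_group (carrier M \<times> carrier N) (tensor_rels M N)) G"
    using assms(4,5) unfolding add_monoid_tensor .
qed (use assms(6,7) in \<open>auto simp: pure_tensor_def carrier_tensor\<close>)

section \<open>Tensor products of lists of bimodules\<close>

lemma listset_iff: "xs \<in> listset As \<longleftrightarrow> list_all2 (\<in>) xs As"
  by (induction As arbitrary: xs) (auto simp: set_Cons_def list_all2_Cons2)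

lemma listset_update: "xs \<in> listset As \<Longrightarrow> i < length As \<Longrightarrow> x \<in> As ! i \<Longrightarrow> xs[i := x] \<in> listset As"
  unfolding listset_iff by (metis list_all2_update_cong list_update_id)

lemma listset_nth: "xs \<in> listset As \<Longrightarrow> i < length As \<Longrightarrow> xs ! i \<in> As ! i"
  unfolding listset_iff by (metis list_all2_conv_all_nth)

lemma listset_length: "xs \<in> listset As \<Longrightarrow> length xs = length As"
  unfolding listset_iff by (rule list_all2_lengthD)

lemma list_rel_grp:
  assumes "\<forall>M\<in>set Ms. op_closed M"
  shows "rel_grp (listset (map carrier Ms)) (list_rels Ms)"
  unfolding rel_grp_def
proof
  have cl: "op_closed (Ms ! i)" if "i < length Ms" for i using assms that by simp
  fix q assume "q \<in> list_rels Ms"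
  then show "q \<in> carrier (free_Abelian_group (listset (map carrier Ms)))"
    unfolding list_rels_def carrier_free_Abelian_group_iff
  proof (elim UnE CollectE exE conjE)
    fix xs i x y
    assume "q = frag_of (xs[i := x \<oplus>\<^bsub>Ms ! i\<^esub> y]) - frag_of (xs[i := x]) - frag_of (xs[i := y])"
      "xs \<in> listset (map carrier Ms)" "i < length Ms" "x \<in> carrier (Ms ! i)" "y \<in> carrier (Ms ! i)"
    then show "Poly_Mapping.keys q \<subseteq> listset (map carrier Ms)"
      using cl[of i] by (simp only:) (intro keys_rel3 listset_update; simp add: op_closed_def)
  next
    fix xs i b
    assume "q = frag_of (xs[i := xs ! i \<lhd>\<^bsub>Ms ! i\<^esub> b]) - frag_of (xs[Suc i := b \<odot>\<^bsub>Ms ! Suc i\<^esub> xs ! Suc i])"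
      and *: "xs \<in> listset (map carrier Ms)" "Suc i < length Ms"
    then show "Poly_Mapping.keys q \<subseteq> listset (map carrier Ms)"
      using cl[of i] cl[of "Suc i"] listset_nth[OF *(1), of i] listset_nth[OF *(1), of "Suc i"]
      by (simp only:) (intro keys_rel2 listset_update; simp add: op_closed_def)
  qed
qed

lemma add_monoid_tensor_list:
  "hom (add_monoid (tensor_list Ms)) G = hom (pres_group (listset (map carrier Ms)) (list_rels Ms)) G"
  by (rule hom_cong) (simp_all add: tensor_list_def Let_def)

text \<open>The actions on tensor products are defined by lifts into the presented group, while
  lifts are evaluated with an \<open>add_monoid\<close> as target. The choice operator returns the
  same function, since both targets admit the same homomorphisms.\<close>

lemma pres_lift_cong:
  assumes "carrier H = carrier G" "(\<otimes>\<^bsub>H\<^esub>) = (\<otimes>\<^bsub>G\<^esub>)"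
  shows "pres_lift S Q H g = pres_lift S Q G g"
  unfolding pres_lift_def hom_cong(2)[OF assms] ..

lemma carrier_tensor_list:
  "carrier (tensor_list Ms) = carrier (pres_group (listset (map carrier Ms)) (list_rels Ms))"
  by (simp add: tensor_list_def Let_def)

lemma tensor_list_add:
  "t \<oplus>\<^bsub>tensor_list Ms\<^esub> u = t \<otimes>\<^bsub>pres_group (listset (map carrier Ms)) (list_rels Ms)\<^esub> u"
  by (simp add: tensor_list_def Let_def)

lemma tensor_list_comm_group:
  "\<forall>M\<in>set Ms. op_closed M \<Longrightarrow> comm_group (add_monoid (tensor_list Ms))"
  by (rule comm_group_cong[OF pres_comm_group[OF list_rel_grp]]) (simp_all add: tensor_list_def Let_def)

lemma pure_list_closed:
  "\<forall>M\<in>set Ms. op_closed M \<Longrightarrow> xs \<in> listset (map carrier Ms) \<Longrightarrow> pure_list Ms xs \<in> carrier (tensor_list Ms)"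
  unfolding pure_list_def carrier_tensor_list by (rule pres_gen_closed[OF list_rel_grp]) auto

lemma pure_list_add:
  assumes Ms: "\<forall>M\<in>set Ms. op_closed M" and xs: "xs \<in> listset (map carrier Ms)" and i: "i < length Ms"
    and x: "x \<in> carrier (Ms ! i)" and y: "y \<in> carrier (Ms ! i)"
  shows "pure_list Ms (xs[i := x \<oplus>\<^bsub>Ms ! i\<^esub> y]) =
    pure_list Ms (xs[i := x]) \<oplus>\<^bsub>tensor_list Ms\<^esub> pure_list Ms (xs[i := y])"
  unfolding pure_list_def tensor_list_add
proof (intro pres_rel3 list_rel_grp)
  have "op_closed (Ms ! i)" using Ms i by simp
  then show "xs[i := x \<oplus>\<^bsub>Ms ! i\<^esub> y] \<in> listset (map carrier Ms)"
    using assms by (intro listset_update) (auto simp: op_closed_def)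
qed (use assms in \<open>auto intro: listset_update simp: list_rels_def\<close>)

lemma pure_list_balanced:
  assumes Ms: "\<forall>M\<in>set Ms. op_closed M" and xs: "xs \<in> listset (map carrier Ms)" and i: "Suc i < length Ms"
  shows "pure_list Ms (xs[i := xs ! i \<lhd>\<^bsub>Ms ! i\<^esub> b]) =
    pure_list Ms (xs[Suc i := b \<odot>\<^bsub>Ms ! Suc i\<^esub> xs ! Suc i])"
  unfolding pure_list_def
proof (intro pres_rel2 list_rel_grp)
  have *: "op_closed (Ms ! i)" "op_closed (Ms ! Suc i)" using Ms i by simp_all
  have **: "xs ! i \<in> carrier (Ms ! i)" "xs ! Suc i \<in> carrier (Ms ! Suc i)"
    using listset_nth[OF xs, of i] listset_nth[OF xs, of "Suc i"] i by auto
  show "xs[i := xs ! i \<lhd>\<^bsub>Ms ! i\<^esub> b] \<in> listset (map carrier Ms)"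
    "xs[Suc i := b \<odot>\<^bsub>Ms ! Suc i\<^esub> xs ! Suc i] \<in> listset (map carrier Ms)"
    using assms * ** by (auto intro!: listset_update simp: op_closed_def)
  show "frag_of (xs[i := xs ! i \<lhd>\<^bsub>Ms ! i\<^esub> b]) - frag_of (xs[Suc i := b \<odot>\<^bsub>Ms ! Suc i\<^esub> xs ! Suc i])
      \<in> list_rels Ms"
    using assms unfolding list_rels_def by blast
qed (use assms in auto)

lemma list_lift:
  assumes Ms: "\<forall>M\<in>set Ms. op_closed M" and G: "comm_group G"
    and g: "\<And>xs. xs \<in> listset (map carrier Ms) \<Longrightarrow> g xs \<in> carrier G"
    and add: "\<And>xs i x y. xs \<in> listset (map carrier Ms) \<Longrightarrow> i < length Ms \<Longrightarrow> x \<in> carrier (Ms ! i) \<Longrightarrow>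
      y \<in> carrier (Ms ! i) \<Longrightarrow> g (xs[i := x \<oplus>\<^bsub>Ms ! i\<^esub> y]) = g (xs[i := x]) \<otimes>\<^bsub>G\<^esub> g (xs[i := y])"
    and balanced: "\<And>xs i b. xs \<in> listset (map carrier Ms) \<Longrightarrow> Suc i < length Ms \<Longrightarrow>
      g (xs[i := xs ! i \<lhd>\<^bsub>Ms ! i\<^esub> b]) = g (xs[Suc i := b \<odot>\<^bsub>Ms ! Suc i\<^esub> xs ! Suc i])"
  shows list_lift_hom: "pres_lift (listset (map carrier Ms)) (list_rels Ms) G g
      \<in> hom (add_monoid (tensor_list Ms)) G"
    and list_lift_pure: "xs \<in> listset (map carrier Ms) \<Longrightarrow>
      pres_lift (listset (map carrier Ms)) (list_rels Ms) G g (pure_list Ms xs) = g xs"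
proof -
  interpret G: comm_group G by fact
  have cl: "op_closed (Ms ! i)" if "i < length Ms" for i using Ms that by simp
  have rels: "h q = \<one>\<^bsub>G\<^esub>"
    if h: "h \<in> hom (free_Abelian_group (listset (map carrier Ms))) G"
      "\<And>s. s \<in> listset (map carrier Ms) \<Longrightarrow> h (frag_of s) = g s"
      and q: "q \<in> list_rels Ms" for h q
    using q unfolding list_rels_def
  proof (elim UnE CollectE exE conjE)
    fix xs i x y
    assume *: "q = frag_of (xs[i := x \<oplus>\<^bsub>Ms ! i\<^esub> y]) - frag_of (xs[i := x]) - frag_of (xs[i := y])"
      "xs \<in> listset (map carrier Ms)" "i < length Ms" "x \<in> carrier (Ms ! i)" "y \<in> carrier (Ms ! i)"
    show ?thesis unfolding *(1)
    proof (rule hom_rel3[where g = g, OF G.is_group h(1)])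
      show "h (frag_of s) = g s" if "s \<in> listset (map carrier Ms)" for s using that by (rule h(2))
      show "g (xs[i := x \<oplus>\<^bsub>Ms ! i\<^esub> y]) = g (xs[i := x]) \<otimes>\<^bsub>G\<^esub> g (xs[i := y])"
        using * by (intro add)
    qed (use * cl[of i] in \<open>auto intro!: listset_update simp: op_closed_def G\<close>)
  next
    fix xs i b
    assume *: "q = frag_of (xs[i := xs ! i \<lhd>\<^bsub>Ms ! i\<^esub> b]) - frag_of (xs[Suc i := b \<odot>\<^bsub>Ms ! Suc i\<^esub> xs ! Suc i])"
      "xs \<in> listset (map carrier Ms)" "Suc i < length Ms"
    show ?thesis unfolding *(1)
    proof (rule hom_rel2[where g = g, OF G.is_group h(1)])
      show "h (frag_of s) = g s" if "s \<in> listset (map carrier Ms)" for s using that by (rule h(2))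
      show "g (xs[i := xs ! i \<lhd>\<^bsub>Ms ! i\<^esub> b]) = g (xs[Suc i := b \<odot>\<^bsub>Ms ! Suc i\<^esub> xs ! Suc i])"
        using * by (intro balanced)
    qed (use * cl[of i] cl[of "Suc i"] listset_nth[OF *(2), of i] listset_nth[OF *(2), of "Suc i"]
        in \<open>auto intro!: listset_update simp: op_closed_def\<close>)
  qed
  let ?S = "listset (map carrier Ms)"
  show "pres_lift ?S (list_rels Ms) G g \<in> hom (add_monoid (tensor_list Ms)) G"
    unfolding add_monoid_tensor_list
  proof (rule pres_lift_hom[OF list_rel_grp[OF Ms] G])
    show "h q = \<one>\<^bsub>G\<^esub>" if "h \<in> hom (free_Abelian_group ?S) G"
      "\<And>s. s \<in> ?S \<Longrightarrow> h (frag_of s) = g s" "q \<in> list_rels Ms" for h q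
      using that by (rule rels)
  qed (auto simp: g)
  show "pres_lift ?S (list_rels Ms) G g (pure_list Ms xs) = g xs" if xs: "xs \<in> ?S"
    unfolding pure_list_def
  proof (rule pres_lift_gen[OF list_rel_grp[OF Ms] G])
    show "h q = \<one>\<^bsub>G\<^esub>" if "h \<in> hom (free_Abelian_group ?S) G"
      "\<And>s. s \<in> ?S \<Longrightarrow> h (frag_of s) = g s" "q \<in> list_rels Ms" for h q
      using that by (rule rels)
  qed (auto simp: g xs)
qed

text \<open>Acting on leg 0 respects the relators: updates at different positions commute,
  additivity at position 0 is that of the action on the leg, and balancing between legs 0 and 1
  survives because the two actions on leg 0 commute.\<close>

lemma tensor_list_smult:
  assumes Ms: "\<forall>M\<in>set Ms. bimodule M" and ne: "Ms \<noteq> []"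
  shows tensor_list_smult_hom: "(\<lambda>t. b \<odot>\<^bsub>tensor_list Ms\<^esub> t)
      \<in> hom (add_monoid (tensor_list Ms)) (add_monoid (tensor_list Ms))"
    and tensor_list_smult_pure: "xs \<in> listset (map carrier Ms) \<Longrightarrow>
      b \<odot>\<^bsub>tensor_list Ms\<^esub> pure_list Ms xs = pure_list Ms (xs[0 := b \<odot>\<^bsub>Ms ! 0\<^esub> xs ! 0])"
proof -
  let ?S = "listset (map carrier Ms)"
  let ?g = "\<lambda>xs. pure_list Ms (xs[0 := b \<odot>\<^bsub>Ms ! 0\<^esub> xs ! 0])"
  have cl: "\<forall>M\<in>set Ms. op_closed M" using Ms bimodule_op_closed by blast
  have bi: "bimodule (Ms ! i)" if "i < length Ms" for i using Ms that by simp
  have len: "0 < length Ms" using ne by simp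
  have upd: "xs[0 := b \<odot>\<^bsub>Ms ! 0\<^esub> xs ! 0] \<in> ?S" if "xs \<in> ?S" for xs
    using that listset_nth[OF that, of 0] len bimodule.smult_closed[OF bi[OF len]]
    by (intro listset_update) auto
  have g: "?g xs \<in> carrier (add_monoid (tensor_list Ms))" if "xs \<in> ?S" for xs
    using pure_list_closed[OF cl upd[OF that]] by simp
  have add: "?g (xs[i := x \<oplus>\<^bsub>Ms ! i\<^esub> y]) = ?g (xs[i := x]) \<otimes>\<^bsub>add_monoid (tensor_list Ms)\<^esub> ?g (xs[i := y])"
    if *: "xs \<in> ?S" "i < length Ms" "x \<in> carrier (Ms ! i)" "y \<in> carrier (Ms ! i)" for xs i x y
  proof (cases "i = 0")
    case True
    then show ?thesis
      using * pure_list_add[OF cl *(1) len, of "b \<odot>\<^bsub>Ms ! 0\<^esub> x" "b \<odot>\<^bsub>Ms ! 0\<^esub> y"] listset_length[OF *(1)]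
        bimodule.smult_add[OF bi[OF len]] bimodule.smult_closed[OF bi[OF len]]
      by simp
  next
    case False
    then show ?thesis
      using * pure_list_add[OF cl upd[OF *(1)] *(2-4)]
      by (simp add: list_update_swap)
  qed
  have bal: "?g (xs[i := xs ! i \<lhd>\<^bsub>Ms ! i\<^esub> c]) = ?g (xs[Suc i := c \<odot>\<^bsub>Ms ! Suc i\<^esub> xs ! Suc i])"
    if *: "xs \<in> ?S" "Suc i < length Ms" for xs i c
  proof (cases "i = 0")
    case True
    then show ?thesis
      using * pure_list_balanced[OF cl upd[OF *(1)] *(2), of c] listset_length[OF *(1)]
        len listset_nth[OF *(1), of 0] bimodule.smult_rsmult[OF bi[OF len]]
      by (simp add: list_update_swap)
  next
    case False
    then show ?thesis
      using * pure_list_balanced[OF cl upd[OF *(1)] *(2), of c] listset_length[OF *(1)]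
      by (simp add: list_update_swap)
  qed
  note G = tensor_list_comm_group[OF cl]
  have eq: "(\<lambda>t. b \<odot>\<^bsub>tensor_list Ms\<^esub> t) = pres_lift ?S (list_rels Ms) (add_monoid (tensor_list Ms)) ?g"
    by (subst pres_lift_cong[where G = "pres_group ?S (list_rels Ms)"]) (simp_all add: tensor_list_def Let_def)
  show "(\<lambda>t. b \<odot>\<^bsub>tensor_list Ms\<^esub> t) \<in> hom (add_monoid (tensor_list Ms)) (add_monoid (tensor_list Ms))"
    unfolding eq by (rule list_lift_hom[OF cl G g add bal])
  show "b \<odot>\<^bsub>tensor_list Ms\<^esub> pure_list Ms xs = ?g xs" if "xs \<in> ?S"
    using list_lift_pure[OF cl G g add bal that] fun_cong[OF eq, of "pure_list Ms xs"] by simp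
qed

text \<open>Mirror image at the last leg; the delicate relator is now the balancing in which
  position \<open>Suc i\<close> is the last one.\<close>

lemma tensor_list_rsmult:
  assumes Ms: "\<forall>M\<in>set Ms. bimodule M" and ne: "Ms \<noteq> []"
  defines "n \<equiv> length Ms - 1"
  shows tensor_list_rsmult_hom: "(\<lambda>t. t \<lhd>\<^bsub>tensor_list Ms\<^esub> b)
      \<in> hom (add_monoid (tensor_list Ms)) (add_monoid (tensor_list Ms))"
    and tensor_list_rsmult_pure: "xs \<in> listset (map carrier Ms) \<Longrightarrow>
      pure_list Ms xs \<lhd>\<^bsub>tensor_list Ms\<^esub> b = pure_list Ms (xs[n := xs ! n \<lhd>\<^bsub>Ms ! n\<^esub> b])"
proof -
  let ?S = "listset (map carrier Ms)"
  let ?g = "\<lambda>xs. pure_list Ms (xs[n := xs ! n \<lhd>\<^bsub>Ms ! n\<^esub> b])"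
  have cl: "\<forall>M\<in>set Ms. op_closed M" using Ms bimodule_op_closed by blast
  have bi: "bimodule (Ms ! i)" if "i < length Ms" for i using Ms that by simp
  have len: "n < length Ms" using ne by (simp add: n_def)
  have upd: "xs[n := xs ! n \<lhd>\<^bsub>Ms ! n\<^esub> b] \<in> ?S" if "xs \<in> ?S" for xs
    using that listset_nth[OF that, of n] len bimodule.rsmult_closed[OF bi[OF len]]
    by (intro listset_update) auto
  have g: "?g xs \<in> carrier (add_monoid (tensor_list Ms))" if "xs \<in> ?S" for xs
    using pure_list_closed[OF cl upd[OF that]] by simp
  have add: "?g (xs[i := x \<oplus>\<^bsub>Ms ! i\<^esub> y]) = ?g (xs[i := x]) \<otimes>\<^bsub>add_monoid (tensor_list Ms)\<^esub> ?g (xs[i := y])"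
    if *: "xs \<in> ?S" "i < length Ms" "x \<in> carrier (Ms ! i)" "y \<in> carrier (Ms ! i)" for xs i x y
  proof (cases "i = n")
    case True
    then show ?thesis
      using * pure_list_add[OF cl *(1) len, of "x \<lhd>\<^bsub>Ms ! n\<^esub> b" "y \<lhd>\<^bsub>Ms ! n\<^esub> b"] listset_length[OF *(1)]
        bimodule.rsmult_add[OF bi[OF len]] bimodule.rsmult_closed[OF bi[OF len]]
      by simp
  next
    case False
    then show ?thesis
      using * pure_list_add[OF cl upd[OF *(1)] *(2-4)]
      by (simp add: list_update_swap)
  qed
  have bal: "?g (xs[i := xs ! i \<lhd>\<^bsub>Ms ! i\<^esub> c]) = ?g (xs[Suc i := c \<odot>\<^bsub>Ms ! Suc i\<^esub> xs ! Suc i])"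
    if *: "xs \<in> ?S" "Suc i < length Ms" for xs i c
  proof (cases "Suc i = n")
    case True
    then show ?thesis
      using * pure_list_balanced[OF cl upd[OF *(1)] *(2), of c] listset_length[OF *(1)] len
        listset_nth[OF *(1), of n] bimodule.smult_rsmult[OF bi[OF len]]
      by (auto simp: list_update_swap)
  next
    case False
    moreover have "i \<noteq> n" using * by (auto simp: n_def)
    ultimately show ?thesis
      using * pure_list_balanced[OF cl upd[OF *(1)] *(2), of c] listset_length[OF *(1)]
      by (simp add: list_update_swap)
  qed
  note G = tensor_list_comm_group[OF cl]
  have eq: "(\<lambda>t. t \<lhd>\<^bsub>tensor_list Ms\<^esub> b) = pres_lift ?S (list_rels Ms) (add_monoid (tensor_list Ms)) ?g"
    by (subst pres_lift_cong[where G = "pres_group ?S (list_rels Ms)"]) (simp_all add: tensor_list_def Let_def n_def)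
  show "(\<lambda>t. t \<lhd>\<^bsub>tensor_list Ms\<^esub> b) \<in> hom (add_monoid (tensor_list Ms)) (add_monoid (tensor_list Ms))"
    unfolding eq by (rule list_lift_hom[OF cl G g add bal])
  show "pure_list Ms xs \<lhd>\<^bsub>tensor_list Ms\<^esub> b = ?g xs" if "xs \<in> ?S"
    using list_lift_pure[OF cl G g add bal that] fun_cong[OF eq, of "pure_list Ms xs"] by simp
qed


section \<open>Reduced free products\<close>

lemma bimodule_comm_group: "bimodule M \<Longrightarrow> comm_group (add_monoid M)"
  by (simp add: bimodule_def abelian_group.a_comm_group)

lemma with_B_simps [simp]:
  "carrier (with_B M) = UNIV \<times> carrier M"
  "\<zero>\<^bsub>with_B M\<^esub> = (0, \<zero>\<^bsub>M\<^esub>)"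
  "(a, x) \<oplus>\<^bsub>with_B M\<^esub> (b, y) = (a + b, x \<oplus>\<^bsub>M\<^esub> y)"
  "c \<odot>\<^bsub>with_B M\<^esub> (a, x) = (c * a, c \<odot>\<^bsub>M\<^esub> x)"
  "(a, x) \<lhd>\<^bsub>with_B M\<^esub> c = (a * c, x \<lhd>\<^bsub>M\<^esub> c)"
  by (simp_all add: with_B_def)

lemma with_B_comm_group:
  assumes "comm_group (add_monoid M)"
  shows "comm_group (add_monoid (with_B M))"
proof -
  interpret M: comm_group "add_monoid M" by fact
  note c = M.m_closed M.m_assoc M.m_comm M.l_one M.one_closed M.l_inv_ex
  show ?thesis
  proof (rule comm_groupI)
    fix x assume "x \<in> carrier (add_monoid (with_B M))"
    then obtain a m where x: "x = (a, m)" "m \<in> carrier M" by auto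
    obtain n where "n \<in> carrier M" "n \<oplus>\<^bsub>M\<^esub> m = \<zero>\<^bsub>M\<^esub>"
      using M.l_inv_ex[of m] x by auto
    then show "\<exists>y\<in>carrier (add_monoid (with_B M)).
        y \<otimes>\<^bsub>add_monoid (with_B M)\<^esub> x = \<one>\<^bsub>add_monoid (with_B M)\<^esub>"
      using x by (intro bexI[of _ "(- a, n)"]) auto
  qed (use c in \<open>auto simp: algebra_simps\<close>)
qed

lemma direct_sum_simps:
  "carrier (direct_sum I M) = carrier (sum_group I (\<lambda>i. add_monoid (M i)))"
  "\<zero>\<^bsub>direct_sum I M\<^esub> = (\<lambda>i\<in>I. \<zero>\<^bsub>M i\<^esub>)"
  "f \<oplus>\<^bsub>direct_sum I M\<^esub> g = (\<lambda>i\<in>I. f i \<oplus>\<^bsub>M i\<^esub> g i)"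
  "b \<odot>\<^bsub>direct_sum I M\<^esub> f = (\<lambda>i\<in>I. b \<odot>\<^bsub>M i\<^esub> f i)"
  "f \<lhd>\<^bsub>direct_sum I M\<^esub> b = (\<lambda>i\<in>I. f i \<lhd>\<^bsub>M i\<^esub> b)"
  by (simp_all add: direct_sum_def Let_def)

lemma direct_sum_comm_group:
  assumes "\<And>i. i \<in> I \<Longrightarrow> comm_group (add_monoid (M i))"
  shows "comm_group (add_monoid (direct_sum I M))"
proof -
  let ?G = "sum_group I (\<lambda>i. add_monoid (M i))"
  have g: "group (add_monoid (M i))" if "i \<in> I" for i
    using assms[OF that] by (simp add: comm_group_def)
  have "comm_group ?G"
  proof (rule group.group_comm_groupI)
    show "group ?G" using g by simp
    fix x y assume "x \<in> carrier ?G" "y \<in> carrier ?G"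
    then show "x \<otimes>\<^bsub>?G\<^esub> y = y \<otimes>\<^bsub>?G\<^esub> x"
      using comm_monoid.m_comm[OF comm_group.axioms(1)[OF assms]]
      by (intro ext) (auto simp: carrier_sum_group[OF g] PiE_iff restrict_def)
  qed
  then show ?thesis
    by (rule comm_group_cong) (simp_all add: direct_sum_def Let_def)
qed

text \<open>Places an arbitrary element of the tensor product for \<open>ks\<close>, elementary or
  not, into its summand. Splitting a vector into its components produces such elements.\<close>

definition free_single where
  "free_single K X ks t = (0, \<lambda>js\<in>alt_words K. if js = ks then t else \<zero>\<^bsub>tensor_list (map X js)\<^esub>)"

text \<open>The empty word stands for the vacuum, so that a tensor and what remains after removing
  its only leg are treated alike.\<close>

definition free_gen where
  "free_gen K X ks xs = (if ks = [] then free_scalar K X 1 else free_pure K X ks xs)"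

locale free_prod =
  fixes K :: "'k set" and X :: "'k \<Rightarrow> ('b::complex_algebra_1, 'x) bimodule"
  assumes bim: "k \<in> K \<Longrightarrow> bimodule (X k)"
begin

abbreviation "F \<equiv> free_product K X"
abbreviation "I \<equiv> alt_words K"
abbreviation "LS ks \<equiv> listset (map (\<lambda>j. carrier (X j)) ks)"
abbreviation "T ks \<equiv> tensor_list (map X ks)"
abbreviation "scal \<equiv> free_scalar K X"
abbreviation "pure \<equiv> free_pure K X"

lemma LS_eq: "listset (map carrier (map X ks)) = LS ks"
  by (simp add: comp_def)

lemma words_bim: "ks \<in> I \<Longrightarrow> \<forall>M\<in>set (map X ks). bimodule M"
  and words_cl: "ks \<in> I \<Longrightarrow> \<forall>M\<in>set (map X ks). op_closed M"
  and words_ne: "ks \<in> I \<Longrightarrow> ks \<noteq> []" "ks \<in> I \<Longrightarrow> map X ks \<noteq> []"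
  using bim bimodule_op_closed by (auto simp: alt_words_def)

lemma T_comm_group: "ks \<in> I \<Longrightarrow> comm_group (add_monoid (T ks))"
  by (rule tensor_list_comm_group[OF words_cl])

lemma T_group: "ks \<in> I \<Longrightarrow> group (add_monoid (T ks))"
  using T_comm_group by (simp add: comm_group_def)

lemma F_carrier: "carrier F = UNIV \<times> {f \<in> \<Pi>\<^sub>E ks\<in>I. carrier (T ks). finite {ks\<in>I. f ks \<noteq> \<zero>\<^bsub>T ks\<^esub>}}"
  unfolding free_product_def with_B_simps direct_sum_simps
  by (subst carrier_sum_group) (simp_all add: T_group)

lemma F_zero: "\<zero>\<^bsub>F\<^esub> = scal 0"
  by (simp add: free_product_def direct_sum_simps free_scalar_def)

lemma F_add: "(a, f) \<oplus>\<^bsub>F\<^esub> (b, g) = (a + b, \<lambda>ks\<in>I. f ks \<oplus>\<^bsub>T ks\<^esub> g ks)"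
  by (simp add: free_product_def direct_sum_simps)

lemma F_smult: "b \<odot>\<^bsub>F\<^esub> (a, f) = (b * a, \<lambda>ks\<in>I. b \<odot>\<^bsub>T ks\<^esub> f ks)"
  by (simp add: free_product_def direct_sum_simps)

lemma F_rsmult: "(a, f) \<lhd>\<^bsub>F\<^esub> b = (a * b, \<lambda>ks\<in>I. f ks \<lhd>\<^bsub>T ks\<^esub> b)"
  by (simp add: free_product_def direct_sum_simps)

lemma F_comm_group: "comm_group (add_monoid F)"
  unfolding free_product_def by (intro with_B_comm_group direct_sum_comm_group T_comm_group)

sublocale F: abelian_group F
  using F_comm_group by (intro abelian_group.intro comm_group_abelian_groupI abelian_monoidI abelian_groupI)
    (auto simp: comm_group_def comm_monoid_def comm_monoid_axioms_def)

lemma T_zero_closed: "ks \<in> I \<Longrightarrow> \<zero>\<^bsub>T ks\<^esub> \<in> carrier (T ks)"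
  using T_group[of ks] group.is_monoid monoid.one_closed by fastforce

lemma T_zero_add: "ks \<in> I \<Longrightarrow> t \<in> carrier (T ks) \<Longrightarrow> \<zero>\<^bsub>T ks\<^esub> \<oplus>\<^bsub>T ks\<^esub> t = t"
  using T_group[of ks] group.is_monoid monoid.l_one by fastforce

lemma T_hom_zero:
  "ks \<in> I \<Longrightarrow> h \<in> hom (add_monoid (T ks)) (add_monoid (T ks)) \<Longrightarrow> h \<zero>\<^bsub>T ks\<^esub> = \<zero>\<^bsub>T ks\<^esub>"
  using hom_one[OF _ T_group T_group, of h ks ks] by simp

lemma scal_closed: "scal c \<in> carrier F"
  by (simp add: F_carrier free_scalar_def T_zero_closed)

lemma scal_add: "scal (a + b) = scal a \<oplus>\<^bsub>F\<^esub> scal b"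
  unfolding free_scalar_def F_add by (auto simp: fun_eq_iff T_zero_add T_zero_closed)

lemma single_closed: "ks \<in> I \<Longrightarrow> t \<in> carrier (T ks) \<Longrightarrow> free_single K X ks t \<in> carrier F"
  by (auto simp: F_carrier free_single_def T_zero_closed intro: finite_subset[of _ "{ks}"])

lemma single_add:
  "ks \<in> I \<Longrightarrow> t \<in> carrier (T ks) \<Longrightarrow> u \<in> carrier (T ks) \<Longrightarrow>
    free_single K X ks (t \<oplus>\<^bsub>T ks\<^esub> u) = free_single K X ks t \<oplus>\<^bsub>F\<^esub> free_single K X ks u"
  unfolding free_single_def F_add by (auto simp: fun_eq_iff T_zero_add T_zero_closed)

lemma pure_single: "pure ks xs = free_single K X ks (pure_list (map X ks) xs)"
  by (auto simp: free_pure_def free_single_def)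

lemma pure_list_closed': "ks \<in> I \<Longrightarrow> xs \<in> LS ks \<Longrightarrow> pure_list (map X ks) xs \<in> carrier (T ks)"
  by (rule pure_list_closed[OF words_cl]) (simp_all only: LS_eq)

lemma pure_closed: "ks \<in> I \<Longrightarrow> xs \<in> LS ks \<Longrightarrow> pure ks xs \<in> carrier F"
  unfolding pure_single by (intro single_closed pure_list_closed')

lemma pure_add:
  assumes "ks \<in> I" "xs \<in> LS ks" "i < length ks" "x \<in> carrier (X (ks ! i))" "y \<in> carrier (X (ks ! i))"
  shows "pure ks (xs[i := x \<oplus>\<^bsub>X (ks ! i)\<^esub> y]) = pure ks (xs[i := x]) \<oplus>\<^bsub>F\<^esub> pure ks (xs[i := y])"
proof -
  have "xs[i := x] \<in> LS ks" "xs[i := y] \<in> LS ks"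
    using assms by (auto intro!: listset_update)
  then show ?thesis
    using assms pure_list_add[OF words_cl[OF assms(1)], of xs i x y]
    by (simp add: pure_single LS_eq[unfolded map_map] single_add[symmetric] pure_list_closed')
qed

lemma pure_balanced:
  assumes "ks \<in> I" "xs \<in> LS ks" "Suc i < length ks"
  shows "pure ks (xs[i := xs ! i \<lhd>\<^bsub>X (ks ! i)\<^esub> b]) = pure ks (xs[Suc i := b \<odot>\<^bsub>X (ks ! Suc i)\<^esub> xs ! Suc i])"
  using assms pure_list_balanced[OF words_cl[OF assms(1)], of xs i b]
  by (simp add: pure_single LS_eq[unfolded map_map])

lemma single_smult:
  "ks \<in> I \<Longrightarrow> b \<odot>\<^bsub>F\<^esub> free_single K X ks t = free_single K X ks (b \<odot>\<^bsub>T ks\<^esub> t)"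
  unfolding free_single_def F_smult
  by (auto simp: fun_eq_iff T_hom_zero[OF _ tensor_list_smult_hom[OF words_bim words_ne(2)]])

lemma single_rsmult:
  "ks \<in> I \<Longrightarrow> free_single K X ks t \<lhd>\<^bsub>F\<^esub> b = free_single K X ks (t \<lhd>\<^bsub>T ks\<^esub> b)"
  unfolding free_single_def F_rsmult
  by (auto simp: fun_eq_iff T_hom_zero[OF _ tensor_list_rsmult_hom[OF words_bim words_ne(2)]])

lemma smult_scal: "b \<odot>\<^bsub>F\<^esub> scal c = scal (b * c)"
  unfolding free_scalar_def F_smult
  by (auto simp: fun_eq_iff T_hom_zero[OF _ tensor_list_smult_hom[OF words_bim words_ne(2)]])

lemma rsmult_scal: "scal c \<lhd>\<^bsub>F\<^esub> b = scal (c * b)"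
  unfolding free_scalar_def F_rsmult
  by (auto simp: fun_eq_iff T_hom_zero[OF _ tensor_list_rsmult_hom[OF words_bim words_ne(2)]])

lemma smult_hom: "(\<lambda>v. b \<odot>\<^bsub>F\<^esub> v) \<in> hom (add_monoid F) (add_monoid F)"
proof (rule homI)
  have h: "(\<lambda>t. b \<odot>\<^bsub>T ks\<^esub> t) \<in> hom (add_monoid (T ks)) (add_monoid (T ks))" if "ks \<in> I" for ks
    by (rule tensor_list_smult_hom[OF words_bim[OF that] words_ne(2)[OF that]])
  fix v assume "v \<in> carrier (add_monoid F)"
  then obtain c f where v: "v = (c, f)" "f \<in> (\<Pi>\<^sub>E ks\<in>I. carrier (T ks))" "finite {ks\<in>I. f ks \<noteq> \<zero>\<^bsub>T ks\<^esub>}"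
    by (auto simp: F_carrier)
  then show "b \<odot>\<^bsub>F\<^esub> v \<in> carrier (add_monoid F)"
    using hom_in_carrier[OF h] T_hom_zero[OF _ h]
    by (auto simp: F_carrier F_smult PiE_iff intro: finite_subset[OF _ v(3)])
  fix w assume "w \<in> carrier (add_monoid F)"
  then obtain d g where w: "w = (d, g)" "g \<in> (\<Pi>\<^sub>E ks\<in>I. carrier (T ks))"
    by (auto simp: F_carrier)
  show "b \<odot>\<^bsub>F\<^esub> (v \<otimes>\<^bsub>add_monoid F\<^esub> w) = b \<odot>\<^bsub>F\<^esub> v \<otimes>\<^bsub>add_monoid F\<^esub> (b \<odot>\<^bsub>F\<^esub> w)"
    using v w hom_mult[OF h]
    by (auto simp: F_smult F_add distrib_left fun_eq_iff PiE_iff)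
qed

lemma rsmult_hom: "(\<lambda>v. v \<lhd>\<^bsub>F\<^esub> b) \<in> hom (add_monoid F) (add_monoid F)"
proof (rule homI)
  have h: "(\<lambda>t. t \<lhd>\<^bsub>T ks\<^esub> b) \<in> hom (add_monoid (T ks)) (add_monoid (T ks))" if "ks \<in> I" for ks
    by (rule tensor_list_rsmult_hom[OF words_bim[OF that] words_ne(2)[OF that]])
  fix v assume "v \<in> carrier (add_monoid F)"
  then obtain c f where v: "v = (c, f)" "f \<in> (\<Pi>\<^sub>E ks\<in>I. carrier (T ks))" "finite {ks\<in>I. f ks \<noteq> \<zero>\<^bsub>T ks\<^esub>}"
    by (auto simp: F_carrier)
  then show "v \<lhd>\<^bsub>F\<^esub> b \<in> carrier (add_monoid F)"
    using hom_in_carrier[OF h] T_hom_zero[OF _ h]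
    by (auto simp: F_carrier F_rsmult PiE_iff intro: finite_subset[OF _ v(3)])
  fix w assume "w \<in> carrier (add_monoid F)"
  then obtain d g where w: "w = (d, g)" "g \<in> (\<Pi>\<^sub>E ks\<in>I. carrier (T ks))"
    by (auto simp: F_carrier)
  show "(v \<otimes>\<^bsub>add_monoid F\<^esub> w) \<lhd>\<^bsub>F\<^esub> b = v \<lhd>\<^bsub>F\<^esub> b \<otimes>\<^bsub>add_monoid F\<^esub> (w \<lhd>\<^bsub>F\<^esub> b)"
    using v w hom_mult[OF h]
    by (auto simp: F_rsmult F_add distrib_right fun_eq_iff PiE_iff)
qed

lemma smult_pure:
  assumes "ks \<in> I" "xs \<in> LS ks"
  shows "b \<odot>\<^bsub>F\<^esub> pure ks xs = pure ks (xs[0 := b \<odot>\<^bsub>X (ks ! 0)\<^esub> xs ! 0])"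
  using assms tensor_list_smult_pure[OF words_bim words_ne(2), OF assms(1) assms(1), of xs b] words_ne(1)[OF assms(1)]
  by (simp add: pure_single single_smult LS_eq[unfolded map_map])

lemma rsmult_pure:
  assumes "ks \<in> I" "xs \<in> LS ks"
  defines "n \<equiv> length ks - 1"
  shows "pure ks xs \<lhd>\<^bsub>F\<^esub> b = pure ks (xs[n := xs ! n \<lhd>\<^bsub>X (ks ! n)\<^esub> b])"
  using assms tensor_list_rsmult_pure[OF words_bim words_ne(2), OF assms(1) assms(1), of xs b] words_ne(1)[OF assms(1)]
  by (simp add: pure_single single_rsmult LS_eq[unfolded map_map])

text \<open>Negating one leg negates an elementary tensor. Sums of elementary tensors are therefore
  closed under inverses, and induction over vectors needs no case for negatives.\<close>

lemma pure_uminus: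
  assumes ks: "ks \<in> I" and xs: "xs \<in> LS ks"
  shows "\<exists>ys\<in>LS ks. pure ks xs \<oplus>\<^bsub>F\<^esub> pure ks ys = \<zero>\<^bsub>F\<^esub>"
proof -
  have len: "0 < length ks" using words_ne[OF ks] by simp
  then have "ks ! 0 \<in> K" using ks nth_mem[OF len] by (auto simp: alt_words_def simp del: nth_mem)
  then interpret M: bimodule "X (ks ! 0)" by (rule bim)
  have x: "xs ! 0 \<in> carrier (X (ks ! 0))" using listset_nth[OF xs, of 0] len by simp
  define ys where "ys = xs[0 := \<ominus>\<^bsub>X (ks ! 0)\<^esub> xs ! 0]"
  have z: "xs[0 := \<zero>\<^bsub>X (ks ! 0)\<^esub>] \<in> LS ks" using xs len by (intro listset_update) auto
  have "pure ks (xs[0 := \<zero>\<^bsub>X (ks ! 0)\<^esub>]) \<oplus>\<^bsub>F\<^esub> pure ks (xs[0 := \<zero>\<^bsub>X (ks ! 0)\<^esub>])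
      = pure ks (xs[0 := \<zero>\<^bsub>X (ks ! 0)\<^esub>])"
    using pure_add[OF ks xs len, of "\<zero>\<^bsub>X (ks ! 0)\<^esub>" "\<zero>\<^bsub>X (ks ! 0)\<^esub>"] by simp
  then have "pure ks (xs[0 := \<zero>\<^bsub>X (ks ! 0)\<^esub>]) = \<zero>\<^bsub>F\<^esub>"
    using pure_closed[OF ks z] by (metis F.add.r_cancel_one)
  then have "pure ks xs \<oplus>\<^bsub>F\<^esub> pure ks ys = \<zero>\<^bsub>F\<^esub>"
    using pure_add[OF ks xs len, of "xs ! 0" "\<ominus>\<^bsub>X (ks ! 0)\<^esub> xs ! 0"] x
    by (simp add: ys_def M.r_neg)
  moreover have "ys \<in> LS ks" unfolding ys_def using xs len x by (intro listset_update) auto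
  ultimately show ?thesis by blast
qed

lemma F_induct [consumes 1, case_names scalar pure add]:
  assumes v: "v \<in> carrier F"
    and scalar: "\<And>c. P (scal c)"
    and pure: "\<And>ks xs. ks \<in> I \<Longrightarrow> xs \<in> LS ks \<Longrightarrow> P (pure ks xs)"
    and add: "\<And>u v. u \<in> carrier F \<Longrightarrow> v \<in> carrier F \<Longrightarrow> P u \<Longrightarrow> P v \<Longrightarrow> P (u \<oplus>\<^bsub>F\<^esub> v)"
  shows "P v"
proof -
  have zero: "P \<zero>\<^bsub>F\<^esub>" using scalar[of 0] by (simp add: F_zero)
  have single: "P (free_single K X ks t)" if ks: "ks \<in> I" and t: "t \<in> carrier (T ks)" for ks t
  proof -
    let ?G = "pres_group (listset (map carrier (map X ks))) (list_rels (map X ks))"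
    let ?s = "free_single K X ks"
    note rg = list_rel_grp[OF words_cl[OF ks]]
    interpret G: comm_group ?G by (rule pres_comm_group[OF rg])
    have c: "carrier ?G = carrier (T ks)" by (simp add: carrier_tensor_list)
    have s: "?s (x \<otimes>\<^bsub>?G\<^esub> y) = ?s x \<oplus>\<^bsub>F\<^esub> ?s y" if "x \<in> carrier ?G" "y \<in> carrier ?G" for x y
      using that single_add[OF ks] unfolding c tensor_list_add by simp
    have s1: "?s \<one>\<^bsub>?G\<^esub> = \<zero>\<^bsub>F\<^esub>"
      using s[of "\<one>\<^bsub>?G\<^esub>" "\<one>\<^bsub>?G\<^esub>"] single_closed[OF ks, of "\<one>\<^bsub>?G\<^esub>"] c
      by (metis F.add.r_cancel_one G.one_closed G.r_one)
    \<comment> \<open>Strengthened to an element and its inverse: \<open>pres_induct\<close> forms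
      differences, whereas \<open>P\<close> is closed under sums only.\<close>
    have "P (?s t) \<and> P (?s (inv\<^bsub>?G\<^esub> t))"
    proof (rule pres_induct[OF rg t[folded c]])
      show "P (?s \<one>\<^bsub>?G\<^esub>) \<and> P (?s (inv\<^bsub>?G\<^esub> \<one>\<^bsub>?G\<^esub>))" using s1 zero by (simp del: map_map)
    next
      fix xs assume "xs \<in> listset (map carrier (map X ks))"
      then have xs: "xs \<in> LS ks" by (simp only: LS_eq)
      let ?p = "pres_gen (listset (map carrier (map X ks))) (list_rels (map X ks)) xs"
      have p: "?p \<in> carrier ?G" "?s ?p = pure ks xs"
        using pure_list_closed'[OF ks xs] unfolding c by (simp_all add: pure_single pure_list_def)
      obtain ys where ys: "ys \<in> LS ks" "pure ks xs \<oplus>\<^bsub>F\<^esub> pure ks ys = \<zero>\<^bsub>F\<^esub>"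
        using pure_uminus[OF ks xs] by blast
      have "pure ks xs \<oplus>\<^bsub>F\<^esub> ?s (inv\<^bsub>?G\<^esub> ?p) = \<zero>\<^bsub>F\<^esub>"
        using s[of ?p "inv\<^bsub>?G\<^esub> ?p"] p s1 by (simp del: map_map)
      then have "?s (inv\<^bsub>?G\<^esub> ?p) = pure ks ys"
        using ys pure_closed[OF ks xs] pure_closed[OF ks ys(1)] single_closed[OF ks, of "inv\<^bsub>?G\<^esub> ?p"] p c
        by (metis F.add.right_cancel F.add.m_comm G.inv_closed)
      then show "P (?s ?p) \<and> P (?s (inv\<^bsub>?G\<^esub> ?p))" using p pure ks xs ys by (simp del: map_map)
    next
      fix x y assume xy: "x \<in> carrier ?G" "y \<in> carrier ?G" "P (?s x) \<and> P (?s (inv\<^bsub>?G\<^esub> x))"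
        "P (?s y) \<and> P (?s (inv\<^bsub>?G\<^esub> y))"
      have i: "inv\<^bsub>?G\<^esub> x \<in> carrier ?G" "inv\<^bsub>?G\<^esub> y \<in> carrier ?G" using xy by blast+
      have "inv\<^bsub>?G\<^esub> (x \<otimes>\<^bsub>?G\<^esub> inv\<^bsub>?G\<^esub> y) = inv\<^bsub>?G\<^esub> x \<otimes>\<^bsub>?G\<^esub> y"
        using xy i by (metis G.inv_mult G.inv_inv)
      moreover note s[OF xy(1) i(2)] s[OF i(1) xy(2)]
      moreover have "?s z \<in> carrier F" if "z \<in> carrier ?G" for z
        using that single_closed[OF ks] unfolding c by blast
      ultimately show "P (?s (x \<otimes>\<^bsub>?G\<^esub> inv\<^bsub>?G\<^esub> y)) \<and> P (?s (inv\<^bsub>?G\<^esub> (x \<otimes>\<^bsub>?G\<^esub> inv\<^bsub>?G\<^esub> y)))"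
        using xy i add by metis
    qed
    then show ?thesis ..
  qed
  obtain c f where cf: "v = (c, f)" "f \<in> (\<Pi>\<^sub>E ks\<in>I. carrier (T ks))" "finite {ks\<in>I. f ks \<noteq> \<zero>\<^bsub>T ks\<^esub>}"
    using v by (auto simp: F_carrier)
  \<comment> \<open>Induction over a finite set that contains the support, splitting off one summand
    at a time.\<close>
  have "P (c, f)" if "finite A" "f \<in> (\<Pi>\<^sub>E ks\<in>I. carrier (T ks))" "{ks\<in>I. f ks \<noteq> \<zero>\<^bsub>T ks\<^esub>} \<subseteq> A" for A f
    using that
  proof (induction A arbitrary: f)
    case empty
    then have "(c, f) = scal c"
      by (auto simp: free_scalar_def fun_eq_iff PiE_iff extensional_def)
    then show ?case using scalar by simp
  next
    case (insert ks A)
    show ?case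
    proof (cases "ks \<in> I")
      case True
      define g where "g = (\<lambda>js\<in>I. if js = ks then \<zero>\<^bsub>T js\<^esub> else f js)"
      have g: "g \<in> (\<Pi>\<^sub>E ks\<in>I. carrier (T ks))" "{ks\<in>I. g ks \<noteq> \<zero>\<^bsub>T ks\<^esub>} \<subseteq> A"
        using insert.prems by (auto simp: g_def PiE_iff T_zero_closed split: if_splits)
      have fk: "f ks \<in> carrier (T ks)" using insert.prems True by (auto simp: PiE_iff)
      have "(c, f) = free_single K X ks (f ks) \<oplus>\<^bsub>F\<^esub> (c, g)"
        using insert.prems T_comm_group
        by (auto simp: F_add free_single_def g_def fun_eq_iff PiE_iff extensional_def T_zero_add T_zero_closed
            comm_monoid.m_comm[OF comm_group.axioms(1)[OF T_comm_group], simplified, of _ "f ks" "\<zero>\<^bsub>T ks\<^esub>"])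
      moreover have "(c, g) \<in> carrier F"
        using g finite_subset[OF g(2) insert.hyps(1)] by (simp add: F_carrier)
      ultimately show ?thesis
        using add[OF single_closed[OF True fk] _ single[OF True fk] insert.IH[OF g]] by simp
    next
      case False
      then show ?thesis using insert.prems by (intro insert.IH) auto
    qed
  qed
  from this[OF cf(3) cf(2)] show ?thesis using cf by simp
qed

lemma F_hom_eq:
  assumes "h \<in> hom (add_monoid F) G" "h' \<in> hom (add_monoid F) G"
    and "\<And>c. h (scal c) = h' (scal c)"
    and "\<And>ks xs. ks \<in> I \<Longrightarrow> xs \<in> LS ks \<Longrightarrow> h (pure ks xs) = h' (pure ks xs)"
    and "v \<in> carrier F"
  shows "h v = h' v"
  using assms(5)
  by (induction rule: F_induct) (use assms hom_mult[OF assms(1)] hom_mult[OF assms(2)] in auto)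

text \<open>The homomorphism is glued from the universal properties of the summands; the product
  over all words makes sense because every vector has finite support.\<close>

lemma F_univ:
  assumes G: "comm_group G" and g0: "\<And>c. g0 c \<in> carrier G" "\<And>a b. g0 (a + b) = g0 a \<otimes>\<^bsub>G\<^esub> g0 b"
    and g: "\<And>ks xs. ks \<in> I \<Longrightarrow> xs \<in> LS ks \<Longrightarrow> g ks xs \<in> carrier G"
    and g_add: "\<And>ks xs i x y. ks \<in> I \<Longrightarrow> xs \<in> LS ks \<Longrightarrow> i < length ks \<Longrightarrow> x \<in> carrier (X (ks ! i)) \<Longrightarrow>
      y \<in> carrier (X (ks ! i)) \<Longrightarrow> g ks (xs[i := x \<oplus>\<^bsub>X (ks ! i)\<^esub> y]) = g ks (xs[i := x]) \<otimes>\<^bsub>G\<^esub> g ks (xs[i := y])"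
    and g_bal: "\<And>ks xs i b. ks \<in> I \<Longrightarrow> xs \<in> LS ks \<Longrightarrow> Suc i < length ks \<Longrightarrow>
      g ks (xs[i := xs ! i \<lhd>\<^bsub>X (ks ! i)\<^esub> b]) = g ks (xs[Suc i := b \<odot>\<^bsub>X (ks ! Suc i)\<^esub> xs ! Suc i])"
  obtains h where "h \<in> hom (add_monoid F) G" "\<And>c. h (scal c) = g0 c"
    "\<And>ks xs. ks \<in> I \<Longrightarrow> xs \<in> LS ks \<Longrightarrow> h (pure ks xs) = g ks xs"
proof -
  interpret G: comm_group G by fact
  let ?l = "\<lambda>ks. pres_lift (listset (map carrier (map X ks))) (list_rels (map X ks)) G (g ks)"
  have l: "?l ks \<in> hom (add_monoid (T ks)) G" "xs \<in> LS ks \<Longrightarrow> ?l ks (pure_list (map X ks) xs) = g ks xs"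
    if ks: "ks \<in> I" for ks xs
  proof -
    have a: "g ks xs \<in> carrier G" if "xs \<in> listset (map carrier (map X ks))" for xs
      using that g[OF ks] by (simp only: LS_eq)
    have b: "g ks (xs[i := x \<oplus>\<^bsub>map X ks ! i\<^esub> y]) = g ks (xs[i := x]) \<otimes>\<^bsub>G\<^esub> g ks (xs[i := y])"
      if "xs \<in> listset (map carrier (map X ks))" "i < length (map X ks)" "x \<in> carrier (map X ks ! i)"
        "y \<in> carrier (map X ks ! i)" for xs i x y
      using that g_add[OF ks, of xs i x y] by (simp add: comp_def)
    have c: "g ks (xs[i := xs ! i \<lhd>\<^bsub>map X ks ! i\<^esub> b]) = g ks (xs[Suc i := b \<odot>\<^bsub>map X ks ! Suc i\<^esub> xs ! Suc i])"
      if "xs \<in> listset (map carrier (map X ks))" "Suc i < length (map X ks)" for xs i b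
      using that g_bal[OF ks, of xs i b] by (simp add: comp_def)
    show "?l ks \<in> hom (add_monoid (T ks)) G"
      by (rule list_lift_hom[OF words_cl[OF ks] G a b c])
    show "?l ks (pure_list (map X ks) xs) = g ks xs" if "xs \<in> LS ks"
      by (rule list_lift_pure[OF words_cl[OF ks] G a b c]) (use that in \<open>simp_all only: LS_eq\<close>)
  qed
  have l0: "?l ks \<zero>\<^bsub>T ks\<^esub> = \<one>\<^bsub>G\<^esub>" if "ks \<in> I" for ks
    using hom_one[OF l(1)[OF that] T_group[OF that] G.is_group] by simp
  define s where "s f = gfinprod G (\<lambda>ks. ?l ks (f ks)) I" for f
  let ?D = "sum_group I (\<lambda>ks. add_monoid (T ks))"
  have s: "s \<in> hom ?D G"
    unfolding s_def by (rule G.hom_group_sum) (use l T_group in auto)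
  define h where "h = (\<lambda>(c, f). g0 c \<otimes>\<^bsub>G\<^esub> s f)"
  have FD: "carrier F = UNIV \<times> carrier ?D"
    by (simp add: free_product_def direct_sum_simps)
  have sc: "s f \<in> carrier G" if "f \<in> carrier ?D" for f
    using hom_in_carrier[OF s that] .
  have h: "h \<in> hom (add_monoid F) G"
  proof (rule homI)
    fix u assume "u \<in> carrier (add_monoid F)"
    then show "h u \<in> carrier G" by (auto simp: FD h_def g0 sc)
    fix v assume "v \<in> carrier (add_monoid F)"
    with \<open>u \<in> _\<close> obtain a f b f' where uv: "u = (a, f)" "v = (b, f')" "f \<in> carrier ?D" "f' \<in> carrier ?D"
      by (auto simp: FD)
    then have "s (\<lambda>ks\<in>I. f ks \<oplus>\<^bsub>T ks\<^esub> f' ks) = s f \<otimes>\<^bsub>G\<^esub> s f'"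
      using hom_mult[OF s, of f f'] by simp
    then show "h (u \<otimes>\<^bsub>add_monoid F\<^esub> v) = h u \<otimes>\<^bsub>G\<^esub> h v"
      using uv by (simp add: h_def F_add g0 sc G.m_ac)
  qed
  moreover have "h (scal c) = g0 c" for c
  proof -
    have "s (\<lambda>js\<in>I. \<zero>\<^bsub>T js\<^esub>) = \<one>\<^bsub>G\<^esub>"
      using hom_one[OF s] T_group G.is_group by simp
    then show ?thesis by (simp add: h_def free_scalar_def g0)
  qed
  moreover have "h (pure ks xs) = g ks xs" if ks: "ks \<in> I" and xs: "xs \<in> LS ks" for ks xs
  proof -
    let ?f = "\<lambda>js\<in>I. if js = ks then pure_list (map X ks) xs else \<zero>\<^bsub>T js\<^esub>"
    have "s ?f = gfinprod G (\<lambda>js. ?l js (?f js)) {ks}"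
      unfolding s_def
    proof (rule G.gfinprod_mono_neutral_cong_right)
      show "(\<lambda>js. ?l js (?f js)) \<in> I \<rightarrow> carrier G"
        using ks l(2)[OF ks xs] l0 g[OF ks xs] by auto
    qed (use ks l0 in auto)
    also have "\<dots> = g ks xs"
      using g[OF ks xs] l(2)[OF ks xs] ks by (subst G.gfinprod_eq_finprod) auto
    \<comment> \<open>An elementary tensor has \<open>B\<close>-component 0, and additivity of
      \<open>g0\<close> forces \<open>g0 0\<close> to be the unit.\<close>
    finally show ?thesis
      using g0(2)[of 0 0] g0(1)[of 0] g[OF ks xs]
      by (simp add: h_def free_pure_def)
  qed
  ultimately show thesis by (rule that)
qed

end

lemma listset_Cons [simp]: "x # xs \<in> listset (A # As) \<longleftrightarrow> x \<in> A \<and> xs \<in> listset As"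
  by (simp add: set_Cons_def)

lemma listset_snoc [simp]: "xs @ [x] \<in> listset (As @ [A]) \<longleftrightarrow> x \<in> A \<and> xs \<in> listset As"
proof -
  have "length xs = length As" if "list_all2 (\<in>) (xs @ [x]) (As @ [A])"
    using list_all2_lengthD[OF that] by simp
  moreover have "length xs = length As" if "list_all2 (\<in>) xs As"
    using list_all2_lengthD[OF that] by simp
  ultimately show ?thesis
    by (auto simp: listset_iff list_all2_append)
qed

lemma listset_ConsE:
  "zs \<in> listset (A # As) \<Longrightarrow> (\<And>x xs. zs = x # xs \<Longrightarrow> x \<in> A \<Longrightarrow> xs \<in> listset As \<Longrightarrow> P) \<Longrightarrow> P"
  by (auto simp: set_Cons_def)

lemma listset_snocE:
  assumes "zs \<in> listset (As @ [A])" "\<And>x xs. zs = xs @ [x] \<Longrightarrow> x \<in> A \<Longrightarrow> xs \<in> listset As \<Longrightarrow> P"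
  shows P
proof -
  have "zs \<noteq> []" using listset_length[OF assms(1)] by auto
  then obtain xs x where "zs = xs @ [x]" by (cases zs rule: rev_cases) auto
  then show P using assms by auto
qed

declare listset.simps(2) [simp del]

lemma hom_comp: "h \<in> hom G H \<Longrightarrow> h' \<in> hom H L \<Longrightarrow> (\<lambda>v. h' (h v)) \<in> hom G L"
  by (auto simp: hom_def Pi_iff)

section \<open>Bimodule laws and subspaces of the free product\<close>

context free_prod
begin

lemma LS_ConsE: "zs \<in> LS (k # ks) \<Longrightarrow> (\<And>x xs. zs = x # xs \<Longrightarrow> x \<in> carrier (X k) \<Longrightarrow> xs \<in> LS ks \<Longrightarrow> P) \<Longrightarrow> P"
  by (simp, erule listset_ConsE, blast)

lemma LS_snocE: "zs \<in> LS (ks @ [k]) \<Longrightarrow> (\<And>x xs. zs = xs @ [x] \<Longrightarrow> x \<in> carrier (X k) \<Longrightarrow> xs \<in> LS ks \<Longrightarrow> P) \<Longrightarrow> P"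
  by (simp, erule listset_snocE, blast)

abbreviation "gen \<equiv> free_gen K X"

abbreviation "words0 \<equiv> insert [] I"

lemma gen_simps [simp]: "gen [] xs = scal 1" "ks \<noteq> [] \<Longrightarrow> gen ks xs = pure ks xs"
  by (simp_all add: free_gen_def)

lemma gen_closed: "ks \<in> words0 \<Longrightarrow> xs \<in> LS ks \<Longrightarrow> gen ks xs \<in> carrier F"
  using words_ne by (auto simp: free_gen_def scal_closed pure_closed)

lemma words_Cons: "k \<in> K \<Longrightarrow> ks \<in> words0 \<Longrightarrow> ks = [] \<or> hd ks \<noteq> k \<Longrightarrow> k # ks \<in> I"
  by (auto simp: alt_words_def distinct_adj_Cons)

lemma words_ConsD: "k # ks \<in> I \<Longrightarrow> k \<in> K \<and> ks \<in> words0 \<and> (ks = [] \<or> hd ks \<noteq> k)"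
  by (auto simp: alt_words_def distinct_adj_Cons)

lemma words_snoc: "k \<in> K \<Longrightarrow> ks \<in> words0 \<Longrightarrow> ks = [] \<or> last ks \<noteq> k \<Longrightarrow> ks @ [k] \<in> I"
  by (auto simp: alt_words_def distinct_adj_append_iff)

lemma words_snocD: "ks @ [k] \<in> I \<Longrightarrow> k \<in> K \<and> ks \<in> words0 \<and> (ks = [] \<or> last ks \<noteq> k)"
  by (auto simp: alt_words_def distinct_adj_append_iff)

lemma pure_add_Cons:
  assumes "k # ks \<in> I" "xs \<in> LS ks" "x \<in> carrier (X k)" "y \<in> carrier (X k)"
  shows "pure (k # ks) ((x \<oplus>\<^bsub>X k\<^esub> y) # xs) = pure (k # ks) (x # xs) \<oplus>\<^bsub>F\<^esub> pure (k # ks) (y # xs)"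
  using pure_add[OF assms(1), of "x # xs" 0 x y] assms by simp

lemma pure_add_snoc:
  assumes "ks @ [k] \<in> I" "xs \<in> LS ks" "x \<in> carrier (X k)" "y \<in> carrier (X k)"
  shows "pure (ks @ [k]) (xs @ [x \<oplus>\<^bsub>X k\<^esub> y]) = pure (ks @ [k]) (xs @ [x]) \<oplus>\<^bsub>F\<^esub> pure (ks @ [k]) (xs @ [y])"
proof -
  have [simp]: "length xs = length ks" using listset_length[OF assms(2)] by simp
  have "xs @ [x] \<in> LS (ks @ [k])" using assms by simp
  from pure_add[OF assms(1) this, of "length ks" x y] show ?thesis using assms
    by (simp add: list_update_append)
qed

lemma smult_pure_Cons:
  assumes "k # ks \<in> I" "x # xs \<in> LS (k # ks)"
  shows "b \<odot>\<^bsub>F\<^esub> pure (k # ks) (x # xs) = pure (k # ks) ((b \<odot>\<^bsub>X k\<^esub> x) # xs)"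
  using smult_pure[OF assms] by simp

lemma rsmult_pure_snoc:
  assumes "ks @ [k] \<in> I" "xs @ [x] \<in> LS (ks @ [k])"
  shows "pure (ks @ [k]) (xs @ [x]) \<lhd>\<^bsub>F\<^esub> b = pure (ks @ [k]) (xs @ [x \<lhd>\<^bsub>X k\<^esub> b])"
proof -
  have "length xs = length ks" using listset_length[OF assms(2)] by simp
  then show ?thesis using rsmult_pure[OF assms, of b] by (simp add: list_update_append nth_append)
qed

lemma pure_balanced_Cons:
  assumes "k # ks \<in> I" "ks \<noteq> []" "x \<in> carrier (X k)" "xs \<in> LS ks"
  shows "pure (k # ks) ((x \<lhd>\<^bsub>X k\<^esub> b) # xs) = pure (k # ks) (x # xs[0 := b \<odot>\<^bsub>X (ks ! 0)\<^esub> xs ! 0])"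
proof -
  have "x # xs \<in> LS (k # ks)" using assms by simp
  from pure_balanced[OF assms(1) this, of 0 b] show ?thesis using assms by simp
qed

lemma pure_balanced_snoc:
  assumes "ks @ [k] \<in> I" "ks \<noteq> []" "x \<in> carrier (X k)" "xs \<in> LS ks"
  defines "n \<equiv> length ks - 1"
  shows "pure (ks @ [k]) (xs @ [b \<odot>\<^bsub>X k\<^esub> x]) = pure (ks @ [k]) (xs[n := xs ! n \<lhd>\<^bsub>X (ks ! n)\<^esub> b] @ [x])"
proof -
  have "xs @ [x] \<in> LS (ks @ [k])" using assms by simp
  moreover have "length xs = length ks" using listset_length[OF assms(4)] by simp
  ultimately show ?thesis using pure_balanced[OF assms(1), of "xs @ [x]" n b] assms(2)
    by (simp add: n_def list_update_append nth_append)
qed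

text \<open>Adding the zero leg to itself doubles the tensor without changing it.\<close>

lemma pure_zero:
  assumes "ks \<in> I" "xs \<in> LS ks" "i < length ks" "xs ! i = \<zero>\<^bsub>X (ks ! i)\<^esub>"
  shows "pure ks xs = \<zero>\<^bsub>F\<^esub>"
proof -
  have "ks ! i \<in> K" using assms nth_mem[OF assms(3)] by (auto simp: alt_words_def simp del: nth_mem)
  then interpret M: bimodule "X (ks ! i)" by (rule bim)
  have "pure ks xs = pure ks xs \<oplus>\<^bsub>F\<^esub> pure ks xs"
    using pure_add[OF assms(1-3) M.zero_closed M.zero_closed] assms(4)
    by simp (metis list_update_id)
  then show ?thesis using pure_closed[OF assms(1,2)] by (metis F.add.r_cancel_one')
qed

text \<open>This law and those after it follow one scheme: both sides are homomorphisms, so scalars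
  and elementary tensors suffice, and on the latter the law is inherited from the first or the last
  leg.\<close>

lemma smult_one: "v \<in> carrier F \<Longrightarrow> 1 \<odot>\<^bsub>F\<^esub> v = v"
proof (rule F_hom_eq[where h = "\<lambda>v. 1 \<odot>\<^bsub>F\<^esub> v" and h' = "\<lambda>v. v", OF smult_hom])
  fix ks xs assume *: "ks \<in> I" "xs \<in> LS ks"
  then obtain k js where k: "ks = k # js" using words_ne by (cases ks) auto
  show "1 \<odot>\<^bsub>F\<^esub> pure ks xs = pure ks xs"
    using * words_ConsD unfolding k
    by (elim LS_ConsE) (auto simp: smult_pure_Cons bimodule.one_smult[OF bim])
qed (auto simp: hom_def smult_scal)

lemma rsmult_one: "v \<in> carrier F \<Longrightarrow> v \<lhd>\<^bsub>F\<^esub> 1 = v"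
proof (rule F_hom_eq[where h = "\<lambda>v. v \<lhd>\<^bsub>F\<^esub> 1" and h' = "\<lambda>v. v", OF rsmult_hom])
  fix ks xs assume *: "ks \<in> I" "xs \<in> LS ks"
  then obtain k js where k: "ks = js @ [k]" using words_ne by (cases ks rule: rev_cases) auto
  show "pure ks xs \<lhd>\<^bsub>F\<^esub> 1 = pure ks xs"
    using * words_snocD unfolding k
    by (elim LS_snocE) (auto simp: rsmult_pure_snoc bimodule.one_rsmult[OF bim])
qed (auto simp: hom_def rsmult_scal)

lemma hom_F_add: "h \<in> hom G (add_monoid F) \<Longrightarrow> h' \<in> hom G (add_monoid F) \<Longrightarrow>
    (\<lambda>v. h v \<oplus>\<^bsub>F\<^esub> h' v) \<in> hom G (add_monoid F)"
  by (auto simp: hom_def F.a_ac Pi_iff)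

lemma smult_mult: "v \<in> carrier F \<Longrightarrow> (a * b) \<odot>\<^bsub>F\<^esub> v = a \<odot>\<^bsub>F\<^esub> (b \<odot>\<^bsub>F\<^esub> v)"
proof (rule F_hom_eq[where h = "\<lambda>v. (a * b) \<odot>\<^bsub>F\<^esub> v" and h' = "\<lambda>v. a \<odot>\<^bsub>F\<^esub> (b \<odot>\<^bsub>F\<^esub> v)", OF smult_hom hom_comp[OF smult_hom smult_hom]])
  fix ks xs assume *: "ks \<in> I" "xs \<in> LS ks"
  then obtain k js where k: "ks = k # js" using words_ne by (cases ks) auto
  show "(a * b) \<odot>\<^bsub>F\<^esub> pure ks xs = a \<odot>\<^bsub>F\<^esub> (b \<odot>\<^bsub>F\<^esub> pure ks xs)"
    using * words_ConsD unfolding k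
    by (elim LS_ConsE) (auto simp: smult_pure_Cons bimodule.mult_smult[OF bim] bimodule.smult_closed[OF bim])
qed (auto simp: smult_scal mult.assoc)

lemma rsmult_mult: "v \<in> carrier F \<Longrightarrow> v \<lhd>\<^bsub>F\<^esub> (a * b) = v \<lhd>\<^bsub>F\<^esub> a \<lhd>\<^bsub>F\<^esub> b"
proof (rule F_hom_eq[where h = "\<lambda>v. v \<lhd>\<^bsub>F\<^esub> (a * b)" and h' = "\<lambda>v. v \<lhd>\<^bsub>F\<^esub> a \<lhd>\<^bsub>F\<^esub> b", OF rsmult_hom hom_comp[OF rsmult_hom rsmult_hom]])
  fix ks xs assume *: "ks \<in> I" "xs \<in> LS ks"
  then obtain k js where k: "ks = js @ [k]" using words_ne by (cases ks rule: rev_cases) auto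
  show "pure ks xs \<lhd>\<^bsub>F\<^esub> (a * b) = pure ks xs \<lhd>\<^bsub>F\<^esub> a \<lhd>\<^bsub>F\<^esub> b"
    using * words_snocD unfolding k
    by (elim LS_snocE) (auto simp: rsmult_pure_snoc bimodule.mult_rsmult[OF bim] bimodule.rsmult_closed[OF bim])
qed (auto simp: rsmult_scal mult.assoc)

lemma smult_zero: "v \<in> carrier F \<Longrightarrow> 0 \<odot>\<^bsub>F\<^esub> v = \<zero>\<^bsub>F\<^esub>"
proof (rule F_hom_eq[where h = "\<lambda>v. 0 \<odot>\<^bsub>F\<^esub> v" and h' = "\<lambda>v. \<zero>\<^bsub>F\<^esub>" and G = "add_monoid F", OF smult_hom])
  fix ks xs assume *: "ks \<in> I" "xs \<in> LS ks"
  then obtain k js where k: "ks = k # js" using words_ne by (cases ks) auto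
  have kK: "k \<in> K" using * words_ConsD unfolding k by blast
  interpret M: bimodule "X k" by (rule bim[OF kK])
  have z: "0 \<odot>\<^bsub>X k\<^esub> x = \<zero>\<^bsub>X k\<^esub>" if "x \<in> carrier (X k)" for x
    using M.add_smult[OF that, of 0 0] M.smult_closed[OF that, of 0] by (metis M.add.r_cancel_one' add_0)
  show "0 \<odot>\<^bsub>F\<^esub> pure ks xs = \<zero>\<^bsub>F\<^esub>"
    using * unfolding k
    by (elim LS_ConsE) (auto simp: smult_pure_Cons z intro!: pure_zero[where i = 0])
qed (auto simp: smult_scal hom_def F_zero[symmetric])

lemma rsmult_zero: "v \<in> carrier F \<Longrightarrow> v \<lhd>\<^bsub>F\<^esub> 0 = \<zero>\<^bsub>F\<^esub>"
proof (rule F_hom_eq[where h = "\<lambda>v. v \<lhd>\<^bsub>F\<^esub> 0" and h' = "\<lambda>v. \<zero>\<^bsub>F\<^esub>" and G = "add_monoid F", OF rsmult_hom])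
  fix ks xs assume *: "ks \<in> I" "xs \<in> LS ks"
  then obtain k js where k: "ks = js @ [k]" using words_ne by (cases ks rule: rev_cases) auto
  have kK: "k \<in> K" using * words_snocD unfolding k by blast
  interpret M: bimodule "X k" by (rule bim[OF kK])
  have z: "x \<lhd>\<^bsub>X k\<^esub> 0 = \<zero>\<^bsub>X k\<^esub>" if "x \<in> carrier (X k)" for x
    using M.add_rsmult[OF that, of 0 0] M.rsmult_closed[OF that, of 0] by (metis M.add.r_cancel_one' add_0)
  show "pure ks xs \<lhd>\<^bsub>F\<^esub> 0 = \<zero>\<^bsub>F\<^esub>"
    using * unfolding k
  proof (elim LS_snocE)
    fix x ys assume x: "js @ [k] \<in> I" "xs = ys @ [x]" "x \<in> carrier (X k)" "ys \<in> LS js"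
    moreover have "length ys = length js" using listset_length[OF x(4)] by simp
    moreover have "ys @ [\<zero>\<^bsub>X k\<^esub>] \<in> LS (js @ [k])" using x by simp
    ultimately show "pure (js @ [k]) xs \<lhd>\<^bsub>F\<^esub> 0 = \<zero>\<^bsub>F\<^esub>"
      by (auto simp: rsmult_pure_snoc z nth_append intro!: pure_zero[where i = "length js"])
  qed
qed (auto simp: rsmult_scal hom_def F_zero[symmetric])

lemma smult_add_left: "v \<in> carrier F \<Longrightarrow> (a + b) \<odot>\<^bsub>F\<^esub> v = a \<odot>\<^bsub>F\<^esub> v \<oplus>\<^bsub>F\<^esub> b \<odot>\<^bsub>F\<^esub> v"
proof (rule F_hom_eq[where h = "\<lambda>v. (a + b) \<odot>\<^bsub>F\<^esub> v" and h' = "\<lambda>v. a \<odot>\<^bsub>F\<^esub> v \<oplus>\<^bsub>F\<^esub> b \<odot>\<^bsub>F\<^esub> v", OF smult_hom hom_F_add[OF smult_hom smult_hom]])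
  fix ks xs assume *: "ks \<in> I" "xs \<in> LS ks"
  then obtain k js where k: "ks = k # js" using words_ne by (cases ks) auto
  show "(a + b) \<odot>\<^bsub>F\<^esub> pure ks xs = a \<odot>\<^bsub>F\<^esub> pure ks xs \<oplus>\<^bsub>F\<^esub> b \<odot>\<^bsub>F\<^esub> pure ks xs"
    using * words_ConsD unfolding k
    by (elim LS_ConsE) (auto simp: smult_pure_Cons bimodule.add_smult[OF bim] bimodule.smult_closed[OF bim]
        pure_add_Cons)
qed (auto simp: smult_scal distrib_right scal_add)

lemma rsmult_add_left: "v \<in> carrier F \<Longrightarrow> v \<lhd>\<^bsub>F\<^esub> (a + b) = v \<lhd>\<^bsub>F\<^esub> a \<oplus>\<^bsub>F\<^esub> v \<lhd>\<^bsub>F\<^esub> b"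
proof (rule F_hom_eq[where h = "\<lambda>v. v \<lhd>\<^bsub>F\<^esub> (a + b)" and h' = "\<lambda>v. v \<lhd>\<^bsub>F\<^esub> a \<oplus>\<^bsub>F\<^esub> v \<lhd>\<^bsub>F\<^esub> b", OF rsmult_hom hom_F_add[OF rsmult_hom rsmult_hom]])
  fix ks xs assume *: "ks \<in> I" "xs \<in> LS ks"
  then obtain k js where k: "ks = js @ [k]" using words_ne by (cases ks rule: rev_cases) auto
  show "pure ks xs \<lhd>\<^bsub>F\<^esub> (a + b) = pure ks xs \<lhd>\<^bsub>F\<^esub> a \<oplus>\<^bsub>F\<^esub> pure ks xs \<lhd>\<^bsub>F\<^esub> b"
    using * words_snocD unfolding k
    by (elim LS_snocE) (auto simp: rsmult_pure_snoc bimodule.add_rsmult[OF bim] bimodule.rsmult_closed[OF bim]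
        pure_add_snoc)
qed (auto simp: rsmult_scal distrib_left scal_add)

text \<open>One construction for \<open>free_left\<close> and \<open>free_right\<close>, where
  \<open>Q\<close> restricts the first or the last letter of a word.\<close>

definition "part Q = F\<lparr>carrier := {(b, f) \<in> carrier F. \<forall>ks\<in>I. \<not> Q ks \<longrightarrow> f ks = \<zero>\<^bsub>T ks\<^esub>}\<rparr>"

lemma part_simps [simp]:
  "add (part Q) = add F" "smult (part Q) = smult F" "rsmult (part Q) = rsmult F" "\<zero>\<^bsub>part Q\<^esub> = \<zero>\<^bsub>F\<^esub>"
  by (simp_all add: part_def)

lemma part_carrier: "v \<in> carrier (part Q) \<longleftrightarrow> v \<in> carrier F \<and> (\<forall>ks\<in>I. \<not> Q ks \<longrightarrow> snd v ks = \<zero>\<^bsub>T ks\<^esub>)"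
  by (auto simp: part_def)

lemma scal_part: "scal c \<in> carrier (part Q)"
  unfolding part_carrier by (simp add: scal_closed) (simp add: free_scalar_def)

lemma pure_part: "ks \<in> I \<Longrightarrow> xs \<in> LS ks \<Longrightarrow> Q ks \<Longrightarrow> pure ks xs \<in> carrier (part Q)"
  unfolding part_carrier by (simp add: pure_closed) (auto simp: free_pure_def)

lemma part_op_closed: "op_closed (part Q)"
  unfolding op_closed_def
proof (intro conjI ballI allI; unfold part_simps part_carrier; elim conjE; intro conjI ballI impI)
  fix v w ks assume "v \<in> carrier F" "w \<in> carrier F" "\<forall>ks\<in>I. \<not> Q ks \<longrightarrow> snd v ks = \<zero>\<^bsub>T ks\<^esub>"
    "\<forall>ks\<in>I. \<not> Q ks \<longrightarrow> snd w ks = \<zero>\<^bsub>T ks\<^esub>" "ks \<in> I" "\<not> Q ks"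
  then show "snd (v \<oplus>\<^bsub>F\<^esub> w) ks = \<zero>\<^bsub>T ks\<^esub>"
    by (cases v; cases w) (simp add: F_add T_zero_add T_zero_closed)
next
  fix v b ks assume *: "v \<in> carrier F" "\<forall>ks\<in>I. \<not> Q ks \<longrightarrow> snd v ks = \<zero>\<^bsub>T ks\<^esub>" "ks \<in> I" "\<not> Q ks"
  show "snd (b \<odot>\<^bsub>F\<^esub> v) ks = \<zero>\<^bsub>T ks\<^esub>"
    using * T_hom_zero[OF *(3) tensor_list_smult_hom[OF words_bim words_ne(2)]]
    by (cases v) (simp add: F_smult)
  show "snd (v \<lhd>\<^bsub>F\<^esub> b) ks = \<zero>\<^bsub>T ks\<^esub>"
    using * T_hom_zero[OF *(3) tensor_list_rsmult_hom[OF words_bim words_ne(2)]]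
    by (cases v) (simp add: F_rsmult)
qed (use hom_in_carrier[OF smult_hom] hom_in_carrier[OF rsmult_hom] in auto)

lemma part_induct [consumes 1, case_names scalar pure add]:
  assumes v: "v \<in> carrier (part Q)"
    and scalar: "\<And>c. P (scal c)"
    and pure: "\<And>ks xs. ks \<in> I \<Longrightarrow> xs \<in> LS ks \<Longrightarrow> Q ks \<Longrightarrow> P (pure ks xs)"
    and add: "\<And>u v. u \<in> carrier (part Q) \<Longrightarrow> v \<in> carrier (part Q) \<Longrightarrow> P u \<Longrightarrow> P v \<Longrightarrow> P (u \<oplus>\<^bsub>F\<^esub> v)"
  shows "P v"
proof -
  define q where "q = (\<lambda>(b :: 'b, f). (b, \<lambda>ks\<in>I. if Q ks then f ks else \<zero>\<^bsub>T ks\<^esub>))"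
  have q: "q v \<in> carrier (part Q)" if "v \<in> carrier F" for v
    using that by (auto simp: F_carrier part_carrier q_def PiE_iff T_zero_closed
        elim!: rev_finite_subset split: if_splits)
  have "P (q v)" if "v \<in> carrier F" for v
    using that
  proof (induction rule: F_induct)
    case (scalar c)
    have "q (scal c) = scal c" by (auto simp: q_def free_scalar_def fun_eq_iff)
    then show ?case using assms(2) by simp
  next
    case (pure ks xs)
    then show ?case
    proof (cases "Q ks")
      case True
      then have "q (pure ks xs) = pure ks xs" by (auto simp: q_def free_pure_def fun_eq_iff)
      then show ?thesis using assms(3) pure True by simp
    next
      case False
      then have "q (pure ks xs) = scal 0" by (auto simp: q_def free_pure_def free_scalar_def fun_eq_iff)
      then show ?thesis using assms(2) by simp
    qed
  next
    case (add u v)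
    have "q (u \<oplus>\<^bsub>F\<^esub> v) = q u \<oplus>\<^bsub>F\<^esub> q v"
      by (cases u; cases v) (auto simp: q_def F_add fun_eq_iff T_zero_add T_zero_closed)
    then show ?case using assms(4) add q by simp
  qed
  moreover have "q v = v"
    using v by (auto simp: part_carrier F_carrier q_def fun_eq_iff PiE_iff extensional_def)
  ultimately show ?thesis using v by (metis part_carrier)
qed

lemma with_B_op_closed: "k \<in> K \<Longrightarrow> op_closed (with_B (X k))"
  using bimodule_op_closed[OF bim] by (auto simp: op_closed_def)

end

section \<open>The isomorphism \<open>V\<close> and the left regular representation\<close>

context free_prod
begin

lemma free_left_part: "free_left K X k = part (\<lambda>ks. hd ks \<noteq> k)"
  by (simp add: free_left_def part_def)

lemma free_right_part: "free_right K X k = part (\<lambda>ks. last ks \<noteq> k)"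
  by (simp add: free_right_def part_def)

lemma smultF_closed: "v \<in> carrier F \<Longrightarrow> b \<odot>\<^bsub>F\<^esub> v \<in> carrier F"
  using hom_in_carrier[OF smult_hom, of v] by simp

lemma rsmultF_closed: "v \<in> carrier F \<Longrightarrow> v \<lhd>\<^bsub>F\<^esub> b \<in> carrier F"
  using hom_in_carrier[OF rsmult_hom, of v] by simp

lemma smultF_add: "u \<in> carrier F \<Longrightarrow> v \<in> carrier F \<Longrightarrow> b \<odot>\<^bsub>F\<^esub> (u \<oplus>\<^bsub>F\<^esub> v) = b \<odot>\<^bsub>F\<^esub> u \<oplus>\<^bsub>F\<^esub> b \<odot>\<^bsub>F\<^esub> v"
  using hom_mult[OF smult_hom, of u v] by simp

lemma rsmultF_add: "u \<in> carrier F \<Longrightarrow> v \<in> carrier F \<Longrightarrow> (u \<oplus>\<^bsub>F\<^esub> v) \<lhd>\<^bsub>F\<^esub> b = u \<lhd>\<^bsub>F\<^esub> b \<oplus>\<^bsub>F\<^esub> v \<lhd>\<^bsub>F\<^esub> b"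
  using hom_mult[OF rsmult_hom, of u v] by simp

text \<open>The operator that puts a leg in front is defined on all of \<open>F\<close>, where the
  universal property is available. The value 0 on words beginning with \<open>k\<close> is a choice
  compatible with additivity and balancing; vectors of \<open>free_left\<close> do not involve it.
  On a scalar the new leg absorbs the scalar from the right.\<close>

lemma left_creation:
  assumes k: "k \<in> K"
  obtains cr where
    "\<And>x. x \<in> carrier (X k) \<Longrightarrow> cr x \<in> hom (add_monoid F) (add_monoid F)"
    "\<And>x c. x \<in> carrier (X k) \<Longrightarrow> cr x (scal c) = pure [k] [x \<lhd>\<^bsub>X k\<^esub> c]"
    "\<And>x ks xs. x \<in> carrier (X k) \<Longrightarrow> ks \<in> I \<Longrightarrow> xs \<in> LS ks \<Longrightarrow>
      cr x (pure ks xs) = (if hd ks = k then \<zero>\<^bsub>F\<^esub> else pure (k # ks) (x # xs))"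
proof -
  interpret M: bimodule "X k" by (rule bim[OF k])
  have kI: "[k] \<in> I" using words_Cons[OF k, of "[]"] by simp
  have "\<exists>h. h \<in> hom (add_monoid F) (add_monoid F) \<and> (\<forall>c. h (scal c) = pure [k] [x \<lhd>\<^bsub>X k\<^esub> c]) \<and>
      (\<forall>ks\<in>I. \<forall>xs\<in>LS ks. h (pure ks xs) = (if hd ks = k then \<zero>\<^bsub>F\<^esub> else pure (k # ks) (x # xs)))"
    if x: "x \<in> carrier (X k)" for x
  proof (rule F_univ[OF F_comm_group])
    show "pure [k] [x \<lhd>\<^bsub>X k\<^esub> c] \<in> carrier (add_monoid F)" for c
      using x kI by (auto intro!: pure_closed M.rsmult_closed)
    show "pure [k] [x \<lhd>\<^bsub>X k\<^esub> (a + b)] = pure [k] [x \<lhd>\<^bsub>X k\<^esub> a] \<otimes>\<^bsub>add_monoid F\<^esub> pure [k] [x \<lhd>\<^bsub>X k\<^esub> b]" for a b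
      using x kI by (simp add: M.add_rsmult pure_add_Cons M.rsmult_closed)
    let ?g = "\<lambda>ks xs. if hd ks = k then \<zero>\<^bsub>F\<^esub> else pure (k # ks) (x # xs)"
    fix ks xs assume ks: "ks \<in> I" "xs \<in> LS ks"
    have kk: "k # ks \<in> I" "x # xs \<in> LS (k # ks)" if "hd ks \<noteq> k"
      using words_Cons[OF k, of ks] that ks x by auto
    show "?g ks xs \<in> carrier (add_monoid F)"
      using kk by (auto intro!: pure_closed simp del: list.map)
    show "?g ks (xs[i := y \<oplus>\<^bsub>X (ks ! i)\<^esub> z]) = ?g ks (xs[i := y]) \<otimes>\<^bsub>add_monoid F\<^esub> ?g ks (xs[i := z])"
      if "i < length ks" "y \<in> carrier (X (ks ! i))" "z \<in> carrier (X (ks ! i))" for i y z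
      using that kk pure_add[of "k # ks" "x # xs" "Suc i" y z] by simp
    show "?g ks (xs[i := xs ! i \<lhd>\<^bsub>X (ks ! i)\<^esub> b]) = ?g ks (xs[Suc i := b \<odot>\<^bsub>X (ks ! Suc i)\<^esub> xs ! Suc i])"
      if "Suc i < length ks" for i b
      using that kk pure_balanced[of "k # ks" "x # xs" "Suc i" b] by simp
  qed auto
  then obtain cr where "\<forall>x\<in>carrier (X k). cr x \<in> hom (add_monoid F) (add_monoid F) \<and>
      (\<forall>c. cr x (scal c) = pure [k] [x \<lhd>\<^bsub>X k\<^esub> c]) \<and>
      (\<forall>ks\<in>I. \<forall>xs\<in>LS ks. cr x (pure ks xs) = (if hd ks = k then \<zero>\<^bsub>F\<^esub> else pure (k # ks) (x # xs)))"
    using bchoice[of "carrier (X k)"] by (metis (no_types, lifting))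
  then show thesis by (intro that) auto
qed

text \<open>\<open>V_inv\<close> is defined by choice, so everything rests on the existence of a
  suitable homomorphism: it sends the tensor of \<open>(b, x)\<close> and \<open>n\<close> to
  \<open>b \<odot> n\<close> plus the vector with leg \<open>x\<close> created in front of
  \<open>n\<close>.\<close>

lemma V_inv_props:
  assumes k: "k \<in> K"
  defines "M \<equiv> with_B (X k)" and "N \<equiv> free_left K X k"
  shows V_inv_hom: "V_inv K X k \<in> hom (add_monoid (tensor M N)) (add_monoid F)"
    and V_inv_gen: "ks \<in> words0 \<Longrightarrow> xs \<in> LS ks \<Longrightarrow> ks = [] \<or> hd ks \<noteq> k \<Longrightarrow> x \<in> carrier (X k) \<Longrightarrow>
      V_inv K X k (pure_tensor M N (b, x) (gen ks xs)) = b \<odot>\<^bsub>F\<^esub> gen ks xs \<oplus>\<^bsub>F\<^esub> gen (k # ks) (x # xs)"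
    and V_inv_scal: "x \<in> carrier (X k) \<Longrightarrow> V_inv K X k (pure_tensor M N (b, x) (scal c)) =
      scal (b * c) \<oplus>\<^bsub>F\<^esub> pure [k] [x \<lhd>\<^bsub>X k\<^esub> c]"
proof -
  interpret M: bimodule "X k" by (rule bim[OF k])
  obtain cr where cr: "\<And>x. x \<in> carrier (X k) \<Longrightarrow> cr x \<in> hom (add_monoid F) (add_monoid F)"
    "\<And>x c. x \<in> carrier (X k) \<Longrightarrow> cr x (scal c) = pure [k] [x \<lhd>\<^bsub>X k\<^esub> c]"
    "\<And>x ks xs. x \<in> carrier (X k) \<Longrightarrow> ks \<in> I \<Longrightarrow> xs \<in> LS ks \<Longrightarrow>
      cr x (pure ks xs) = (if hd ks = k then \<zero>\<^bsub>F\<^esub> else pure (k # ks) (x # xs))"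
    using left_creation[OF k] by blast
  have kI: "[k] \<in> I" using words_Cons[OF k, of "[]"] by simp
  have ops: "op_closed M" "op_closed N"
    by (simp_all add: M_def N_def with_B_op_closed[OF k] free_left_part part_op_closed)
  have NF: "n \<in> carrier F" if "n \<in> carrier N" for n
    using that by (simp add: N_def free_left_part part_carrier)
  define f where "f = (\<lambda>(b, x) n. b \<odot>\<^bsub>F\<^esub> n \<oplus>\<^bsub>F\<^esub> cr x n)"
  have cr_add: "cr (x \<oplus>\<^bsub>X k\<^esub> y) n = cr x n \<oplus>\<^bsub>F\<^esub> cr y n"
    if x: "x \<in> carrier (X k)" "y \<in> carrier (X k)" and n: "n \<in> carrier F" for x y n
  proof (rule F_hom_eq[where h = "cr (x \<oplus>\<^bsub>X k\<^esub> y)" and h' = "\<lambda>n. cr x n \<oplus>\<^bsub>F\<^esub> cr y n", OF _ hom_F_add])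
    show "cr (x \<oplus>\<^bsub>X k\<^esub> y) (scal c) = cr x (scal c) \<oplus>\<^bsub>F\<^esub> cr y (scal c)" for c
      using x kI by (simp add: cr M.rsmult_add M.rsmult_closed pure_add_Cons)
    show "cr (x \<oplus>\<^bsub>X k\<^esub> y) (pure ks xs) = cr x (pure ks xs) \<oplus>\<^bsub>F\<^esub> cr y (pure ks xs)" if "ks \<in> I" "xs \<in> LS ks" for ks xs
      using x that words_Cons[OF k, of ks] by (simp add: cr pure_add_Cons)
  qed (use x n cr in auto)
  \<comment> \<open>This is what makes the map balanced: \<open>c\<close> moves from the created leg
    to the front of \<open>n\<close>.\<close>
  have cr_bal: "cr (x \<lhd>\<^bsub>X k\<^esub> c) n = cr x (c \<odot>\<^bsub>F\<^esub> n)"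
    if x: "x \<in> carrier (X k)" and n: "n \<in> carrier F" for x c n
  proof (rule F_hom_eq[where h = "cr (x \<lhd>\<^bsub>X k\<^esub> c)" and h' = "\<lambda>n. cr x (c \<odot>\<^bsub>F\<^esub> n)", OF _ hom_comp[OF smult_hom]])
    show "cr (x \<lhd>\<^bsub>X k\<^esub> c) (scal d) = cr x (c \<odot>\<^bsub>F\<^esub> scal d)" for d
      using x by (simp add: cr M.rsmult_closed smult_scal M.mult_rsmult)
    show "cr (x \<lhd>\<^bsub>X k\<^esub> c) (pure ks xs) = cr x (c \<odot>\<^bsub>F\<^esub> pure ks xs)" if ks: "ks \<in> I" "xs \<in> LS ks" for ks xs
    proof -
      have len: "0 < length ks" using words_ne[OF ks(1)] by simp
      have "ks ! 0 \<in> K" using ks nth_mem[OF len] by (auto simp: alt_words_def simp del: nth_mem)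
      then have "c \<odot>\<^bsub>X (ks ! 0)\<^esub> xs ! 0 \<in> carrier (X (ks ! 0))"
        using listset_nth[OF ks(2), of 0] len by (simp add: bimodule.smult_closed[OF bim])
      then have "xs[0 := c \<odot>\<^bsub>X (ks ! 0)\<^esub> xs ! 0] \<in> LS ks"
        using ks len by (intro listset_update) auto
      then show ?thesis
        using x ks words_Cons[OF k, of ks] pure_balanced_Cons[of k ks x xs c] words_ne[OF ks(1)]
        by (simp add: cr M.rsmult_closed smult_pure)
    qed
  qed (use x n cr M.rsmult_closed in auto)
  have crF: "cr x n \<in> carrier F" if "x \<in> carrier (X k)" "n \<in> carrier F" for x n
    using hom_in_carrier[OF cr(1), of x n] that by simp
  have cr_addr: "cr x (n \<oplus>\<^bsub>F\<^esub> n') = cr x n \<oplus>\<^bsub>F\<^esub> cr x n'"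
    if "x \<in> carrier (X k)" "n \<in> carrier F" "n' \<in> carrier F" for x n n'
    using hom_mult[OF cr(1), of x n n'] that by simp
  have h: "\<exists>h. h \<in> hom (add_monoid (tensor M N)) (add_monoid F) \<and>
      (\<forall>m\<in>carrier M. \<forall>n\<in>carrier N. h (pure_tensor M N m n) = f m n)"
  proof (intro exI conjI ballI)
    have c: "f m n \<in> carrier (add_monoid F)" if "m \<in> carrier M" "n \<in> carrier N" for m n
      using that by (cases m) (simp add: f_def M_def NF crF smultF_closed)
    have al: "f (m \<oplus>\<^bsub>M\<^esub> m') n = f m n \<otimes>\<^bsub>add_monoid F\<^esub> f m' n"
      if "m \<in> carrier M" "m' \<in> carrier M" "n \<in> carrier N" for m m' n
      using that by (cases m; cases m') (simp add: f_def M_def NF crF smultF_closed smult_add_left cr_add F.a_ac)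
    have ar: "f m (n \<oplus>\<^bsub>N\<^esub> n') = f m n \<otimes>\<^bsub>add_monoid F\<^esub> f m n'"
      if "m \<in> carrier M" "n \<in> carrier N" "n' \<in> carrier N" for m n n'
      using that NF[OF that(2)] NF[OF that(3)]
      by (cases m) (simp add: f_def M_def N_def free_left_part crF smultF_closed smultF_add cr_addr F.a_ac)
    have b: "f (m \<lhd>\<^bsub>M\<^esub> c) n = f m (c \<odot>\<^bsub>N\<^esub> n)" if "m \<in> carrier M" "n \<in> carrier N" for m c n
      using that NF[OF that(2)]
      by (cases m) (simp add: f_def M_def N_def free_left_part smult_mult cr_bal)
    show "tensor_lift M N (add_monoid F) f \<in> hom (add_monoid (tensor M N)) (add_monoid F)"
      by (rule tensor_lift_hom[OF ops F_comm_group c al ar b])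
    show "tensor_lift M N (add_monoid F) f (pure_tensor M N m n) = f m n"
      if "m \<in> carrier M" "n \<in> carrier N" for m n
      by (rule tensor_lift_pure[OF ops F_comm_group c al ar b that])
  qed
  let ?P = "\<lambda>h. h \<in> hom (add_monoid (tensor M N)) (add_monoid F) \<and>
       (\<forall>b. \<forall>x\<in>carrier (X k).
         (\<forall>c. h (pure_tensor M N (b, x) (scal c)) = scal (b * c) \<oplus>\<^bsub>F\<^esub> pure [k] [x \<lhd>\<^bsub>X k\<^esub> c]) \<and>
         (\<forall>ks\<in>I. \<forall>xs\<in>LS ks. hd ks \<noteq> k \<longrightarrow>
            h (pure_tensor M N (b, x) (pure ks xs)) =
              b \<odot>\<^bsub>F\<^esub> pure ks xs \<oplus>\<^bsub>F\<^esub> pure (k # ks) (x # xs)))"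
  obtain h where h: "h \<in> hom (add_monoid (tensor M N)) (add_monoid F)"
      "\<And>m n. m \<in> carrier M \<Longrightarrow> n \<in> carrier N \<Longrightarrow> h (pure_tensor M N m n) = f m n"
    using h by blast
  have "(b, x) \<in> carrier M \<longleftrightarrow> x \<in> carrier (X k)" "scal c \<in> carrier N" for b x c
    by (simp_all add: M_def N_def free_left_part scal_part)
  moreover have "pure ks xs \<in> carrier N" if "ks \<in> I" "xs \<in> LS ks" "hd ks \<noteq> k" for ks xs
    using that by (simp add: N_def free_left_part pure_part)
  ultimately have "?P h"
    using h(1) by (auto simp: h(2) f_def smult_scal cr)
  then have "\<exists>h. ?P h" by blast
  then have P: "?P (SOME h. ?P h)" by (rule someI_ex)
  have V: "V_inv K X k = (SOME h. ?P h)"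
    by (simp add: V_inv_def Let_def M_def N_def)
  note P = P[folded V]
  show "V_inv K X k \<in> hom (add_monoid (tensor M N)) (add_monoid F)" using P by blast
  show s: "V_inv K X k (pure_tensor M N (b, x) (scal c)) = scal (b * c) \<oplus>\<^bsub>F\<^esub> pure [k] [x \<lhd>\<^bsub>X k\<^esub> c]"
    if "x \<in> carrier (X k)" for b c x using P that by blast
  show "V_inv K X k (pure_tensor M N (b, x) (gen ks xs)) = b \<odot>\<^bsub>F\<^esub> gen ks xs \<oplus>\<^bsub>F\<^esub> gen (k # ks) (x # xs)"
    if "ks \<in> words0" "xs \<in> LS ks" "ks = [] \<or> hd ks \<noteq> k" "x \<in> carrier (X k)"
  proof (cases "ks = []")
    case True
    then show ?thesis using that s[of x b 1] by (simp add: smult_scal M.one_rsmult)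
  next
    case False
    then show ?thesis using that P by auto
  qed
qed

text \<open>Injectivity cannot be checked on generators of a tensor product. Instead an inverse is
  built from the universal property of \<open>F\<close>: a first leg of colour \<open>k\<close> is
  split off, and in front of any other word \<open>(1, 0)\<close> is placed.\<close>

lemma V_inv_left_inverse:
  assumes k: "k \<in> K"
  defines "M \<equiv> with_B (X k)" and "N \<equiv> free_left K X k"
  obtains U where "U \<in> hom (add_monoid F) (add_monoid (tensor M N))"
    "\<And>t. t \<in> carrier (tensor M N) \<Longrightarrow> U (V_inv K X k t) = t"
proof -
  interpret Xk: bimodule "X k" by (rule bim[OF k])
  have kI: "[k] \<in> I" using words_Cons[OF k, of "[]"] by simp
  have ops: "op_closed M" "op_closed N"
    by (simp_all add: M_def N_def with_B_op_closed[OF k] free_left_part part_op_closed)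
  let ?T = "tensor M N"
  let ?p = "pure_tensor M N"
  note TG = tensor_comm_group[OF ops]
  interpret TG: comm_group "add_monoid ?T" by (rule TG)
  have addN: "n \<oplus>\<^bsub>N\<^esub> n' = n \<oplus>\<^bsub>F\<^esub> n'" "b \<odot>\<^bsub>N\<^esub> n = b \<odot>\<^bsub>F\<^esub> n" for n n' b
    by (simp_all add: N_def free_left_part)
  have scN: "scal c \<in> carrier N" for c by (simp add: N_def free_left_part scal_part)
  have puN: "pure ks xs \<in> carrier N" if "ks \<in> I" "xs \<in> LS ks" "hd ks \<noteq> k" for ks xs
    using that by (simp add: N_def free_left_part pure_part)
  have geN: "gen ks xs \<in> carrier N" if "ks \<in> words0" "xs \<in> LS ks" "ks = [] \<or> hd ks \<noteq> k" for ks xs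
    using that scN puN words_ne by (cases "ks = []") auto
  have m1: "(1, \<zero>\<^bsub>X k\<^esub>) \<in> carrier M" by (simp add: M_def)
  have mM: "(b, x) \<in> carrier M \<longleftrightarrow> x \<in> carrier (X k)" for b x by (simp add: M_def)
  have z: "\<zero>\<^bsub>X k\<^esub> \<lhd>\<^bsub>X k\<^esub> b = \<zero>\<^bsub>X k\<^esub>" for b
    using Xk.rsmult_add[of "\<zero>\<^bsub>X k\<^esub>" "\<zero>\<^bsub>X k\<^esub>" b] Xk.rsmult_closed[of "\<zero>\<^bsub>X k\<^esub>" b]
    by simp
  let ?g = "\<lambda>ks xs. if hd ks = k then ?p (0, hd xs) (gen (tl ks) (tl xs)) else ?p (1, \<zero>\<^bsub>X k\<^esub>) (pure ks xs)"
  obtain U where U: "U \<in> hom (add_monoid F) (add_monoid ?T)"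
    "\<And>c. U (scal c) = ?p (1, \<zero>\<^bsub>X k\<^esub>) (scal c)"
    "\<And>ks xs. ks \<in> I \<Longrightarrow> xs \<in> LS ks \<Longrightarrow> U (pure ks xs) = ?g ks xs"
  proof (rule F_univ[OF TG, of "\<lambda>c. ?p (1, \<zero>\<^bsub>X k\<^esub>) (scal c)" ?g])
    show "?p (1, \<zero>\<^bsub>X k\<^esub>) (scal c) \<in> carrier (add_monoid ?T)" for c
      using pure_tensor_closed[OF ops m1 scN] by simp
    show "?p (1, \<zero>\<^bsub>X k\<^esub>) (scal (a + b)) = ?p (1, \<zero>\<^bsub>X k\<^esub>) (scal a) \<otimes>\<^bsub>add_monoid ?T\<^esub> ?p (1, \<zero>\<^bsub>X k\<^esub>) (scal b)" for a b
      using pure_tensor_add_right[OF ops m1 scN scN] by (simp add: scal_add addN)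
    fix ks xs assume ks: "ks \<in> I" "xs \<in> LS ks"
    then obtain j js where j: "ks = j # js" using words_ne by (cases ks) auto
    then have xs': "xs \<in> LS (j # js)" using ks by simp
    then obtain x ys where x: "xs = x # ys" "x \<in> carrier (X j)" "ys \<in> LS js"
      using ks j by (elim LS_ConsE)
    have js: "j \<in> K" "js \<in> words0" "js = [] \<or> hd js \<noteq> j" using words_ConsD[of j js] ks j by auto
    show "?g ks xs \<in> carrier (add_monoid ?T)"
      using ks j x js m1 by (cases "j = k") (simp_all add: pure_tensor_closed[OF ops] mM geN puN)
    show "?g ks (xs[i := y \<oplus>\<^bsub>X (ks ! i)\<^esub> z]) = ?g ks (xs[i := y]) \<otimes>\<^bsub>add_monoid ?T\<^esub> ?g ks (xs[i := z])"
      if i: "i < length ks" "y \<in> carrier (X (ks ! i))" "z \<in> carrier (X (ks ! i))" for i y z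
    proof (cases "j = k")
      case True
      show ?thesis
      proof (cases i)
        case 0
        then show ?thesis
          using i j x True js pure_tensor_add_left[OF ops, of "(0, y)" "(0, z)" "gen js ys"]
          by (simp add: mM geN) (simp add: M_def)
      next
        case (Suc i')
        then have ne: "js \<noteq> []" "js \<in> I" using i j js by auto
        have "ys[i' := y] \<in> LS js" "ys[i' := z] \<in> LS js"
          using i j x Suc by (auto intro!: listset_update)
        then show ?thesis
          using i j x True js ne Suc pure_tensor_add_right[OF ops, of "(0, x)" "pure js (ys[i' := y])" "pure js (ys[i' := z])"]
            pure_add[OF ne(2) x(3), of i' y z]
          by (simp add: mM puN addN)
      qed
    next
      case False
      have "xs[i := y] \<in> LS ks" "xs[i := z] \<in> LS ks"
        using i ks by (auto intro!: listset_update)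
      then show ?thesis
        using False j ks pure_add[OF ks i] pure_tensor_add_right[OF ops m1, of "pure ks (xs[i := y])" "pure ks (xs[i := z])"]
        by (simp add: puN addN)
    qed
    show "?g ks (xs[i := xs ! i \<lhd>\<^bsub>X (ks ! i)\<^esub> b]) = ?g ks (xs[Suc i := b \<odot>\<^bsub>X (ks ! Suc i)\<^esub> xs ! Suc i])"
      if i: "Suc i < length ks" for i b
    proof (cases "j = k")
      case True
      have ne: "js \<noteq> []" "js \<in> I" using i j js by auto
      show ?thesis
      \<comment> \<open>For \<open>i = 0\<close> the relator straddles the place where the first leg
        is split off, and the balancing of the outer tensor product takes over from that inside
        \<open>F\<close>.\<close>
      proof (cases i)
        case 0
        then show ?thesis
          using i j x True js ne pure_tensor_balanced[OF ops, of "(0, x)" "pure js ys" b]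
          by (simp add: mM puN addN smult_pure) (simp add: M_def)
      next
        case (Suc i')
        then show ?thesis
          using i j x True js ne pure_balanced[OF ne(2) x(3), of i' b] by simp
      qed
    next
      case False
      then show ?thesis using pure_balanced[OF ks i] j by simp
    qed
  qed auto
  show thesis
  proof (rule that[OF U(1)])
    fix t assume t: "t \<in> carrier ?T"
    note V = V_inv_hom[OF k, folded M_def N_def]
    note hUV = hom_comp[OF V U(1)]
    have id: "(\<lambda>t. t) \<in> hom (add_monoid ?T) (add_monoid ?T)" by (simp add: hom_def)
    have "U (V_inv K X k (?p m n)) = ?p m n" if m: "m \<in> carrier M" and n: "n \<in> carrier N" for m n
    proof -
      obtain b x where m: "m = (b, x)" "x \<in> carrier (X k)" using m by (auto simp: M_def)
      \<comment> \<open>The scalar \<open>b\<close> passes through the tensor sign, and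
        \<open>(b, x)\<close> is split into \<open>(b, 0)\<close> and \<open>(0, x)\<close>; these
        match the two summands in the formula for \<open>V_inv\<close>.\<close>
      have p1: "?p (1, \<zero>\<^bsub>X k\<^esub>) (b \<odot>\<^bsub>F\<^esub> n) = ?p (b, \<zero>\<^bsub>X k\<^esub>) n" if "n \<in> carrier N" for n
        using pure_tensor_balanced[OF ops m1 that, of b] addN by (simp add: M_def z)
      have p2: "?p (b, \<zero>\<^bsub>X k\<^esub>) n \<oplus>\<^bsub>?T\<^esub> ?p (0, x) n = ?p (b, x) n" if "n \<in> carrier N" for n
        using pure_tensor_add_left[OF ops _ _ that, of "(b, \<zero>\<^bsub>X k\<^esub>)" "(0, x)"] m by (simp add: mM) (simp add: M_def)
      show ?thesis
        using n unfolding N_def free_left_part m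
      proof (induction rule: part_induct)
        case (scalar c)
        have "U (V_inv K X k (?p (b, x) (scal c))) =
            U (scal (b * c)) \<oplus>\<^bsub>?T\<^esub> U (pure [k] [x \<lhd>\<^bsub>X k\<^esub> c])"
          using hom_mult[OF U(1), of "scal (b * c)" "pure [k] [x \<lhd>\<^bsub>X k\<^esub> c]"] m kI
          by (simp add: V_inv_scal[OF k, folded M_def N_def] scal_closed pure_closed Xk.rsmult_closed)
        also have "U (scal (b * c)) = ?p (b, \<zero>\<^bsub>X k\<^esub>) (scal c)"
          using p1[OF scN, of c] by (simp add: U smult_scal)
        also have "U (pure [k] [x \<lhd>\<^bsub>X k\<^esub> c]) = ?p (0, x) (scal c)"
          using m kI pure_tensor_balanced[OF ops _ scN, of "(0, x)" c 1]
          by (simp add: U(3) Xk.rsmult_closed mM addN smult_scal) (simp add: M_def)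
        finally show ?case using p2[OF scN] by (simp add: N_def free_left_part)
      next
        case (pure ks xs)
        then have kk: "k # ks \<in> I" using words_Cons[OF k, of ks] by simp
        have sF: "b \<odot>\<^bsub>F\<^esub> pure ks xs \<in> carrier F"
          using hom_in_carrier[OF smult_hom] pure pure_closed by simp
        have "U (V_inv K X k (?p (b, x) (pure ks xs))) =
            U (b \<odot>\<^bsub>F\<^esub> pure ks xs) \<oplus>\<^bsub>?T\<^esub> U (pure (k # ks) (x # xs))"
          using hom_mult[OF U(1), of "b \<odot>\<^bsub>F\<^esub> pure ks xs" "pure (k # ks) (x # xs)"] m kk sF pure words_ne(1)
            V_inv_gen[OF k, folded M_def N_def, of ks xs x b]
          by (auto simp: pure_closed)
        also have "U (b \<odot>\<^bsub>F\<^esub> pure ks xs) = ?p (1, \<zero>\<^bsub>X k\<^esub>) (b \<odot>\<^bsub>F\<^esub> pure ks xs)"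
        proof -
          have len: "0 < length ks" using words_ne[OF pure(1)] by simp
          have "ks ! 0 \<in> K" using pure nth_mem[OF len] by (auto simp: alt_words_def simp del: nth_mem)
          then have "b \<odot>\<^bsub>X (ks ! 0)\<^esub> xs ! 0 \<in> carrier (X (ks ! 0))"
            using listset_nth[OF pure(2), of 0] len by (simp add: bimodule.smult_closed[OF bim])
          then have "xs[0 := b \<odot>\<^bsub>X (ks ! 0)\<^esub> xs ! 0] \<in> LS ks"
            using pure len by (intro listset_update) auto
          then show ?thesis using pure by (simp add: smult_pure U(3))
        qed
        also have "\<dots> = ?p (b, \<zero>\<^bsub>X k\<^esub>) (pure ks xs)" using p1 puN pure by simp
        also have "U (pure (k # ks) (x # xs)) = ?p (0, x) (pure ks xs)"
          using m kk pure words_ne(1) by (auto simp: U(3))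
        finally show ?case using p2 puN pure by (simp add: N_def free_left_part)
      next
        case (add u v)
        then have uv: "u \<in> carrier N" "v \<in> carrier N" by (simp_all add: N_def free_left_part)
        have "?p (b, x) (u \<oplus>\<^bsub>F\<^esub> v) = ?p (b, x) u \<otimes>\<^bsub>add_monoid ?T\<^esub> ?p (b, x) v"
          using pure_tensor_add_right[OF ops _ uv, of "(b, x)"] m by (simp add: mM addN)
        then show ?case
          using hom_mult[OF hUV, of "?p (b, x) u" "?p (b, x) v"] add(3,4) m uv
            pure_tensor_closed[OF ops, of "(b, x)" u] pure_tensor_closed[OF ops, of "(b, x)" v]
          by (simp add: mM) (simp add: N_def free_left_part)
      qed
    qed
    then show "U (V_inv K X k t) = t"
      using tensor_hom_eq[OF ops TG.is_group hUV id _ t] by blast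
  qed
qed

lemma left_ops_with_B:
  assumes "a \<in> left_ops (with_B (X k))" and "k \<in> K"
  shows left_ops_closed: "m \<in> carrier (with_B (X k)) \<Longrightarrow> a m \<in> carrier (with_B (X k))"
    and left_ops_add: "m \<in> carrier (with_B (X k)) \<Longrightarrow> m' \<in> carrier (with_B (X k)) \<Longrightarrow>
      a (m \<oplus>\<^bsub>with_B (X k)\<^esub> m') = a m \<oplus>\<^bsub>with_B (X k)\<^esub> a m'"
    and left_ops_rsmult: "m \<in> carrier (with_B (X k)) \<Longrightarrow> a (m \<lhd>\<^bsub>with_B (X k)\<^esub> b) = a m \<lhd>\<^bsub>with_B (X k)\<^esub> b"
proof -
  have h: "a \<in> hom (add_monoid (with_B (X k))) (add_monoid (with_B (X k)))"
    using assms by (simp add: left_ops_def linear_ops_def)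
  show "m \<in> carrier (with_B (X k)) \<Longrightarrow> a m \<in> carrier (with_B (X k))"
    using hom_in_carrier[OF h, of m] by simp
  show "m \<in> carrier (with_B (X k)) \<Longrightarrow> m' \<in> carrier (with_B (X k)) \<Longrightarrow>
      a (m \<oplus>\<^bsub>with_B (X k)\<^esub> m') = a m \<oplus>\<^bsub>with_B (X k)\<^esub> a m'"
    using hom_mult[OF h, of m m'] by simp
  show "m \<in> carrier (with_B (X k)) \<Longrightarrow> a (m \<lhd>\<^bsub>with_B (X k)\<^esub> b) = a m \<lhd>\<^bsub>with_B (X k)\<^esub> b"
    using assms unfolding left_ops_def by blast
qed

text \<open>For surjectivity, a scalar \<open>c\<close> comes from \<open>(c, 0)\<close> and the
  vacuum, a word beginning with \<open>k\<close> from \<open>(0, x)\<close> and its remainder, any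
  other word from \<open>(1, 0)\<close> and itself. Each time one of the two summands of
  \<open>V_inv\<close> vanishes.\<close>

lemma V_inv_bij:
  assumes k: "k \<in> K"
  defines "M \<equiv> with_B (X k)" and "N \<equiv> free_left K X k"
  shows "V_inv K X k \<in> iso (add_monoid (tensor M N)) (add_monoid F)"
proof -
  interpret Xk: bimodule "X k" by (rule bim[OF k])
  have ops: "op_closed M" "op_closed N"
    by (simp_all add: M_def N_def with_B_op_closed[OF k] free_left_part part_op_closed)
  note V = V_inv_hom[OF k, folded M_def N_def]
  obtain U where U: "\<And>t. t \<in> carrier (tensor M N) \<Longrightarrow> U (V_inv K X k t) = t"
    using V_inv_left_inverse[OF k] unfolding M_def N_def by blast
  interpret TG: comm_group "add_monoid (tensor M N)" by (rule tensor_comm_group[OF ops])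
  have mM: "(b, x) \<in> carrier M \<longleftrightarrow> x \<in> carrier (X k)" for b x by (simp add: M_def)
  have scN: "scal c \<in> carrier N" for c by (simp add: N_def free_left_part scal_part)
  have puN: "pure ks xs \<in> carrier N" if "ks \<in> I" "xs \<in> LS ks" "hd ks \<noteq> k" for ks xs
    using that by (simp add: N_def free_left_part pure_part)
  have geN: "gen ks xs \<in> carrier N" if "ks \<in> words0" "xs \<in> LS ks" "ks = [] \<or> hd ks \<noteq> k" for ks xs
    using that scN puN words_ne by (cases "ks = []") auto
  have "v \<in> V_inv K X k ` carrier (tensor M N)" if "v \<in> carrier F" for v
    using that
  proof (induction rule: F_induct)
    case (scalar c)
    have "[k] \<in> I" using words_Cons[OF k, of "[]"] by simp
    then have "pure [k] [\<zero>\<^bsub>X k\<^esub>] = \<zero>\<^bsub>F\<^esub>" by (intro pure_zero[where i = 0]) auto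
    then have "V_inv K X k (pure_tensor M N (c, \<zero>\<^bsub>X k\<^esub>) (gen [] [])) = scal c"
      using V_inv_gen[OF k, folded M_def N_def, of "[]" "[]" "\<zero>\<^bsub>X k\<^esub>" c]
      by (simp add: smult_scal scal_closed)
    moreover have "pure_tensor M N (c, \<zero>\<^bsub>X k\<^esub>) (gen [] []) \<in> carrier (tensor M N)"
      by (intro pure_tensor_closed ops) (simp_all add: mM scN)
    ultimately show ?case by (metis imageI)
  next
    case (pure ks xs)
    then obtain j js where j: "ks = j # js" using words_ne by (cases ks) auto
    then have xs': "xs \<in> LS (j # js)" using pure by simp
    then obtain x ys where x: "xs = x # ys" "x \<in> carrier (X j)" "ys \<in> LS js"
      by (elim LS_ConsE)
    have js: "j \<in> K" "js \<in> words0" "js = [] \<or> hd js \<noteq> j" using words_ConsD[of j js] pure j by auto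
    show ?case
    proof (cases "j = k")
      case True
      then have "V_inv K X k (pure_tensor M N (0, x) (gen js ys)) = pure ks xs"
        using V_inv_gen[OF k, folded M_def N_def, of js ys x 0] x js gen_closed[of js ys] pure j
        by (simp add: smult_zero pure_closed)
      moreover have "pure_tensor M N (0, x) (gen js ys) \<in> carrier (tensor M N)"
        using x js True by (intro pure_tensor_closed ops geN) (simp_all add: mM)
      ultimately show ?thesis by (metis imageI)
    next
      case False
      have "k # ks \<in> I" using words_Cons[OF k, of ks] pure False j by simp
      moreover from this have "pure (k # ks) (\<zero>\<^bsub>X k\<^esub> # xs) = \<zero>\<^bsub>F\<^esub>"
        using pure by (intro pure_zero[where i = 0]) auto
      ultimately have "V_inv K X k (pure_tensor M N (1, \<zero>\<^bsub>X k\<^esub>) (gen ks xs)) = pure ks xs"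
        using V_inv_gen[OF k, folded M_def N_def, of ks xs "\<zero>\<^bsub>X k\<^esub>" 1] pure False j
        by (simp add: smult_one pure_closed)
      moreover have "pure_tensor M N (1, \<zero>\<^bsub>X k\<^esub>) (gen ks xs) \<in> carrier (tensor M N)"
        using False j pure by (intro pure_tensor_closed ops geN) (simp_all add: mM)
      ultimately show ?thesis by (metis imageI)
    qed
  next
    case (add u v)
    then obtain t s where "t \<in> carrier (tensor M N)" "s \<in> carrier (tensor M N)"
      "u = V_inv K X k t" "v = V_inv K X k s" by blast
    then show ?case
      using hom_mult[OF V, of t s] TG.m_closed[of t s] by (metis (no_types, lifting) imageI monoid.simps(1) partial_object.simps(1))
  qed
  moreover have "V_inv K X k t \<in> carrier F" if "t \<in> carrier (tensor M N)" for t
    using hom_in_carrier[OF V, of t] that by simp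
  ultimately have "V_inv K X k ` carrier (tensor M N) = carrier F" by blast
  moreover have "inj_on (V_inv K X k) (carrier (tensor M N))" by (rule inj_on_inverseI[of _ U]) (rule U)
  ultimately show ?thesis using V by (simp add: iso_def bij_betw_def)
qed

text \<open>The formula is stated on images of elementary tensors under \<open>V_inv\<close>, where
  \<open>V_map\<close> cancels. Taking \<open>(1, 0)\<close> or \<open>(0, x)\<close> for
  \<open>(b, x)\<close> will yield the action on tensors that do not, respectively do, begin with
  colour \<open>k\<close>.\<close>

lemma left_reg_props:
  assumes k: "k \<in> K" and a: "a \<in> left_ops (with_B (X k))"
  shows left_reg_hom: "left_reg K X k a \<in> hom (add_monoid F) (add_monoid F)"
    and left_reg_gen: "ks \<in> words0 \<Longrightarrow> xs \<in> LS ks \<Longrightarrow> ks = [] \<or> hd ks \<noteq> k \<Longrightarrow> x \<in> carrier (X k) \<Longrightarrow>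
      a (b, x) = (b', x') \<Longrightarrow>
      left_reg K X k a (b \<odot>\<^bsub>F\<^esub> gen ks xs \<oplus>\<^bsub>F\<^esub> gen (k # ks) (x # xs)) =
        b' \<odot>\<^bsub>F\<^esub> gen ks xs \<oplus>\<^bsub>F\<^esub> gen (k # ks) (x' # xs)"
proof -
  let ?M = "with_B (X k)" and ?N = "free_left K X k"
  let ?T = "tensor ?M ?N"
  have ops: "op_closed ?M" "op_closed ?N"
    by (simp_all add: with_B_op_closed[OF k] free_left_part part_op_closed)
  note TG = tensor_comm_group[OF ops]
  interpret TG: comm_group "add_monoid ?T" by (rule TG)
  note V = V_inv_hom[OF k] V_inv_bij[OF k]
  have V': "V_map K X k \<in> hom (add_monoid F) (add_monoid ?T)"
    using group.iso_set_sym[OF TG.is_group V(2)] by (simp add: V_map_def iso_def)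
  have "tensor_map ?M ?N a id \<in> hom (add_monoid ?T) (add_monoid ?T) \<and>
      (\<forall>m\<in>carrier ?M. \<forall>n\<in>carrier ?N. tensor_map ?M ?N a id (pure_tensor ?M ?N m n) = pure_tensor ?M ?N (a m) n)"
  proof -
    let ?g = "\<lambda>m n. pure_tensor ?M ?N (a m) (id n)"
    have c: "?g m n \<in> carrier (add_monoid ?T)" if "m \<in> carrier ?M" "n \<in> carrier ?N" for m n
      using pure_tensor_closed[OF ops left_ops_closed[OF a k that(1)] that(2)] by simp
    have al: "?g (m \<oplus>\<^bsub>?M\<^esub> m') n = ?g m n \<otimes>\<^bsub>add_monoid ?T\<^esub> ?g m' n"
      if "m \<in> carrier ?M" "m' \<in> carrier ?M" "n \<in> carrier ?N" for m m' n
      using pure_tensor_add_left[OF ops left_ops_closed[OF a k that(1)] left_ops_closed[OF a k that(2)] that(3)]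
        left_ops_add[OF a k that(1,2)] by simp
    have ar: "?g m (n \<oplus>\<^bsub>?N\<^esub> n') = ?g m n \<otimes>\<^bsub>add_monoid ?T\<^esub> ?g m n'"
      if "m \<in> carrier ?M" "n \<in> carrier ?N" "n' \<in> carrier ?N" for m n n'
      using pure_tensor_add_right[OF ops left_ops_closed[OF a k that(1)] that(2,3)] by simp
    have b: "?g (m \<lhd>\<^bsub>?M\<^esub> c) n = ?g m (c \<odot>\<^bsub>?N\<^esub> n)" if "m \<in> carrier ?M" "n \<in> carrier ?N" for m c n
      using pure_tensor_balanced[OF ops left_ops_closed[OF a k that(1)] that(2)]
        left_ops_rsmult[OF a k that(1)] by simp
    show ?thesis
      unfolding tensor_map_def
      using tensor_lift_hom[where g = ?g, OF ops TG c al ar b] tensor_lift_pure[where g = ?g, OF ops TG c al ar b]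
      by simp
  qed
  note tm = conjunct1[OF this] conjunct2[OF this]
  show "left_reg K X k a \<in> hom (add_monoid F) (add_monoid F)"
    unfolding left_reg_def comp_def
    by (rule hom_comp[OF V' hom_comp[OF tm(1) V(1)]])
  assume ks: "ks \<in> words0" "xs \<in> LS ks" "ks = [] \<or> hd ks \<noteq> k" and x: "x \<in> carrier (X k)" and ax: "a (b, x) = (b', x')"
  have x': "x' \<in> carrier (X k)" using left_ops_closed[OF a k, of "(b, x)"] x ax by simp
  have geN: "gen ks xs \<in> carrier ?N"
    using ks words_ne by (cases "ks = []") (auto simp: free_left_part scal_part pure_part)
  let ?t = "pure_tensor ?M ?N (b, x) (gen ks xs)"
  have t: "?t \<in> carrier ?T" using x geN by (intro pure_tensor_closed ops) auto
  have "inj_on (V_inv K X k) (carrier ?T)" using V(2) by (simp add: iso_def bij_betw_def)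
  then have "V_map K X k (V_inv K X k ?t) = ?t"
    using t by (simp add: V_map_def)
  then have "left_reg K X k a (V_inv K X k ?t) = V_inv K X k (pure_tensor ?M ?N (b', x') (gen ks xs))"
    using tm(2) x geN ax by (simp add: left_reg_def)
  then show "left_reg K X k a (b \<odot>\<^bsub>F\<^esub> gen ks xs \<oplus>\<^bsub>F\<^esub> gen (k # ks) (x # xs)) =
      b' \<odot>\<^bsub>F\<^esub> gen ks xs \<oplus>\<^bsub>F\<^esub> gen (k # ks) (x' # xs)"
    using V_inv_gen[OF k ks x, of b] V_inv_gen[OF k ks x', of b'] by simp
qed

end

section \<open>The isomorphism \<open>W\<close> and the right regular representation\<close>

context free_prod
begin

text \<open>Mirror image of \<open>left_creation\<close>: the leg is appended at the end and absorbs
  a scalar from the left.\<close>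

lemma right_creation:
  assumes k: "k \<in> K"
  obtains cr where
    "\<And>x. x \<in> carrier (X k) \<Longrightarrow> cr x \<in> hom (add_monoid F) (add_monoid F)"
    "\<And>x c. x \<in> carrier (X k) \<Longrightarrow> cr x (scal c) = pure [k] [c \<odot>\<^bsub>X k\<^esub> x]"
    "\<And>x ks xs. x \<in> carrier (X k) \<Longrightarrow> ks \<in> I \<Longrightarrow> xs \<in> LS ks \<Longrightarrow>
      cr x (pure ks xs) = (if last ks = k then \<zero>\<^bsub>F\<^esub> else pure (ks @ [k]) (xs @ [x]))"
proof -
  interpret M: bimodule "X k" by (rule bim[OF k])
  have kI: "[k] \<in> I" using words_snoc[OF k, of "[]"] by simp
  have "\<exists>h. h \<in> hom (add_monoid F) (add_monoid F) \<and> (\<forall>c. h (scal c) = pure [k] [c \<odot>\<^bsub>X k\<^esub> x]) \<and>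
      (\<forall>ks\<in>I. \<forall>xs\<in>LS ks. h (pure ks xs) = (if last ks = k then \<zero>\<^bsub>F\<^esub> else pure (ks @ [k]) (xs @ [x])))"
    if x: "x \<in> carrier (X k)" for x
  proof (rule F_univ[OF F_comm_group])
    show "pure [k] [c \<odot>\<^bsub>X k\<^esub> x] \<in> carrier (add_monoid F)" for c
      using x kI by (auto intro!: pure_closed M.smult_closed)
    show "pure [k] [(a + b) \<odot>\<^bsub>X k\<^esub> x] = pure [k] [a \<odot>\<^bsub>X k\<^esub> x] \<otimes>\<^bsub>add_monoid F\<^esub> pure [k] [b \<odot>\<^bsub>X k\<^esub> x]" for a b
      using x kI by (simp add: M.add_smult pure_add_Cons M.smult_closed)
    let ?g = "\<lambda>ks xs. if last ks = k then \<zero>\<^bsub>F\<^esub> else pure (ks @ [k]) (xs @ [x])"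
    fix ks xs assume ks: "ks \<in> I" "xs \<in> LS ks"
    have kk: "ks @ [k] \<in> I" "xs @ [x] \<in> LS (ks @ [k])" if "last ks \<noteq> k"
      using words_snoc[OF k, of ks] that ks x by auto
    show "?g ks xs \<in> carrier (add_monoid F)"
      using kk by (auto intro!: pure_closed)
    show "?g ks (xs[i := y \<oplus>\<^bsub>X (ks ! i)\<^esub> z]) = ?g ks (xs[i := y]) \<otimes>\<^bsub>add_monoid F\<^esub> ?g ks (xs[i := z])"
      if "i < length ks" "y \<in> carrier (X (ks ! i))" "z \<in> carrier (X (ks ! i))" for i y z
      using that kk pure_add[of "ks @ [k]" "xs @ [x]" i y z] listset_length[OF ks(2)]
      by (simp add: list_update_append nth_append)
    show "?g ks (xs[i := xs ! i \<lhd>\<^bsub>X (ks ! i)\<^esub> b]) = ?g ks (xs[Suc i := b \<odot>\<^bsub>X (ks ! Suc i)\<^esub> xs ! Suc i])"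
      if "Suc i < length ks" for i b
      using that kk pure_balanced[of "ks @ [k]" "xs @ [x]" i b] listset_length[OF ks(2)]
      by (simp add: list_update_append nth_append)
  qed auto
  then obtain cr where "\<forall>x\<in>carrier (X k). cr x \<in> hom (add_monoid F) (add_monoid F) \<and>
      (\<forall>c. cr x (scal c) = pure [k] [c \<odot>\<^bsub>X k\<^esub> x]) \<and>
      (\<forall>ks\<in>I. \<forall>xs\<in>LS ks. cr x (pure ks xs) = (if last ks = k then \<zero>\<^bsub>F\<^esub> else pure (ks @ [k]) (xs @ [x])))"
    using bchoice[of "carrier (X k)"] by (metis (no_types, lifting))
  then show thesis by (intro that) auto
qed

lemma W_inv_props:
  assumes k: "k \<in> K"
  defines "N \<equiv> free_right K X k" and "M \<equiv> with_B (X k)"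
  shows W_inv_hom: "W_inv K X k \<in> hom (add_monoid (tensor N M)) (add_monoid F)"
    and W_inv_gen: "ks \<in> words0 \<Longrightarrow> xs \<in> LS ks \<Longrightarrow> ks = [] \<or> last ks \<noteq> k \<Longrightarrow> x \<in> carrier (X k) \<Longrightarrow>
      W_inv K X k (pure_tensor N M (gen ks xs) (b, x)) = gen ks xs \<lhd>\<^bsub>F\<^esub> b \<oplus>\<^bsub>F\<^esub> gen (ks @ [k]) (xs @ [x])"
    and W_inv_scal: "x \<in> carrier (X k) \<Longrightarrow> W_inv K X k (pure_tensor N M (scal c) (b, x)) =
      scal (c * b) \<oplus>\<^bsub>F\<^esub> pure [k] [c \<odot>\<^bsub>X k\<^esub> x]"
proof -
  interpret M: bimodule "X k" by (rule bim[OF k])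
  obtain cr where cr: "\<And>x. x \<in> carrier (X k) \<Longrightarrow> cr x \<in> hom (add_monoid F) (add_monoid F)"
    "\<And>x c. x \<in> carrier (X k) \<Longrightarrow> cr x (scal c) = pure [k] [c \<odot>\<^bsub>X k\<^esub> x]"
    "\<And>x ks xs. x \<in> carrier (X k) \<Longrightarrow> ks \<in> I \<Longrightarrow> xs \<in> LS ks \<Longrightarrow>
      cr x (pure ks xs) = (if last ks = k then \<zero>\<^bsub>F\<^esub> else pure (ks @ [k]) (xs @ [x]))"
    using right_creation[OF k] by blast
  have kI: "[k] \<in> I" using words_snoc[OF k, of "[]"] by simp
  have ops: "op_closed N" "op_closed M"
    by (simp_all add: M_def N_def with_B_op_closed[OF k] free_right_part part_op_closed)
  have NF: "n \<in> carrier F" if "n \<in> carrier N" for n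
    using that by (simp add: N_def free_right_part part_carrier)
  define f where "f = (\<lambda>n (b, x). n \<lhd>\<^bsub>F\<^esub> b \<oplus>\<^bsub>F\<^esub> cr x n)"
  have cr_add: "cr (x \<oplus>\<^bsub>X k\<^esub> y) n = cr x n \<oplus>\<^bsub>F\<^esub> cr y n"
    if x: "x \<in> carrier (X k)" "y \<in> carrier (X k)" and n: "n \<in> carrier F" for x y n
  proof (rule F_hom_eq[where h = "cr (x \<oplus>\<^bsub>X k\<^esub> y)" and h' = "\<lambda>n. cr x n \<oplus>\<^bsub>F\<^esub> cr y n", OF _ hom_F_add])
    show "cr (x \<oplus>\<^bsub>X k\<^esub> y) (scal c) = cr x (scal c) \<oplus>\<^bsub>F\<^esub> cr y (scal c)" for c
      using x kI by (simp add: cr M.smult_add M.smult_closed pure_add_Cons)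
    show "cr (x \<oplus>\<^bsub>X k\<^esub> y) (pure ks xs) = cr x (pure ks xs) \<oplus>\<^bsub>F\<^esub> cr y (pure ks xs)" if "ks \<in> I" "xs \<in> LS ks" for ks xs
      using x that words_snoc[OF k, of ks] by (simp add: cr pure_add_snoc)
  qed (use x n cr in auto)
  have cr_bal: "cr (c \<odot>\<^bsub>X k\<^esub> x) n = cr x (n \<lhd>\<^bsub>F\<^esub> c)"
    if x: "x \<in> carrier (X k)" and n: "n \<in> carrier F" for x c n
  proof (rule F_hom_eq[where h = "cr (c \<odot>\<^bsub>X k\<^esub> x)" and h' = "\<lambda>n. cr x (n \<lhd>\<^bsub>F\<^esub> c)", OF _ hom_comp[OF rsmult_hom]])
    show "cr (c \<odot>\<^bsub>X k\<^esub> x) (scal d) = cr x (scal d \<lhd>\<^bsub>F\<^esub> c)" for d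
      using x by (simp add: cr M.smult_closed rsmult_scal M.mult_smult)
    show "cr (c \<odot>\<^bsub>X k\<^esub> x) (pure ks xs) = cr x (pure ks xs \<lhd>\<^bsub>F\<^esub> c)" if ks: "ks \<in> I" "xs \<in> LS ks" for ks xs
    proof -
      define n where "n = length ks - 1"
      have len: "n < length ks" using words_ne[OF ks(1)] by (simp add: n_def)
      have "ks ! n \<in> K" using ks nth_mem[OF len] by (auto simp: alt_words_def simp del: nth_mem)
      then have "xs ! n \<lhd>\<^bsub>X (ks ! n)\<^esub> c \<in> carrier (X (ks ! n))"
        using listset_nth[OF ks(2), of n] len by (simp add: bimodule.rsmult_closed[OF bim])
      then have "xs[n := xs ! n \<lhd>\<^bsub>X (ks ! n)\<^esub> c] \<in> LS ks"
        using ks len by (intro listset_update) auto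
      then show ?thesis
        using x ks words_snoc[OF k, of ks] pure_balanced_snoc[of ks k x xs c, folded n_def] words_ne[OF ks(1)]
        by (simp add: cr M.smult_closed rsmult_pure n_def)
    qed
  qed (use x n cr M.smult_closed in auto)
  have crF: "cr x n \<in> carrier F" if "x \<in> carrier (X k)" "n \<in> carrier F" for x n
    using hom_in_carrier[OF cr(1), of x n] that by simp
  have cr_addr: "cr x (n \<oplus>\<^bsub>F\<^esub> n') = cr x n \<oplus>\<^bsub>F\<^esub> cr x n'"
    if "x \<in> carrier (X k)" "n \<in> carrier F" "n' \<in> carrier F" for x n n'
    using hom_mult[OF cr(1), of x n n'] that by simp
  have h: "\<exists>h. h \<in> hom (add_monoid (tensor N M)) (add_monoid F) \<and>
      (\<forall>n\<in>carrier N. \<forall>m\<in>carrier M. h (pure_tensor N M n m) = f n m)"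
  proof (intro exI conjI ballI)
    have c: "f n m \<in> carrier (add_monoid F)" if "n \<in> carrier N" "m \<in> carrier M" for m n
      using that by (cases m) (simp add: f_def M_def NF crF rsmultF_closed)
    have ar: "f n (m \<oplus>\<^bsub>M\<^esub> m') = f n m \<otimes>\<^bsub>add_monoid F\<^esub> f n m'"
      if "n \<in> carrier N" "m \<in> carrier M" "m' \<in> carrier M" for m m' n
      using that by (cases m; cases m') (simp add: f_def M_def NF crF rsmultF_closed rsmult_add_left cr_add F.a_ac)
    have al: "f (n \<oplus>\<^bsub>N\<^esub> n') m = f n m \<otimes>\<^bsub>add_monoid F\<^esub> f n' m"
      if "n \<in> carrier N" "n' \<in> carrier N" "m \<in> carrier M" for m n n'
      using that NF[OF that(1)] NF[OF that(2)]
      by (cases m) (simp add: f_def M_def N_def free_right_part crF rsmultF_closed rsmultF_add cr_addr F.a_ac)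
    have b: "f (n \<lhd>\<^bsub>N\<^esub> c) m = f n (c \<odot>\<^bsub>M\<^esub> m)" if "n \<in> carrier N" "m \<in> carrier M" for m c n
      using that NF[OF that(1)]
      by (cases m) (simp add: f_def M_def N_def free_right_part rsmult_mult cr_bal)
    show "tensor_lift N M (add_monoid F) f \<in> hom (add_monoid (tensor N M)) (add_monoid F)"
      by (rule tensor_lift_hom[OF ops F_comm_group c al ar b])
    show "tensor_lift N M (add_monoid F) f (pure_tensor N M n m) = f n m"
      if "n \<in> carrier N" "m \<in> carrier M" for m n
      by (rule tensor_lift_pure[OF ops F_comm_group c al ar b that])
  qed
  let ?P = "\<lambda>h. h \<in> hom (add_monoid (tensor N M)) (add_monoid F) \<and>
       (\<forall>b. \<forall>x\<in>carrier (X k).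
         (\<forall>c. h (pure_tensor N M (scal c) (b, x)) = scal (c * b) \<oplus>\<^bsub>F\<^esub> pure [k] [c \<odot>\<^bsub>X k\<^esub> x]) \<and>
         (\<forall>ks\<in>I. \<forall>xs\<in>LS ks. last ks \<noteq> k \<longrightarrow>
            h (pure_tensor N M (pure ks xs) (b, x)) =
              pure ks xs \<lhd>\<^bsub>F\<^esub> b \<oplus>\<^bsub>F\<^esub> pure (ks @ [k]) (xs @ [x])))"
  obtain h where h: "h \<in> hom (add_monoid (tensor N M)) (add_monoid F)"
      "\<And>m n. n \<in> carrier N \<Longrightarrow> m \<in> carrier M \<Longrightarrow> h (pure_tensor N M n m) = f n m"
    using h by blast
  have "(b, x) \<in> carrier M \<longleftrightarrow> x \<in> carrier (X k)" "scal c \<in> carrier N" for b x c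
    by (simp_all add: M_def N_def free_right_part scal_part)
  moreover have "pure ks xs \<in> carrier N" if "ks \<in> I" "xs \<in> LS ks" "last ks \<noteq> k" for ks xs
    using that by (simp add: N_def free_right_part pure_part)
  ultimately have "?P h"
    using h(1) by (auto simp: h(2) f_def rsmult_scal cr)
  then have "\<exists>h. ?P h" by blast
  then have P: "?P (SOME h. ?P h)" by (rule someI_ex)
  have V: "W_inv K X k = (SOME h. ?P h)"
    by (simp add: W_inv_def Let_def M_def N_def)
  note P = P[folded V]
  show "W_inv K X k \<in> hom (add_monoid (tensor N M)) (add_monoid F)" using P by blast
  show s: "W_inv K X k (pure_tensor N M (scal c) (b, x)) = scal (c * b) \<oplus>\<^bsub>F\<^esub> pure [k] [c \<odot>\<^bsub>X k\<^esub> x]"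
    if "x \<in> carrier (X k)" for b c x using P that by blast
  show "W_inv K X k (pure_tensor N M (gen ks xs) (b, x)) = gen ks xs \<lhd>\<^bsub>F\<^esub> b \<oplus>\<^bsub>F\<^esub> gen (ks @ [k]) (xs @ [x])"
    if "ks \<in> words0" "xs \<in> LS ks" "ks = [] \<or> last ks \<noteq> k" "x \<in> carrier (X k)"
  proof (cases "ks = []")
    case True
    then show ?thesis using that s[of x 1 b] by (simp add: rsmult_scal M.one_smult)
  next
    case False
    then show ?thesis using that P by auto
  qed
qed

text \<open>As for \<open>V_inv\<close>, with the last leg split off. The relator straddling the
  split is the one with \<open>Suc i = length js\<close>.\<close>

lemma W_inv_left_inverse:
  assumes k: "k \<in> K"
  defines "N \<equiv> free_right K X k" and "M \<equiv> with_B (X k)"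
  obtains U where "U \<in> hom (add_monoid F) (add_monoid (tensor N M))"
    "\<And>t. t \<in> carrier (tensor N M) \<Longrightarrow> U (W_inv K X k t) = t"
proof -
  interpret Xk: bimodule "X k" by (rule bim[OF k])
  have kI: "[k] \<in> I" using words_snoc[OF k, of "[]"] by simp
  have ops: "op_closed N" "op_closed M"
    by (simp_all add: M_def N_def with_B_op_closed[OF k] free_right_part part_op_closed)
  let ?T = "tensor N M"
  let ?p = "pure_tensor N M"
  note TG = tensor_comm_group[OF ops]
  interpret TG: comm_group "add_monoid ?T" by (rule TG)
  have addN: "n \<oplus>\<^bsub>N\<^esub> n' = n \<oplus>\<^bsub>F\<^esub> n'" "n \<lhd>\<^bsub>N\<^esub> b = n \<lhd>\<^bsub>F\<^esub> b" for n n' b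
    by (simp_all add: N_def free_right_part)
  have scN: "scal c \<in> carrier N" for c by (simp add: N_def free_right_part scal_part)
  have puN: "pure ks xs \<in> carrier N" if "ks \<in> I" "xs \<in> LS ks" "last ks \<noteq> k" for ks xs
    using that by (simp add: N_def free_right_part pure_part)
  have geN: "gen ks xs \<in> carrier N" if "ks \<in> words0" "xs \<in> LS ks" "ks = [] \<or> last ks \<noteq> k" for ks xs
    using that scN puN words_ne by (cases "ks = []") auto
  have m1: "(1, \<zero>\<^bsub>X k\<^esub>) \<in> carrier M" by (simp add: M_def)
  have mM: "(b, x) \<in> carrier M \<longleftrightarrow> x \<in> carrier (X k)" for b x by (simp add: M_def)
  have z: "b \<odot>\<^bsub>X k\<^esub> \<zero>\<^bsub>X k\<^esub> = \<zero>\<^bsub>X k\<^esub>" for b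
    using Xk.smult_add[of "\<zero>\<^bsub>X k\<^esub>" "\<zero>\<^bsub>X k\<^esub>" b] Xk.smult_closed[of "\<zero>\<^bsub>X k\<^esub>" b]
    by simp
  let ?g = "\<lambda>ks xs. if last ks = k then ?p (gen (butlast ks) (butlast xs)) (0, last xs) else ?p (pure ks xs) (1, \<zero>\<^bsub>X k\<^esub>)"
  obtain U where U: "U \<in> hom (add_monoid F) (add_monoid ?T)"
    "\<And>c. U (scal c) = ?p (scal c) (1, \<zero>\<^bsub>X k\<^esub>)"
    "\<And>ks xs. ks \<in> I \<Longrightarrow> xs \<in> LS ks \<Longrightarrow> U (pure ks xs) = ?g ks xs"
  proof (rule F_univ[OF TG, of "\<lambda>c. ?p (scal c) (1, \<zero>\<^bsub>X k\<^esub>)" ?g])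
    show "?p (scal c) (1, \<zero>\<^bsub>X k\<^esub>) \<in> carrier (add_monoid ?T)" for c
      using pure_tensor_closed[OF ops scN m1] by simp
    show "?p (scal (a + b)) (1, \<zero>\<^bsub>X k\<^esub>) = ?p (scal a) (1, \<zero>\<^bsub>X k\<^esub>) \<otimes>\<^bsub>add_monoid ?T\<^esub> ?p (scal b) (1, \<zero>\<^bsub>X k\<^esub>)" for a b
      using pure_tensor_add_left[OF ops scN scN m1] by (simp add: scal_add addN)
    fix ks xs assume ks: "ks \<in> I" "xs \<in> LS ks"
    then obtain j js where j: "ks = js @ [j]" using words_ne by (cases ks rule: rev_cases) auto
    then have xs': "xs \<in> LS (js @ [j])" using ks by simp
    then obtain x ys where x: "xs = ys @ [x]" "x \<in> carrier (X j)" "ys \<in> LS js"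
      using ks j by (elim LS_snocE)
    have len: "length ys = length js" using listset_length[OF x(3)] by simp
    have js: "j \<in> K" "js \<in> words0" "js = [] \<or> last js \<noteq> j" using words_snocD[of js j] ks j by auto
    show "?g ks xs \<in> carrier (add_monoid ?T)"
      using ks j x js m1 by (cases "j = k") (simp_all add: pure_tensor_closed[OF ops] mM geN puN)
    show "?g ks (xs[i := y \<oplus>\<^bsub>X (ks ! i)\<^esub> z]) = ?g ks (xs[i := y]) \<otimes>\<^bsub>add_monoid ?T\<^esub> ?g ks (xs[i := z])"
      if i: "i < length ks" "y \<in> carrier (X (ks ! i))" "z \<in> carrier (X (ks ! i))" for i y z
    proof (cases "j = k")
      case True
      show ?thesis
      proof (cases "i = length js")
        case 0: True
        then show ?thesis
          using i j x True js len pure_tensor_add_right[OF ops, of "gen js ys" "(0, y)" "(0, z)"]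
          by (simp add: mM geN list_update_append nth_append) (simp add: M_def)
      next
        case False
        then have ne: "js \<noteq> []" "js \<in> I" and i': "i < length js" using i j js by auto
        have "ys[i := y] \<in> LS js" "ys[i := z] \<in> LS js"
          using i j x i' by (auto intro!: listset_update simp: nth_append)
        then show ?thesis
          using i j x True js ne i' len pure_tensor_add_left[OF ops, of "pure js (ys[i := y])" "pure js (ys[i := z])" "(0, x)"]
            pure_add[OF ne(2) x(3), of i y z]
          by (simp add: mM puN addN list_update_append nth_append butlast_append)
      qed
    next
      case False
      have "xs[i := y] \<in> LS ks" "xs[i := z] \<in> LS ks"
        using i ks by (auto intro!: listset_update)
      then show ?thesis
        using False j ks pure_add[OF ks i] pure_tensor_add_left[OF ops _ _ m1, of "pure ks (xs[i := y])" "pure ks (xs[i := z])"]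
        by (simp add: puN addN)
    qed
    show "?g ks (xs[i := xs ! i \<lhd>\<^bsub>X (ks ! i)\<^esub> b]) = ?g ks (xs[Suc i := b \<odot>\<^bsub>X (ks ! Suc i)\<^esub> xs ! Suc i])"
      if i: "Suc i < length ks" for i b
    proof (cases "j = k")
      case True
      have ne: "js \<noteq> []" "js \<in> I" using i j js by auto
      show ?thesis
      proof (cases "Suc i = length js")
        case 0: True
        then have n: "i = length js - 1" "i < length js" by auto
        show ?thesis
          using i j x True js ne n 0 len pure_tensor_balanced[OF ops, of "pure js ys" "(0, x)" b]
          by (simp add: mM puN addN rsmult_pure list_update_append nth_append) (simp add: M_def)
      next
        case False
        then show ?thesis
          using i j x True js ne len pure_balanced[OF ne(2) x(3), of i b]
          by (simp add: list_update_append nth_append)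
      qed
    next
      case False
      then show ?thesis using pure_balanced[OF ks i] j by simp
    qed
  qed auto
  show thesis
  proof (rule that[OF U(1)])
    fix t assume t: "t \<in> carrier ?T"
    note V = W_inv_hom[OF k, folded M_def N_def]
    note hUV = hom_comp[OF V U(1)]
    have id: "(\<lambda>t. t) \<in> hom (add_monoid ?T) (add_monoid ?T)" by (simp add: hom_def)
    have "U (W_inv K X k (?p n m)) = ?p n m" if n: "n \<in> carrier N" and m: "m \<in> carrier M" for m n
    proof -
      obtain b x where m: "m = (b, x)" "x \<in> carrier (X k)" using m by (auto simp: M_def)
      have p1: "?p (n \<lhd>\<^bsub>F\<^esub> b) (1, \<zero>\<^bsub>X k\<^esub>) = ?p n (b, \<zero>\<^bsub>X k\<^esub>)" if "n \<in> carrier N" for n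
        using pure_tensor_balanced[OF ops that m1, of b] addN by (simp add: M_def z)
      have p2: "?p n (b, \<zero>\<^bsub>X k\<^esub>) \<oplus>\<^bsub>?T\<^esub> ?p n (0, x) = ?p n (b, x)" if "n \<in> carrier N" for n
        using pure_tensor_add_right[OF ops that, of "(b, \<zero>\<^bsub>X k\<^esub>)" "(0, x)"] m by (simp add: mM) (simp add: M_def)
      show ?thesis
        using n unfolding N_def free_right_part m
      proof (induction rule: part_induct)
        case (scalar c)
        have "U (W_inv K X k (?p (scal c) (b, x))) =
            U (scal (c * b)) \<oplus>\<^bsub>?T\<^esub> U (pure [k] [c \<odot>\<^bsub>X k\<^esub> x])"
          using hom_mult[OF U(1), of "scal (c * b)" "pure [k] [c \<odot>\<^bsub>X k\<^esub> x]"] m kI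
          by (simp add: W_inv_scal[OF k, folded M_def N_def] scal_closed pure_closed Xk.smult_closed)
        also have "U (scal (c * b)) = ?p (scal c) (b, \<zero>\<^bsub>X k\<^esub>)"
          using p1[OF scN, of c] by (simp add: U rsmult_scal)
        also have "U (pure [k] [c \<odot>\<^bsub>X k\<^esub> x]) = ?p (scal c) (0, x)"
          using m kI pure_tensor_balanced[OF ops scN, of "(0, x)" 1 c]
          by (simp add: U(3) Xk.smult_closed mM addN rsmult_scal) (simp add: M_def)
        finally show ?case using p2[OF scN] by (simp add: N_def free_right_part)
      next
        case (pure ks xs)
        then have kk: "ks @ [k] \<in> I" using words_snoc[OF k, of ks] by simp
        have sF: "pure ks xs \<lhd>\<^bsub>F\<^esub> b \<in> carrier F"
          using pure by (simp add: rsmultF_closed pure_closed)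
        have "U (W_inv K X k (?p (pure ks xs) (b, x))) =
            U (pure ks xs \<lhd>\<^bsub>F\<^esub> b) \<oplus>\<^bsub>?T\<^esub> U (pure (ks @ [k]) (xs @ [x]))"
          using hom_mult[OF U(1), of "pure ks xs \<lhd>\<^bsub>F\<^esub> b" "pure (ks @ [k]) (xs @ [x])"] m kk sF pure words_ne(1)
            W_inv_gen[OF k, folded M_def N_def, of ks xs x b]
          by (auto simp: pure_closed)
        also have "U (pure ks xs \<lhd>\<^bsub>F\<^esub> b) = ?p (pure ks xs \<lhd>\<^bsub>F\<^esub> b) (1, \<zero>\<^bsub>X k\<^esub>)"
        proof -
          define n where "n = length ks - 1"
          have len: "n < length ks" using words_ne[OF pure(1)] by (simp add: n_def)
          have "ks ! n \<in> K" using pure nth_mem[OF len] by (auto simp: alt_words_def simp del: nth_mem)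
          then have "xs ! n \<lhd>\<^bsub>X (ks ! n)\<^esub> b \<in> carrier (X (ks ! n))"
            using listset_nth[OF pure(2), of n] len by (simp add: bimodule.rsmult_closed[OF bim])
          then have "xs[n := xs ! n \<lhd>\<^bsub>X (ks ! n)\<^esub> b] \<in> LS ks"
            using pure len by (intro listset_update) auto
          then show ?thesis using pure by (simp add: rsmult_pure n_def U(3))
        qed
        also have "\<dots> = ?p (pure ks xs) (b, \<zero>\<^bsub>X k\<^esub>)" using p1 puN pure by simp
        also have "U (pure (ks @ [k]) (xs @ [x])) = ?p (pure ks xs) (0, x)"
          using m kk pure words_ne(1) by (auto simp: U(3))
        finally show ?case using p2 puN pure by (simp add: N_def free_right_part)
      next
        case (add u v)
        then have uv: "u \<in> carrier N" "v \<in> carrier N" by (simp_all add: N_def free_right_part)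
        have "?p (u \<oplus>\<^bsub>F\<^esub> v) (b, x) = ?p u (b, x) \<otimes>\<^bsub>add_monoid ?T\<^esub> ?p v (b, x)"
          using pure_tensor_add_left[OF ops uv, of "(b, x)"] m by (simp add: mM addN)
        then show ?case
          using hom_mult[OF hUV, of "?p u (b, x)" "?p v (b, x)"] add(3,4) m uv
            pure_tensor_closed[OF ops, of u "(b, x)"] pure_tensor_closed[OF ops, of v "(b, x)"]
          by (simp add: mM) (simp add: N_def free_right_part)
      qed
    qed
    then show "U (W_inv K X k t) = t"
      using tensor_hom_eq[OF ops TG.is_group hUV id _ t] by blast
  qed
qed

lemma right_ops_with_B:
  assumes "a \<in> right_ops (with_B (X k))" and "k \<in> K"
  shows right_ops_closed: "m \<in> carrier (with_B (X k)) \<Longrightarrow> a m \<in> carrier (with_B (X k))"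
    and right_ops_add: "m \<in> carrier (with_B (X k)) \<Longrightarrow> m' \<in> carrier (with_B (X k)) \<Longrightarrow>
      a (m \<oplus>\<^bsub>with_B (X k)\<^esub> m') = a m \<oplus>\<^bsub>with_B (X k)\<^esub> a m'"
    and right_ops_smult: "m \<in> carrier (with_B (X k)) \<Longrightarrow> a (b \<odot>\<^bsub>with_B (X k)\<^esub> m) = b \<odot>\<^bsub>with_B (X k)\<^esub> a m"
proof -
  have h: "a \<in> hom (add_monoid (with_B (X k))) (add_monoid (with_B (X k)))"
    using assms by (simp add: right_ops_def linear_ops_def)
  show "m \<in> carrier (with_B (X k)) \<Longrightarrow> a m \<in> carrier (with_B (X k))"
    using hom_in_carrier[OF h, of m] by simp
  show "m \<in> carrier (with_B (X k)) \<Longrightarrow> m' \<in> carrier (with_B (X k)) \<Longrightarrow>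
      a (m \<oplus>\<^bsub>with_B (X k)\<^esub> m') = a m \<oplus>\<^bsub>with_B (X k)\<^esub> a m'"
    using hom_mult[OF h, of m m'] by simp
  show "m \<in> carrier (with_B (X k)) \<Longrightarrow> a (b \<odot>\<^bsub>with_B (X k)\<^esub> m) = b \<odot>\<^bsub>with_B (X k)\<^esub> a m"
    using assms unfolding right_ops_def by blast
qed

lemma W_inv_bij:
  assumes k: "k \<in> K"
  defines "N \<equiv> free_right K X k" and "M \<equiv> with_B (X k)"
  shows "W_inv K X k \<in> iso (add_monoid (tensor N M)) (add_monoid F)"
proof -
  interpret Xk: bimodule "X k" by (rule bim[OF k])
  have ops: "op_closed N" "op_closed M"
    by (simp_all add: M_def N_def with_B_op_closed[OF k] free_right_part part_op_closed)
  note V = W_inv_hom[OF k, folded M_def N_def]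
  obtain U where U: "\<And>t. t \<in> carrier (tensor N M) \<Longrightarrow> U (W_inv K X k t) = t"
    using W_inv_left_inverse[OF k] unfolding M_def N_def by blast
  interpret TG: comm_group "add_monoid (tensor N M)" by (rule tensor_comm_group[OF ops])
  have mM: "(b, x) \<in> carrier M \<longleftrightarrow> x \<in> carrier (X k)" for b x by (simp add: M_def)
  have scN: "scal c \<in> carrier N" for c by (simp add: N_def free_right_part scal_part)
  have puN: "pure ks xs \<in> carrier N" if "ks \<in> I" "xs \<in> LS ks" "last ks \<noteq> k" for ks xs
    using that by (simp add: N_def free_right_part pure_part)
  have geN: "gen ks xs \<in> carrier N" if "ks \<in> words0" "xs \<in> LS ks" "ks = [] \<or> last ks \<noteq> k" for ks xs
    using that scN puN words_ne by (cases "ks = []") auto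
  have "v \<in> W_inv K X k ` carrier (tensor N M)" if "v \<in> carrier F" for v
    using that
  proof (induction rule: F_induct)
    case (scalar c)
    have "[k] \<in> I" using words_snoc[OF k, of "[]"] by simp
    then have "pure [k] [\<zero>\<^bsub>X k\<^esub>] = \<zero>\<^bsub>F\<^esub>" by (intro pure_zero[where i = 0]) auto
    then have "W_inv K X k (pure_tensor N M (gen [] []) (c, \<zero>\<^bsub>X k\<^esub>)) = scal c"
      using W_inv_gen[OF k, folded M_def N_def, of "[]" "[]" "\<zero>\<^bsub>X k\<^esub>" c]
      by (simp add: rsmult_scal scal_closed)
    moreover have "pure_tensor N M (gen [] []) (c, \<zero>\<^bsub>X k\<^esub>) \<in> carrier (tensor N M)"
      by (intro pure_tensor_closed ops) (simp_all add: mM scN)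
    ultimately show ?case by (metis imageI)
  next
    case (pure ks xs)
    then obtain j js where j: "ks = js @ [j]" using words_ne by (cases ks rule: rev_cases) auto
    then have xs': "xs \<in> LS (js @ [j])" using pure by simp
    then obtain x ys where x: "xs = ys @ [x]" "x \<in> carrier (X j)" "ys \<in> LS js"
      by (elim LS_snocE)
    have js: "j \<in> K" "js \<in> words0" "js = [] \<or> last js \<noteq> j" using words_snocD[of js j] pure j by auto
    show ?case
    proof (cases "j = k")
      case True
      then have "W_inv K X k (pure_tensor N M (gen js ys) (0, x)) = pure ks xs"
        using W_inv_gen[OF k, folded M_def N_def, of js ys x 0] x js gen_closed[of js ys] pure j
        by (simp add: rsmult_zero pure_closed)
      moreover have "pure_tensor N M (gen js ys) (0, x) \<in> carrier (tensor N M)"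
        using x js True by (intro pure_tensor_closed ops geN) (simp_all add: mM)
      ultimately show ?thesis by (metis imageI)
    next
      case False
      have "ks @ [k] \<in> I" using words_snoc[OF k, of ks] pure False j by simp
      moreover from this have "pure (ks @ [k]) (xs @ [\<zero>\<^bsub>X k\<^esub>]) = \<zero>\<^bsub>F\<^esub>"
        using pure listset_length[OF pure(2)] by (intro pure_zero[where i = "length ks"]) (auto simp: nth_append)
      ultimately have "W_inv K X k (pure_tensor N M (gen ks xs) (1, \<zero>\<^bsub>X k\<^esub>)) = pure ks xs"
        using W_inv_gen[OF k, folded M_def N_def, of ks xs "\<zero>\<^bsub>X k\<^esub>" 1] pure False j
        by (simp add: rsmult_one pure_closed)
      moreover have "pure_tensor N M (gen ks xs) (1, \<zero>\<^bsub>X k\<^esub>) \<in> carrier (tensor N M)"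
        using False j pure by (intro pure_tensor_closed ops geN) (simp_all add: mM)
      ultimately show ?thesis by (metis imageI)
    qed
  next
    case (add u v)
    then obtain t s where "t \<in> carrier (tensor N M)" "s \<in> carrier (tensor N M)"
      "u = W_inv K X k t" "v = W_inv K X k s" by blast
    then show ?case
      using hom_mult[OF V, of t s] TG.m_closed[of t s] by (metis (no_types, lifting) imageI monoid.simps(1) partial_object.simps(1))
  qed
  moreover have "W_inv K X k t \<in> carrier F" if "t \<in> carrier (tensor N M)" for t
    using hom_in_carrier[OF V, of t] that by simp
  ultimately have "W_inv K X k ` carrier (tensor N M) = carrier F" by blast
  moreover have "inj_on (W_inv K X k) (carrier (tensor N M))" by (rule inj_on_inverseI[of _ U]) (rule U)
  ultimately show ?thesis using V by (simp add: iso_def bij_betw_def)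
qed

lemma right_reg_props:
  assumes k: "k \<in> K" and a: "a \<in> right_ops (with_B (X k))"
  shows right_reg_hom: "right_reg K X k a \<in> hom (add_monoid F) (add_monoid F)"
    and right_reg_gen: "ks \<in> words0 \<Longrightarrow> xs \<in> LS ks \<Longrightarrow> ks = [] \<or> last ks \<noteq> k \<Longrightarrow> x \<in> carrier (X k) \<Longrightarrow>
      a (b, x) = (b', x') \<Longrightarrow>
      right_reg K X k a (gen ks xs \<lhd>\<^bsub>F\<^esub> b \<oplus>\<^bsub>F\<^esub> gen (ks @ [k]) (xs @ [x])) =
        gen ks xs \<lhd>\<^bsub>F\<^esub> b' \<oplus>\<^bsub>F\<^esub> gen (ks @ [k]) (xs @ [x'])"
proof -
  let ?M = "with_B (X k)" and ?N = "free_right K X k"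
  let ?T = "tensor ?N ?M"
  have ops: "op_closed ?N" "op_closed ?M"
    by (simp_all add: with_B_op_closed[OF k] free_right_part part_op_closed)
  note TG = tensor_comm_group[OF ops]
  interpret TG: comm_group "add_monoid ?T" by (rule TG)
  note V = W_inv_hom[OF k] W_inv_bij[OF k]
  have V': "W_map K X k \<in> hom (add_monoid F) (add_monoid ?T)"
    using group.iso_set_sym[OF TG.is_group V(2)] by (simp add: W_map_def iso_def)
  have "tensor_map ?N ?M id a \<in> hom (add_monoid ?T) (add_monoid ?T) \<and>
      (\<forall>n\<in>carrier ?N. \<forall>m\<in>carrier ?M. tensor_map ?N ?M id a (pure_tensor ?N ?M n m) = pure_tensor ?N ?M n (a m))"
  proof -
    let ?g = "\<lambda>n m. pure_tensor ?N ?M (id n) (a m)"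
    have c: "?g n m \<in> carrier (add_monoid ?T)" if "n \<in> carrier ?N" "m \<in> carrier ?M" for m n
      using pure_tensor_closed[OF ops that(1) right_ops_closed[OF a k that(2)]] by simp
    have ar: "?g n (m \<oplus>\<^bsub>?M\<^esub> m') = ?g n m \<otimes>\<^bsub>add_monoid ?T\<^esub> ?g n m'"
      if "n \<in> carrier ?N" "m \<in> carrier ?M" "m' \<in> carrier ?M" for m m' n
      using pure_tensor_add_right[OF ops that(1) right_ops_closed[OF a k that(2)] right_ops_closed[OF a k that(3)]]
        right_ops_add[OF a k that(2,3)] by simp
    have al: "?g (n \<oplus>\<^bsub>?N\<^esub> n') m = ?g n m \<otimes>\<^bsub>add_monoid ?T\<^esub> ?g n' m"
      if "n \<in> carrier ?N" "n' \<in> carrier ?N" "m \<in> carrier ?M" for m n n'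
      using pure_tensor_add_left[OF ops that(1,2) right_ops_closed[OF a k that(3)]] by simp
    have b: "?g (n \<lhd>\<^bsub>?N\<^esub> c) m = ?g n (c \<odot>\<^bsub>?M\<^esub> m)" if "n \<in> carrier ?N" "m \<in> carrier ?M" for m c n
      using pure_tensor_balanced[OF ops that(1) right_ops_closed[OF a k that(2)]]
        right_ops_smult[OF a k that(2)] by simp
    show ?thesis
      unfolding tensor_map_def
      using tensor_lift_hom[where g = ?g, OF ops TG c al ar b] tensor_lift_pure[where g = ?g, OF ops TG c al ar b]
      by simp
  qed
  note tm = conjunct1[OF this] conjunct2[OF this]
  show "right_reg K X k a \<in> hom (add_monoid F) (add_monoid F)"
    unfolding right_reg_def comp_def
    by (rule hom_comp[OF V' hom_comp[OF tm(1) V(1)]])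
  assume ks: "ks \<in> words0" "xs \<in> LS ks" "ks = [] \<or> last ks \<noteq> k" and x: "x \<in> carrier (X k)" and ax: "a (b, x) = (b', x')"
  have x': "x' \<in> carrier (X k)" using right_ops_closed[OF a k, of "(b, x)"] x ax by simp
  have geN: "gen ks xs \<in> carrier ?N"
    using ks words_ne by (cases "ks = []") (auto simp: free_right_part scal_part pure_part)
  let ?t = "pure_tensor ?N ?M (gen ks xs) (b, x)"
  have t: "?t \<in> carrier ?T" using x geN by (intro pure_tensor_closed ops) auto
  have "inj_on (W_inv K X k) (carrier ?T)" using V(2) by (simp add: iso_def bij_betw_def)
  then have "W_map K X k (W_inv K X k ?t) = ?t"
    using t by (simp add: W_map_def)
  then have "right_reg K X k a (W_inv K X k ?t) = W_inv K X k (pure_tensor ?N ?M (gen ks xs) (b', x'))"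
    using tm(2) x geN ax by (simp add: right_reg_def)
  then show "right_reg K X k a (gen ks xs \<lhd>\<^bsub>F\<^esub> b \<oplus>\<^bsub>F\<^esub> gen (ks @ [k]) (xs @ [x])) =
      gen ks xs \<lhd>\<^bsub>F\<^esub> b' \<oplus>\<^bsub>F\<^esub> gen (ks @ [k]) (xs @ [x'])"
    using W_inv_gen[OF k ks x, of b] W_inv_gen[OF k ks x', of b'] by simp
qed

end


section \<open>The algebra of a probability space acting on a quotient of itself\<close>

lemma alg_record_op_closed: "op_closed alg_record"
  by (simp add: op_closed_def alg_record_def)

lemma bbop_pure_closed: "bbop_pure b1 b2 \<in> carrier (tensor alg_record alg_record)"
  by (rule pure_tensor_closed[OF alg_record_op_closed alg_record_op_closed]) (simp_all add: alg_record_def)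

lemma bbop_pure_add_left: "bbop_pure (b + b') c = bbop_pure b c \<oplus>\<^bsub>tensor alg_record alg_record\<^esub> bbop_pure b' c"
  using pure_tensor_add_left[OF alg_record_op_closed alg_record_op_closed, of b b' c] by (simp add: alg_record_def)

lemma bbop_pure_add_right: "bbop_pure b (c + c') = bbop_pure b c \<oplus>\<^bsub>tensor alg_record alg_record\<^esub> bbop_pure b c'"
  using pure_tensor_add_right[OF alg_record_op_closed alg_record_op_closed, of b c c'] by (simp add: alg_record_def)

lemma bbop_pure_scale: "bbop_pure (c *\<^sub>C b) b' = bbop_pure b (c *\<^sub>C b')"
  using pure_tensor_balanced[OF alg_record_op_closed alg_record_op_closed, of b b' c] by (simp add: alg_record_def)

lemma bbop_lift:
  fixes g :: "'b::complex_algebra_1 \<Rightarrow> 'b \<Rightarrow> ('b \<times> 'b \<Rightarrow>\<^sub>0 int) set"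
  assumes "\<And>x y. g x y \<in> carrier (tensor alg_record alg_record)"
    and "\<And>x x' y. g (x + x') y = g x y \<oplus>\<^bsub>tensor alg_record alg_record\<^esub> g x' y"
    and "\<And>x y y'. g x (y + y') = g x y \<oplus>\<^bsub>tensor alg_record alg_record\<^esub> g x y'"
    and "\<And>x c y. g (c *\<^sub>C x) y = g x (c *\<^sub>C y)"
  shows "tensor_lift alg_record alg_record (add_monoid (tensor alg_record alg_record)) g (bbop_pure x y) = g x y"
  using assms
  by (intro tensor_lift_pure[OF alg_record_op_closed alg_record_op_closed
        tensor_comm_group[OF alg_record_op_closed alg_record_op_closed]]) (simp_all add: alg_record_def)

text \<open>The product is defined by two nested lifts, one for each factor, which are evaluated in
  turn. The reversed order in the second slot is the multiplication of the opposite algebra.\<close>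

lemma bbop_mult_pure: "bbop_pure b1 b2 \<otimes>\<^bsub>bbop\<^esub> bbop_pure c1 c2 = bbop_pure (b1 * c1) (c2 * b2)"
proof -
  let ?l = "tensor_lift alg_record alg_record (add_monoid (tensor alg_record alg_record))"
  have "?l (\<lambda>c1 c2. bbop_pure (b1 * c1) (c2 * b2)) (bbop_pure c1 c2) = bbop_pure (b1 * c1) (c2 * b2)"
    for b1 b2 :: 'a
    by (rule bbop_lift) (simp_all add: bbop_pure_closed distrib_left distrib_right bbop_pure_add_left
        bbop_pure_add_right mult_scaleC_right mult_scaleC_left bbop_pure_scale)
  then have "bbop_pure b1 b2 \<otimes>\<^bsub>bbop\<^esub> bbop_pure c1 c2 = ?l (\<lambda>b1 b2. bbop_pure (b1 * c1) (c2 * b2)) (bbop_pure b1 b2)"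
    by (simp add: bbop_def Let_def)
  also have "\<dots> = bbop_pure (b1 * c1) (c2 * b2)"
    by (rule bbop_lift) (simp_all add: bbop_pure_closed distrib_left distrib_right bbop_pure_add_left
        bbop_pure_add_right mult_scaleC_right mult_scaleC_left bbop_pure_scale)
  finally show ?thesis .
qed

lemma tensor_smult: "b \<odot>\<^bsub>tensor M N\<^esub> t =
    tensor_lift M N (add_monoid (tensor M N)) (\<lambda>x y. pure_tensor M N (b \<odot>\<^bsub>M\<^esub> x) y) t"
proof -
  let ?G = "pres_group (carrier M \<times> carrier N) (tensor_rels M N)"
  have "tensor_lift M N (add_monoid (tensor M N)) g = tensor_lift M N ?G g" for g
    unfolding tensor_lift_def by (rule pres_lift_cong) (simp_all add: tensor_def Let_def)
  then show ?thesis by (simp add: tensor_def Let_def)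
qed

lemma alg_record_simps: "c \<odot>\<^bsub>alg_record\<^esub> x = c *\<^sub>C x" "x \<otimes>\<^bsub>alg_record\<^esub> y = x * y"
  "x \<oplus>\<^bsub>alg_record\<^esub> y = x + y" "\<one>\<^bsub>alg_record\<^esub> = 1"
  by (simp_all add: alg_record_def)

lemma bbop_simps: "carrier bbop = carrier (tensor alg_record alg_record)"
  "t \<oplus>\<^bsub>bbop\<^esub> u = t \<oplus>\<^bsub>tensor alg_record alg_record\<^esub> u" "\<one>\<^bsub>bbop\<^esub> = bbop_pure 1 1"
  by (simp_all add: bbop_def Let_def)

lemma bbop_smult_pure: "c \<odot>\<^bsub>bbop\<^esub> bbop_pure b1 b2 = bbop_pure (c *\<^sub>C b1) b2"
proof -
  let ?l = "tensor_lift alg_record alg_record (add_monoid (tensor alg_record alg_record))"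
  have "c \<odot>\<^bsub>bbop\<^esub> bbop_pure b1 b2 = ?l (\<lambda>x y. bbop_pure (c *\<^sub>C x) y) (bbop_pure b1 b2)"
    using tensor_smult[of alg_record alg_record c] by (simp add: bbop_def Let_def alg_record_simps)
  also have "\<dots> = bbop_pure (c *\<^sub>C b1) b2"
    by (rule bbop_lift) (simp_all add: bbop_pure_closed bbop_pure_add_left bbop_pure_add_right
        scaleC_add_right bbop_pure_scale scaleC_scaleC mult.commute)
  finally show ?thesis .
qed

context bb_prob_space
begin

abbreviation "L \<equiv> L_op \<epsilon>"
abbreviation "R \<equiv> R_op \<epsilon>"

lemma eps_mult: "\<epsilon> (bbop_pure b1 b2) * \<epsilon> (bbop_pure c1 c2) = \<epsilon> (bbop_pure (b1 * c1) (c2 * b2))"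
  using ring_hom_mult[OF eps_hom, of "bbop_pure b1 b2" "bbop_pure c1 c2"]
  by (simp add: bbop_mult_pure bbop_simps alg_record_simps bbop_pure_closed)

lemma eps_add: "t \<in> carrier (tensor alg_record alg_record) \<Longrightarrow> u \<in> carrier (tensor alg_record alg_record) \<Longrightarrow>
    \<epsilon> (t \<oplus>\<^bsub>tensor alg_record alg_record\<^esub> u) = \<epsilon> t + \<epsilon> u"
  using ring_hom_add[OF eps_hom, of t u] by (simp add: bbop_simps alg_record_simps)

lemma L_add: "L (b + c) = L b + L c" and R_add: "R (b + c) = R b + R c"
  by (simp_all add: L_op_def R_op_def bbop_pure_add_left bbop_pure_add_right eps_add bbop_pure_closed)

text \<open>\<open>R\<close> reverses products because its argument sits in the opposite algebra.
  This is what makes left multiplication by \<open>R b\<close> a right action.\<close>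

lemma L_mult: "L (b * c) = L b * L c" and R_mult: "R (b * c) = R c * R b"
  and L_R_commute: "R c * L b = L b * R c"
  by (simp_all add: L_op_def R_op_def eps_mult)

lemma L_one [simp]: "L 1 = 1" and R_one [simp]: "R 1 = 1"
  using ring_hom_one[OF eps_hom] by (simp_all add: L_op_def R_op_def bbop_simps alg_record_simps)

lemma L_scale: "L (c *\<^sub>C b) = c *\<^sub>C L b" and R_scale: "R (c *\<^sub>C b) = c *\<^sub>C R b"
proof -
  have c: "bbop_pure x y \<in> carrier bbop" for x y :: 'b
    using bbop_pure_closed by (simp add: bbop_simps)
  show "L (c *\<^sub>C b) = c *\<^sub>C L b" "R (c *\<^sub>C b) = c *\<^sub>C R b"
    using eps_scale[OF c, of c b 1] eps_scale[OF c, of c 1 b]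
    by (simp_all add: L_op_def R_op_def bbop_smult_pure bbop_pure_scale)
qed

lemma L_zero [simp]: "L 0 = 0" and R_zero [simp]: "R 0 = 0"
  using L_add[of 0 0] R_add[of 0 0] by simp_all

sublocale E: Vector_Spaces.linear "(*\<^sub>C)" "(*\<^sub>C)" E
  by (rule E_linear)

lemma E_L: "E (L b * T) = b * E T" and E_R: "E (R b * T) = E T * b"
  using E_bimodule[of b 1 T] E_bimodule[of 1 b T] by (simp_all add: L_op_def R_op_def)

lemma E_LR: "E (T * L b) = E (T * R b)"
  using E_left_right[of T b] by (simp add: L_op_def R_op_def)

section \<open>The quotient bimodule and left multiplication on it\<close>

text \<open>The coset of \<open>T\<close> modulo the largest left ideal contained in the kernel of
  \<open>E\<close>. Left multiplication is compatible with these classes.\<close>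

definition wcls :: "'a \<Rightarrow> 'a set" where
  "wcls T = {S. \<forall>u. E (u * S) = E (u * T)}"

definition wrep :: "'a set \<Rightarrow> 'a" where
  "wrep c = (SOME T. T \<in> c)"

text \<open>Both actions of \<open>B\<close> are left multiplications, by \<open>L b\<close> and by
  \<open>R b\<close>, since right multiplication need not respect the classes. The condition
  \<open>E T = 0\<close> depends on the class only, as \<open>u = 1\<close> shows.\<close>

definition quot :: "('b, 'a set) bimodule" where
  "quot = \<lparr>carrier = wcls ` {T. E T = 0}, mult = undefined, one = undefined,
     zero = wcls 0, add = (\<lambda>c d. wcls (wrep c + wrep d)),
     smult = (\<lambda>b c. wcls (L b * wrep c)), rsmult = (\<lambda>c b. wcls (R b * wrep c))\<rparr>"

lemma wcls_eq: "wcls S = wcls T \<longleftrightarrow> (\<forall>u. E (u * S) = E (u * T))"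
  by (auto simp: wcls_def)

lemma wcls_wrep: "E (u * wrep (wcls T)) = E (u * T)"
proof -
  have "T \<in> wcls T" by (simp add: wcls_def)
  then have "wrep (wcls T) \<in> wcls T" unfolding wrep_def by (rule someI)
  then show ?thesis by (simp add: wcls_def)
qed

lemma E_wrep: "E (wrep (wcls T)) = E T"
  using wcls_wrep[of 1 T] by simp

lemma wcls_wrep_wcls: "wcls (wrep (wcls T)) = wcls T"
  by (simp add: wcls_eq wcls_wrep)

lemma quot_simps:
  "carrier quot = wcls ` {T. E T = 0}" "\<zero>\<^bsub>quot\<^esub> = wcls 0"
  "wcls S \<oplus>\<^bsub>quot\<^esub> wcls T = wcls (S + T)"
  "b \<odot>\<^bsub>quot\<^esub> wcls T = wcls (L b * T)"
  "wcls T \<lhd>\<^bsub>quot\<^esub> b = wcls (R b * T)"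
  by (simp_all add: quot_def wcls_eq wcls_wrep distrib_left E.add mult.assoc[symmetric])

text \<open>The carrier is stable because \<open>E (L b * T)\<close> and \<open>E (R b * T)\<close>
  are multiples of \<open>E T\<close>. Complex scalars are central because
  \<open>L (c *\<^sub>C 1)\<close> and \<open>R (c *\<^sub>C 1)\<close> both equal
  \<open>c *\<^sub>C 1\<close>.\<close>

lemma quot_bimodule: "bimodule quot"
proof -
  have "abelian_group quot"
  proof (rule abelian_groupI)
    fix x assume "x \<in> carrier quot"
    then obtain T where T: "x = wcls T" "E T = 0" by (auto simp: quot_simps)
    then show "\<exists>y\<in>carrier quot. y \<oplus>\<^bsub>quot\<^esub> x = \<zero>\<^bsub>quot\<^esub>"
      by (intro bexI[of _ "wcls (- T)"]) (auto simp: quot_simps E.neg)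
  qed (auto simp: quot_simps E.add E.zero ac_simps intro!: imageI)
  then show ?thesis
    by (intro bimodule.intro bimodule_axioms.intro)
      (auto simp: quot_simps E_L E_R L_add R_add L_mult R_mult distrib_left distrib_right
        mult.assoc L_R_commute L_scale R_scale mult_scaleC_left mult_scaleC_right E.zero
        simp flip: mult.assoc L_R_commute)
qed

text \<open>The vector of \<open>T\<close> in \<open>with_B quot\<close>: the vacuum part is
  represented by \<open>L (E T)\<close>, and the remainder has expectation 0 once
  \<open>E (L b) = b\<close> is known.\<close>

definition qv :: "'a \<Rightarrow> 'b \<times> 'a set" where
  "qv T = (E T, wcls (T - L (E T)))"

definition lmul :: "'a \<Rightarrow> 'b \<times> 'a set \<Rightarrow> 'b \<times> 'a set" where
  "lmul a x = qv (a * (L (fst x) + wrep (snd x)))"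

text \<open>The first component of \<open>qv T\<close> carries no further information: it is the
  functional with \<open>u = 1\<close>.\<close>

lemma qv_eq: "qv S = qv T \<longleftrightarrow> (\<forall>u. E (u * S) = E (u * T))"
proof
  assume "qv S = qv T"
  then show "\<forall>u. E (u * S) = E (u * T)"
    by (auto simp: qv_def wcls_eq right_diff_distrib E.diff)
next
  assume *: "\<forall>u. E (u * S) = E (u * T)"
  then have "E S = E T" by (metis mult_1)
  with * show "qv S = qv T"
    by (auto simp: qv_def wcls_eq right_diff_distrib E.diff)
qed

end

text \<open>Unitality is assumed separately from the axioms of the space and will be derived from a
  realization. It gives \<open>E (L b) = b\<close>, so that \<open>qv (L b)\<close> is the scalar
  \<open>b\<close>.\<close>

locale unital_bb = bb_prob_space +
  assumes E_one: "E 1 = 1"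
begin

lemma E_Lb: "E (L b) = b"
  using E_L[of b 1] by (simp add: E_one)

lemma qv_closed: "qv T \<in> carrier (with_B quot)"
  by (simp add: qv_def quot_simps E.diff E_Lb)

lemma qv_surj: "x \<in> carrier (with_B quot) \<Longrightarrow> qv (L (fst x) + wrep (snd x)) = x"
  by (auto simp: quot_simps qv_def E.add E_Lb E_wrep wcls_wrep_wcls)

lemma qvE: "x \<in> carrier (with_B quot) \<Longrightarrow> (\<And>T. x = qv T \<Longrightarrow> P) \<Longrightarrow> P"
  using qv_surj by metis

lemma qv_zero_part: "E T = 0 \<Longrightarrow> qv T = (0, wcls T)"
  by (simp add: qv_def)

lemma qv_L: "qv (L b) = (b, \<zero>\<^bsub>quot\<^esub>)"
  by (simp add: qv_def E_Lb quot_simps)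

text \<open>The representative chosen by \<open>wrep\<close> is invisible, because \<open>qv\<close>
  depends on the functionals \<open>E (u * _)\<close> only.\<close>

lemma lmul_qv: "lmul a (qv T) = qv (a * T)"
proof -
  have "qv (L (fst (qv T)) + wrep (snd (qv T))) = qv T"
    by (rule qv_surj[OF qv_closed])
  then show ?thesis
    by (simp add: lmul_def qv_eq flip: mult.assoc)
qed

lemma qv_add: "qv S \<oplus>\<^bsub>with_B quot\<^esub> qv T = qv (S + T)"
  by (simp add: qv_def quot_simps E.add L_add algebra_simps)

lemma smult_qv: "b \<odot>\<^bsub>with_B quot\<^esub> qv T = qv (L b * T)"
  by (simp add: qv_def quot_simps E_L L_mult right_diff_distrib mult.assoc)

text \<open>The point is the vacuum part of \<open>qv T\<close>, represented by a left element
  \<open>L e\<close>: there \<open>R b\<close> has to act as right multiplication by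
  \<open>b\<close>. By the axiom \<open>E_LR\<close>, \<open>L b\<close> and \<open>R b\<close> have
  the same effect on the vacuum.\<close>

lemma rsmult_qv: "qv T \<lhd>\<^bsub>with_B quot\<^esub> b = qv (R b * T)"
proof -
  have "E (u * (R b * L e)) = E (u * (L e * L b))" for u e
    using E_LR[of "u * L e" b] by (simp add: L_R_commute mult.assoc)
  then show ?thesis
    by (simp add: qv_def quot_simps E_R L_mult right_diff_distrib wcls_eq E.diff)
qed

lemma qv_one: "qv 1 = (1, \<zero>\<^bsub>quot\<^esub>)"
  using qv_L[of 1] by simp

lemma lmul_linear_ops: "lmul a \<in> linear_ops (with_B quot)"
proof -
  have "lmul a \<in> hom (add_monoid (with_B quot)) (add_monoid (with_B quot))"
  proof (rule homI)
    fix x y assume "x \<in> carrier (add_monoid (with_B quot))" "y \<in> carrier (add_monoid (with_B quot))"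
    then obtain S T where "x = qv S" "y = qv T" using qvE by (metis partial_object.simps(1))
    then show "lmul a (x \<otimes>\<^bsub>add_monoid (with_B quot)\<^esub> y) =
        lmul a x \<otimes>\<^bsub>add_monoid (with_B quot)\<^esub> lmul a y"
      by (simp add: qv_add lmul_qv distrib_left)
  qed (use qv_closed in \<open>simp add: lmul_def\<close>)
  moreover have "lmul a ((c *\<^sub>C 1) \<odot>\<^bsub>with_B quot\<^esub> x) = (c *\<^sub>C 1) \<odot>\<^bsub>with_B quot\<^esub> lmul a x"
    if x: "x \<in> carrier (with_B quot)" for c x
  proof -
    obtain T where "x = qv T" using x by (rule qvE)
    then show ?thesis by (simp add: smult_qv lmul_qv L_scale mult_scaleC_left mult_scaleC_right)
  qed
  ultimately show ?thesis unfolding linear_ops_def by blast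
qed

text \<open>Elements of \<open>left_alg \<epsilon>\<close> commute with \<open>R b\<close>, and left
  multiplication by \<open>R b\<close> is the right action on \<open>with_B quot\<close>.\<close>

lemma lmul_left_ops: "a \<in> left_alg \<epsilon> \<Longrightarrow> lmul a \<in> left_ops (with_B quot)"
proof -
  assume a: "a \<in> left_alg \<epsilon>"
  have "lmul a (x \<lhd>\<^bsub>with_B quot\<^esub> b) = lmul a x \<lhd>\<^bsub>with_B quot\<^esub> b" if x: "x \<in> carrier (with_B quot)" for b x
  proof -
    obtain T where "x = qv T" using x by (rule qvE)
    then show ?thesis using a by (simp add: rsmult_qv lmul_qv left_alg_def flip: mult.assoc)
  qed
  then show ?thesis using lmul_linear_ops unfolding left_ops_def by blast
qed

lemma lmul_right_ops: "a \<in> right_alg \<epsilon> \<Longrightarrow> lmul a \<in> right_ops (with_B quot)"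
proof -
  assume a: "a \<in> right_alg \<epsilon>"
  have "lmul a (b \<odot>\<^bsub>with_B quot\<^esub> x) = b \<odot>\<^bsub>with_B quot\<^esub> lmul a x" if x: "x \<in> carrier (with_B quot)" for b x
  proof -
    obtain T where "x = qv T" using x by (rule qvE)
    then show ?thesis using a by (simp add: smult_qv lmul_qv right_alg_def flip: mult.assoc)
  qed
  then show ?thesis using lmul_linear_ops unfolding right_ops_def by blast
qed

lemma lmul_rep: "lmul ` S \<subseteq> \<L> \<Longrightarrow> rep S (with_B quot) \<L> lmul"
  unfolding rep_def
proof (intro conjI ballI allI)
  fix s t x assume "x \<in> carrier (with_B quot)"
  then obtain T where x: "x = qv T" by (rule qvE)
  show "lmul (s + t) x = lmul s x \<oplus>\<^bsub>with_B quot\<^esub> lmul t x" "lmul (s * t) x = lmul s (lmul t x)"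
    "lmul (c *\<^sub>C s) x = (c *\<^sub>C 1) \<odot>\<^bsub>with_B quot\<^esub> lmul s x" for c
    by (simp_all add: x lmul_qv qv_add smult_qv distrib_right mult.assoc L_scale mult_scaleC_left)
qed

lemma lmul_unital_rep: "lmul ` S \<subseteq> \<L> \<Longrightarrow> unital_rep S (with_B quot) \<L> lmul"
  unfolding unital_rep_def using lmul_rep lmul_qv by (metis mult_1 qvE)

end


section \<open>Additive spans and the regular representations on elementary tensors\<close>

text \<open>Zero and addition are parameters so that the same notion serves vectors of a free
  product, pairs of vectors (where it generates additive relations) and elements of the algebra.
  Negatives are not built in.\<close>

inductive_set aspan :: "'v \<Rightarrow> ('v \<Rightarrow> 'v \<Rightarrow> 'v) \<Rightarrow> 'v set \<Rightarrow> 'v set"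
  for z :: 'v and p :: "'v \<Rightarrow> 'v \<Rightarrow> 'v" and G :: "'v set" where
  aspan_zero: "z \<in> aspan z p G"
| aspan_gen: "g \<in> G \<Longrightarrow> g \<in> aspan z p G"
| aspan_add: "u \<in> aspan z p G \<Longrightarrow> v \<in> aspan z p G \<Longrightarrow> p u v \<in> aspan z p G"

lemma aspan_mono:
  assumes "v \<in> aspan z p G" and "G \<subseteq> H"
  shows "v \<in> aspan z p H"
  using assms(1)
proof induction
  case (aspan_gen g)
  then show ?case using assms(2) by (blast intro: aspan.aspan_gen)
qed (rule aspan.aspan_zero, rule aspan.aspan_add)

lemma aspan_image:
  assumes v: "v \<in> aspan z p G" and zero: "h z \<in> aspan z' p' H"
    and gen: "\<And>g. g \<in> G \<Longrightarrow> h g \<in> aspan z' p' H"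
    and add: "\<And>u v. u \<in> aspan z p G \<Longrightarrow> v \<in> aspan z p G \<Longrightarrow> h (p u v) = p' (h u) (h v)"
  shows "h v \<in> aspan z' p' H"
  using v
proof induction
  case (aspan_add u v)
  then show ?case using add[of u v] aspan.aspan_add[of "h u" z' p' H "h v"] by simp
qed (use zero gen in simp_all)

lemma aspan_pred:
  assumes v: "v \<in> aspan z p G" and zero: "P z" and gen: "\<And>g. g \<in> G \<Longrightarrow> P g"
    and add: "\<And>u v. P u \<Longrightarrow> P v \<Longrightarrow> P (p u v)"
  shows "P v"
  using v
proof induction
  case (aspan_add u v)
  then show ?case by (intro add)
qed (use zero gen in simp_all)

context free_prod
begin

text \<open>The inclusion of \<open>with_B (X k)\<close> into the free product. On its image the
  left and the right regular representation of colour \<open>k\<close> both act by the given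
  operators.\<close>

definition emb :: "'k \<Rightarrow> 'b \<times> 'x \<Rightarrow> ('b, 'k, 'x) free_vec" where
  "emb k v = scal (fst v) \<oplus>\<^bsub>F\<^esub> pure [k] [snd v]"

lemma word1: "k \<in> K \<Longrightarrow> [k] \<in> I"
  using words_Cons[of k "[]"] by simp

lemma emb_closed: "k \<in> K \<Longrightarrow> v \<in> carrier (with_B (X k)) \<Longrightarrow> emb k v \<in> carrier F"
  by (cases v) (simp add: emb_def scal_closed pure_closed word1)

lemma fst_add: "fst (u \<oplus>\<^bsub>F\<^esub> v) = fst u + fst v"
  by (cases u; cases v) (simp add: F_add)

lemma fst_scal [simp]: "fst (scal c) = c" and fst_pure [simp]: "fst (pure ks xs) = 0"
  by (simp_all add: free_scalar_def free_pure_def)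

lemma fst_zero [simp]: "fst \<zero>\<^bsub>F\<^esub> = 0"
  by (simp add: F_zero)

lemma fst_emb [simp]: "fst (emb k v) = fst v"
  by (simp add: emb_def fst_add)

lemma emb_scalar: "k \<in> K \<Longrightarrow> emb k (c, \<zero>\<^bsub>X k\<^esub>) = scal c"
proof -
  assume k: "k \<in> K"
  interpret M: bimodule "X k" by (rule bim[OF k])
  have "pure [k] [\<zero>\<^bsub>X k\<^esub>] = \<zero>\<^bsub>F\<^esub>" using word1[OF k] by (intro pure_zero[where i = 0]) auto
  then show ?thesis by (simp add: emb_def scal_closed)
qed

lemma emb_vector: "k \<in> K \<Longrightarrow> x \<in> carrier (X k) \<Longrightarrow> emb k (0, x) = pure [k] [x]"
  using F.l_zero[OF pure_closed[OF word1]] by (simp add: emb_def flip: F_zero)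

lemma Xzero: assumes "k \<in> K" shows "\<zero>\<^bsub>X k\<^esub> \<in> carrier (X k)"
proof -
  interpret M: bimodule "X k" by (rule bim[OF assms])
  show ?thesis by (rule M.zero_closed)
qed

lemma vacuum_closed: "k \<in> K \<Longrightarrow> (c, \<zero>\<^bsub>X k\<^esub>) \<in> carrier (with_B (X k))"
  by (simp add: Xzero)

lemma left_reg_closed: "k \<in> K \<Longrightarrow> a \<in> left_ops (with_B (X k)) \<Longrightarrow> v \<in> carrier F \<Longrightarrow> left_reg K X k a v \<in> carrier F"
  using hom_in_carrier[OF left_reg_hom, of k a v] by simp

lemma right_reg_closed: "k \<in> K \<Longrightarrow> a \<in> right_ops (with_B (X k)) \<Longrightarrow> v \<in> carrier F \<Longrightarrow> right_reg K X k a v \<in> carrier F"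
  using hom_in_carrier[OF right_reg_hom, of k a v] by simp

lemma left_reg_add: "k \<in> K \<Longrightarrow> a \<in> left_ops (with_B (X k)) \<Longrightarrow> u \<in> carrier F \<Longrightarrow> v \<in> carrier F \<Longrightarrow>
    left_reg K X k a (u \<oplus>\<^bsub>F\<^esub> v) = left_reg K X k a u \<oplus>\<^bsub>F\<^esub> left_reg K X k a v"
  using hom_mult[OF left_reg_hom, of k a u v] by simp

lemma right_reg_add: "k \<in> K \<Longrightarrow> a \<in> right_ops (with_B (X k)) \<Longrightarrow> u \<in> carrier F \<Longrightarrow> v \<in> carrier F \<Longrightarrow>
    right_reg K X k a (u \<oplus>\<^bsub>F\<^esub> v) = right_reg K X k a u \<oplus>\<^bsub>F\<^esub> right_reg K X k a v"
  using hom_mult[OF right_reg_hom, of k a u v] by simp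

lemma left_reg_zero: "k \<in> K \<Longrightarrow> a \<in> left_ops (with_B (X k)) \<Longrightarrow> left_reg K X k a \<zero>\<^bsub>F\<^esub> = \<zero>\<^bsub>F\<^esub>"
  using hom_one[OF left_reg_hom comm_group.axioms(2)[OF F_comm_group] comm_group.axioms(2)[OF F_comm_group], of k a]
  by simp

lemma right_reg_zero: "k \<in> K \<Longrightarrow> a \<in> right_ops (with_B (X k)) \<Longrightarrow> right_reg K X k a \<zero>\<^bsub>F\<^esub> = \<zero>\<^bsub>F\<^esub>"
  using hom_one[OF right_reg_hom comm_group.axioms(2)[OF F_comm_group] comm_group.axioms(2)[OF F_comm_group], of k a]
  by simp

lemma left_reg_emb:
  assumes k: "k \<in> K" and a: "a \<in> left_ops (with_B (X k))" and v: "v \<in> carrier (with_B (X k))"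
  shows "left_reg K X k a (emb k v) = emb k (a v)"
  using left_reg_gen[OF k a, of "[]" "[]" "snd v" "fst v" "fst (a v)" "snd (a v)"] v
  by (auto simp: emb_def smult_scal)

lemma right_reg_emb:
  assumes k: "k \<in> K" and a: "a \<in> right_ops (with_B (X k))" and v: "v \<in> carrier (with_B (X k))"
  shows "right_reg K X k a (emb k v) = emb k (a v)"
  using right_reg_gen[OF k a, of "[]" "[]" "snd v" "fst v" "fst (a v)" "snd (a v)"] v
  by (auto simp: emb_def rsmult_scal)

lemma left_reg_new:
  assumes k: "k \<in> K" and a: "a \<in> left_ops (with_B (X k))" and ks: "ks \<in> words0" "xs \<in> LS ks" "ks = [] \<or> hd ks \<noteq> k"
    and av: "a (1, \<zero>\<^bsub>X k\<^esub>) = (b, y)"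
  shows "left_reg K X k a (gen ks xs) = b \<odot>\<^bsub>F\<^esub> gen ks xs \<oplus>\<^bsub>F\<^esub> pure (k # ks) (y # xs)"
proof -
  have "gen (k # ks) (\<zero>\<^bsub>X k\<^esub> # xs) = \<zero>\<^bsub>F\<^esub>"
    using words_Cons[OF k ks(1,3)] ks Xzero[OF k] by (simp add: pure_zero[where i = 0])
  then show ?thesis
    using left_reg_gen[OF k a ks Xzero[OF k] av] gen_closed[OF ks(1,2)] by (simp add: smult_one)
qed

lemma left_reg_old:
  assumes k: "k \<in> K" and a: "a \<in> left_ops (with_B (X k))" and ks: "ks \<in> words0" "xs \<in> LS ks" "ks = [] \<or> hd ks \<noteq> k"
    and x: "x \<in> carrier (X k)" and av: "a (0, x) = (b, y)"
  shows "left_reg K X k a (pure (k # ks) (x # xs)) = b \<odot>\<^bsub>F\<^esub> gen ks xs \<oplus>\<^bsub>F\<^esub> pure (k # ks) (y # xs)"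
  using left_reg_gen[OF k a ks x av] gen_closed[OF ks(1,2)] words_Cons[OF k ks(1,3)] ks x
  by (simp add: smult_zero pure_closed)

lemma right_reg_new:
  assumes k: "k \<in> K" and a: "a \<in> right_ops (with_B (X k))" and ks: "ks \<in> words0" "xs \<in> LS ks" "ks = [] \<or> last ks \<noteq> k"
    and av: "a (1, \<zero>\<^bsub>X k\<^esub>) = (b, y)"
  shows "right_reg K X k a (gen ks xs) = gen ks xs \<lhd>\<^bsub>F\<^esub> b \<oplus>\<^bsub>F\<^esub> pure (ks @ [k]) (xs @ [y])"
proof -
  have "length xs = length ks" using listset_length[OF ks(2)] by simp
  then have "gen (ks @ [k]) (xs @ [\<zero>\<^bsub>X k\<^esub>]) = \<zero>\<^bsub>F\<^esub>"
    using words_snoc[OF k ks(1,3)] ks Xzero[OF k] by (simp add: pure_zero[where i = "length ks"] nth_append)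
  then show ?thesis
    using right_reg_gen[OF k a ks Xzero[OF k] av] gen_closed[OF ks(1,2)] by (simp add: rsmult_one)
qed

lemma right_reg_old:
  assumes k: "k \<in> K" and a: "a \<in> right_ops (with_B (X k))" and ks: "ks \<in> words0" "xs \<in> LS ks" "ks = [] \<or> last ks \<noteq> k"
    and x: "x \<in> carrier (X k)" and av: "a (0, x) = (b, y)"
  shows "right_reg K X k a (pure (ks @ [k]) (xs @ [x])) = gen ks xs \<lhd>\<^bsub>F\<^esub> b \<oplus>\<^bsub>F\<^esub> pure (ks @ [k]) (xs @ [y])"
  using right_reg_gen[OF k a ks x av] gen_closed[OF ks(1,2)] words_snoc[OF k ks(1,3)] ks x
  by (simp add: rsmult_zero pure_closed)

text \<open>Word and legs are kept together as a list of coloured legs, the empty list being the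
  vacuum. Invariant families of tensors can then be described by conditions on such lists.\<close>

definition tvec :: "('k \<times> 'x) list \<Rightarrow> ('b, 'k, 'x) free_vec" where
  "tvec ps = gen (map fst ps) (map snd ps)"

definition tens :: "('k \<times> 'x) list \<Rightarrow> bool" where
  "tens ps \<longleftrightarrow> distinct_adj (map fst ps) \<and> (\<forall>(k, x)\<in>set ps. k \<in> K \<and> x \<in> carrier (X k))"

lemma LS_pairs: "map snd ps \<in> LS (map fst ps) \<longleftrightarrow> (\<forall>(k, x)\<in>set ps. x \<in> carrier (X k))"
  by (induction ps) auto

lemma tens_iff: "tens ps \<longleftrightarrow> map fst ps \<in> words0 \<and> map snd ps \<in> LS (map fst ps)"
  unfolding LS_pairs by (auto simp: tens_def alt_words_def)

end

lemma with_B_bimodule: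
  assumes "bimodule M"
  shows "bimodule (with_B M)"
proof -
  interpret M: bimodule M by fact
  have "abelian_group (with_B M)"
    using with_B_comm_group[OF bimodule_comm_group[OF assms]]
    by (intro comm_group_abelian_groupI)
  then show ?thesis
    by (intro bimodule.intro bimodule_axioms.intro)
      (auto simp: M.smult_closed M.rsmult_closed M.smult_add M.rsmult_add M.add_smult M.add_rsmult M.mult_smult
        M.mult_rsmult M.one_smult M.one_rsmult M.smult_rsmult M.scalar_central distrib_left distrib_right mult.assoc
        mult_scaleC_left mult_scaleC_right)
qed

text \<open>\<open>same_distribution\<close> composes operators, whereas the inductions below follow
  one vector through a word.\<close>

lemma foldr_comp: "foldr (\<lambda>(j, Z) T. \<Phi> j Z \<circ> T) w id v = foldr (\<lambda>(j, Z) v. \<Phi> j Z v) w v"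
  by (induction w) auto

context free_prod
begin

lemma tens_Nil [simp]: "tens []"
  by (simp add: tens_def)

lemma tens_Cons: "tens ((k, x) # ps) \<longleftrightarrow> k \<in> K \<and> x \<in> carrier (X k) \<and> tens ps \<and> (ps = [] \<or> fst (hd ps) \<noteq> k)"
  by (cases ps) (auto simp: tens_def)

lemma tens_snoc: "tens (ps @ [(k, x)]) \<longleftrightarrow> k \<in> K \<and> x \<in> carrier (X k) \<and> tens ps \<and> (ps = [] \<or> fst (last ps) \<noteq> k)"
  by (cases ps rule: rev_cases) (auto simp: tens_def distinct_adj_append_iff)

lemma tvec_Nil: "tvec [] = scal 1"
  by (simp add: tvec_def)

lemma tvec_closed: "tens ps \<Longrightarrow> tvec ps \<in> carrier F"
  unfolding tens_iff tvec_def by (intro gen_closed) auto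

lemma tvec_single: "k \<in> K \<Longrightarrow> x \<in> carrier (X k) \<Longrightarrow> tvec [(k, x)] = emb k (0, x)"
  by (simp add: tvec_def emb_vector)

lemma fst_tvec: "ps \<noteq> [] \<Longrightarrow> fst (tvec ps) = 0"
  by (simp add: tvec_def)

lemma smult_tvec: "tens ((k, x) # ps) \<Longrightarrow> b \<odot>\<^bsub>F\<^esub> tvec ((k, x) # ps) = tvec ((k, b \<odot>\<^bsub>X k\<^esub> x) # ps)"
  unfolding tens_iff tvec_def by (simp add: smult_pure_Cons)

lemma rsmult_tvec: "tens (ps @ [(k, x)]) \<Longrightarrow> tvec (ps @ [(k, x)]) \<lhd>\<^bsub>F\<^esub> b = tvec (ps @ [(k, x \<lhd>\<^bsub>X k\<^esub> b)])"
  unfolding tens_iff tvec_def by (simp add: rsmult_pure_snoc)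

lemma smult_tvec_Nil: "b \<odot>\<^bsub>F\<^esub> tvec [] = scal b" and rsmult_tvec_Nil: "tvec [] \<lhd>\<^bsub>F\<^esub> b = scal b"
  by (simp_all add: tvec_Nil smult_scal rsmult_scal)

lemma left_tvec_new:
  assumes "k \<in> K" "a \<in> left_ops (with_B (X k))" "tens ps" "ps = [] \<or> fst (hd ps) \<noteq> k" "a (1, \<zero>\<^bsub>X k\<^esub>) = (b, y)"
  shows "left_reg K X k a (tvec ps) = b \<odot>\<^bsub>F\<^esub> tvec ps \<oplus>\<^bsub>F\<^esub> tvec ((k, y) # ps)"
proof -
  have "map fst ps = [] \<or> hd (map fst ps) \<noteq> k" using assms(4) by (cases ps) auto
  then show ?thesis
    using left_reg_new[OF assms(1,2), of "map fst ps" "map snd ps" b y] assms(3,5)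
    unfolding tens_iff tvec_def by simp
qed

lemma left_tvec_old:
  assumes "k \<in> K" "a \<in> left_ops (with_B (X k))" "tens ((k, x) # ps)" "a (0, x) = (b, y)"
  shows "left_reg K X k a (tvec ((k, x) # ps)) = b \<odot>\<^bsub>F\<^esub> tvec ps \<oplus>\<^bsub>F\<^esub> tvec ((k, y) # ps)"
proof -
  have "tens ps" "ps = [] \<or> fst (hd ps) \<noteq> k" "x \<in> carrier (X k)" using assms(3) by (auto simp: tens_Cons)
  moreover from this have "map fst ps = [] \<or> hd (map fst ps) \<noteq> k" by (cases ps) auto
  ultimately show ?thesis
    using left_reg_old[OF assms(1,2), of "map fst ps" "map snd ps" x b y] assms(4)
    unfolding tens_iff tvec_def by simp
qed

lemma right_tvec_new:
  assumes "k \<in> K" "a \<in> right_ops (with_B (X k))" "tens ps" "ps = [] \<or> fst (last ps) \<noteq> k" "a (1, \<zero>\<^bsub>X k\<^esub>) = (b, y)"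
  shows "right_reg K X k a (tvec ps) = tvec ps \<lhd>\<^bsub>F\<^esub> b \<oplus>\<^bsub>F\<^esub> tvec (ps @ [(k, y)])"
proof -
  have "map fst ps = [] \<or> last (map fst ps) \<noteq> k" using assms(4) by (cases ps rule: rev_cases) auto
  then show ?thesis
    using right_reg_new[OF assms(1,2), of "map fst ps" "map snd ps" b y] assms(3,5)
    unfolding tens_iff tvec_def by simp
qed

lemma right_tvec_old:
  assumes "k \<in> K" "a \<in> right_ops (with_B (X k))" "tens (ps @ [(k, x)])" "a (0, x) = (b, y)"
  shows "right_reg K X k a (tvec (ps @ [(k, x)])) = tvec ps \<lhd>\<^bsub>F\<^esub> b \<oplus>\<^bsub>F\<^esub> tvec (ps @ [(k, y)])"
proof -
  have "tens ps" "ps = [] \<or> fst (last ps) \<noteq> k" "x \<in> carrier (X k)" using assms(3) by (auto simp: tens_snoc)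
  moreover from this have "map fst ps = [] \<or> last (map fst ps) \<noteq> k" by (cases ps rule: rev_cases) auto
  ultimately show ?thesis
    using right_reg_old[OF assms(1,2), of "map fst ps" "map snd ps" x b y] assms(4)
    unfolding tens_iff tvec_def by simp
qed

abbreviation "tspan P \<equiv> aspan \<zero>\<^bsub>F\<^esub> (\<oplus>\<^bsub>F\<^esub>) (tvec ` P)"

lemma aspan_closed: "v \<in> aspan \<zero>\<^bsub>F\<^esub> (\<oplus>\<^bsub>F\<^esub>) G \<Longrightarrow> G \<subseteq> carrier F \<Longrightarrow> v \<in> carrier F"
  by (erule aspan_pred) auto

text \<open>The scheme behind the invariance proofs: a left operator of colour \<open>k\<close>
  creates a first leg of that colour or changes the existing one, and in both cases it also yields
  the tensor without this leg, multiplied by a vacuum part \<open>b\<close>. Both results must lie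
  in the target span.\<close>

lemma left_reg_tspan:
  assumes v: "v \<in> tspan P" and k: "k \<in> K" and a: "a \<in> left_ops (with_B (X k))" and P: "\<And>ps. ps \<in> P \<Longrightarrow> tens ps"
    and new: "\<And>ps b y. ps \<in> P \<Longrightarrow> ps = [] \<or> fst (hd ps) \<noteq> k \<Longrightarrow> a (1, \<zero>\<^bsub>X k\<^esub>) = (b, y) \<Longrightarrow>
      b \<odot>\<^bsub>F\<^esub> tvec ps \<in> aspan \<zero>\<^bsub>F\<^esub> (\<oplus>\<^bsub>F\<^esub>) G \<and> tvec ((k, y) # ps) \<in> aspan \<zero>\<^bsub>F\<^esub> (\<oplus>\<^bsub>F\<^esub>) G"
    and old: "\<And>x ps b y. (k, x) # ps \<in> P \<Longrightarrow> a (0, x) = (b, y) \<Longrightarrow>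
      b \<odot>\<^bsub>F\<^esub> tvec ps \<in> aspan \<zero>\<^bsub>F\<^esub> (\<oplus>\<^bsub>F\<^esub>) G \<and> tvec ((k, y) # ps) \<in> aspan \<zero>\<^bsub>F\<^esub> (\<oplus>\<^bsub>F\<^esub>) G"
  shows "left_reg K X k a v \<in> aspan \<zero>\<^bsub>F\<^esub> (\<oplus>\<^bsub>F\<^esub>) G"
proof (rule aspan_image[OF v])
  have PF: "tvec ` P \<subseteq> carrier F" using P tvec_closed by auto
  show "left_reg K X k a (u \<oplus>\<^bsub>F\<^esub> v) = left_reg K X k a u \<oplus>\<^bsub>F\<^esub> left_reg K X k a v"
    if "u \<in> tspan P" "v \<in> tspan P" for u v
    using aspan_closed[OF that(1) PF] aspan_closed[OF that(2) PF] by (rule left_reg_add[OF k a])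
  fix g assume "g \<in> tvec ` P"
  then obtain ps where ps: "g = tvec ps" "ps \<in> P" by blast
  show "left_reg K X k a g \<in> aspan \<zero>\<^bsub>F\<^esub> (\<oplus>\<^bsub>F\<^esub>) G"
  proof (cases "ps = [] \<or> fst (hd ps) \<noteq> k")
    case True
    obtain b y where "a (1, \<zero>\<^bsub>X k\<^esub>) = (b, y)" by force
    then show ?thesis
      using left_tvec_new[OF k a P[OF ps(2)] True] new[OF ps(2) True] ps by (auto intro: aspan.aspan_add)
  next
    case False
    then obtain x qs where ps': "ps = (k, x) # qs" by (cases ps) auto
    obtain b y where "a (0, x) = (b, y)" by force
    then show ?thesis
      using left_tvec_old[OF k a P[OF ps(2)[unfolded ps']]] old[OF ps(2)[unfolded ps']] ps ps'
      by (auto intro: aspan.aspan_add)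
  qed
qed (simp add: left_reg_zero[OF k a] aspan.aspan_zero)

lemma right_reg_tspan:
  assumes v: "v \<in> tspan P" and k: "k \<in> K" and a: "a \<in> right_ops (with_B (X k))" and P: "\<And>ps. ps \<in> P \<Longrightarrow> tens ps"
    and new: "\<And>ps b y. ps \<in> P \<Longrightarrow> ps = [] \<or> fst (last ps) \<noteq> k \<Longrightarrow> a (1, \<zero>\<^bsub>X k\<^esub>) = (b, y) \<Longrightarrow>
      tvec ps \<lhd>\<^bsub>F\<^esub> b \<in> aspan \<zero>\<^bsub>F\<^esub> (\<oplus>\<^bsub>F\<^esub>) G \<and> tvec (ps @ [(k, y)]) \<in> aspan \<zero>\<^bsub>F\<^esub> (\<oplus>\<^bsub>F\<^esub>) G"
    and old: "\<And>x ps b y. ps @ [(k, x)] \<in> P \<Longrightarrow> a (0, x) = (b, y) \<Longrightarrow>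
      tvec ps \<lhd>\<^bsub>F\<^esub> b \<in> aspan \<zero>\<^bsub>F\<^esub> (\<oplus>\<^bsub>F\<^esub>) G \<and> tvec (ps @ [(k, y)]) \<in> aspan \<zero>\<^bsub>F\<^esub> (\<oplus>\<^bsub>F\<^esub>) G"
  shows "right_reg K X k a v \<in> aspan \<zero>\<^bsub>F\<^esub> (\<oplus>\<^bsub>F\<^esub>) G"
proof (rule aspan_image[OF v])
  have PF: "tvec ` P \<subseteq> carrier F" using P tvec_closed by auto
  show "right_reg K X k a (u \<oplus>\<^bsub>F\<^esub> v) = right_reg K X k a u \<oplus>\<^bsub>F\<^esub> right_reg K X k a v"
    if "u \<in> tspan P" "v \<in> tspan P" for u v
    using aspan_closed[OF that(1) PF] aspan_closed[OF that(2) PF] by (rule right_reg_add[OF k a])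
  fix g assume "g \<in> tvec ` P"
  then obtain ps where ps: "g = tvec ps" "ps \<in> P" by blast
  show "right_reg K X k a g \<in> aspan \<zero>\<^bsub>F\<^esub> (\<oplus>\<^bsub>F\<^esub>) G"
  proof (cases "ps = [] \<or> fst (last ps) \<noteq> k")
    case True
    obtain b y where "a (1, \<zero>\<^bsub>X k\<^esub>) = (b, y)" by force
    then show ?thesis
      using right_tvec_new[OF k a P[OF ps(2)] True] new[OF ps(2) True] ps by (auto intro: aspan.aspan_add)
  next
    case False
    then obtain x qs where ps': "ps = qs @ [(k, x)]" by (cases ps rule: rev_cases) auto
    obtain b y where "a (0, x) = (b, y)" by force
    then show ?thesis
      using right_tvec_old[OF k a P[OF ps(2)[unfolded ps']]] old[OF ps(2)[unfolded ps']] ps ps'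
      by (auto intro: aspan.aspan_add)
  qed
qed (simp add: right_reg_zero[OF k a] aspan.aspan_zero)

end

section \<open>A given realization and its bimodule relation with \<open>quot\<close>\<close>

locale realization = unital_bb E \<epsilon> + free_prod K X
  for E :: "'a::complex_algebra_1 \<Rightarrow> 'b::complex_algebra_1" and \<epsilon> :: "('b, 'a) bbop_map"
    and K :: "'k set" and X :: "'k \<Rightarrow> ('b, 'x) bimodule" +
  fixes C D :: "'k \<Rightarrow> 'a set" and l r :: "'k \<Rightarrow> 'a \<Rightarrow> 'b \<times> 'x \<Rightarrow> 'b \<times> 'x"
  assumes face: "k \<in> K \<Longrightarrow> face_pair \<epsilon> (C k) (D k)"
    and l_ops: "k \<in> K \<Longrightarrow> a \<in> C k \<Longrightarrow> l k a \<in> left_ops (with_B (X k))"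
    and r_ops: "k \<in> K \<Longrightarrow> d \<in> D k \<Longrightarrow> r k d \<in> right_ops (with_B (X k))"
    and dist: "same_distribution E (free_expectation K X) (K <+> K) (case_sum C D)
         (case_sum (\<lambda>k Z. left_reg K X k (l k Z)) (\<lambda>k Z. right_reg K X k (r k Z)))"
begin

sublocale Q: free_prod K "\<lambda>_. quot"
  by (rule free_prod.intro) (rule quot_bimodule)

definition letters :: "(('k + 'k) \<times> 'a) list \<Rightarrow> bool" where
  "letters w \<longleftrightarrow> set w \<subseteq> Sigma (K <+> K) (case_sum C D)"

text \<open>\<open>run\<close> follows a vector through a word in the given realization,
  \<open>qrun\<close> does so in the free product of copies of \<open>quot\<close>.\<close>

definition run where
  "run w v = foldr (\<lambda>(j, Z) v. case_sum (\<lambda>k Z. left_reg K X k (l k Z)) (\<lambda>k Z. right_reg K X k (r k Z)) j Z v) w v"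

definition qrun where
  "qrun w v = foldr (\<lambda>(j, Z) v. case_sum (\<lambda>k Z. left_reg K (\<lambda>_. quot) k (lmul Z))
     (\<lambda>k Z. right_reg K (\<lambda>_. quot) k (lmul Z)) j Z v) w v"

lemma run_simps [simp]:
  "run [] v = v" "run ((Inl k, a) # w) v = left_reg K X k (l k a) (run w v)"
  "run ((Inr k, a) # w) v = right_reg K X k (r k a) (run w v)"
  by (simp_all add: run_def)

lemma qrun_simps [simp]:
  "qrun [] v = v" "qrun ((Inl k, a) # w) v = left_reg K (\<lambda>_. quot) k (lmul a) (qrun w v)"
  "qrun ((Inr k, a) # w) v = right_reg K (\<lambda>_. quot) k (lmul a) (qrun w v)"
  by (simp_all add: qrun_def)

lemma letters_simps [simp]:
  "letters []" "letters ((Inl k, a) # w) \<longleftrightarrow> k \<in> K \<and> a \<in> C k \<and> letters w"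
  "letters ((Inr k, a) # w) \<longleftrightarrow> k \<in> K \<and> a \<in> D k \<and> letters w"
  by (auto simp: letters_def)

lemma run_E: "letters w \<Longrightarrow> E (prod_list (map snd w)) = fst (run w (scal 1))"
proof (cases "w = []")
  case False
  assume "letters w"
  with False have "E (prod_list (map snd w)) = free_expectation K X (foldr (\<lambda>(j, Z) T.
      case_sum (\<lambda>k Z. left_reg K X k (l k Z)) (\<lambda>k Z. right_reg K X k (r k Z)) j Z \<circ> T) w id)"
    by (intro dist[unfolded same_distribution_def, rule_format]) (simp add: letters_def)
  then show ?thesis by (simp only: free_expectation_def foldr_comp run_def)
qed (simp add: E_one)

lemma lL: "k \<in> K \<Longrightarrow> L b \<in> C k" and rR: "k \<in> K \<Longrightarrow> R b \<in> D k"
  using face[of k] unfolding face_pair_def by blast+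

lemma lmul_C: "k \<in> K \<Longrightarrow> a \<in> C k \<Longrightarrow> lmul a \<in> left_ops (with_B quot)"
  and lmul_D: "k \<in> K \<Longrightarrow> d \<in> D k \<Longrightarrow> lmul d \<in> right_ops (with_B quot)"
  using face[of k] lmul_left_ops[of a] lmul_right_ops[of d] unfolding face_pair_def by blast+

text \<open>Pairs of vectors obtained from the two vacua by the same letters and the same
  multiplications by \<open>B\<close>. A left letter commutes with the right action, so it suffices
  to insert a left multiplication before it; for right letters it is the other way round. The level
  \<open>n\<close> is one less than the number of letters and measures the induction in the
  comparison.\<close>

inductive chain :: "'k \<Rightarrow> nat \<Rightarrow> 'b \<times> 'x \<Rightarrow> 'b \<times> 'a set \<Rightarrow> bool" for k where
  left0: "a \<in> C k \<Longrightarrow> chain k 0 (l k a (1, \<zero>\<^bsub>X k\<^esub>)) (lmul a (1, \<zero>\<^bsub>quot\<^esub>))"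
| right0: "d \<in> D k \<Longrightarrow> chain k 0 (r k d (1, \<zero>\<^bsub>X k\<^esub>)) (lmul d (1, \<zero>\<^bsub>quot\<^esub>))"
| left: "chain k n x x' \<Longrightarrow> a \<in> C k \<Longrightarrow>
    chain k (Suc n) (l k a (b \<odot>\<^bsub>with_B (X k)\<^esub> x)) (lmul a (b \<odot>\<^bsub>with_B quot\<^esub> x'))"
| right: "chain k n x x' \<Longrightarrow> d \<in> D k \<Longrightarrow>
    chain k (Suc n) (r k d (x \<lhd>\<^bsub>with_B (X k)\<^esub> b)) (lmul d (x' \<lhd>\<^bsub>with_B quot\<^esub> b))"

lemma wM: "k \<in> K \<Longrightarrow> bimodule (with_B (X k))" and wQ: "bimodule (with_B quot)"
  by (rule with_B_bimodule, erule bim) (rule with_B_bimodule, rule quot_bimodule)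

lemma l_closed: "k \<in> K \<Longrightarrow> a \<in> C k \<Longrightarrow> x \<in> carrier (with_B (X k)) \<Longrightarrow> l k a x \<in> carrier (with_B (X k))"
  by (rule left_ops_closed[OF l_ops])

lemma r_closed: "k \<in> K \<Longrightarrow> d \<in> D k \<Longrightarrow> x \<in> carrier (with_B (X k)) \<Longrightarrow> r k d x \<in> carrier (with_B (X k))"
  by (rule right_ops_closed[OF r_ops])

lemma lmul_closed: "lmul a x \<in> carrier (with_B quot)"
  by (simp only: lmul_def qv_closed)

lemma chain_closed:
  assumes k: "k \<in> K" and "chain k n x x'"
  shows "x \<in> carrier (with_B (X k)) \<and> x' \<in> carrier (with_B quot)"
proof -
  interpret M: bimodule "with_B (X k)" by (rule wM[OF k])
  note Q = bimodule.smult_closed[OF wQ] bimodule.rsmult_closed[OF wQ]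
  show ?thesis
    using assms(2)
  proof induction
    case (left0 a)
    show ?case by (intro conjI l_closed[OF k left0] vacuum_closed[OF k] lmul_closed)
  next
    case (right0 d)
    show ?case by (intro conjI r_closed[OF k right0] vacuum_closed[OF k] lmul_closed)
  next
    case (left n x x' a b)
    then show ?case by (intro conjI l_closed[OF k] M.smult_closed lmul_closed) simp_all
  next
    case (right n x x' d b)
    then show ?case by (intro conjI r_closed[OF k] M.rsmult_closed lmul_closed) simp_all
  qed
qed

text \<open>Additive hull of the diagonal of \<open>B\<close> and of the two-sided multiples of
  chains of level below \<open>N\<close>. The bound is strict, so \<open>rel k 0\<close> is the
  diagonal alone.\<close>

definition rel :: "'k \<Rightarrow> nat \<Rightarrow> (('b \<times> 'x) \<times> 'b \<times> 'a set) set" where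
  "rel k N = aspan (\<zero>\<^bsub>with_B (X k)\<^esub>, \<zero>\<^bsub>with_B quot\<^esub>)
     (\<lambda>u v. (fst u \<oplus>\<^bsub>with_B (X k)\<^esub> fst v, snd u \<oplus>\<^bsub>with_B quot\<^esub> snd v))
     (range (\<lambda>c. ((c, \<zero>\<^bsub>X k\<^esub>), (c, \<zero>\<^bsub>quot\<^esub>))) \<union>
      {(b \<odot>\<^bsub>with_B (X k)\<^esub> x \<lhd>\<^bsub>with_B (X k)\<^esub> c, b \<odot>\<^bsub>with_B quot\<^esub> x' \<lhd>\<^bsub>with_B quot\<^esub> c) | b c m x x'. chain k m x x' \<and> m < N})"

end

lemma (in bimodule) smult_zero_right: "b \<odot> \<zero> = \<zero>"
  using smult_add[of \<zero> \<zero> b] smult_closed[of \<zero> b] by simp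

lemma (in bimodule) rsmult_zero_left: "\<zero> \<lhd> b = \<zero>"
  using rsmult_add[of \<zero> \<zero> b] rsmult_closed[of \<zero> b] by simp

lemma (in bimodule) smult_hom: "(\<lambda>x. b \<odot> x) \<in> hom (add_monoid M) (add_monoid M)"
  by (simp add: hom_def smult_closed smult_add)

lemma (in bimodule) rsmult_hom: "(\<lambda>x. x \<lhd> b) \<in> hom (add_monoid M) (add_monoid M)"
  by (simp add: hom_def rsmult_closed rsmult_add)

lemma left_ops_hom: "a \<in> left_ops M \<Longrightarrow> a \<in> hom (add_monoid M) (add_monoid M)"
  and right_ops_hom: "a \<in> right_ops M \<Longrightarrow> a \<in> hom (add_monoid M) (add_monoid M)"
  by (simp_all add: left_ops_def right_ops_def linear_ops_def)

context realization
begin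

sublocale Wq: bimodule "with_B quot" by (rule wQ)

lemma rel_gen:
  assumes "chain k m x x'" "m < N"
  shows "(b \<odot>\<^bsub>with_B (X k)\<^esub> x \<lhd>\<^bsub>with_B (X k)\<^esub> c, b \<odot>\<^bsub>with_B quot\<^esub> x' \<lhd>\<^bsub>with_B quot\<^esub> c) \<in> rel k N"
  unfolding rel_def using assms by (intro aspan.aspan_gen) blast

lemma rel_scalar: "((c, \<zero>\<^bsub>X k\<^esub>), (c, \<zero>\<^bsub>quot\<^esub>)) \<in> rel k N"
  unfolding rel_def by (intro aspan.aspan_gen) blast

lemma rel_add: "(x, x') \<in> rel k N \<Longrightarrow> (y, y') \<in> rel k N \<Longrightarrow>
    (x \<oplus>\<^bsub>with_B (X k)\<^esub> y, x' \<oplus>\<^bsub>with_B quot\<^esub> y') \<in> rel k N"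
  unfolding rel_def
  by (drule (1) aspan.aspan_add) (simp only: fst_conv snd_conv)

lemma rel_mono: "p \<in> rel k N \<Longrightarrow> N \<le> N' \<Longrightarrow> p \<in> rel k N'"
  unfolding rel_def by (erule aspan_mono) force

lemma rel_closed:
  assumes k: "k \<in> K" and p: "p \<in> rel k N"
  shows "fst p \<in> carrier (with_B (X k)) \<and> snd p \<in> carrier (with_B quot)"
proof -
  interpret M: bimodule "with_B (X k)" by (rule wM[OF k])
  show ?thesis
  proof (rule aspan_pred[OF p[unfolded rel_def]])
    fix g assume "g \<in> range (\<lambda>c. ((c, \<zero>\<^bsub>X k\<^esub>), (c, \<zero>\<^bsub>quot\<^esub>))) \<union>
      {(b \<odot>\<^bsub>with_B (X k)\<^esub> x \<lhd>\<^bsub>with_B (X k)\<^esub> c, b \<odot>\<^bsub>with_B quot\<^esub> x' \<lhd>\<^bsub>with_B quot\<^esub> c) | b c m x x'. chain k m x x' \<and> m < N}"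
    then show "fst g \<in> carrier (with_B (X k)) \<and> snd g \<in> carrier (with_B quot)"
    proof (elim UnE rangeE CollectE exE conjE)
      fix c assume "g = ((c, \<zero>\<^bsub>X k\<^esub>), (c, \<zero>\<^bsub>quot\<^esub>))"
      then show ?thesis using vacuum_closed[OF k] Q.vacuum_closed[OF k] by simp
    next
      fix b c m x x' assume "g = (b \<odot>\<^bsub>with_B (X k)\<^esub> x \<lhd>\<^bsub>with_B (X k)\<^esub> c, b \<odot>\<^bsub>with_B quot\<^esub> x' \<lhd>\<^bsub>with_B quot\<^esub> c)"
        and "chain k m x x'"
      then show ?thesis using chain_closed[OF k]
        by (simp only: fst_conv snd_conv) (intro conjI M.rsmult_closed M.smult_closed Wq.rsmult_closed Wq.smult_closed; blast)
    qed
  qed (auto simp del: with_B_simps intro: M.a_closed Wq.a_closed)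
qed

lemma rel_map:
  assumes k: "k \<in> K" and p: "(x, x') \<in> rel k N"
    and h: "h \<in> hom (add_monoid (with_B (X k))) (add_monoid (with_B (X k)))"
      "h' \<in> hom (add_monoid (with_B quot)) (add_monoid (with_B quot))"
    and scalar: "\<And>c. (h (c, \<zero>\<^bsub>X k\<^esub>), h' (c, \<zero>\<^bsub>quot\<^esub>)) \<in> rel k N'"
    and gen: "\<And>b c m x x'. chain k m x x' \<Longrightarrow> m < N \<Longrightarrow>
      (h (b \<odot>\<^bsub>with_B (X k)\<^esub> x \<lhd>\<^bsub>with_B (X k)\<^esub> c), h' (b \<odot>\<^bsub>with_B quot\<^esub> x' \<lhd>\<^bsub>with_B quot\<^esub> c)) \<in> rel k N'"
  shows "(h x, h' x') \<in> rel k N'"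
proof -
  interpret M: bimodule "with_B (X k)" by (rule wM[OF k])
  have "(\<lambda>p. (h (fst p), h' (snd p))) (x, x') \<in> rel k N'"
    unfolding rel_def
  proof (rule aspan_image[OF p[unfolded rel_def]], unfold rel_def[symmetric])
    show "(h (fst (\<zero>\<^bsub>with_B (X k)\<^esub>, \<zero>\<^bsub>with_B quot\<^esub>)), h' (snd (\<zero>\<^bsub>with_B (X k)\<^esub>, \<zero>\<^bsub>with_B quot\<^esub>))) \<in> rel k N'"
      using scalar[of 0] by simp
    show "(h (fst g), h' (snd g)) \<in> rel k N'" if "g \<in> range (\<lambda>c. ((c, \<zero>\<^bsub>X k\<^esub>), (c, \<zero>\<^bsub>quot\<^esub>))) \<union>
      {(b \<odot>\<^bsub>with_B (X k)\<^esub> x \<lhd>\<^bsub>with_B (X k)\<^esub> c, b \<odot>\<^bsub>with_B quot\<^esub> x' \<lhd>\<^bsub>with_B quot\<^esub> c) | b c m x x'. chain k m x x' \<and> m < N}" for g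
      using that
    proof (elim UnE rangeE CollectE exE conjE)
      fix c assume "g = ((c, \<zero>\<^bsub>X k\<^esub>), (c, \<zero>\<^bsub>quot\<^esub>))"
      then show ?thesis using scalar by simp
    next
      fix b c m x x' assume "g = (b \<odot>\<^bsub>with_B (X k)\<^esub> x \<lhd>\<^bsub>with_B (X k)\<^esub> c, b \<odot>\<^bsub>with_B quot\<^esub> x' \<lhd>\<^bsub>with_B quot\<^esub> c)"
        and "chain k m x x'" "m < N"
      then show ?thesis using gen by simp
    qed
    fix u v assume uv: "u \<in> rel k N" "v \<in> rel k N"
    show "(h (fst (fst u \<oplus>\<^bsub>with_B (X k)\<^esub> fst v, snd u \<oplus>\<^bsub>with_B quot\<^esub> snd v)),
        h' (snd (fst u \<oplus>\<^bsub>with_B (X k)\<^esub> fst v, snd u \<oplus>\<^bsub>with_B quot\<^esub> snd v))) =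
       (fst (h (fst u), h' (snd u)) \<oplus>\<^bsub>with_B (X k)\<^esub> fst (h (fst v), h' (snd v)),
        snd (h (fst u), h' (snd u)) \<oplus>\<^bsub>with_B quot\<^esub> snd (h (fst v), h' (snd v)))"
      using rel_closed[OF k uv(1)] rel_closed[OF k uv(2)]
        hom_mult[OF h(1), of "fst u" "fst v"] hom_mult[OF h(2), of "snd u" "snd v"]
      by (simp del: with_B_simps)
  qed
  then show ?thesis by simp
qed

lemma rel_smult:
  assumes k: "k \<in> K" and p: "(x, x') \<in> rel k N"
  shows "(b \<odot>\<^bsub>with_B (X k)\<^esub> x, b \<odot>\<^bsub>with_B quot\<^esub> x') \<in> rel k N"
proof -
  interpret M: bimodule "with_B (X k)" by (rule wM[OF k])
  interpret M0: bimodule "X k" by (rule bim[OF k])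
  interpret Q0: bimodule quot by (rule quot_bimodule)
  show ?thesis
  proof (rule rel_map[OF k p M.smult_hom Wq.smult_hom])
    show "(b \<odot>\<^bsub>with_B (X k)\<^esub> (c, \<zero>\<^bsub>X k\<^esub>), b \<odot>\<^bsub>with_B quot\<^esub> (c, \<zero>\<^bsub>quot\<^esub>)) \<in> rel k N" for c
      using rel_scalar[of "b * c"] by (simp add: M0.smult_zero_right Q0.smult_zero_right)
    fix b' c m x x' assume c: "chain k m x x'" "m < N"
    then show "(b \<odot>\<^bsub>with_B (X k)\<^esub> (b' \<odot>\<^bsub>with_B (X k)\<^esub> x \<lhd>\<^bsub>with_B (X k)\<^esub> c),
        b \<odot>\<^bsub>with_B quot\<^esub> (b' \<odot>\<^bsub>with_B quot\<^esub> x' \<lhd>\<^bsub>with_B quot\<^esub> c)) \<in> rel k N"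
      using rel_gen[OF c, of "b * b'" c] chain_closed[OF k c(1)]
      by (simp add: M.mult_smult Wq.mult_smult M.smult_rsmult Wq.smult_rsmult M.smult_closed Wq.smult_closed del: with_B_simps)
  qed
qed

lemma rel_rsmult:
  assumes k: "k \<in> K" and p: "(x, x') \<in> rel k N"
  shows "(x \<lhd>\<^bsub>with_B (X k)\<^esub> b, x' \<lhd>\<^bsub>with_B quot\<^esub> b) \<in> rel k N"
proof -
  interpret M: bimodule "with_B (X k)" by (rule wM[OF k])
  interpret M0: bimodule "X k" by (rule bim[OF k])
  interpret Q0: bimodule quot by (rule quot_bimodule)
  show ?thesis
  proof (rule rel_map[OF k p M.rsmult_hom Wq.rsmult_hom])
    show "((c, \<zero>\<^bsub>X k\<^esub>) \<lhd>\<^bsub>with_B (X k)\<^esub> b, (c, \<zero>\<^bsub>quot\<^esub>) \<lhd>\<^bsub>with_B quot\<^esub> b) \<in> rel k N" for c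
      using rel_scalar[of "c * b"] by (simp add: M0.rsmult_zero_left Q0.rsmult_zero_left)
    fix b' c m x x' assume c: "chain k m x x'" "m < N"
    then show "((b' \<odot>\<^bsub>with_B (X k)\<^esub> x \<lhd>\<^bsub>with_B (X k)\<^esub> c) \<lhd>\<^bsub>with_B (X k)\<^esub> b,
        (b' \<odot>\<^bsub>with_B quot\<^esub> x' \<lhd>\<^bsub>with_B quot\<^esub> c) \<lhd>\<^bsub>with_B quot\<^esub> b) \<in> rel k N"
      using rel_gen[OF c, of b' "c * b"] chain_closed[OF k c(1)]
      by (simp add: M.mult_rsmult Wq.mult_rsmult M.smult_closed Wq.smult_closed del: with_B_simps)
  qed
qed

lemma vacuum_smult: "k \<in> K \<Longrightarrow> (c, \<zero>\<^bsub>X k\<^esub>) = c \<odot>\<^bsub>with_B (X k)\<^esub> (1, \<zero>\<^bsub>X k\<^esub>)"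
  and vacuum_rsmult: "k \<in> K \<Longrightarrow> (c, \<zero>\<^bsub>X k\<^esub>) = (1, \<zero>\<^bsub>X k\<^esub>) \<lhd>\<^bsub>with_B (X k)\<^esub> c"
  by (simp_all add: bimodule.smult_zero_right[OF bim] bimodule.rsmult_zero_left[OF bim])

lemma qvacuum_smult: "(c, \<zero>\<^bsub>quot\<^esub>) = c \<odot>\<^bsub>with_B quot\<^esub> (1, \<zero>\<^bsub>quot\<^esub>)"
  and qvacuum_rsmult: "(c, \<zero>\<^bsub>quot\<^esub>) = (1, \<zero>\<^bsub>quot\<^esub>) \<lhd>\<^bsub>with_B quot\<^esub> c"
  by (simp_all add: bimodule.smult_zero_right[OF quot_bimodule] bimodule.rsmult_zero_left[OF quot_bimodule])

lemma qvacuum_closed: "(c, \<zero>\<^bsub>quot\<^esub>) \<in> carrier (with_B quot)"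
  using bimodule.axioms(1)[OF quot_bimodule] by (simp add: abelian_group_def abelian_monoid.zero_closed)

lemma rel_chain:
  assumes k: "k \<in> K" and c: "chain k m x x'" "m < N"
  shows "(x \<lhd>\<^bsub>with_B (X k)\<^esub> c, x' \<lhd>\<^bsub>with_B quot\<^esub> c) \<in> rel k N" "(b \<odot>\<^bsub>with_B (X k)\<^esub> x, b \<odot>\<^bsub>with_B quot\<^esub> x') \<in> rel k N"
proof -
  interpret M: bimodule "with_B (X k)" by (rule wM[OF k])
  show "(x \<lhd>\<^bsub>with_B (X k)\<^esub> c, x' \<lhd>\<^bsub>with_B quot\<^esub> c) \<in> rel k N" "(b \<odot>\<^bsub>with_B (X k)\<^esub> x, b \<odot>\<^bsub>with_B quot\<^esub> x') \<in> rel k N"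
    using rel_gen[OF c, of 1 c] rel_gen[OF c, of b 1] chain_closed[OF k c(1)]
    by (simp_all add: M.one_smult Wq.one_smult M.one_rsmult Wq.one_rsmult M.smult_closed Wq.smult_closed del: with_B_simps)
qed

text \<open>On a generator the right factor \<open>c\<close> passes through the operator, and what
  remains is a chain with one more letter; hence the level rises by one.\<close>

lemma rel_left:
  assumes k: "k \<in> K" and p: "(x, x') \<in> rel k N" and a: "a \<in> C k"
  shows "(l k a x, lmul a x') \<in> rel k (Suc N)"
proof -
  interpret M: bimodule "with_B (X k)" by (rule wM[OF k])
  note la = l_ops[OF k a] and qa = lmul_C[OF k a]
  note lr = left_ops_rsmult[OF la k] and qr = Q.left_ops_rsmult[OF qa k]
  show ?thesis
  proof (rule rel_map[OF k p left_ops_hom[OF la] left_ops_hom[OF qa]])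
    show "(l k a (c, \<zero>\<^bsub>X k\<^esub>), lmul a (c, \<zero>\<^bsub>quot\<^esub>)) \<in> rel k (Suc N)" for c
      using rel_chain(1)[OF k left0[OF a], of "Suc N" c]
      unfolding vacuum_rsmult[OF k, of c] qvacuum_rsmult[of c] lr[OF vacuum_closed[OF k]] qr[OF qvacuum_closed] by simp
    fix b c m x x' assume c: "chain k m x x'" "m < N"
    then show "(l k a (b \<odot>\<^bsub>with_B (X k)\<^esub> x \<lhd>\<^bsub>with_B (X k)\<^esub> c), lmul a (b \<odot>\<^bsub>with_B quot\<^esub> x' \<lhd>\<^bsub>with_B quot\<^esub> c)) \<in> rel k (Suc N)"
      using rel_chain(1)[OF k left[OF c(1) a], of "Suc N" b c] chain_closed[OF k c(1)]
      by (simp add: lr qr M.smult_closed Wq.smult_closed del: with_B_simps)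
  qed
qed

lemma rel_right:
  assumes k: "k \<in> K" and p: "(x, x') \<in> rel k N" and d: "d \<in> D k"
  shows "(r k d x, lmul d x') \<in> rel k (Suc N)"
proof -
  interpret M: bimodule "with_B (X k)" by (rule wM[OF k])
  note la = r_ops[OF k d] and qa = lmul_D[OF k d]
  note lr = right_ops_smult[OF la k] and qr = Q.right_ops_smult[OF qa k]
  show ?thesis
  proof (rule rel_map[OF k p right_ops_hom[OF la] right_ops_hom[OF qa]])
    show "(r k d (c, \<zero>\<^bsub>X k\<^esub>), lmul d (c, \<zero>\<^bsub>quot\<^esub>)) \<in> rel k (Suc N)" for c
      using rel_chain(2)[OF k right0[OF d], of "Suc N" c]
      unfolding vacuum_smult[OF k, of c] qvacuum_smult[of c] lr[OF vacuum_closed[OF k]] qr[OF qvacuum_closed] by simp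
    fix b c m x x' assume c: "chain k m x x'" "m < N"
    then show "(r k d (b \<odot>\<^bsub>with_B (X k)\<^esub> x \<lhd>\<^bsub>with_B (X k)\<^esub> c), lmul d (b \<odot>\<^bsub>with_B quot\<^esub> x' \<lhd>\<^bsub>with_B quot\<^esub> c)) \<in> rel k (Suc N)"
      using rel_chain(2)[OF k right[OF c(1) d], of "Suc N" b c] chain_closed[OF k c(1)]
      by (simp add: lr qr M.smult_rsmult Wq.smult_rsmult M.rsmult_closed Wq.rsmult_closed del: with_B_simps)
  qed
qed

text \<open>The diagonal of \<open>B\<close> belongs to the relation, so a common vacuum part can be
  subtracted.\<close>

lemma rel_vec: 
  assumes k: "k \<in> K" and p: "((b, x), (b, x')) \<in> rel k N"
  shows "((0, x), (0, x')) \<in> rel k N"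
proof -
  have c: "x \<in> carrier (X k)" "x' \<in> carrier quot" using rel_closed[OF k p] by auto
  interpret M0: bimodule "X k" by (rule bim[OF k])
  interpret Q0: bimodule quot by (rule quot_bimodule)
  show ?thesis using c rel_add[OF p rel_scalar[of "- b"]] by simp
qed

text \<open>Vacuum parts are additive and compatible with both actions of \<open>B\<close>, so the
  generating chains decide. Their agreement is a hypothesis here and is the real content of the
  comparison.\<close>

lemma rel_fst:
  assumes k: "k \<in> K" and p: "(x, x') \<in> rel k N"
    and H: "\<And>m x x'. m < N \<Longrightarrow> chain k m x x' \<Longrightarrow> fst x = fst x'"
  shows "fst x = fst x'"
proof -
  have "fst (fst (x, x')) = fst (snd (x, x'))"
  proof (rule aspan_pred[OF p[unfolded rel_def]])
    fix g assume "g \<in> range (\<lambda>c. ((c, \<zero>\<^bsub>X k\<^esub>), (c, \<zero>\<^bsub>quot\<^esub>))) \<union>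
      {(b \<odot>\<^bsub>with_B (X k)\<^esub> x \<lhd>\<^bsub>with_B (X k)\<^esub> c, b \<odot>\<^bsub>with_B quot\<^esub> x' \<lhd>\<^bsub>with_B quot\<^esub> c) | b c m x x'. chain k m x x' \<and> m < N}"
    then show "fst (fst g) = fst (snd g)"
    proof (elim UnE rangeE CollectE exE conjE)
      fix b c m x x' assume g: "g = (b \<odot>\<^bsub>with_B (X k)\<^esub> x \<lhd>\<^bsub>with_B (X k)\<^esub> c, b \<odot>\<^bsub>with_B quot\<^esub> x' \<lhd>\<^bsub>with_B quot\<^esub> c)"
        and c: "chain k m x x'" "m < N"
      from H[OF c(2,1)] show ?thesis unfolding g by (cases x; cases x') simp
    qed simp
  qed (auto simp: with_B_def)
  then show ?thesis by simp
qed

text \<open>In \<open>quot\<close> the letters from \<open>B\<close> act through the bimodule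
  structure; this is the property that an arbitrary realization may lack.\<close>

lemma lmul_L: "x \<in> carrier (with_B quot) \<Longrightarrow> lmul (L b) x = b \<odot>\<^bsub>with_B quot\<^esub> x"
  by (erule qvE) (simp only: lmul_qv smult_qv)

lemma lmul_R: "x \<in> carrier (with_B quot) \<Longrightarrow> lmul (R b) x = x \<lhd>\<^bsub>with_B quot\<^esub> b"
  by (erule qvE) (simp only: lmul_qv rsmult_qv)

end


section \<open>Comparison of two realizations\<close>

context free_prod
begin

lemma hd_pairs_cases: "tens ps \<Longrightarrow> ps \<noteq> [] \<Longrightarrow> (\<And>k x qs. ps = (k, x) # qs \<Longrightarrow> k \<in> K \<Longrightarrow> x \<in> carrier (X k) \<Longrightarrow> P) \<Longrightarrow> P"
  by (cases ps) (auto simp: tens_Cons)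

lemma last_pairs_cases: "tens ps \<Longrightarrow> ps \<noteq> [] \<Longrightarrow> (\<And>k x qs. ps = qs @ [(k, x)] \<Longrightarrow> k \<in> K \<Longrightarrow> x \<in> carrier (X k) \<Longrightarrow> P) \<Longrightarrow> P"
  by (cases ps rule: rev_cases) (auto simp: tens_snoc)

lemma left_vac_closed: "k \<in> K \<Longrightarrow> a \<in> left_ops (with_B (X k)) \<Longrightarrow> a (1, \<zero>\<^bsub>X k\<^esub>) = (b, y) \<Longrightarrow> y \<in> carrier (X k)"
  using left_ops_closed[of a k "(1, \<zero>\<^bsub>X k\<^esub>)"] vacuum_closed[of k 1] by auto

lemma left_leg_closed: "k \<in> K \<Longrightarrow> a \<in> left_ops (with_B (X k)) \<Longrightarrow> x \<in> carrier (X k) \<Longrightarrow> a (c, x) = (b, y) \<Longrightarrow> y \<in> carrier (X k)"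
  using left_ops_closed[of a k "(c, x)"] by auto

lemma right_vac_closed: "k \<in> K \<Longrightarrow> a \<in> right_ops (with_B (X k)) \<Longrightarrow> a (1, \<zero>\<^bsub>X k\<^esub>) = (b, y) \<Longrightarrow> y \<in> carrier (X k)"
  using right_ops_closed[of a k "(1, \<zero>\<^bsub>X k\<^esub>)"] vacuum_closed[of k 1] by auto

lemma right_leg_closed: "k \<in> K \<Longrightarrow> a \<in> right_ops (with_B (X k)) \<Longrightarrow> x \<in> carrier (X k) \<Longrightarrow> a (c, x) = (b, y) \<Longrightarrow> y \<in> carrier (X k)"
  using right_ops_closed[of a k "(c, x)"] by auto

lemma tspan_gen: "ps \<in> P \<Longrightarrow> tvec ps \<in> tspan P"
  by (intro aspan.aspan_gen imageI)

lemma emb_tvec: "k \<in> K \<Longrightarrow> x \<in> carrier (X k) \<Longrightarrow> emb k (c, x) = scal c \<oplus>\<^bsub>F\<^esub> tvec [(k, x)]"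
  by (simp add: emb_def tvec_def)

lemma tspan_fst: "v \<in> tspan P \<Longrightarrow> (\<And>ps. ps \<in> P \<Longrightarrow> ps \<noteq> []) \<Longrightarrow> fst v = 0"
  by (erule aspan_pred) (auto simp: fst_add fst_tvec)

end

context realization
begin

definition leg :: "'k \<Rightarrow> nat \<Rightarrow> 'x \<Rightarrow> bool" where
  "leg k N x \<longleftrightarrow> (\<exists>x'. ((0, x), (0, x')) \<in> rel k N)"

text \<open>Error tensors with auxiliary colour \<open>k\<close>: some leg has this colour, and
  every leg of this colour is tied to a vector of \<open>quot\<close>, so that the effect of
  \<open>L b\<close> and \<open>R b\<close> of colour \<open>k\<close> on it can be
  followed.\<close>

definition junk :: "'k \<Rightarrow> nat \<Rightarrow> ('k \<times> 'x) list set" where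
  "junk k N = {ps. tens ps \<and> k \<in> fst ` set ps \<and> (\<forall>(i, x)\<in>set ps. i = k \<longrightarrow> leg k N x)}"

lemma leg_mono: "leg k N x \<Longrightarrow> N \<le> N' \<Longrightarrow> leg k N' x"
  unfolding leg_def by (elim exE) (rule exI, erule (1) rel_mono)

lemma junk_subset:
  assumes N: "N \<le> N'"
  shows "junk k N \<subseteq> junk k N'"
proof
  fix ps assume ps: "ps \<in> junk k N"
  have "leg k N' x" if "(k, x) \<in> set ps" for x
    using ps that leg_mono[OF _ N, of k x] by (auto simp: junk_def)
  then show "ps \<in> junk k N'" using ps by (auto simp: junk_def)
qed

lemma junk_mono: "v \<in> tspan (junk k N) \<Longrightarrow> N \<le> N' \<Longrightarrow> v \<in> tspan (junk k N')"
  by (erule aspan_mono) (intro image_mono junk_subset)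

lemma leg_smult: "k \<in> K \<Longrightarrow> leg k N x \<Longrightarrow> leg k N (b \<odot>\<^bsub>X k\<^esub> x)"
  unfolding leg_def using rel_smult[of k "(0, x)" _ N b] by fastforce

lemma leg_rsmult: "k \<in> K \<Longrightarrow> leg k N x \<Longrightarrow> leg k N (x \<lhd>\<^bsub>X k\<^esub> b)"
  unfolding leg_def using rel_rsmult[of k "(0, x)" _ N b] by fastforce

lemma junk_tens: "ps \<in> junk k N \<Longrightarrow> tens ps"
  by (simp add: junk_def)

lemma junk_ne: "ps \<in> junk k N \<Longrightarrow> ps \<noteq> []"
  by (auto simp: junk_def)

lemma junk_smult:
  assumes ps: "ps \<in> junk k N"
  shows "b \<odot>\<^bsub>F\<^esub> tvec ps \<in> tspan (junk k N)"
proof -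
  obtain j x qs where j: "ps = (j, x) # qs" "j \<in> K" "x \<in> carrier (X j)"
    using junk_tens[OF ps] junk_ne[OF ps] by (rule hd_pairs_cases)
  then have "(j, b \<odot>\<^bsub>X j\<^esub> x) # qs \<in> junk k N"
    using ps leg_smult[of k N x b] by (auto simp: junk_def tens_Cons bimodule.smult_closed[OF bim])
  then show ?thesis using junk_tens[OF ps] by (simp add: j smult_tvec tspan_gen)
qed

lemma junk_rsmult:
  assumes ps: "ps \<in> junk k N"
  shows "tvec ps \<lhd>\<^bsub>F\<^esub> b \<in> tspan (junk k N)"
proof -
  obtain j x qs where j: "ps = qs @ [(j, x)]" "j \<in> K" "x \<in> carrier (X j)"
    using junk_tens[OF ps] junk_ne[OF ps] by (rule last_pairs_cases)
  then have "qs @ [(j, x \<lhd>\<^bsub>X j\<^esub> b)] \<in> junk k N"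
    using ps leg_rsmult[of k N x b] by (auto simp: junk_def tens_snoc bimodule.rsmult_closed[OF bim])
  then show ?thesis using junk_tens[OF ps] by (simp add: j rsmult_tvec tspan_gen)
qed

text \<open>An operator of another colour neither changes nor removes a leg of colour
  \<open>k\<close>, except through a multiplication by \<open>B\<close>, which keeps the leg
  controlled.\<close>

lemma junk_left_other:
  assumes v: "v \<in> tspan (junk k N)" and j: "j \<in> K" "j \<noteq> k" and a: "a \<in> left_ops (with_B (X j))"
  shows "left_reg K X j a v \<in> tspan (junk k N)"
proof (rule left_reg_tspan[OF v j(1) a junk_tens])
  fix ps b y assume ps: "ps \<in> junk k N" "ps = [] \<or> fst (hd ps) \<noteq> j" and y: "a (1, \<zero>\<^bsub>X j\<^esub>) = (b, y)"
  then have "(j, y) # ps \<in> junk k N"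
    using left_vac_closed[OF j(1) a y] j by (auto simp: junk_def tens_Cons)
  then show "b \<odot>\<^bsub>F\<^esub> tvec ps \<in> tspan (junk k N) \<and> tvec ((j, y) # ps) \<in> tspan (junk k N)"
    using junk_smult[OF ps(1)] by (simp add: tspan_gen)
next
  fix x ps b y assume ps: "(j, x) # ps \<in> junk k N" and y: "a (0, x) = (b, y)"
  then have "(j, y) # ps \<in> junk k N" "ps \<in> junk k N"
    using left_leg_closed[OF j(1) a _ y] j by (auto simp: junk_def tens_Cons)
  then show "b \<odot>\<^bsub>F\<^esub> tvec ps \<in> tspan (junk k N) \<and> tvec ((j, y) # ps) \<in> tspan (junk k N)"
    using junk_smult by (simp add: tspan_gen)
qed

lemma junk_right_other:
  assumes v: "v \<in> tspan (junk k N)" and j: "j \<in> K" "j \<noteq> k" and a: "a \<in> right_ops (with_B (X j))"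
  shows "right_reg K X j a v \<in> tspan (junk k N)"
proof (rule right_reg_tspan[OF v j(1) a junk_tens])
  fix ps b y assume ps: "ps \<in> junk k N" "ps = [] \<or> fst (last ps) \<noteq> j" and y: "a (1, \<zero>\<^bsub>X j\<^esub>) = (b, y)"
  then have "ps @ [(j, y)] \<in> junk k N"
    using right_vac_closed[OF j(1) a y] j by (auto simp: junk_def tens_snoc)
  then show "tvec ps \<lhd>\<^bsub>F\<^esub> b \<in> tspan (junk k N) \<and> tvec (ps @ [(j, y)]) \<in> tspan (junk k N)"
    using junk_rsmult[OF ps(1)] by (simp add: tspan_gen)
next
  fix x ps b y assume ps: "ps @ [(j, x)] \<in> junk k N" and y: "a (0, x) = (b, y)"
  then have "ps @ [(j, y)] \<in> junk k N" "ps \<in> junk k N"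
    using right_leg_closed[OF j(1) a _ y] j by (auto simp: junk_def tens_snoc)
  then show "tvec ps \<lhd>\<^bsub>F\<^esub> b \<in> tspan (junk k N) \<and> tvec (ps @ [(j, y)]) \<in> tspan (junk k N)"
    using junk_rsmult by (simp add: tspan_gen)
qed

text \<open>A realization need not map \<open>L b\<close> to the left multiplication by \<open>b\<close>.  The following
  hypothesis on the vectors of level at most \<open>N\<close> makes up for this.\<close>

definition tame :: "'k \<Rightarrow> nat \<Rightarrow> bool" where
  "tame k N \<longleftrightarrow> (\<forall>m\<le>N. \<forall>x x'. chain k m x x' \<longrightarrow> fst x = fst x')"

lemma tame_fst: "tame k N \<Longrightarrow> k \<in> K \<Longrightarrow> (x, x') \<in> rel k (Suc N) \<Longrightarrow> fst x = fst x'"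
  unfolding tame_def by (rule rel_fst, assumption, assumption) (meson less_Suc_eq_le)

text \<open>On the side of \<open>quot\<close> these letters send the vacuum to
  \<open>(b, 0)\<close>; tameness transfers the vacuum part to the realization, and the rest becomes
  a controlled leg.\<close>

lemma tame_vac:
  assumes k: "k \<in> K" and t: "tame k N"
  shows "l k (L b) (1, \<zero>\<^bsub>X k\<^esub>) = (b', y) \<Longrightarrow> b' = b \<and> leg k 1 y"
    and "r k (R b) (1, \<zero>\<^bsub>X k\<^esub>) = (b', y) \<Longrightarrow> b' = b \<and> leg k 1 y"
proof -
  have t0: "tame k 0" using t unfolding tame_def by (meson le0 le_trans)
  assume y: "l k (L b) (1, \<zero>\<^bsub>X k\<^esub>) = (b', y)"
  have p: "(l k (L b) (1, \<zero>\<^bsub>X k\<^esub>), lmul (L b) (1, \<zero>\<^bsub>quot\<^esub>)) \<in> rel k (Suc 0)"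
    by (rule rel_left[OF k rel_scalar lL[OF k]])
  have q: "lmul (L b) (1, \<zero>\<^bsub>quot\<^esub>) = (b, \<zero>\<^bsub>quot\<^esub>)"
    unfolding lmul_L[OF qvacuum_closed] qvacuum_smult[symmetric] ..
  have eq: "b' = b" using tame_fst[OF t0 k p] by (simp add: y q)
  show "b' = b \<and> leg k 1 y"
    using rel_vec[OF k p[unfolded y q eq]] eq by (auto simp: leg_def)
next
  have t0: "tame k 0" using t unfolding tame_def by (meson le0 le_trans)
  assume y: "r k (R b) (1, \<zero>\<^bsub>X k\<^esub>) = (b', y)"
  have p: "(r k (R b) (1, \<zero>\<^bsub>X k\<^esub>), lmul (R b) (1, \<zero>\<^bsub>quot\<^esub>)) \<in> rel k (Suc 0)"
    by (rule rel_right[OF k rel_scalar rR[OF k]])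
  have q: "lmul (R b) (1, \<zero>\<^bsub>quot\<^esub>) = (b, \<zero>\<^bsub>quot\<^esub>)"
    unfolding lmul_R[OF qvacuum_closed] qvacuum_rsmult[symmetric] ..
  have eq: "b' = b" using tame_fst[OF t0 k p] by (simp add: y q)
  show "b' = b \<and> leg k 1 y"
    using rel_vec[OF k p[unfolded y q eq]] eq by (auto simp: leg_def)
qed

text \<open>On \<open>quot\<close> the letters act by the bimodule structure and keep the vacuum
  part 0. By tameness the same holds in the realization, so a controlled leg cannot be
  removed.\<close>

lemma tame_leg:
  assumes k: "k \<in> K" and t: "tame k N" and x: "leg k N x"
  shows "l k (L b) (0, x) = (b', y) \<Longrightarrow> b' = 0 \<and> leg k (Suc N) y"
    and "r k (R b) (0, x) = (b', y) \<Longrightarrow> b' = 0 \<and> leg k (Suc N) y"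
proof -
  obtain x' where x': "((0, x), (0, x')) \<in> rel k N" using x by (auto simp: leg_def)
  have q: "(0, x') \<in> carrier (with_B quot)" using rel_closed[OF k x'] by simp
  show "b' = 0 \<and> leg k (Suc N) y" if y: "l k (L b) (0, x) = (b', y)"
  proof -
    have p: "((b', y), (0, b \<odot>\<^bsub>quot\<^esub> x')) \<in> rel k (Suc N)"
      using rel_left[OF k x' lL[OF k, of b]] by (simp add: y lmul_L[OF q])
    then have "b' = 0" using tame_fst[OF t k p] by simp
    then show ?thesis using p by (auto simp: leg_def)
  qed
  show "b' = 0 \<and> leg k (Suc N) y" if y: "r k (R b) (0, x) = (b', y)"
  proof -
    have p: "((b', y), (0, x' \<lhd>\<^bsub>quot\<^esub> b)) \<in> rel k (Suc N)"
      using rel_right[OF k x' rR[OF k, of b]] by (simp add: y lmul_R[OF q])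
    then have "b' = 0" using tame_fst[OF t k p] by simp
    then show ?thesis using p by (auto simp: leg_def)
  qed
qed

text \<open>When \<open>L b\<close> meets a leg of colour \<open>k\<close>, the vacuum part of the
  result is 0, so the summand without that leg drops out. The level rises because one more letter
  has acted on the leg.\<close>

lemma junk_left_L:
  assumes v: "v \<in> tspan (junk k N)" and k: "k \<in> K" and t: "tame k N"
  shows "left_reg K X k (l k (L b)) v \<in> tspan (junk k (Suc N))"
proof (rule left_reg_tspan[OF v k l_ops[OF k lL[OF k]] junk_tens])
  note a = l_ops[OF k lL[OF k, of b]]
  fix ps b' y assume ps: "ps \<in> junk k N" "ps = [] \<or> fst (hd ps) \<noteq> k" and y: "l k (L b) (1, \<zero>\<^bsub>X k\<^esub>) = (b', y)"
  have "leg k (Suc N) y" using tame_vac(1)[OF k t y] leg_mono by auto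
  then have "(k, y) # ps \<in> junk k (Suc N)"
    using ps left_vac_closed[OF k a y] k leg_mono[of k N _ "Suc N"] by (auto simp: junk_def tens_Cons)
  then show "b' \<odot>\<^bsub>F\<^esub> tvec ps \<in> tspan (junk k (Suc N)) \<and> tvec ((k, y) # ps) \<in> tspan (junk k (Suc N))"
    using junk_smult[OF ps(1), of b'] junk_mono[of _ k N "Suc N"] by (simp add: tspan_gen)
next
  note a = l_ops[OF k lL[OF k, of b]]
  fix x ps b' y assume ps: "(k, x) # ps \<in> junk k N" and y: "l k (L b) (0, x) = (b', y)"
  have "leg k N x" using ps by (auto simp: junk_def)
  from tame_leg(1)[OF k t this y] have y': "b' = 0" "leg k (Suc N) y" by auto
  then have "(k, y) # ps \<in> junk k (Suc N)"
    using ps left_leg_closed[OF k a _ y] k leg_mono[of k N _ "Suc N"] by (auto simp: junk_def tens_Cons)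
  moreover have "b' \<odot>\<^bsub>F\<^esub> tvec ps = \<zero>\<^bsub>F\<^esub>"
    using junk_tens[OF ps] by (simp add: y' smult_zero tvec_closed tens_Cons)
  ultimately show "b' \<odot>\<^bsub>F\<^esub> tvec ps \<in> tspan (junk k (Suc N)) \<and> tvec ((k, y) # ps) \<in> tspan (junk k (Suc N))"
    by (simp add: tspan_gen aspan.aspan_zero)
qed

lemma junk_right_R:
  assumes v: "v \<in> tspan (junk k N)" and k: "k \<in> K" and t: "tame k N"
  shows "right_reg K X k (r k (R b)) v \<in> tspan (junk k (Suc N))"
proof (rule right_reg_tspan[OF v k r_ops[OF k rR[OF k]] junk_tens])
  note a = r_ops[OF k rR[OF k, of b]]
  fix ps b' y assume ps: "ps \<in> junk k N" "ps = [] \<or> fst (last ps) \<noteq> k" and y: "r k (R b) (1, \<zero>\<^bsub>X k\<^esub>) = (b', y)"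
  have "leg k (Suc N) y" using tame_vac(2)[OF k t y] leg_mono by auto
  then have "ps @ [(k, y)] \<in> junk k (Suc N)"
    using ps right_vac_closed[OF k a y] k leg_mono[of k N _ "Suc N"] by (auto simp: junk_def tens_snoc)
  then show "tvec ps \<lhd>\<^bsub>F\<^esub> b' \<in> tspan (junk k (Suc N)) \<and> tvec (ps @ [(k, y)]) \<in> tspan (junk k (Suc N))"
    using junk_rsmult[OF ps(1), of b'] junk_mono[of _ k N "Suc N"] by (simp add: tspan_gen)
next
  note a = r_ops[OF k rR[OF k, of b]]
  fix x ps b' y assume ps: "ps @ [(k, x)] \<in> junk k N" and y: "r k (R b) (0, x) = (b', y)"
  have "leg k N x" using ps by (auto simp: junk_def)
  from tame_leg(2)[OF k t this y] have y': "b' = 0" "leg k (Suc N) y" by auto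
  then have "ps @ [(k, y)] \<in> junk k (Suc N)"
    using ps right_leg_closed[OF k a _ y] k leg_mono[of k N _ "Suc N"] by (auto simp: junk_def tens_snoc)
  moreover have "tvec ps \<lhd>\<^bsub>F\<^esub> b' = \<zero>\<^bsub>F\<^esub>"
    using junk_tens[OF ps] by (simp add: y' rsmult_zero tvec_closed tens_snoc)
  ultimately show "tvec ps \<lhd>\<^bsub>F\<^esub> b' \<in> tspan (junk k (Suc N)) \<and> tvec (ps @ [(k, y)]) \<in> tspan (junk k (Suc N))"
    by (simp add: tspan_gen aspan.aspan_zero)
qed

text \<open>The letter \<open>L b\<close> of colour \<open>k\<close> sends the vacuum to
  \<open>b\<close> plus a leg of colour \<open>k\<close>. On a vector of colour \<open>j\<close> it
  is thus multiplication by \<open>b\<close> up to two error tensors, one from the scalar part and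
  one from the leg.\<close>

lemma emb_left_L:
  assumes jk: "j \<in> K" "k \<in> K" "j \<noteq> k" and t: "tame k N" and x: "x \<in> carrier (with_B (X j))"
  obtains u where "left_reg K X k (l k (L b)) (emb j x) = emb j (b \<odot>\<^bsub>with_B (X j)\<^esub> x) \<oplus>\<^bsub>F\<^esub> u"
    "u \<in> tspan (junk k 1)"
proof -
  interpret M: bimodule "X k" by (rule bim[OF jk(2)])
  obtain c x0 where x: "x = (c, x0)" "x0 \<in> carrier (X j)" using x by auto
  note a = l_ops[OF jk(2) lL[OF jk(2), of b]]
  obtain b' y where y: "l k (L b) (1, \<zero>\<^bsub>X k\<^esub>) = (b', y)" by force
  then have b': "b' = b" and ly: "leg k 1 y" using tame_vac(1)[OF jk(2) t y] by auto
  have yc: "y \<in> carrier (X k)" by (rule left_vac_closed[OF jk(2) a y])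
  have lc: "l k (L b) (c, \<zero>\<^bsub>X k\<^esub>) = (b * c, y \<lhd>\<^bsub>X k\<^esub> c)"
    unfolding vacuum_rsmult[OF jk(2), of c] left_ops_rsmult[OF a jk(2) vacuum_closed[OF jk(2)]]
    by (simp add: y b')
  have t1: "tens [(j, x0)]" using x jk by (simp add: tens_Cons)
  let ?u1 = "tvec [(k, y \<lhd>\<^bsub>X k\<^esub> c)]" and ?u2 = "tvec [(k, y), (j, x0)]"
  have u: "[(k, y \<lhd>\<^bsub>X k\<^esub> c)] \<in> junk k 1" "[(k, y), (j, x0)] \<in> junk k 1"
    using jk x yc ly leg_rsmult[OF jk(2) ly] by (auto simp: junk_def tens_Cons M.rsmult_closed)
  have "left_reg K X k (l k (L b)) (scal c) = scal (b * c) \<oplus>\<^bsub>F\<^esub> ?u1"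
    using left_reg_emb[OF jk(2) a vacuum_closed[OF jk(2)], of c] yc
    unfolding emb_scalar[OF jk(2)] lc by (simp add: emb_tvec jk M.rsmult_closed)
  moreover have "left_reg K X k (l k (L b)) (tvec [(j, x0)]) = tvec [(j, b \<odot>\<^bsub>X j\<^esub> x0)] \<oplus>\<^bsub>F\<^esub> ?u2"
    using left_tvec_new[OF jk(2) a t1 _ y] jk t1 by (simp add: b' smult_tvec)
  moreover have c: "scal (b * c) \<in> carrier F" "?u1 \<in> carrier F" "tvec [(j, b \<odot>\<^bsub>X j\<^esub> x0)] \<in> carrier F" "?u2 \<in> carrier F"
    using u junk_tens x jk by (auto intro!: tvec_closed scal_closed simp: tens_Cons bimodule.smult_closed[OF bim])
  ultimately have "left_reg K X k (l k (L b)) (emb j x) = emb j (b \<odot>\<^bsub>with_B (X j)\<^esub> x) \<oplus>\<^bsub>F\<^esub> (?u1 \<oplus>\<^bsub>F\<^esub> ?u2)"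
    using x jk t1 left_reg_add[OF jk(2) a scal_closed tvec_closed[OF t1], of c]
    by (simp add: emb_tvec bimodule.smult_closed[OF bim] F.a_ac)
  then show thesis using u by (intro that[of "?u1 \<oplus>\<^bsub>F\<^esub> ?u2"] aspan.aspan_add tspan_gen)
qed

lemma emb_right_R:
  assumes jk: "j \<in> K" "k \<in> K" "j \<noteq> k" and t: "tame k N" and x: "x \<in> carrier (with_B (X j))"
  obtains u where "right_reg K X k (r k (R b)) (emb j x) = emb j (x \<lhd>\<^bsub>with_B (X j)\<^esub> b) \<oplus>\<^bsub>F\<^esub> u"
    "u \<in> tspan (junk k 1)"
proof -
  interpret M: bimodule "X k" by (rule bim[OF jk(2)])
  obtain c x0 where x: "x = (c, x0)" "x0 \<in> carrier (X j)" using x by auto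
  note a = r_ops[OF jk(2) rR[OF jk(2), of b]]
  obtain b' y where y: "r k (R b) (1, \<zero>\<^bsub>X k\<^esub>) = (b', y)" by force
  then have b': "b' = b" and ly: "leg k 1 y" using tame_vac(2)[OF jk(2) t y] by auto
  have yc: "y \<in> carrier (X k)" by (rule right_vac_closed[OF jk(2) a y])
  have lc: "r k (R b) (c, \<zero>\<^bsub>X k\<^esub>) = (c * b, c \<odot>\<^bsub>X k\<^esub> y)"
    unfolding vacuum_smult[OF jk(2), of c] right_ops_smult[OF a jk(2) vacuum_closed[OF jk(2)]]
    by (simp add: y b')
  have t1: "tens [(j, x0)]" using x jk by (simp add: tens_Cons)
  let ?u1 = "tvec [(k, c \<odot>\<^bsub>X k\<^esub> y)]" and ?u2 = "tvec [(j, x0), (k, y)]"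
  have u: "[(k, c \<odot>\<^bsub>X k\<^esub> y)] \<in> junk k 1" "[(j, x0), (k, y)] \<in> junk k 1"
    using jk x yc ly leg_smult[OF jk(2) ly] by (auto simp: junk_def tens_Cons M.smult_closed)
  have "right_reg K X k (r k (R b)) (scal c) = scal (c * b) \<oplus>\<^bsub>F\<^esub> ?u1"
    using right_reg_emb[OF jk(2) a vacuum_closed[OF jk(2)], of c] yc
    unfolding emb_scalar[OF jk(2)] lc by (simp add: emb_tvec jk M.smult_closed)
  moreover have "right_reg K X k (r k (R b)) (tvec [(j, x0)]) = tvec [(j, x0 \<lhd>\<^bsub>X j\<^esub> b)] \<oplus>\<^bsub>F\<^esub> ?u2"
    using right_tvec_new[OF jk(2) a t1 _ y] jk t1 rsmult_tvec[of "[]" j x0 b] by (simp add: b')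
  moreover have c: "scal (c * b) \<in> carrier F" "?u1 \<in> carrier F" "tvec [(j, x0 \<lhd>\<^bsub>X j\<^esub> b)] \<in> carrier F" "?u2 \<in> carrier F"
    using u junk_tens x jk by (auto intro!: tvec_closed scal_closed simp: tens_Cons bimodule.rsmult_closed[OF bim])
  ultimately have "right_reg K X k (r k (R b)) (emb j x) = emb j (x \<lhd>\<^bsub>with_B (X j)\<^esub> b) \<oplus>\<^bsub>F\<^esub> (?u1 \<oplus>\<^bsub>F\<^esub> ?u2)"
    using x jk t1 right_reg_add[OF jk(2) a scal_closed tvec_closed[OF t1], of c]
    by (simp add: emb_tvec bimodule.rsmult_closed[OF bim] F.a_ac)
  then show thesis using u by (intro that[of "?u1 \<oplus>\<^bsub>F\<^esub> ?u2"] aspan.aspan_add tspan_gen)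
qed

lemma junk_closed: "v \<in> tspan (junk k N) \<Longrightarrow> v \<in> carrier F"
  by (erule aspan_closed) (auto simp: junk_def tvec_closed)

text \<open>The multiplications by elements of \<open>B\<close> inside a vector of colour \<open>j\<close> are imitated by the
  operators \<open>L b\<close> and \<open>R b\<close> of another colour \<open>k\<close>; the error consists of tensors with a leg of
  colour \<open>k\<close>, which cannot return to the vacuum.\<close>

lemma simulation:
  assumes jk: "j \<in> K" "k \<in> K" "j \<noteq> k" and c: "chain j n x x'" and t: "\<And>m. m < n \<Longrightarrow> tame k m"
  shows "\<exists>w u. letters w \<and> run w (scal 1) = emb j x \<oplus>\<^bsub>F\<^esub> u \<and> u \<in> tspan (junk k n) \<and>
    x' = qv (prod_list (map snd w))"
  using c t
proof induction
  case (left0 a)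
  note la = l_ops[OF jk(1) left0(1)]
  have "run [(Inl j, a)] (scal 1) = emb j (l j a (1, \<zero>\<^bsub>X j\<^esub>))"
    using left_reg_emb[OF jk(1) la vacuum_closed[OF jk(1)], of 1] jk by (simp add: emb_scalar)
  moreover have "lmul a (1, \<zero>\<^bsub>quot\<^esub>) = qv (prod_list (map snd [(Inl j, a)]))"
    by (simp add: lmul_qv flip: qv_one)
  ultimately show ?case
    using jk left0 aspan.aspan_zero emb_closed[OF jk(1) left_ops_closed[OF la jk(1) vacuum_closed[OF jk(1)]]]
    by (intro exI[of _ "[(Inl j, a)]"] exI[of _ "\<zero>\<^bsub>F\<^esub>"]) auto
next
  case (right0 d)
  note la = r_ops[OF jk(1) right0(1)]
  have "run [(Inr j, d)] (scal 1) = emb j (r j d (1, \<zero>\<^bsub>X j\<^esub>))"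
    using right_reg_emb[OF jk(1) la vacuum_closed[OF jk(1)], of 1] jk by (simp add: emb_scalar)
  moreover have "lmul d (1, \<zero>\<^bsub>quot\<^esub>) = qv (prod_list (map snd [(Inr j, d)]))"
    by (simp add: lmul_qv flip: qv_one)
  ultimately show ?case
    using jk right0 aspan.aspan_zero emb_closed[OF jk(1) right_ops_closed[OF la jk(1) vacuum_closed[OF jk(1)]]]
    by (intro exI[of _ "[(Inr j, d)]"] exI[of _ "\<zero>\<^bsub>F\<^esub>"]) auto
next
  case (left n x x' a b)
  note aj = l_ops[OF jk(1) left(2)] and ak = l_ops[OF jk(2) lL[OF jk(2), of b]]
  obtain w u where w: "letters w" "run w (scal 1) = emb j x \<oplus>\<^bsub>F\<^esub> u" "u \<in> tspan (junk k n)"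
    "x' = qv (prod_list (map snd w))" using left by (metis less_Suc_eq)
  have t: "tame k n" using left by simp
  have xc: "x \<in> carrier (with_B (X j))" using chain_closed[OF jk(1) left(1)] by simp
  then have bx: "b \<odot>\<^bsub>with_B (X j)\<^esub> x \<in> carrier (with_B (X j))" by (rule bimodule.smult_closed[OF wM[OF jk(1)]])
  obtain u1 where u1: "left_reg K X k (l k (L b)) (emb j x) = emb j (b \<odot>\<^bsub>with_B (X j)\<^esub> x) \<oplus>\<^bsub>F\<^esub> u1" "u1 \<in> tspan (junk k 1)"
    by (rule emb_left_L[OF jk t xc])
  define u2 where "u2 = u1 \<oplus>\<^bsub>F\<^esub> left_reg K X k (l k (L b)) u"
  have u2: "u2 \<in> tspan (junk k (Suc n))"
    unfolding u2_def using junk_mono[OF u1(2)] junk_left_L[OF w(3) jk(2) t] by (intro aspan.aspan_add) auto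
  note uc = junk_closed[OF w(3)] junk_closed[OF u1(2)] junk_closed[OF u2]
  have "left_reg K X k (l k (L b)) (run w (scal 1)) = emb j (b \<odot>\<^bsub>with_B (X j)\<^esub> x) \<oplus>\<^bsub>F\<^esub> u2"
    using u1 uc left_reg_closed[OF jk(2) ak uc(1)] emb_closed[OF jk(1) xc] emb_closed[OF jk(1) bx]
    by (simp add: w(2) left_reg_add[OF jk(2) ak] u2_def F.a_assoc)
  then have "run ((Inl j, a) # (Inl k, L b) # w) (scal 1) =
      emb j (l j a (b \<odot>\<^bsub>with_B (X j)\<^esub> x)) \<oplus>\<^bsub>F\<^esub> left_reg K X j (l j a) u2"
    using left_reg_add[OF jk(1) aj emb_closed[OF jk(1) bx] uc(3)] left_reg_emb[OF jk(1) aj bx] by simp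
  moreover have "left_reg K X j (l j a) u2 \<in> tspan (junk k (Suc n))"
    by (rule junk_left_other[OF u2 jk(1,3) aj])
  \<comment> \<open>In \<open>quot\<close> the colour of a letter is immaterial: \<open>L b\<close>
    is multiplication by \<open>b\<close> whichever colour carries it, and the vector is that of the
    product of all letters.\<close>
  moreover have "lmul a (b \<odot>\<^bsub>with_B quot\<^esub> x') = qv (prod_list (map snd ((Inl j, a) # (Inl k, L b) # w)))"
    unfolding w(4) smult_qv lmul_qv by simp
  moreover have "letters ((Inl j, a) # (Inl k, L b) # w)" using w jk left lL by simp
  ultimately show ?case by blast
next
  case (right n x x' d b)
  note aj = r_ops[OF jk(1) right(2)] and ak = r_ops[OF jk(2) rR[OF jk(2), of b]]
  obtain w u where w: "letters w" "run w (scal 1) = emb j x \<oplus>\<^bsub>F\<^esub> u" "u \<in> tspan (junk k n)"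
    "x' = qv (prod_list (map snd w))" using right by (metis less_Suc_eq)
  have t: "tame k n" using right by simp
  have xc: "x \<in> carrier (with_B (X j))" using chain_closed[OF jk(1) right(1)] by simp
  then have bx: "x \<lhd>\<^bsub>with_B (X j)\<^esub> b \<in> carrier (with_B (X j))" by (rule bimodule.rsmult_closed[OF wM[OF jk(1)]])
  obtain u1 where u1: "right_reg K X k (r k (R b)) (emb j x) = emb j (x \<lhd>\<^bsub>with_B (X j)\<^esub> b) \<oplus>\<^bsub>F\<^esub> u1" "u1 \<in> tspan (junk k 1)"
    by (rule emb_right_R[OF jk t xc])
  define u2 where "u2 = u1 \<oplus>\<^bsub>F\<^esub> right_reg K X k (r k (R b)) u"
  have u2: "u2 \<in> tspan (junk k (Suc n))"
    unfolding u2_def using junk_mono[OF u1(2)] junk_right_R[OF w(3) jk(2) t] by (intro aspan.aspan_add) auto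
  note uc = junk_closed[OF w(3)] junk_closed[OF u1(2)] junk_closed[OF u2]
  have "right_reg K X k (r k (R b)) (run w (scal 1)) = emb j (x \<lhd>\<^bsub>with_B (X j)\<^esub> b) \<oplus>\<^bsub>F\<^esub> u2"
    using u1 uc right_reg_closed[OF jk(2) ak uc(1)] emb_closed[OF jk(1) xc] emb_closed[OF jk(1) bx]
    by (simp add: w(2) right_reg_add[OF jk(2) ak] u2_def F.a_assoc)
  then have "run ((Inr j, d) # (Inr k, R b) # w) (scal 1) =
      emb j (r j d (x \<lhd>\<^bsub>with_B (X j)\<^esub> b)) \<oplus>\<^bsub>F\<^esub> right_reg K X j (r j d) u2"
    using right_reg_add[OF jk(1) aj emb_closed[OF jk(1) bx] uc(3)] right_reg_emb[OF jk(1) aj bx] by simp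
  moreover have "right_reg K X j (r j d) u2 \<in> tspan (junk k (Suc n))"
    by (rule junk_right_other[OF u2 jk(1,3) aj])
  moreover have "lmul d (x' \<lhd>\<^bsub>with_B quot\<^esub> b) = qv (prod_list (map snd ((Inr j, d) # (Inr k, R b) # w)))"
    unfolding w(4) rsmult_qv lmul_qv by simp
  moreover have "letters ((Inr j, d) # (Inr k, R b) # w)" using w jk right rR by simp
  ultimately show ?case by blast
qed

text \<open>Strong induction on the level, for all colours at once, because simulating a chain of
  colour \<open>j\<close> needs the auxiliary colour \<open>k\<close> to be tame at all lower
  levels. The simulating word has the prescribed moment, and the error has vacuum part 0.\<close>

lemma chain_fst:
  assumes two: "\<And>j. j \<in> K \<Longrightarrow> \<exists>k\<in>K. j \<noteq> k"
  shows "j \<in> K \<Longrightarrow> chain j n x x' \<Longrightarrow> fst x = fst x'"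
proof (induction n arbitrary: j x x' rule: less_induct)
  case (less n)
  obtain k where k: "k \<in> K" "j \<noteq> k" using two less.prems by blast
  have "tame k m" if "m < n" for m
    unfolding tame_def using less.IH[OF _ k(1)] that by (meson le_less_trans)
  from simulation[OF less.prems(1) k less.prems(2) this] obtain w u where
    w: "letters w" "run w (scal 1) = emb j x \<oplus>\<^bsub>F\<^esub> u" "u \<in> tspan (junk k n)" "x' = qv (prod_list (map snd w))"
    by blast
  have "fst u = 0" using tspan_fst[OF w(3) junk_ne] by simp
  then show ?case using run_E[OF w(1)] by (simp add: w(2,4) fst_add qv_def)
qed

end

lemma list_all2_snoc: "list_all2 R (xs @ [x]) (ys @ [y]) \<longleftrightarrow> list_all2 R xs ys \<and> R x y"
  by (cases "length xs = length ys") (auto simp: list_all2_append dest: list_all2_lengthD)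

lemma letter_cases [case_names left right]:
  obtains i a where "p = (Inl i, a)" | i a where "p = (Inr i, a)"
  by (cases p; cases "fst p") auto

section \<open>The induced relation between the two free products\<close>

context realization
begin

text \<open>The level may differ from leg to leg; it was a measure for the induction that is now
  complete.\<close>

definition legs_match :: "('k \<times> 'x) list \<Rightarrow> ('k \<times> 'a set) list \<Rightarrow> bool" where
  "legs_match ps ps' \<longleftrightarrow> tens ps \<and> Q.tens ps' \<and>
     list_all2 (\<lambda>p p'. fst p = fst p' \<and> (\<exists>N. ((0, snd p), (0, snd p')) \<in> rel (fst p) N)) ps ps'"

definition vrel :: "(('b, 'k, 'x) free_vec \<times> ('b, 'k, 'a set) free_vec) set" where
  "vrel = aspan (\<zero>\<^bsub>F\<^esub>, \<zero>\<^bsub>Q.F\<^esub>) (\<lambda>u v. (fst u \<oplus>\<^bsub>F\<^esub> fst v, snd u \<oplus>\<^bsub>Q.F\<^esub> snd v))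
     (range (\<lambda>c. (scal c, Q.scal c)) \<union> {(tvec ps, Q.tvec ps') | ps ps'. legs_match ps ps'})"

lemma vrel_scal: "(scal c, Q.scal c) \<in> vrel"
  unfolding vrel_def by (intro aspan.aspan_gen) blast

lemma vrel_tvec: "legs_match ps ps' \<Longrightarrow> (tvec ps, Q.tvec ps') \<in> vrel"
  unfolding vrel_def by (intro aspan.aspan_gen) blast

lemma vrel_add: "(x, x') \<in> vrel \<Longrightarrow> (y, y') \<in> vrel \<Longrightarrow> (x \<oplus>\<^bsub>F\<^esub> y, x' \<oplus>\<^bsub>Q.F\<^esub> y') \<in> vrel"
  unfolding vrel_def by (drule (1) aspan.aspan_add) (simp only: fst_conv snd_conv)

lemma vrel_induct:
  assumes p: "p \<in> vrel" and zero: "P (\<zero>\<^bsub>F\<^esub>, \<zero>\<^bsub>Q.F\<^esub>)" and scal: "\<And>c. P (scal c, Q.scal c)"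
    and tvec: "\<And>ps ps'. legs_match ps ps' \<Longrightarrow> P (tvec ps, Q.tvec ps')"
    and add: "\<And>u v. P u \<Longrightarrow> P v \<Longrightarrow> P (fst u \<oplus>\<^bsub>F\<^esub> fst v, snd u \<oplus>\<^bsub>Q.F\<^esub> snd v)"
  shows "P p"
proof (rule aspan_pred[OF p[unfolded vrel_def] zero _ add])
  fix g assume "g \<in> range (\<lambda>c. (scal c, Q.scal c)) \<union> {(tvec ps, Q.tvec ps') | ps ps'. legs_match ps ps'}"
  then show "P g" using scal tvec by blast
qed

lemma vrel_closed: "p \<in> vrel \<Longrightarrow> fst p \<in> carrier F \<and> snd p \<in> carrier Q.F"
  by (erule vrel_induct) (auto simp: scal_closed Q.scal_closed tvec_closed Q.tvec_closed legs_match_def)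

text \<open>Matched lists are empty together, and a tensor with legs has no vacuum part.\<close>

lemma vrel_fst: "p \<in> vrel \<Longrightarrow> fst (fst p) = fst (snd p)"
proof (erule vrel_induct)
  fix ps ps' assume "legs_match ps ps'"
  then show "fst (fst (tvec ps, Q.tvec ps')) = fst (snd (tvec ps, Q.tvec ps'))"
    by (cases ps; cases ps') (auto simp: legs_match_def fst_tvec Q.fst_tvec tvec_Nil Q.tvec_Nil)
qed (auto simp: fst_add Q.fst_add)

lemma legs_match_Cons: "legs_match ((k, x) # ps) ((k, x') # ps') \<longleftrightarrow>
    tens ((k, x) # ps) \<and> Q.tens ((k, x') # ps') \<and> (\<exists>N. ((0, x), (0, x')) \<in> rel k N) \<and> legs_match ps ps'"
  by (auto simp: legs_match_def tens_Cons Q.tens_Cons)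

lemma legs_match_snoc: "legs_match (ps @ [(k, x)]) (ps' @ [(k, x')]) \<longleftrightarrow>
    tens (ps @ [(k, x)]) \<and> Q.tens (ps' @ [(k, x')]) \<and> (\<exists>N. ((0, x), (0, x')) \<in> rel k N) \<and> legs_match ps ps'"
  by (auto simp: legs_match_def tens_snoc Q.tens_snoc list_all2_snoc)

lemma legs_match_fst: "legs_match ps ps' \<Longrightarrow> map fst ps = map fst ps'"
  unfolding legs_match_def by (auto simp: list_all2_conv_all_nth intro: nth_equalityI)

lemma legs_match_tens: "legs_match ps ps' \<Longrightarrow> tens ps" "legs_match ps ps' \<Longrightarrow> Q.tens ps'"
  by (simp_all add: legs_match_def)

lemma legs_match_ConsE:
  assumes "legs_match ps ps'" "ps \<noteq> []"
  obtains k x qs x' qs' where "ps = (k, x) # qs" "ps' = (k, x') # qs'" "k \<in> K"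
    "x \<in> carrier (X k)" "x' \<in> carrier quot"
proof -
  obtain k x qs where p: "ps = (k, x) # qs" using assms(2) by (cases ps) auto
  then obtain x' qs' where "ps' = (k, x') # qs'" using legs_match_fst[OF assms(1)] by (cases ps') auto
  with p show thesis using assms(1) by (intro that[of k x qs x' qs']) (auto simp: legs_match_Cons tens_Cons Q.tens_Cons)
qed

lemma legs_match_snocE:
  assumes "legs_match ps ps'" "ps \<noteq> []"
  obtains k x qs x' qs' where "ps = qs @ [(k, x)]" "ps' = qs' @ [(k, x')]" "k \<in> K"
    "x \<in> carrier (X k)" "x' \<in> carrier quot"
proof -
  obtain k x qs where p: "ps = qs @ [(k, x)]" using assms(2) by (cases ps rule: rev_cases) auto
  then obtain x' qs' where "ps' = qs' @ [(k, x')]" using legs_match_fst[OF assms(1)] by (cases ps' rule: rev_cases) auto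
  with p show thesis using assms(1) by (intro that[of qs k x qs' x']) (auto simp: legs_match_snoc tens_snoc Q.tens_snoc)
qed

lemma vrel_smult: "legs_match ps ps' \<Longrightarrow> (b \<odot>\<^bsub>F\<^esub> tvec ps, b \<odot>\<^bsub>Q.F\<^esub> Q.tvec ps') \<in> vrel"
proof (cases "ps = []")
  case True
  assume "legs_match ps ps'"
  then have "ps' = []" using True by (auto simp: legs_match_def)
  then show ?thesis using True vrel_scal by (simp add: smult_tvec_Nil Q.smult_tvec_Nil)
next
  case False
  assume m: "legs_match ps ps'"
  obtain k x qs x' qs' where p: "ps = (k, x) # qs" "ps' = (k, x') # qs'" and k: "k \<in> K"
    and x: "x \<in> carrier (X k)" "x' \<in> carrier quot"
    by (rule legs_match_ConsE[OF m False])
  obtain N where "((0, x), (0, x')) \<in> rel k N" using m p by (auto simp: legs_match_Cons)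
  from rel_smult[OF k this, of b] have "((0, b \<odot>\<^bsub>X k\<^esub> x), (0, b \<odot>\<^bsub>quot\<^esub> x')) \<in> rel k N" by simp
  then have "legs_match ((k, b \<odot>\<^bsub>X k\<^esub> x) # qs) ((k, b \<odot>\<^bsub>quot\<^esub> x') # qs')"
    using m k x unfolding p
    by (auto simp: legs_match_Cons tens_Cons Q.tens_Cons bimodule.smult_closed[OF bim] bimodule.smult_closed[OF quot_bimodule])
  then show ?thesis
    using vrel_tvec smult_tvec[of k x qs b] Q.smult_tvec[of k x' qs' b] legs_match_tens[OF m] by (simp add: p)
qed

lemma vrel_rsmult: "legs_match ps ps' \<Longrightarrow> (tvec ps \<lhd>\<^bsub>F\<^esub> b, Q.tvec ps' \<lhd>\<^bsub>Q.F\<^esub> b) \<in> vrel"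
proof (cases "ps = []")
  case True
  assume "legs_match ps ps'"
  then have "ps' = []" using True by (auto simp: legs_match_def)
  then show ?thesis using True vrel_scal by (simp add: rsmult_tvec_Nil Q.rsmult_tvec_Nil)
next
  case False
  assume m: "legs_match ps ps'"
  obtain k x qs x' qs' where p: "ps = qs @ [(k, x)]" "ps' = qs' @ [(k, x')]" and k: "k \<in> K"
    and x: "x \<in> carrier (X k)" "x' \<in> carrier quot"
    by (rule legs_match_snocE[OF m False])
  obtain N where "((0, x), (0, x')) \<in> rel k N" using m p by (auto simp: legs_match_snoc)
  from rel_rsmult[OF k this, of b] have "((0, x \<lhd>\<^bsub>X k\<^esub> b), (0, x' \<lhd>\<^bsub>quot\<^esub> b)) \<in> rel k N" by simp
  then have "legs_match (qs @ [(k, x \<lhd>\<^bsub>X k\<^esub> b)]) (qs' @ [(k, x' \<lhd>\<^bsub>quot\<^esub> b)])"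
    using m k x unfolding p
    by (auto simp: legs_match_snoc tens_snoc Q.tens_snoc bimodule.rsmult_closed[OF bim] bimodule.rsmult_closed[OF quot_bimodule])
  then show ?thesis
    using vrel_tvec rsmult_tvec[of qs k x b] Q.rsmult_tvec[of qs' k x' b] legs_match_tens[OF m] by (simp add: p)
qed

lemma vrel_emb:
  assumes k: "k \<in> K" and p: "((b, y), (b, y')) \<in> rel k N"
  shows "(emb k (b, y), Q.emb k (b, y')) \<in> vrel"
proof -
  have c: "y \<in> carrier (X k)" "y' \<in> carrier quot" using rel_closed[OF k p] by auto
  have "legs_match [(k, y)] [(k, y')]"
    using k c rel_vec[OF k p] by (auto simp: legs_match_def tens_Cons Q.tens_Cons)
  then show ?thesis
    using vrel_add[OF vrel_scal vrel_tvec] k c by (simp add: emb_tvec Q.emb_tvec)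
qed

text \<open>The vacuum parts produced on the two sides agree by \<open>chain_fst\<close>. They can
  be moved into the neighbouring leg because legs are related as bimodule elements, and the new or
  changed leg is covered by \<open>rel_left\<close>.\<close>

lemma vrel_left:
  assumes two: "\<And>j. j \<in> K \<Longrightarrow> \<exists>k\<in>K. j \<noteq> k"
    and k: "k \<in> K" and a: "a \<in> C k" and p: "(v, v') \<in> vrel"
  shows "(left_reg K X k (l k a) v, left_reg K (\<lambda>_. quot) k (lmul a) v') \<in> vrel"
proof -
  note la = l_ops[OF k a] and qa = lmul_C[OF k a]
  have fst: "fst x = fst x'" if "(x, x') \<in> rel k N" for x x' N
    using rel_fst[OF k that] chain_fst[OF two k] by blast
  \<comment> \<open>Membership in \<open>vrel\<close> is part of the induction predicate because the
    additive step needs both vectors to lie in the carriers.\<close>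
  have "(\<lambda>p. p \<in> vrel \<and> (left_reg K X k (l k a) (fst p), left_reg K (\<lambda>_. quot) k (lmul a) (snd p)) \<in> vrel) (v, v')"
  proof (rule vrel_induct[OF p])
    show "(\<zero>\<^bsub>F\<^esub>, \<zero>\<^bsub>Q.F\<^esub>) \<in> vrel \<and>
        (left_reg K X k (l k a) (fst (\<zero>\<^bsub>F\<^esub>, \<zero>\<^bsub>Q.F\<^esub>)), left_reg K (\<lambda>_. quot) k (lmul a) (snd (\<zero>\<^bsub>F\<^esub>, \<zero>\<^bsub>Q.F\<^esub>))) \<in> vrel"
      using vrel_scal[of 0] by (simp add: left_reg_zero[OF k la] Q.left_reg_zero[OF k qa] F_zero[symmetric] Q.F_zero[symmetric])
  next
    fix c
    obtain b y b' y' where y: "l k a (c, \<zero>\<^bsub>X k\<^esub>) = (b, y)" "lmul a (c, \<zero>\<^bsub>quot\<^esub>) = (b', y')" by force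
    have r: "((b, y), (b', y')) \<in> rel k (Suc 0)" using rel_left[OF k rel_scalar a, of c 0] by (simp add: y)
    then have "b' = b" using fst by force
    then show "(scal c, Q.scal c) \<in> vrel \<and> (left_reg K X k (l k a) (fst (scal c, Q.scal c)),
        left_reg K (\<lambda>_. quot) k (lmul a) (snd (scal c, Q.scal c))) \<in> vrel"
      using vrel_emb[OF k, of b y y'] r vrel_scal left_reg_emb[OF k la vacuum_closed[OF k], of c]
        Q.left_reg_emb[OF k qa Q.vacuum_closed[OF k], of c]
      by (simp add: emb_scalar[OF k] Q.emb_scalar[OF k] y)
  next
    fix ps ps' assume m: "legs_match ps ps'"
    note t = legs_match_tens[OF m]
    have "(left_reg K X k (l k a) (tvec ps), left_reg K (\<lambda>_. quot) k (lmul a) (Q.tvec ps')) \<in> vrel"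
    proof (cases "ps = [] \<or> fst (hd ps) \<noteq> k")
      case True
      then have True': "ps' = [] \<or> fst (hd ps') \<noteq> k" using legs_match_fst[OF m] by (cases ps; cases ps') auto
      obtain b y b' y' where y: "l k a (1, \<zero>\<^bsub>X k\<^esub>) = (b, y)" "lmul a (1, \<zero>\<^bsub>quot\<^esub>) = (b', y')" by force
      have r: "((b, y), (b', y')) \<in> rel k (Suc 0)" using rel_left[OF k rel_scalar a, of 1 0] by (simp add: y)
      then have b: "b' = b" using fst by force
      have "legs_match ((k, y) # ps) ((k, y') # ps')"
        using m t k rel_closed[OF k r] True True' rel_vec[OF k r[unfolded b]]
        by (auto simp: legs_match_Cons tens_Cons Q.tens_Cons)
      then show ?thesis
        unfolding left_tvec_new[OF k la t(1) True y(1)] Q.left_tvec_new[OF k qa t(2) True' y(2)] b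
        by (intro vrel_add vrel_smult m vrel_tvec)
    next
      case False
      then have ne: "ps \<noteq> []" by simp
      obtain x qs x' qs' where p: "ps = (k, x) # qs" "ps' = (k, x') # qs'"
        using legs_match_ConsE[OF m ne] False by (metis fst_conv list.sel(1))
      have mq: "legs_match qs qs'" using m p by (simp add: legs_match_Cons)
      obtain N where N: "((0, x), (0, x')) \<in> rel k N" using m p by (auto simp: legs_match_Cons)
      obtain b y b' y' where y: "l k a (0, x) = (b, y)" "lmul a (0, x') = (b', y')" by force
      have r: "((b, y), (b', y')) \<in> rel k (Suc N)" using rel_left[OF k N a] by (simp add: y)
      then have b: "b' = b" using fst by force
      have "legs_match ((k, y) # qs) ((k, y') # qs')"
        using m t k rel_closed[OF k r] rel_vec[OF k r[unfolded b]] unfolding p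
        by (auto simp: legs_match_Cons tens_Cons Q.tens_Cons)
      then show ?thesis
        unfolding p left_tvec_old[OF k la t(1)[unfolded p] y(1)] Q.left_tvec_old[OF k qa t(2)[unfolded p] y(2)] b
        by (intro vrel_add vrel_smult mq vrel_tvec)
    qed
    then show "(tvec ps, Q.tvec ps') \<in> vrel \<and> (left_reg K X k (l k a) (fst (tvec ps, Q.tvec ps')),
        left_reg K (\<lambda>_. quot) k (lmul a) (snd (tvec ps, Q.tvec ps'))) \<in> vrel"
      using vrel_tvec[OF m] by simp
  next
    fix u v assume u: "u \<in> vrel \<and> (left_reg K X k (l k a) (fst u), left_reg K (\<lambda>_. quot) k (lmul a) (snd u)) \<in> vrel"
      and v: "v \<in> vrel \<and> (left_reg K X k (l k a) (fst v), left_reg K (\<lambda>_. quot) k (lmul a) (snd v)) \<in> vrel"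
    then show "(fst u \<oplus>\<^bsub>F\<^esub> fst v, snd u \<oplus>\<^bsub>Q.F\<^esub> snd v) \<in> vrel \<and>
       (left_reg K X k (l k a) (fst (fst u \<oplus>\<^bsub>F\<^esub> fst v, snd u \<oplus>\<^bsub>Q.F\<^esub> snd v)),
        left_reg K (\<lambda>_. quot) k (lmul a) (snd (fst u \<oplus>\<^bsub>F\<^esub> fst v, snd u \<oplus>\<^bsub>Q.F\<^esub> snd v))) \<in> vrel"
      using vrel_closed[of u] vrel_closed[of v]
      by (simp add: left_reg_add[OF k la] Q.left_reg_add[OF k qa] vrel_add)
  qed
  then show ?thesis by simp
qed

lemma vrel_right:
  assumes two: "\<And>j. j \<in> K \<Longrightarrow> \<exists>k\<in>K. j \<noteq> k"
    and k: "k \<in> K" and a: "a \<in> D k" and p: "(v, v') \<in> vrel"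
  shows "(right_reg K X k (r k a) v, right_reg K (\<lambda>_. quot) k (lmul a) v') \<in> vrel"
proof -
  note la = r_ops[OF k a] and qa = lmul_D[OF k a]
  have fst: "fst x = fst x'" if "(x, x') \<in> rel k N" for x x' N
    using rel_fst[OF k that] chain_fst[OF two k] by blast
  have "(\<lambda>p. p \<in> vrel \<and> (right_reg K X k (r k a) (fst p), right_reg K (\<lambda>_. quot) k (lmul a) (snd p)) \<in> vrel) (v, v')"
  proof (rule vrel_induct[OF p])
    show "(\<zero>\<^bsub>F\<^esub>, \<zero>\<^bsub>Q.F\<^esub>) \<in> vrel \<and>
        (right_reg K X k (r k a) (fst (\<zero>\<^bsub>F\<^esub>, \<zero>\<^bsub>Q.F\<^esub>)), right_reg K (\<lambda>_. quot) k (lmul a) (snd (\<zero>\<^bsub>F\<^esub>, \<zero>\<^bsub>Q.F\<^esub>))) \<in> vrel"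
      using vrel_scal[of 0] by (simp add: right_reg_zero[OF k la] Q.right_reg_zero[OF k qa] F_zero[symmetric] Q.F_zero[symmetric])
  next
    fix c
    obtain b y b' y' where y: "r k a (c, \<zero>\<^bsub>X k\<^esub>) = (b, y)" "lmul a (c, \<zero>\<^bsub>quot\<^esub>) = (b', y')" by force
    have r: "((b, y), (b', y')) \<in> rel k (Suc 0)" using rel_right[OF k rel_scalar a, of c 0] by (simp add: y)
    then have "b' = b" using fst by force
    then show "(scal c, Q.scal c) \<in> vrel \<and> (right_reg K X k (r k a) (fst (scal c, Q.scal c)),
        right_reg K (\<lambda>_. quot) k (lmul a) (snd (scal c, Q.scal c))) \<in> vrel"
      using vrel_emb[OF k, of b y y'] r vrel_scal right_reg_emb[OF k la vacuum_closed[OF k], of c]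
        Q.right_reg_emb[OF k qa Q.vacuum_closed[OF k], of c]
      by (simp add: emb_scalar[OF k] Q.emb_scalar[OF k] y)
  next
    fix ps ps' assume m: "legs_match ps ps'"
    note t = legs_match_tens[OF m]
    have "(right_reg K X k (r k a) (tvec ps), right_reg K (\<lambda>_. quot) k (lmul a) (Q.tvec ps')) \<in> vrel"
    proof (cases "ps = [] \<or> fst (last ps) \<noteq> k")
      case True
      then have True': "ps' = [] \<or> fst (last ps') \<noteq> k"
        using legs_match_fst[OF m] by (cases ps rule: rev_cases; cases ps' rule: rev_cases) auto
      obtain b y b' y' where y: "r k a (1, \<zero>\<^bsub>X k\<^esub>) = (b, y)" "lmul a (1, \<zero>\<^bsub>quot\<^esub>) = (b', y')" by force
      have r: "((b, y), (b', y')) \<in> rel k (Suc 0)" using rel_right[OF k rel_scalar a, of 1 0] by (simp add: y)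
      then have b: "b' = b" using fst by force
      have "legs_match (ps @ [(k, y)]) (ps' @ [(k, y')])"
        using m t k rel_closed[OF k r] True True' rel_vec[OF k r[unfolded b]]
        by (auto simp: legs_match_snoc tens_snoc Q.tens_snoc)
      then show ?thesis
        unfolding right_tvec_new[OF k la t(1) True y(1)] Q.right_tvec_new[OF k qa t(2) True' y(2)] b
        by (intro vrel_add vrel_rsmult m vrel_tvec)
    next
      case False
      then have ne: "ps \<noteq> []" by simp
      obtain x qs x' qs' where p: "ps = qs @ [(k, x)]" "ps' = qs' @ [(k, x')]"
        using legs_match_snocE[OF m ne] False by (metis fst_conv last_snoc)
      have mq: "legs_match qs qs'" using m p by (simp add: legs_match_snoc)
      obtain N where N: "((0, x), (0, x')) \<in> rel k N" using m p by (auto simp: legs_match_snoc)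
      obtain b y b' y' where y: "r k a (0, x) = (b, y)" "lmul a (0, x') = (b', y')" by force
      have r: "((b, y), (b', y')) \<in> rel k (Suc N)" using rel_right[OF k N a] by (simp add: y)
      then have b: "b' = b" using fst by force
      have "legs_match (qs @ [(k, y)]) (qs' @ [(k, y')])"
        using m t k rel_closed[OF k r] rel_vec[OF k r[unfolded b]] unfolding p
        by (auto simp: legs_match_snoc tens_snoc Q.tens_snoc)
      then show ?thesis
        unfolding p right_tvec_old[OF k la t(1)[unfolded p] y(1)] Q.right_tvec_old[OF k qa t(2)[unfolded p] y(2)] b
        by (intro vrel_add vrel_rsmult mq vrel_tvec)
    qed
    then show "(tvec ps, Q.tvec ps') \<in> vrel \<and> (right_reg K X k (r k a) (fst (tvec ps, Q.tvec ps')),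
        right_reg K (\<lambda>_. quot) k (lmul a) (snd (tvec ps, Q.tvec ps'))) \<in> vrel"
      using vrel_tvec[OF m] by simp
  next
    fix u v assume u: "u \<in> vrel \<and> (right_reg K X k (r k a) (fst u), right_reg K (\<lambda>_. quot) k (lmul a) (snd u)) \<in> vrel"
      and v: "v \<in> vrel \<and> (right_reg K X k (r k a) (fst v), right_reg K (\<lambda>_. quot) k (lmul a) (snd v)) \<in> vrel"
    then show "(fst u \<oplus>\<^bsub>F\<^esub> fst v, snd u \<oplus>\<^bsub>Q.F\<^esub> snd v) \<in> vrel \<and>
       (right_reg K X k (r k a) (fst (fst u \<oplus>\<^bsub>F\<^esub> fst v, snd u \<oplus>\<^bsub>Q.F\<^esub> snd v)),
        right_reg K (\<lambda>_. quot) k (lmul a) (snd (fst u \<oplus>\<^bsub>F\<^esub> fst v, snd u \<oplus>\<^bsub>Q.F\<^esub> snd v))) \<in> vrel"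
      using vrel_closed[of u] vrel_closed[of v]
      by (simp add: right_reg_add[OF k la] Q.right_reg_add[OF k qa] vrel_add)
  qed
  then show ?thesis by simp
qed

theorem qrun_E:
  assumes w: "letters w"
  shows "E (prod_list (map snd w)) = fst (qrun w (Q.scal 1))"
proof (cases "\<exists>k. K = {k}")
  case True
  then obtain k where K: "K = {k}" by blast
  have only: "i = k" if "i \<in> K" for i using K that by auto
  have k: "k \<in> K" using K by blast
  \<comment> \<open>With a single colour there is no auxiliary one, but every vector then lies in
    the image of \<open>emb k\<close>, where letters act by left multiplication in the algebra, and
    the claim follows from the definition of \<open>qv\<close>.\<close>
  have "qrun w (Q.scal 1) = Q.emb k (qv (prod_list (map snd w)))"
    using w
  proof (induction w)
    case Nil
    show ?case using Q.emb_scalar[OF k, of 1] by (simp add: qv_one)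
  next
    case (Cons p w)
    show ?case
    proof (cases p rule: letter_cases)
      case p: (left i a)
      then have "a \<in> C k" "i = k" "letters w" using Cons.prems only[of i] by auto
      then show ?thesis
        using Cons.IH p Q.left_reg_emb[OF k lmul_C[OF k] qv_closed] by (simp add: lmul_qv)
    next
      case p: (right i a)
      then have "a \<in> D k" "i = k" "letters w" using Cons.prems only[of i] by auto
      then show ?thesis
        using Cons.IH p Q.right_reg_emb[OF k lmul_D[OF k] qv_closed] by (simp add: lmul_qv)
    qed
  qed
  then show ?thesis by (simp add: qv_def)
next
  case False
  have two: "\<exists>k\<in>K. j \<noteq> k" if j: "j \<in> K" for j
  proof (rule ccontr)
    assume n: "\<not> (\<exists>k\<in>K. j \<noteq> k)"
    have "K = {j}"
    proof (intro equalityI subsetI)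
      fix x assume "x \<in> K"
      with n have "j = x" by (rule_tac ccontr) (erule notE, erule bexI[rotated])
      then show "x \<in> {j}" by simp
    next
      fix x assume "x \<in> {j}"
      then show "x \<in> K" using j by (simp only: singleton_iff)
    qed
    then have "\<exists>k. K = {k}" by (rule exI)
    with False show False by (rule notE)
  qed
  have "(run w (scal 1), qrun w (Q.scal 1)) \<in> vrel"
    using w
  proof (induction w)
    case Nil
    then show ?case using vrel_scal by simp
  next
    case (Cons p w)
    show ?case
    proof (cases p rule: letter_cases)
      case p: (left i a)
      then have "i \<in> K" "a \<in> C i" "letters w" using Cons.prems by (simp_all add: p)
      then show ?thesis unfolding p run_simps qrun_simps by (intro vrel_left two Cons.IH)
    next
      case p: (right i a)
      then have "i \<in> K" "a \<in> D i" "letters w" using Cons.prems by (simp_all add: p)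
      then show ?thesis unfolding p run_simps qrun_simps by (intro vrel_right two Cons.IH)
    qed
  qed
  from vrel_fst[OF this] show ?thesis using run_E[OF w] by simp
qed

end


section \<open>Excess legs and Boolean operators\<close>

lemma subalg_alg: "subalg (alg S)"
  unfolding alg_def
proof (rule hull_in)
  show "subalg (\<Inter>Z)" if "\<forall>x\<in>Z. subalg x" for Z :: "'a set set"
    using that unfolding subalg_def by blast
qed

lemma alg_superset: "S \<subseteq> alg S"
  unfolding alg_def by (rule hull_subset)

lemma alg_minimal: "S \<subseteq> Z \<Longrightarrow> subalg Z \<Longrightarrow> alg S \<subseteq> Z"
  unfolding alg_def by (rule hull_minimal)

context free_prod
begin

abbreviation "bproj k \<equiv> boolean_proj K X k"

lemma bproj_add: "u \<in> carrier F \<Longrightarrow> v \<in> carrier F \<Longrightarrow> bproj k (u \<oplus>\<^bsub>F\<^esub> v) = bproj k u \<oplus>\<^bsub>F\<^esub> bproj k v"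
  by (cases u; cases v) (auto simp: boolean_proj_def F_add fun_eq_iff T_zero_add T_zero_closed)

lemma bproj_scal: "bproj k (scal c) = scal c"
  by (auto simp: boolean_proj_def free_scalar_def fun_eq_iff)

lemma bproj_pure: "bproj k (pure ks xs) = (if ks = [k] then pure ks xs else \<zero>\<^bsub>F\<^esub>)"
  by (auto simp: boolean_proj_def free_pure_def F_zero free_scalar_def fun_eq_iff)

lemma bproj_emb: "k \<in> K \<Longrightarrow> x \<in> carrier (with_B (X k)) \<Longrightarrow> bproj k (emb k x) = emb k x"
  by (cases x) (simp add: emb_def bproj_add scal_closed pure_closed word1 bproj_scal bproj_pure)

lemma bproj_tvec: "ps \<noteq> [] \<Longrightarrow> bproj k (tvec ps) = (if map fst ps = [k] then tvec ps else \<zero>\<^bsub>F\<^esub>)"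
  by (simp add: tvec_def bproj_pure)

lemma bproj_zero: "bproj k \<zero>\<^bsub>F\<^esub> = \<zero>\<^bsub>F\<^esub>"
  by (simp add: F_zero bproj_scal)

lemma emb_add: "k \<in> K \<Longrightarrow> x \<in> carrier (with_B (X k)) \<Longrightarrow> y \<in> carrier (with_B (X k)) \<Longrightarrow>
    emb k (x \<oplus>\<^bsub>with_B (X k)\<^esub> y) = emb k x \<oplus>\<^bsub>F\<^esub> emb k y"
  by (cases x; cases y) (simp add: emb_def scal_add pure_add_Cons word1 scal_closed pure_closed F.a_ac)

end

text \<open>Here \<open>C k\<close> and \<open>D k\<close> are the full bi-free faces, that is, the
  algebras generated by the pair \<open>Al k\<close>, \<open>Ar k\<close> together with the ambient
  subalgebras of the system.\<close>

locale ffb_system = realization E \<epsilon> K X C D l r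
  for E :: "'a::complex_algebra_1 \<Rightarrow> 'b::complex_algebra_1" and \<epsilon> :: "('b, 'a) bbop_map"
    and K :: "'k set" and X :: "'k \<Rightarrow> ('b, 'x) bimodule"
    and C D :: "'k \<Rightarrow> 'a set" and l r :: "'k \<Rightarrow> 'a \<Rightarrow> 'b \<times> 'x \<Rightarrow> 'b \<times> 'x" +
  fixes Al Ar C' D' :: "'k \<Rightarrow> 'a set"
  assumes sub_face: "k \<in> K \<Longrightarrow> face_pair \<epsilon> (Al k) (Ar k)"
    and Al_C: "k \<in> K \<Longrightarrow> Al k \<subseteq> C k" and Ar_D: "k \<in> K \<Longrightarrow> Ar k \<subseteq> D k"
    and C'_C: "k \<in> K \<Longrightarrow> C' k \<subseteq> C k" and D'_D: "k \<in> K \<Longrightarrow> D' k \<subseteq> D k"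
    and D'_left: "k \<in> K \<Longrightarrow> D' k \<subseteq> left_alg \<epsilon>"
    and C'_null: "k \<in> K \<Longrightarrow> c \<in> C' k \<Longrightarrow> a \<in> alg (Al k \<union> Ar k) \<Longrightarrow> c' \<in> C' k \<Longrightarrow> c * a * c' = 0"
    and excess_null: "k \<in> K \<Longrightarrow> Z \<in> alg (Al k \<union> Ar k) * C' k * alg (Al k \<union> Ar k) *
      (D' k * alg (Al k \<union> Ar k) * C' k) ^ n * alg (Al k \<union> Ar k) \<Longrightarrow> E Z = 0"
begin

abbreviation "AA k \<equiv> alg (Al k \<union> Ar k)"

lemma AA_closed:
  assumes k: "k \<in> K"
  shows AA_add: "S \<in> AA k \<Longrightarrow> Z \<in> AA k \<Longrightarrow> S + Z \<in> AA k"
    and AA_mult: "S \<in> AA k \<Longrightarrow> Z \<in> AA k \<Longrightarrow> S * Z \<in> AA k"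
    and AA_L: "L b \<in> AA k" and AA_R: "R b \<in> AA k" and AA_one: "1 \<in> AA k"
    and AA_Al: "a \<in> Al k \<Longrightarrow> a \<in> AA k" and AA_Ar: "a \<in> Ar k \<Longrightarrow> a \<in> AA k"
proof -
  have s: "subalg (AA k)" by (rule subalg_alg)
  have l: "Al k \<subseteq> AA k" and r: "Ar k \<subseteq> AA k"
    using alg_superset[of "Al k \<union> Ar k"] by simp_all
  have f: "1 \<in> Al k" "range L \<subseteq> Al k" "range R \<subseteq> Ar k"
    using sub_face[OF k] by (simp_all add: face_pair_def)
  show "S \<in> AA k \<Longrightarrow> Z \<in> AA k \<Longrightarrow> S + Z \<in> AA k" "S \<in> AA k \<Longrightarrow> Z \<in> AA k \<Longrightarrow> S * Z \<in> AA k"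
    using s by (simp_all add: subalg_def)
  show "a \<in> Al k \<Longrightarrow> a \<in> AA k" by (rule subsetD[OF l])
  show "a \<in> Ar k \<Longrightarrow> a \<in> AA k" by (rule subsetD[OF r])
  show "1 \<in> AA k" using f(1) l by (rule subsetD[rotated])
  show "L b \<in> AA k" by (rule subsetD[OF l], rule subsetD[OF f(2)], rule rangeI)
  show "R b \<in> AA k" by (rule subsetD[OF r], rule subsetD[OF f(3)], rule rangeI)
qed

text \<open>Up to factors from \<open>AA\<close>, sums of words in which letters of
  \<open>C'\<close> and \<open>D'\<close> alternate and both outermost ones are from
  \<open>C'\<close>: one letter of \<open>C'\<close> has no partner. No factor stands between a
  \<open>c\<close> and the \<open>d\<close> that follows it, as in the pairs
  \<open>c * d\<close>.\<close>

definition excess :: "'k \<Rightarrow> 'a set" where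
  "excess k = aspan 0 (+) {a * (c * (t * a')) | a c t a' n. a \<in> AA k \<and> c \<in> C' k \<and>
     t \<in> (D' k * AA k * C' k) ^ n \<and> a' \<in> AA k}"

lemma excess_gen: "a \<in> AA k \<Longrightarrow> c \<in> C' k \<Longrightarrow> t \<in> (D' k * AA k * C' k) ^ n \<Longrightarrow> a' \<in> AA k \<Longrightarrow>
    a * (c * (t * a')) \<in> excess k"
  unfolding excess_def by (rule aspan.aspan_gen) blast

lemma excess_zero: "0 \<in> excess k"
  unfolding excess_def by (rule aspan.aspan_zero)

lemma excess_induct:
  assumes "Z \<in> excess k" "P 0" "\<And>S Z. P S \<Longrightarrow> P Z \<Longrightarrow> P (S + Z)"
    and "\<And>a c t a' n. a \<in> AA k \<Longrightarrow> c \<in> C' k \<Longrightarrow> t \<in> (D' k * AA k * C' k) ^ n \<Longrightarrow> a' \<in> AA k \<Longrightarrow> P (a * (c * (t * a')))"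
  shows "P Z"
proof (rule aspan_pred[OF assms(1)[unfolded excess_def] assms(2) _ assms(3)])
  fix g assume "g \<in> {a * (c * (t * a')) | a c t a' n. a \<in> AA k \<and> c \<in> C' k \<and>
     t \<in> (D' k * AA k * C' k) ^ n \<and> a' \<in> AA k}"
  then show "P g" using assms(4) by blast
qed

lemma excess_add: "S \<in> excess k \<Longrightarrow> Z \<in> excess k \<Longrightarrow> S + Z \<in> excess k"
  unfolding excess_def by (rule aspan.aspan_add)

lemma excess_E: "k \<in> K \<Longrightarrow> Z \<in> excess k \<Longrightarrow> E Z = 0"
proof (erule excess_induct)
  fix a c t a' n assume k: "k \<in> K" and *: "a \<in> AA k" "c \<in> C' k" "t \<in> (D' k * AA k * C' k) ^ n" "a' \<in> AA k"
  \<comment> \<open>The factor from \<open>AA\<close> that the hypothesis has between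
    \<open>c\<close> and the power is taken to be 1.\<close>
  have "a * c * 1 * t * a' \<in> AA k * C' k * AA k * (D' k * AA k * C' k) ^ n * AA k"
    using * AA_one[OF k] by (intro set_times_intro)
  from excess_null[OF k this] show "E (a * (c * (t * a'))) = 0" by (simp add: mult.assoc)
qed (auto simp: E.add E.zero)

lemma excess_AA: "k \<in> K \<Longrightarrow> Z \<in> excess k \<Longrightarrow> a \<in> AA k \<Longrightarrow> a * Z \<in> excess k"
proof (erule excess_induct)
  fix b c t a' n assume "k \<in> K" "a \<in> AA k" "b \<in> AA k" "c \<in> C' k" "t \<in> (D' k * AA k * C' k) ^ n" "a' \<in> AA k"
  then show "a * (b * (c * (t * a'))) \<in> excess k"
    using excess_gen[of "a * b" k c t n a'] by (simp add: AA_mult mult.assoc)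
qed (auto simp: distrib_left excess_zero excess_add)

text \<open>The pair prolongs the alternation: \<open>d * a * c'\<close> becomes a further factor of
  the power, and \<open>c\<close> is the new leading letter.\<close>

lemma excess_pair:
  assumes k: "k \<in> K" and Z: "Z \<in> excess k" and c: "c \<in> C' k" and d: "d \<in> D' k"
  shows "c * (d * Z) \<in> excess k"
  using Z
proof (rule excess_induct)
  fix a c' t a' n assume *: "a \<in> AA k" "c' \<in> C' k" "t \<in> (D' k * AA k * C' k) ^ n" "a' \<in> AA k"
  have "d * a * c' * t \<in> (D' k * AA k * C' k) ^ Suc n"
    unfolding power_Suc using d * by (intro set_times_intro)
  from excess_gen[OF AA_one[OF k] c this *(4)]
  show "c * (d * (a * (c' * (t * a')))) \<in> excess k" by (simp add: mult.assoc)
qed (auto simp: distrib_left excess_zero excess_add)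

text \<open>Two letters of \<open>C'\<close> meet with only an element of \<open>AA\<close> between
  them.\<close>

lemma excess_null_left:
  assumes k: "k \<in> K" and Z: "Z \<in> excess k" and c: "c \<in> C' k"
  shows "c * Z = 0"
  using Z
proof (rule excess_induct)
  fix a c' t a' n assume *: "a \<in> AA k" "c' \<in> C' k"
  show "c * (a * (c' * (t * a'))) = 0"
    using C'_null[OF k c *] by (metis mult.assoc mult_zero_left)
qed (auto simp: distrib_left)

lemma excess_C': "k \<in> K \<Longrightarrow> c \<in> C' k \<Longrightarrow> a \<in> AA k \<Longrightarrow> c * a \<in> excess k"
  using excess_gen[of 1 k c 1 0 a] AA_one[of k] by simp

text \<open>The elements that arise when letters of \<open>AA\<close> and complete pairs
  \<open>c * d\<close> act on the vacuum.\<close>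

inductive_set good :: "'k \<Rightarrow> 'a set" for k where
  good_AA: "a \<in> AA k \<Longrightarrow> a \<in> good k"
| good_mult: "a \<in> AA k \<Longrightarrow> Z \<in> good k \<Longrightarrow> a * Z \<in> good k"
| good_pair: "c \<in> C' k \<Longrightarrow> d \<in> D' k \<Longrightarrow> Z \<in> good k \<Longrightarrow> c * d * Z \<in> good k"
| good_add: "S \<in> good k \<Longrightarrow> Z \<in> good k \<Longrightarrow> S + Z \<in> good k"

text \<open>Reading from the left, \<open>c\<close> either meets only elements of \<open>AA\<close>
  and remains without partner, or it meets the \<open>c'\<close> of a pair and the product is 0. The
  factor \<open>a\<close> collects the elements of \<open>AA\<close> passed on the way.\<close>

lemma good_C': 
  assumes k: "k \<in> K" and Z: "Z \<in> good k" and c: "c \<in> C' k"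
  shows "a \<in> AA k \<Longrightarrow> c * (a * Z) \<in> excess k"
  using Z
proof (induction arbitrary: a)
  case (good_AA a')
  then show ?case using excess_C'[OF k c] AA_mult[OF k] by simp
next
  case (good_mult a' Z)
  then show ?case using AA_mult[OF k, of a a'] by (metis mult.assoc)
next
  case (good_pair c' d Z)
  have "c * a * c' = 0" by (rule C'_null[OF k c good_pair.prems good_pair.hyps(1)])
  then have "c * (a * (c' * d * Z)) = 0" by (metis mult.assoc mult_zero_left)
  then show ?case by (simp add: excess_zero)
next
  case (good_add S Z)
  then show ?case by (simp add: distrib_left excess_add)
qed

text \<open>A leg of excess type with only legs from \<open>AA\<close> to its left is never removed by the operators
  below, so \<open>bad\<close> vectors do not return to the vacuum.\<close>

definition legs :: "'a set \<Rightarrow> 'a set set" where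
  "legs S = wcls ` {Z \<in> S. E Z = 0}"

text \<open>The property that lets a letter of \<open>C'\<close> turn a first leg into an excess
  leg. It is common to \<open>AA\<close>, \<open>excess\<close> and \<open>good\<close>.\<close>

definition lead :: "'k \<Rightarrow> 'a set" where
  "lead k = {Z. \<forall>c\<in>C' k. c * Z \<in> excess k}"

definition bad :: "('k \<times> 'a set) list set" where
  "bad = {ps. Q.tens ps \<and> (\<exists>us i x vs. ps = us @ (i, x) # vs \<and> x \<in> legs (excess i) \<and>
     (\<forall>(j, y)\<in>set us. y \<in> legs (AA j)))}"

text \<open>A condition on the first leg alone, so that right operators acting at the other end
  preserve it; it bridges the moment between the letters \<open>d\<close> and \<open>c\<close> of a
  pair.\<close>

definition leading :: "('k \<times> 'a set) list set" where
  "leading = {ps. Q.tens ps \<and> ps \<noteq> [] \<and> snd (hd ps) \<in> legs (lead (fst (hd ps)))}"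

definition gvec :: "('k \<times> 'a set) list set" where
  "gvec = {ps. Q.tens ps \<and> (\<forall>(j, y)\<in>set ps. y \<in> legs (good j))}"

lemma legs_mono: "S \<subseteq> Z \<Longrightarrow> legs S \<subseteq> legs Z"
  by (auto simp: legs_def)

lemma legs_carrier: "x \<in> legs S \<Longrightarrow> x \<in> carrier quot"
  by (auto simp: legs_def quot_simps)

lemma legsE: "x \<in> legs S \<Longrightarrow> (\<And>Z. x = wcls Z \<Longrightarrow> Z \<in> S \<Longrightarrow> E Z = 0 \<Longrightarrow> P) \<Longrightarrow> P"
  by (auto simp: legs_def)

lemma excess_lead: "k \<in> K \<Longrightarrow> excess k \<subseteq> lead k"
  by (auto simp: lead_def excess_null_left excess_zero)

lemma AA_lead: "k \<in> K \<Longrightarrow> AA k \<subseteq> lead k"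
  by (auto simp: lead_def excess_C')

lemma good_lead: "k \<in> K \<Longrightarrow> good k \<subseteq> lead k"
  using good_C'[OF _ _ _ AA_one] by (auto simp: lead_def)

text \<open>\<open>c\<close> lies in \<open>left_alg \<epsilon>\<close> and so commutes with
  \<open>R b\<close>. This covers tensors with one leg, where the right action of \<open>B\<close>
  reaches the first leg.\<close>

lemma lead_R: "k \<in> K \<Longrightarrow> Z \<in> lead k \<Longrightarrow> R b * Z \<in> lead k"
proof -
  assume k: "k \<in> K" and Z: "Z \<in> lead k"
  have "c * (R b * Z) \<in> excess k" if c: "c \<in> C' k" for c
  proof -
    have "c \<in> left_alg \<epsilon>" using C'_C[OF k] c face[OF k] by (auto simp: face_pair_def)
    then have "c * (R b * Z) = R b * (c * Z)" by (simp add: left_alg_def flip: mult.assoc)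
    then show ?thesis using Z c excess_AA[OF k _ AA_R[OF k]] by (simp add: lead_def)
  qed
  then show ?thesis by (simp add: lead_def)
qed

lemma legs_smult: "x \<in> legs S \<Longrightarrow> (\<And>Z. Z \<in> S \<Longrightarrow> L b * Z \<in> S) \<Longrightarrow> b \<odot>\<^bsub>quot\<^esub> x \<in> legs S"
  by (elim legsE) (auto simp: quot_simps legs_def E_L)

lemma legs_rsmult: "x \<in> legs S \<Longrightarrow> (\<And>Z. Z \<in> S \<Longrightarrow> R b * Z \<in> S) \<Longrightarrow> x \<lhd>\<^bsub>quot\<^esub> b \<in> legs S"
  by (elim legsE) (auto simp: quot_simps legs_def E_R)

lemma lmul_leg: "E Z = 0 \<Longrightarrow> lmul a (0, wcls Z) = qv (a * Z)"
  using lmul_qv[of a Z] by (simp add: qv_zero_part)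

lemma lmul_vac: "lmul a (1, \<zero>\<^bsub>quot\<^esub>) = qv a"
  using lmul_qv[of a 1] by (simp add: qv_one)

text \<open>Subtracting the vacuum part does not leave \<open>S\<close>, which contains every
  \<open>L b\<close>; the sign is absorbed into the argument of \<open>L\<close>, as
  \<open>S\<close> is closed under sums only.\<close>

lemma qv_legs:
  assumes "Z \<in> S" "\<And>b. L b \<in> S" "\<And>U V. U \<in> S \<Longrightarrow> V \<in> S \<Longrightarrow> U + V \<in> S" "qv Z = (b, y)"
  shows "y \<in> legs S"
proof -
  have "L (- E Z) = - L (E Z)"
    using L_add[of "E Z" "- E Z"] by (simp add: add_eq_0_iff)
  then have "Z - L (E Z) = Z + L (- E Z)" by simp
  then have "Z - L (E Z) \<in> S" using assms by metis
  moreover have "E (Z - L (E Z)) = 0" by (simp add: E.diff E_Lb)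
  ultimately show ?thesis using assms(4) by (auto simp: qv_def legs_def)
qed

text \<open>An excess element has expectation 0, so nothing has to be subtracted and the leg is its
  class itself. The set \<open>excess k\<close> need not contain \<open>L b\<close>, which is why
  \<open>qv_legs\<close> is no substitute.\<close>

lemma qv_excess: "k \<in> K \<Longrightarrow> Z \<in> excess k \<Longrightarrow> qv Z = (b, y) \<Longrightarrow> b = 0 \<and> y \<in> legs (excess k)"
  using excess_E[of k Z] by (auto simp: qv_zero_part legs_def)

section \<open>Persistence of excess legs\<close>

lemma bad_tens: "ps \<in> bad \<Longrightarrow> Q.tens ps" and leading_tens: "ps \<in> leading \<Longrightarrow> Q.tens ps"
  and gvec_tens: "ps \<in> gvec \<Longrightarrow> Q.tens ps"
  by (auto simp: bad_def leading_def gvec_def)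

lemma bad_Cons_excess: "Q.tens ((k, x) # ps) \<Longrightarrow> x \<in> legs (excess k) \<Longrightarrow> (k, x) # ps \<in> bad"
  unfolding bad_def by (intro CollectI conjI exI[of _ "[]"] exI) auto

lemma bad_Cons_AA: "Q.tens ((k, x) # ps) \<Longrightarrow> x \<in> legs (AA k) \<Longrightarrow> ps \<in> bad \<Longrightarrow> (k, x) # ps \<in> bad"
proof -
  assume t: "Q.tens ((k, x) # ps)" "x \<in> legs (AA k)" "ps \<in> bad"
  then obtain us i y vs where "ps = us @ (i, y) # vs" "y \<in> legs (excess i)" "\<forall>(j, y)\<in>set us. y \<in> legs (AA j)"
    by (auto simp: bad_def)
  then show ?thesis
    using t unfolding bad_def by (intro CollectI conjI exI[of _ "(k, x) # us"] exI[of _ i] exI[of _ y] exI[of _ vs]) auto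
qed

lemma bad_ConsD: "(k, x) # ps \<in> bad \<Longrightarrow> x \<in> legs (excess k) \<or> (x \<in> legs (AA k) \<and> ps \<in> bad)"
proof -
  assume t: "(k, x) # ps \<in> bad"
  then obtain us i y vs where *: "(k, x) # ps = us @ (i, y) # vs" "y \<in> legs (excess i)" "\<forall>(j, y)\<in>set us. y \<in> legs (AA j)"
    by (auto simp: bad_def)
  show ?thesis
  proof (cases us)
    case Nil
    then show ?thesis using * by simp
  next
    case (Cons u us')
    have "Q.tens ps" using bad_tens[OF t] by (simp add: Q.tens_Cons)
    moreover have "ps = us' @ (i, y) # vs" using * Cons by simp
    ultimately have "ps \<in> bad" using * Cons unfolding bad_def
      by (intro CollectI conjI exI[of _ us'] exI[of _ i] exI[of _ y] exI[of _ vs]) simp_all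
    then show ?thesis using * Cons by auto
  qed
qed

lemma bad_ne: "ps \<in> bad \<Longrightarrow> ps \<noteq> []"
  by (auto simp: bad_def)

lemma bad_leading: "ps \<in> bad \<Longrightarrow> ps \<in> leading"
proof -
  assume b: "ps \<in> bad"
  obtain k x qs where p: "ps = (k, x) # qs" and k: "k \<in> K"
    by (rule Q.hd_pairs_cases[OF bad_tens[OF b] bad_ne[OF b]])
  have "x \<in> legs (lead k)"
    using bad_ConsD[OF b[unfolded p]] legs_mono[OF excess_lead[OF k]] legs_mono[OF AA_lead[OF k]] by blast
  then show ?thesis using bad_tens[OF b] by (simp add: leading_def p)
qed

lemma bad_append:
  assumes b: "ps \<in> bad" and t: "Q.tens (ps @ qs)"
  shows "ps @ qs \<in> bad"
proof -
  obtain us i y vs where "ps = us @ (i, y) # vs" "y \<in> legs (excess i)" "\<forall>(j, y)\<in>set us. y \<in> legs (AA j)"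
    using b by (auto simp: bad_def)
  then show ?thesis
    using t unfolding bad_def
    by (intro CollectI conjI exI[of _ us] exI[of _ i] exI[of _ y] exI[of _ "vs @ qs"]) auto
qed

lemma bad_snocD:
  assumes b: "ps @ [(k, x)] \<in> bad"
  shows "ps \<in> bad \<or> (x \<in> legs (excess k) \<and> (\<forall>(j, y)\<in>set ps. y \<in> legs (AA j)))"
proof -
  obtain us i y vs where *: "ps @ [(k, x)] = us @ (i, y) # vs" "y \<in> legs (excess i)" "\<forall>(j, y)\<in>set us. y \<in> legs (AA j)"
    using b by (auto simp: bad_def)
  show ?thesis
  proof (cases vs rule: rev_cases)
    case Nil
    then show ?thesis using * by auto
  next
    case (snoc vs' v)
    have "Q.tens ps" using bad_tens[OF b] by (simp add: Q.tens_snoc)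
    moreover have "ps = us @ (i, y) # vs'" using * snoc by simp
    ultimately have "ps \<in> bad" using * unfolding bad_def
      by (intro CollectI conjI exI[of _ us] exI[of _ i] exI[of _ y] exI[of _ vs']) simp_all
    then show ?thesis ..
  qed
qed

lemma bad_snoc:
  assumes "Q.tens (ps @ [(k, x)])" "x \<in> legs (excess k)" "\<forall>(j, y)\<in>set ps. y \<in> legs (AA j)"
  shows "ps @ [(k, x)] \<in> bad"
  unfolding bad_def using assms
  by (intro CollectI conjI exI[of _ ps] exI[of _ k] exI[of _ x] exI[of _ "[]"]) auto

lemma quot_closed: "x \<in> carrier quot \<Longrightarrow> b \<odot>\<^bsub>quot\<^esub> x \<in> carrier quot" "x \<in> carrier quot \<Longrightarrow> x \<lhd>\<^bsub>quot\<^esub> b \<in> carrier quot"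
  by (rule bimodule.smult_closed[OF quot_bimodule], assumption)
    (rule bimodule.rsmult_closed[OF quot_bimodule], assumption)

lemma bad_smult: "ps \<in> bad \<Longrightarrow> b \<odot>\<^bsub>Q.F\<^esub> Q.tvec ps \<in> Q.tspan bad"
proof -
  assume p: "ps \<in> bad"
  note t = bad_tens[OF p]
  obtain k x qs where ps: "ps = (k, x) # qs" and k: "k \<in> K"
    by (rule Q.hd_pairs_cases[OF t bad_ne[OF p]])
  have t': "Q.tens ((k, b \<odot>\<^bsub>quot\<^esub> x) # qs)" using t by (auto simp: ps Q.tens_Cons quot_closed)
  have "(k, b \<odot>\<^bsub>quot\<^esub> x) # qs \<in> bad"
    using bad_ConsD[OF p[unfolded ps]]
  proof
    assume "x \<in> legs (excess k)"
    then show ?thesis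
      using t' excess_AA[OF k _ AA_L[OF k]] by (intro bad_Cons_excess legs_smult)
  next
    assume "x \<in> legs (AA k) \<and> qs \<in> bad"
    then show ?thesis
      using t' AA_mult[OF k AA_L[OF k]] by (intro bad_Cons_AA legs_smult) auto
  qed
  then show ?thesis using t by (simp add: ps Q.smult_tvec Q.tspan_gen)
qed

lemma bad_rsmult: "ps \<in> bad \<Longrightarrow> Q.tvec ps \<lhd>\<^bsub>Q.F\<^esub> b \<in> Q.tspan bad"
proof -
  assume p: "ps \<in> bad"
  note t = bad_tens[OF p]
  obtain k x qs where ps: "ps = qs @ [(k, x)]" and k: "k \<in> K"
    by (rule Q.last_pairs_cases[OF t bad_ne[OF p]])
  have t': "Q.tens (qs @ [(k, x \<lhd>\<^bsub>quot\<^esub> b)])" using t by (auto simp: ps Q.tens_snoc quot_closed)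
  have "qs @ [(k, x \<lhd>\<^bsub>quot\<^esub> b)] \<in> bad"
    using bad_snocD[OF p[unfolded ps]]
  proof
    assume "qs \<in> bad"
    then show ?thesis using t' by (rule bad_append)
  next
    assume "x \<in> legs (excess k) \<and> (\<forall>(j, y)\<in>set qs. y \<in> legs (AA j))"
    then show ?thesis
      using t' excess_AA[OF k _ AA_R[OF k]] by (intro bad_snoc legs_rsmult) auto
  qed
  then show ?thesis using t by (simp add: ps Q.rsmult_tvec Q.tspan_gen)
qed

lemma leading_rsmult: "ps \<in> leading \<Longrightarrow> Q.tvec ps \<lhd>\<^bsub>Q.F\<^esub> b \<in> Q.tspan leading"
proof -
  assume p: "ps \<in> leading"
  note t = leading_tens[OF p]
  have "ps \<noteq> []" using p by (simp add: leading_def)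
  then obtain k x qs where ps: "ps = qs @ [(k, x)]" and k: "k \<in> K"
    by (rule Q.last_pairs_cases[OF t])
  have t': "Q.tens (qs @ [(k, x \<lhd>\<^bsub>quot\<^esub> b)])" using t by (auto simp: ps Q.tens_snoc quot_closed)
  have "qs @ [(k, x \<lhd>\<^bsub>quot\<^esub> b)] \<in> leading"
    using p t' legs_rsmult[of x "lead k" b] lead_R[OF k] by (cases qs) (auto simp: leading_def ps)
  then show ?thesis using t by (simp add: ps Q.rsmult_tvec Q.tspan_gen)
qed

lemma lmul_Al: "k \<in> K \<Longrightarrow> a \<in> Al k \<Longrightarrow> lmul a \<in> left_ops (with_B quot)"
  and lmul_Ar: "k \<in> K \<Longrightarrow> a \<in> Ar k \<Longrightarrow> lmul a \<in> right_ops (with_B quot)"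
  and lmul_C': "k \<in> K \<Longrightarrow> a \<in> C' k \<Longrightarrow> lmul a \<in> left_ops (with_B quot)"
  and lmul_D': "k \<in> K \<Longrightarrow> a \<in> D' k \<Longrightarrow> lmul a \<in> right_ops (with_B quot)"
  using lmul_C[of k a] lmul_D[of k a] Al_C[of k] Ar_D[of k] C'_C[of k] D'_D[of k] by blast+

abbreviation "lreg k a \<equiv> left_reg K (\<lambda>_. quot) k (lmul a)"
abbreviation "rreg k a \<equiv> right_reg K (\<lambda>_. quot) k (lmul a)"

text \<open>An excess first leg stays one, with vacuum part 0. A first leg from \<open>AA\<close>
  may disappear, but then the excess leg is still there with fewer legs before it, and a newly
  created leg is again from \<open>AA\<close>.\<close>

lemma bad_left:
  assumes v: "v \<in> Q.tspan bad" and k: "k \<in> K" and a: "a \<in> Al k"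
  shows "lreg k a v \<in> Q.tspan bad"
proof (rule Q.left_reg_tspan[OF v k lmul_Al[OF k a] bad_tens])
  fix ps b y assume p: "ps \<in> bad" "ps = [] \<or> fst (hd ps) \<noteq> k" and y: "lmul a (1, \<zero>\<^bsub>quot\<^esub>) = (b, y)"
  have "y \<in> legs (AA k)"
    using y AA_Al[OF k a] AA_L[OF k] AA_add[OF k] by (intro qv_legs[of a]) (auto simp: lmul_vac)
  then have "(k, y) # ps \<in> bad"
    using p k bad_tens[OF p(1)] legs_carrier by (intro bad_Cons_AA) (auto simp: Q.tens_Cons)
  then show "b \<odot>\<^bsub>Q.F\<^esub> Q.tvec ps \<in> Q.tspan bad \<and> Q.tvec ((k, y) # ps) \<in> Q.tspan bad"
    using bad_smult[OF p(1)] by (simp add: Q.tspan_gen)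
next
  fix x ps b y assume p: "(k, x) # ps \<in> bad" and y: "lmul a (0, x) = (b, y)"
  have t: "Q.tens ((k, y) # ps)" if "y \<in> carrier quot" using bad_tens[OF p] that by (auto simp: Q.tens_Cons)
  show "b \<odot>\<^bsub>Q.F\<^esub> Q.tvec ps \<in> Q.tspan bad \<and> Q.tvec ((k, y) # ps) \<in> Q.tspan bad"
    using bad_ConsD[OF p]
  proof
    assume "x \<in> legs (excess k)"
    then obtain Z where Z: "x = wcls Z" "Z \<in> excess k" "E Z = 0" by (rule legsE)
    then have *: "b = 0 \<and> y \<in> legs (excess k)"
      using qv_excess[OF k excess_AA[OF k Z(2) AA_Al[OF k a]]] y by (simp add: lmul_leg)
    then have "(k, y) # ps \<in> bad" using t legs_carrier by (intro bad_Cons_excess) auto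
    moreover have "b \<odot>\<^bsub>Q.F\<^esub> Q.tvec ps = \<zero>\<^bsub>Q.F\<^esub>"
      using * bad_tens[OF p] by (simp add: Q.smult_zero Q.tvec_closed Q.tens_Cons)
    ultimately show ?thesis by (simp add: Q.tspan_gen aspan.aspan_zero)
  next
    assume *: "x \<in> legs (AA k) \<and> ps \<in> bad"
    then obtain Z where Z: "x = wcls Z" "Z \<in> AA k" "E Z = 0" by (auto elim: legsE)
    then have "y \<in> legs (AA k)"
      using y AA_mult[OF k AA_Al[OF k a] Z(2)] AA_L[OF k] AA_add[OF k]
      by (intro qv_legs[of "a * Z"]) (auto simp: lmul_leg)
    then have "(k, y) # ps \<in> bad" using t legs_carrier * by (intro bad_Cons_AA) auto
    then show ?thesis using * bad_smult by (simp add: Q.tspan_gen)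
  qed
qed

text \<open>Nothing is required to the right of the excess leg, so a right letter matters only when
  the excess leg is the last one; that leg then stays of excess type with vacuum part 0.\<close>

lemma bad_right:
  assumes v: "v \<in> Q.tspan bad" and k: "k \<in> K" and a: "a \<in> Ar k"
  shows "rreg k a v \<in> Q.tspan bad"
proof (rule Q.right_reg_tspan[OF v k lmul_Ar[OF k a] bad_tens])
  fix ps b y assume p: "ps \<in> bad" "ps = [] \<or> fst (last ps) \<noteq> k" and y: "lmul a (1, \<zero>\<^bsub>quot\<^esub>) = (b, y)"
  have "y \<in> carrier quot" by (rule Q.right_vac_closed[OF k lmul_Ar[OF k a] y])
  then have "ps @ [(k, y)] \<in> bad"
    using p k bad_tens[OF p(1)] by (intro bad_append) (auto simp: Q.tens_snoc)
  then show "Q.tvec ps \<lhd>\<^bsub>Q.F\<^esub> b \<in> Q.tspan bad \<and> Q.tvec (ps @ [(k, y)]) \<in> Q.tspan bad"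
    using bad_rsmult[OF p(1)] by (simp add: Q.tspan_gen)
next
  fix x ps b y assume p: "ps @ [(k, x)] \<in> bad" and y: "lmul a (0, x) = (b, y)"
  have x: "x \<in> carrier quot" using bad_tens[OF p] by (simp add: Q.tens_snoc)
  have t: "Q.tens (ps @ [(k, y)])"
    using bad_tens[OF p] Q.right_leg_closed[OF k lmul_Ar[OF k a] x y] by (auto simp: Q.tens_snoc)
  show "Q.tvec ps \<lhd>\<^bsub>Q.F\<^esub> b \<in> Q.tspan bad \<and> Q.tvec (ps @ [(k, y)]) \<in> Q.tspan bad"
    using bad_snocD[OF p]
  proof
    assume "ps \<in> bad"
    then show ?thesis using bad_append[OF _ t] bad_rsmult by (simp add: Q.tspan_gen)
  next
    assume e: "x \<in> legs (excess k) \<and> (\<forall>(j, y)\<in>set ps. y \<in> legs (AA j))"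
    then obtain Z where Z: "x = wcls Z" "Z \<in> excess k" "E Z = 0" by (auto elim: legsE)
    then have *: "b = 0 \<and> y \<in> legs (excess k)"
      using qv_excess[OF k excess_AA[OF k Z(2) AA_Ar[OF k a]]] y by (simp add: lmul_leg)
    then have "ps @ [(k, y)] \<in> bad" using t e by (intro bad_snoc) auto
    moreover have "Q.tvec ps \<lhd>\<^bsub>Q.F\<^esub> b = \<zero>\<^bsub>Q.F\<^esub>"
      using * bad_tens[OF p] by (simp add: Q.rsmult_zero Q.tvec_closed Q.tens_snoc)
    ultimately show ?thesis by (simp add: Q.tspan_gen aspan.aspan_zero)
  qed
qed

text \<open>The letter \<open>c\<close> is either put in front as a new excess leg or turns the
  first leg into one. Both times the vacuum part is 0, so the summand without this leg
  vanishes.\<close>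

lemma leading_left:
  assumes v: "v \<in> Q.tspan leading" and k: "k \<in> K" and c: "c \<in> C' k"
  shows "lreg k c v \<in> Q.tspan bad"
proof (rule Q.left_reg_tspan[OF v k lmul_C'[OF k c] leading_tens])
  fix ps b y assume p: "ps \<in> leading" "ps = [] \<or> fst (hd ps) \<noteq> k" and y: "lmul c (1, \<zero>\<^bsub>quot\<^esub>) = (b, y)"
  have *: "b = 0 \<and> y \<in> legs (excess k)"
    using qv_excess[OF k excess_C'[OF k c AA_one[OF k]]] y by (simp add: lmul_vac)
  then have "(k, y) # ps \<in> bad"
    using p k leading_tens[OF p(1)] legs_carrier by (intro bad_Cons_excess) (auto simp: Q.tens_Cons)
  then show "b \<odot>\<^bsub>Q.F\<^esub> Q.tvec ps \<in> Q.tspan bad \<and> Q.tvec ((k, y) # ps) \<in> Q.tspan bad"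
    using * leading_tens[OF p(1)] by (simp add: Q.tspan_gen Q.smult_zero Q.tvec_closed aspan.aspan_zero)
next
  fix x ps b y assume p: "(k, x) # ps \<in> leading" and y: "lmul c (0, x) = (b, y)"
  then have "x \<in> legs (lead k)" by (simp add: leading_def)
  then obtain Z where Z: "x = wcls Z" "Z \<in> lead k" "E Z = 0" by (rule legsE)
  then have "c * Z \<in> excess k" using c by (simp add: lead_def)
  then have *: "b = 0 \<and> y \<in> legs (excess k)"
    using qv_excess[OF k] y Z by (simp add: lmul_leg)
  then have "(k, y) # ps \<in> bad"
    using leading_tens[OF p] legs_carrier by (intro bad_Cons_excess) (auto simp: Q.tens_Cons)
  then show "b \<odot>\<^bsub>Q.F\<^esub> Q.tvec ps \<in> Q.tspan bad \<and> Q.tvec ((k, y) # ps) \<in> Q.tspan bad"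
    using * leading_tens[OF p] by (simp add: Q.tspan_gen Q.smult_zero Q.tvec_closed Q.tens_Cons aspan.aspan_zero)
qed

text \<open>A right letter of colour \<open>k\<close> can act on the first leg only if this is the
  sole leg and has colour \<open>k\<close>, which is excluded. Factors from \<open>B\<close> that
  reach the first leg are harmless.\<close>

lemma leading_right:
  assumes p: "ps \<in> leading" and k: "k \<in> K" and d: "d \<in> D' k" and ne: "map fst ps \<noteq> [k]"
  shows "rreg k d (Q.tvec ps) \<in> Q.tspan leading"
proof (rule Q.right_reg_tspan[where P = "{ps}", OF _ k lmul_D'[OF k d]])
  show "Q.tvec ps \<in> Q.tspan {ps}" by (rule Q.tspan_gen) simp
  show "Q.tens qs" if "qs \<in> {ps}" for qs using that leading_tens[OF p] by simp
next
  fix qs b y assume q: "qs \<in> {ps}" "qs = [] \<or> fst (last qs) \<noteq> k" and y: "lmul d (1, \<zero>\<^bsub>quot\<^esub>) = (b, y)"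
  have "y \<in> carrier quot" by (rule Q.right_vac_closed[OF k lmul_D'[OF k d] y])
  then have "ps @ [(k, y)] \<in> leading"
    using p q k by (auto simp: leading_def Q.tens_snoc)
  then show "Q.tvec qs \<lhd>\<^bsub>Q.F\<^esub> b \<in> Q.tspan leading \<and> Q.tvec (qs @ [(k, y)]) \<in> Q.tspan leading"
    using leading_rsmult[OF p] q by (simp add: Q.tspan_gen)
next
  fix x qs b y assume q: "qs @ [(k, x)] \<in> {ps}" and y: "lmul d (0, x) = (b, y)"
  then have ps: "ps = qs @ [(k, x)]" by simp
  then have "qs \<noteq> []" using ne by auto
  have x: "x \<in> carrier quot" using leading_tens[OF p] by (simp add: ps Q.tens_snoc)
  have "qs \<in> leading" "qs @ [(k, y)] \<in> leading"
    using p \<open>qs \<noteq> []\<close> Q.right_leg_closed[OF k lmul_D'[OF k d] x y] unfolding ps leading_def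
    by (auto simp: Q.tens_snoc)
  then show "Q.tvec qs \<lhd>\<^bsub>Q.F\<^esub> b \<in> Q.tspan leading \<and> Q.tvec (qs @ [(k, y)]) \<in> Q.tspan leading"
    using leading_rsmult by (simp add: Q.tspan_gen)
qed

text \<open>On vectors of a single colour both regular representations are left multiplications, so
  the two letters act as their product.\<close>

lemma pair_emb: "k \<in> K \<Longrightarrow> c \<in> C' k \<Longrightarrow> d \<in> D' k \<Longrightarrow> lreg k c (rreg k d (Q.emb k (qv Z))) = Q.emb k (qv (c * d * Z))"
  using Q.right_reg_emb[of k "lmul d" "qv Z", OF _ lmul_D' qv_closed]
    Q.left_reg_emb[of k "lmul c" "qv (d * Z)", OF _ lmul_C' qv_closed]
  by (simp add: lmul_qv mult.assoc)

lemma bad_closed: "v \<in> Q.tspan bad \<Longrightarrow> v \<in> carrier Q.F"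
  by (erule Q.aspan_closed) (auto simp: bad_def Q.tvec_closed)

lemma pair_add:
  "k \<in> K \<Longrightarrow> c \<in> C' k \<Longrightarrow> d \<in> D' k \<Longrightarrow> u \<in> carrier Q.F \<Longrightarrow> v \<in> carrier Q.F \<Longrightarrow>
    lreg k c (rreg k d (u \<oplus>\<^bsub>Q.F\<^esub> v)) = lreg k c (rreg k d u) \<oplus>\<^bsub>Q.F\<^esub> lreg k c (rreg k d v)"
  by (simp add: Q.left_reg_add Q.right_reg_add Q.right_reg_closed lmul_C' lmul_D')

text \<open>Between the two letters badness may be lost, since \<open>d\<close> can remove an excess
  leg at the right end. Only \<open>leading\<close> survives, and \<open>c\<close> then restores an
  excess leg in front. A single leg of colour \<open>k\<close> is treated as an element of the
  algebra, where \<open>excess_pair\<close> applies to \<open>c * d * Z\<close> as a whole.\<close>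

lemma bad_pair:
  assumes v: "v \<in> Q.tspan bad" and k: "k \<in> K" and c: "c \<in> C' k" and d: "d \<in> D' k"
  shows "lreg k c (rreg k d v) \<in> Q.tspan bad"
proof (rule aspan_image[OF v])
  show "lreg k c (rreg k d (u \<oplus>\<^bsub>Q.F\<^esub> v)) = lreg k c (rreg k d u) \<oplus>\<^bsub>Q.F\<^esub> lreg k c (rreg k d v)"
    if "u \<in> Q.tspan bad" "v \<in> Q.tspan bad" for u v
    using that bad_closed by (intro pair_add k c d)
  show "lreg k c (rreg k d \<zero>\<^bsub>Q.F\<^esub>) \<in> Q.tspan bad"
    using k c d by (simp add: Q.left_reg_zero Q.right_reg_zero lmul_C' lmul_D' aspan.aspan_zero)
  fix g assume "g \<in> Q.tvec ` bad"
  then obtain ps where g: "g = Q.tvec ps" and p: "ps \<in> bad" by blast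
  show "lreg k c (rreg k d g) \<in> Q.tspan bad"
  proof (cases "map fst ps = [k]")
    case False
    show ?thesis unfolding g by (rule leading_left[OF leading_right[OF bad_leading[OF p] k d False] k c])
  next
    case True
    then obtain x where ps: "ps = [(k, x)]" by (cases ps) auto
    have "[] \<notin> bad" using bad_ne by blast
    then have "x \<in> legs (excess k)" using bad_ConsD[OF p[unfolded ps]] by blast
    then obtain Z where Z: "x = wcls Z" "Z \<in> excess k" "E Z = 0" by (rule legsE)
    have x: "x \<in> carrier quot" using bad_tens[OF p] by (simp add: ps Q.tens_Cons)
    have e: "c * d * Z \<in> excess k" using excess_pair[OF k Z(2) c d] by (simp add: mult.assoc)
    have "g = Q.emb k (qv Z)" using Z x k by (simp add: g ps Q.tvec_single qv_zero_part)
    then have "lreg k c (rreg k d g) = Q.emb k (qv (c * d * Z))" using pair_emb[OF k c d] by simp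
    also have "\<dots> = Q.tvec [(k, wcls (c * d * Z))]"
      using excess_E[OF k e] k by (simp add: qv_zero_part Q.tvec_single quot_simps)
    also have "\<dots> \<in> Q.tspan bad"
      using e excess_E[OF k e] k by (intro Q.tspan_gen bad_Cons_excess) (auto simp: Q.tens_Cons legs_def quot_simps)
    finally show ?thesis .
  qed
qed

end

context free_prod
begin

lemma bproj_closed: "v \<in> carrier F \<Longrightarrow> bproj k v \<in> carrier F"
proof (induction rule: F_induct)
  case (pure ks xs)
  then show ?case by (auto simp: bproj_pure intro: pure_closed)
qed (simp_all add: bproj_scal bproj_add scal_closed)

end

lemma (in bb_prob_space) left_alg_subalg: "subalg (left_alg \<epsilon>)"
  by (auto simp: subalg_def left_alg_def distrib_left distrib_right mult_scaleC_left mult_scaleC_right)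
    (metis mult.assoc)

section \<open>Good vectors and the effect of a pair on them\<close>

context ffb_system
begin

text \<open>Scalars are listed separately: the only scalar among the tensors is the vacuum
  \<open>1\<close>, and an additive span is not closed under multiplication by
  \<open>B\<close>.\<close>

definition gspan where
  "gspan = aspan \<zero>\<^bsub>Q.F\<^esub> (\<oplus>\<^bsub>Q.F\<^esub>) (range Q.scal \<union> Q.tvec ` gvec)"

lemma gspan_scal: "Q.scal c \<in> gspan" and gspan_tvec: "ps \<in> gvec \<Longrightarrow> Q.tvec ps \<in> gspan"
  unfolding gspan_def by (auto intro: aspan.aspan_gen)

lemma gspan_add: "u \<in> gspan \<Longrightarrow> v \<in> gspan \<Longrightarrow> u \<oplus>\<^bsub>Q.F\<^esub> v \<in> gspan"
  unfolding gspan_def by (rule aspan.aspan_add)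

lemma gspan_closed: "v \<in> gspan \<Longrightarrow> v \<in> carrier Q.F"
  unfolding gspan_def by (erule Q.aspan_closed) (auto simp: Q.scal_closed Q.tvec_closed gvec_tens)

lemma good_LR:
  assumes k: "k \<in> K"
  shows good_L: "L b \<in> good k" and good_smult: "Z \<in> good k \<Longrightarrow> L b * Z \<in> good k"
    and good_rsmult: "Z \<in> good k \<Longrightarrow> R b * Z \<in> good k"
  using AA_L[OF k] AA_R[OF k] by (auto intro: good.intros)

lemma gvec_Cons: "(k, x) # ps \<in> gvec \<longleftrightarrow> Q.tens ((k, x) # ps) \<and> x \<in> legs (good k) \<and> ps \<in> gvec"
  by (auto simp: gvec_def Q.tens_Cons)

lemma gvec_snoc: "ps @ [(k, x)] \<in> gvec \<longleftrightarrow> Q.tens (ps @ [(k, x)]) \<and> x \<in> legs (good k) \<and> ps \<in> gvec"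
  by (auto simp: gvec_def Q.tens_snoc)

lemma gvec_smult: "ps \<in> gvec \<Longrightarrow> b \<odot>\<^bsub>Q.F\<^esub> Q.tvec ps \<in> gspan"
proof (cases "ps = []")
  case False
  assume p: "ps \<in> gvec"
  obtain k x qs where ps: "ps = (k, x) # qs" and k: "k \<in> K"
    by (rule Q.hd_pairs_cases[OF gvec_tens[OF p] False])
  have "(k, b \<odot>\<^bsub>quot\<^esub> x) # qs \<in> gvec"
    using p legs_smult[of x "good k" b] good_smult[OF k] unfolding ps gvec_Cons
    by (auto simp: Q.tens_Cons quot_closed)
  then show ?thesis using gvec_tens[OF p] by (simp add: ps Q.smult_tvec gspan_tvec)
qed (simp add: Q.smult_tvec_Nil gspan_scal)

lemma gvec_rsmult: "ps \<in> gvec \<Longrightarrow> Q.tvec ps \<lhd>\<^bsub>Q.F\<^esub> b \<in> gspan"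
proof (cases "ps = []")
  case False
  assume p: "ps \<in> gvec"
  obtain k x qs where ps: "ps = qs @ [(k, x)]" and k: "k \<in> K"
    by (rule Q.last_pairs_cases[OF gvec_tens[OF p] False])
  have "qs @ [(k, x \<lhd>\<^bsub>quot\<^esub> b)] \<in> gvec"
    using p legs_rsmult[of x "good k" b] good_rsmult[OF k] unfolding ps gvec_snoc
    by (auto simp: Q.tens_snoc quot_closed)
  then show ?thesis using gvec_tens[OF p] by (simp add: ps Q.rsmult_tvec gspan_tvec)
qed (simp add: Q.rsmult_tvec_Nil gspan_scal)

lemma qv_good: "k \<in> K \<Longrightarrow> Z \<in> good k \<Longrightarrow> qv Z = (b, y) \<Longrightarrow> y \<in> legs (good k)"
  by (rule qv_legs[of Z]) (auto intro: good_L good_add)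

lemma gspan_emb: 
  assumes k: "k \<in> K" and Z: "Z \<in> good k"
  shows "Q.emb k (qv Z) \<in> gspan"
proof -
  obtain b y where y: "qv Z = (b, y)" by force
  have l: "y \<in> legs (good k)" by (rule qv_good[OF k Z y])
  then have "[(k, y)] \<in> gvec" using k legs_carrier[OF l] by (simp add: gvec_Cons Q.tens_Cons) (simp add: gvec_def)
  then show ?thesis
    using k legs_carrier[OF l] by (simp add: y Q.emb_tvec gspan_add gspan_scal gspan_tvec)
qed

text \<open>Lets a scalar be treated as a vector of any colour, namely the one of the algebra
  element \<open>L c\<close>.\<close>

lemma scal_emb: "k \<in> K \<Longrightarrow> Q.scal c = Q.emb k (qv (L c))"
  by (simp add: qv_L Q.emb_scalar)

lemma gvec_tspan: "ps \<in> gvec \<Longrightarrow> Q.tvec ps \<in> Q.tspan {ps}"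
  by (rule Q.tspan_gen) simp

lemma gspan_left:
  assumes v: "v \<in> gspan" and k: "k \<in> K" and a: "a \<in> Al k"
  shows "lreg k a v \<in> gspan"
  unfolding gspan_def
proof (rule aspan_image[OF v[unfolded gspan_def]], unfold gspan_def[symmetric])
  note la = lmul_Al[OF k a]
  show "lreg k a \<zero>\<^bsub>Q.F\<^esub> \<in> gspan"
    by (subst Q.left_reg_zero[OF k la]) (simp add: Q.F_zero gspan_scal)
  show "lreg k a (u \<oplus>\<^bsub>Q.F\<^esub> v) = lreg k a u \<oplus>\<^bsub>Q.F\<^esub> lreg k a v" if "u \<in> gspan" "v \<in> gspan" for u v
    using that gspan_closed by (intro Q.left_reg_add[OF k la])
  fix g assume "g \<in> range Q.scal \<union> Q.tvec ` gvec"
  then show "lreg k a g \<in> gspan"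
  proof (elim UnE rangeE imageE)
    fix c assume g: "g = Q.scal c"
    have "a * L c \<in> good k" using AA_mult[OF k AA_Al[OF k a] AA_L[OF k]] by (rule good_AA)
    then show ?thesis
      unfolding g scal_emb[OF k] Q.left_reg_emb[OF k la qv_closed] lmul_qv by (rule gspan_emb[OF k])
  next
    fix ps assume g: "g = Q.tvec ps" and p: "ps \<in> gvec"
    show ?thesis
      unfolding g gspan_def
    proof (rule Q.left_reg_tspan[OF gvec_tspan[OF p] k la], unfold gspan_def[symmetric])
      show "Q.tens qs" if "qs \<in> {ps}" for qs using that gvec_tens[OF p] by simp
      fix qs b y assume q: "qs \<in> {ps}" "qs = [] \<or> fst (hd qs) \<noteq> k" and y: "lmul a (1, \<zero>\<^bsub>quot\<^esub>) = (b, y)"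
      have l: "y \<in> legs (good k)"
        using qv_good[OF k good_AA[OF AA_Al[OF k a]]] y by (simp add: lmul_vac)
      then have "(k, y) # ps \<in> gvec"
        using p q k gvec_tens[OF p] legs_carrier[OF l] by (auto simp: gvec_Cons Q.tens_Cons)
      then show "b \<odot>\<^bsub>Q.F\<^esub> Q.tvec qs \<in> gspan \<and> Q.tvec ((k, y) # qs) \<in> gspan"
        using gvec_smult[OF p] q by (simp add: gspan_tvec)
    next
      fix x qs b y assume q: "(k, x) # qs \<in> {ps}" and y: "lmul a (0, x) = (b, y)"
      then have q: "(k, x) # qs \<in> gvec" using p by simp
      then have "x \<in> legs (good k)" by (simp add: gvec_Cons)
      then obtain Z where Z: "x = wcls Z" "Z \<in> good k" "E Z = 0" by (rule legsE)
      have l: "y \<in> legs (good k)"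
        using qv_good[OF k good_mult[OF AA_Al[OF k a] Z(2)]] y Z by (simp add: lmul_leg)
      then have "(k, y) # qs \<in> gvec" "qs \<in> gvec"
        using q legs_carrier[OF l] by (auto simp: gvec_Cons Q.tens_Cons)
      then show "b \<odot>\<^bsub>Q.F\<^esub> Q.tvec qs \<in> gspan \<and> Q.tvec ((k, y) # qs) \<in> gspan"
        using gvec_smult by (simp add: gspan_tvec)
    qed
  qed
qed

lemma gspan_right:
  assumes v: "v \<in> gspan" and k: "k \<in> K" and a: "a \<in> Ar k"
  shows "rreg k a v \<in> gspan"
  unfolding gspan_def
proof (rule aspan_image[OF v[unfolded gspan_def]], unfold gspan_def[symmetric])
  note la = lmul_Ar[OF k a]
  show "rreg k a \<zero>\<^bsub>Q.F\<^esub> \<in> gspan"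
    by (subst Q.right_reg_zero[OF k la]) (simp add: Q.F_zero gspan_scal)
  show "rreg k a (u \<oplus>\<^bsub>Q.F\<^esub> v) = rreg k a u \<oplus>\<^bsub>Q.F\<^esub> rreg k a v" if "u \<in> gspan" "v \<in> gspan" for u v
    using that gspan_closed by (intro Q.right_reg_add[OF k la])
  fix g assume "g \<in> range Q.scal \<union> Q.tvec ` gvec"
  then show "rreg k a g \<in> gspan"
  proof (elim UnE rangeE imageE)
    fix c assume g: "g = Q.scal c"
    have "a * L c \<in> good k" using AA_mult[OF k AA_Ar[OF k a] AA_L[OF k]] by (rule good_AA)
    then show ?thesis
      unfolding g scal_emb[OF k] Q.right_reg_emb[OF k la qv_closed] lmul_qv by (rule gspan_emb[OF k])
  next
    fix ps assume g: "g = Q.tvec ps" and p: "ps \<in> gvec"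
    show ?thesis
      unfolding g gspan_def
    proof (rule Q.right_reg_tspan[OF gvec_tspan[OF p] k la], unfold gspan_def[symmetric])
      show "Q.tens qs" if "qs \<in> {ps}" for qs using that gvec_tens[OF p] by simp
      fix qs b y assume q: "qs \<in> {ps}" "qs = [] \<or> fst (last qs) \<noteq> k" and y: "lmul a (1, \<zero>\<^bsub>quot\<^esub>) = (b, y)"
      have l: "y \<in> legs (good k)"
        using qv_good[OF k good_AA[OF AA_Ar[OF k a]]] y by (simp add: lmul_vac)
      then have "ps @ [(k, y)] \<in> gvec"
        using p q k gvec_tens[OF p] legs_carrier[OF l] by (auto simp: gvec_snoc Q.tens_snoc)
      then show "Q.tvec qs \<lhd>\<^bsub>Q.F\<^esub> b \<in> gspan \<and> Q.tvec (qs @ [(k, y)]) \<in> gspan"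
        using gvec_rsmult[OF p] q by (simp add: gspan_tvec)
    next
      fix x qs b y assume q: "qs @ [(k, x)] \<in> {ps}" and y: "lmul a (0, x) = (b, y)"
      then have q: "qs @ [(k, x)] \<in> gvec" using p by simp
      then have "x \<in> legs (good k)" by (simp add: gvec_snoc)
      then obtain Z where Z: "x = wcls Z" "Z \<in> good k" "E Z = 0" by (rule legsE)
      have l: "y \<in> legs (good k)"
        using qv_good[OF k good_mult[OF AA_Ar[OF k a] Z(2)]] y Z by (simp add: lmul_leg)
      then have "qs @ [(k, y)] \<in> gvec" "qs \<in> gvec"
        using q legs_carrier[OF l] by (auto simp: gvec_snoc Q.tens_snoc)
      then show "Q.tvec qs \<lhd>\<^bsub>Q.F\<^esub> b \<in> gspan \<and> Q.tvec (qs @ [(k, y)]) \<in> gspan"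
        using gvec_rsmult by (simp add: gspan_tvec)
    qed
  qed
qed

abbreviation "qproj k \<equiv> boolean_proj K (\<lambda>_. quot) k"

definition bop where
  "bop k Z v = qproj k (lreg k Z (qproj k v))"

lemma emb_zero: "k \<in> K \<Longrightarrow> Q.emb k (qv 0) = \<zero>\<^bsub>Q.F\<^esub>"
  using scal_emb[of k 0] by (simp add: Q.F_zero)

lemma gvec_single: 
  assumes "ps \<in> gvec" "map fst ps = [k]"
  obtains Z where "Z \<in> good k" "Q.tvec ps = Q.emb k (qv Z)"
proof -
  obtain x where ps: "ps = [(k, x)]" using assms(2) by (cases ps) auto
  then have "x \<in> legs (good k)" and k: "k \<in> K" using assms(1) by (auto simp: gvec_Cons Q.tens_Cons)
  then obtain Z where "x = wcls Z" "Z \<in> good k" "E Z = 0" by (auto elim: legsE)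
  then show thesis
    using k by (intro that[of Z]) (auto simp: ps Q.tvec_single qv_zero_part quot_simps)
qed

text \<open>Only the vacuum and the words \<open>[k]\<close> survive the projection, and on good
  vectors they come from an element of the algebra. By \<open>bop_emb\<close> a Boolean operator
  thus becomes left multiplication applied to that element.\<close>

lemma qproj_gspan:
  assumes k: "k \<in> K" and v: "v \<in> gspan"
  shows "\<exists>Z\<in>good k. qproj k v = Q.emb k (qv Z)"
proof -
  have z: "\<zero>\<^bsub>Q.F\<^esub> = Q.emb k (qv 0)" "0 \<in> good k" using emb_zero[OF k] good_L[OF k, of 0] by simp_all
  have "v \<in> carrier Q.F \<and> (\<exists>Z\<in>good k. qproj k v = Q.emb k (qv Z))"
  proof (rule aspan_pred[OF v[unfolded gspan_def]])
    show "\<zero>\<^bsub>Q.F\<^esub> \<in> carrier Q.F \<and> (\<exists>Z\<in>good k. qproj k \<zero>\<^bsub>Q.F\<^esub> = Q.emb k (qv Z))"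
      by (intro conjI bexI[of _ 0]) (simp_all add: Q.bproj_zero emb_zero[OF k] z(2))
  next
    fix u v assume u: "u \<in> carrier Q.F \<and> (\<exists>Z\<in>good k. qproj k u = Q.emb k (qv Z))"
      and v: "v \<in> carrier Q.F \<and> (\<exists>Z\<in>good k. qproj k v = Q.emb k (qv Z))"
    then obtain S Z where "S \<in> good k" "qproj k u = Q.emb k (qv S)" "Z \<in> good k" "qproj k v = Q.emb k (qv Z)" by blast
    then have "S + Z \<in> good k" "qproj k (u \<oplus>\<^bsub>Q.F\<^esub> v) = Q.emb k (qv (S + Z))"
      using u v Q.emb_add[OF k qv_closed qv_closed, of S Z] by (simp_all add: good_add Q.bproj_add qv_add)
    then show "u \<oplus>\<^bsub>Q.F\<^esub> v \<in> carrier Q.F \<and> (\<exists>Z\<in>good k. qproj k (u \<oplus>\<^bsub>Q.F\<^esub> v) = Q.emb k (qv Z))"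
      using u v by blast
  next
    fix g assume "g \<in> range Q.scal \<union> Q.tvec ` gvec"
    then show "g \<in> carrier Q.F \<and> (\<exists>Z\<in>good k. qproj k g = Q.emb k (qv Z))"
    proof (elim UnE rangeE imageE)
      fix c assume "g = Q.scal c"
      then show ?thesis
        by (intro conjI bexI[of _ "L c"] good_L[OF k])
          (simp_all only: Q.bproj_scal Q.scal_closed scal_emb[OF k, symmetric])
    next
      fix ps assume g: "g = Q.tvec ps" and p: "ps \<in> gvec"
      note c = Q.tvec_closed[OF gvec_tens[OF p]]
      consider "ps = []" | "map fst ps = [k]" | "ps \<noteq> []" "map fst ps \<noteq> [k]" by blast
      then show ?thesis
      proof cases
        case 1
        then show ?thesis
          by (intro conjI bexI[of _ "L 1"] good_L[OF k])
            (simp_all only: g Q.tvec_Nil Q.bproj_scal Q.scal_closed scal_emb[OF k, symmetric])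
      next
        case 2
        obtain Z where Z: "Z \<in> good k" "Q.tvec ps = Q.emb k (qv Z)" by (rule gvec_single[OF p 2])
        then show ?thesis using c Q.bproj_emb[OF k qv_closed, of Z] by (auto simp: g)
      next
        case 3
        then show ?thesis
          by (intro conjI bexI[of _ 0]) (simp_all add: g c gvec_tens[OF p] Q.bproj_tvec emb_zero[OF k] z(2))
      qed
    qed
  qed
  then show ?thesis ..
qed

lemma bop_emb: "k \<in> K \<Longrightarrow> qproj k v = Q.emb k (qv S) \<Longrightarrow> Z \<in> left_alg \<epsilon> \<Longrightarrow> bop k Z v = Q.emb k (qv (Z * S))"
  by (simp add: bop_def Q.left_reg_emb lmul_left_ops qv_closed lmul_qv Q.bproj_emb del: with_B_simps)

lemma bop_add: "k \<in> K \<Longrightarrow> Z \<in> left_alg \<epsilon> \<Longrightarrow> u \<in> carrier Q.F \<Longrightarrow> v \<in> carrier Q.F \<Longrightarrow>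
    bop k Z (u \<oplus>\<^bsub>Q.F\<^esub> v) = bop k Z u \<oplus>\<^bsub>Q.F\<^esub> bop k Z v"
  by (simp add: bop_def Q.bproj_add Q.left_reg_add Q.bproj_closed Q.left_reg_closed lmul_left_ops)

lemma bop_closed: "k \<in> K \<Longrightarrow> Z \<in> left_alg \<epsilon> \<Longrightarrow> v \<in> carrier Q.F \<Longrightarrow> bop k Z v \<in> carrier Q.F"
  by (simp add: bop_def Q.bproj_closed Q.left_reg_closed lmul_left_ops)

lemma C'D'_left:
  assumes k: "k \<in> K" and c: "c \<in> C' k" and d: "d \<in> D' k"
  shows "c * d \<in> left_alg \<epsilon>"
proof -
  have "c \<in> left_alg \<epsilon>" using C'_C[OF k] c face[OF k] by (auto simp: face_pair_def)
  moreover have "d \<in> left_alg \<epsilon>" using D'_left[OF k] d by blast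
  ultimately show ?thesis using left_alg_subalg by (simp add: subalg_def)
qed

lemma gvec_leading: "ps \<in> gvec \<Longrightarrow> ps \<noteq> [] \<Longrightarrow> ps \<in> leading"
proof -
  assume p: "ps \<in> gvec" "ps \<noteq> []"
  obtain k x qs where ps: "ps = (k, x) # qs" and k: "k \<in> K"
    by (rule Q.hd_pairs_cases[OF gvec_tens[OF p(1)] p(2)])
  then show ?thesis using p legs_mono[OF good_lead[OF k]] by (auto simp: leading_def gvec_Cons)
qed

text \<open>A good tensor with legs is \<open>leading\<close>, so outside the words
  \<open>[k]\<close> the whole value of the pair lies in the span of \<open>bad\<close>. On the
  vacuum and on the words \<open>[k]\<close> both operators multiply by \<open>c * d\<close>, and
  the error is 0.\<close>

lemma pair_diff:
  assumes k: "k \<in> K" and c: "c \<in> C' k" and d: "d \<in> D' k" and v: "v \<in> gspan"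
  shows "\<exists>n\<in>Q.tspan bad. lreg k c (rreg k d v) = bop k (c * d) v \<oplus>\<^bsub>Q.F\<^esub> n"
proof -
  note cd = C'D'_left[OF k c d]
  have e: "\<exists>n\<in>Q.tspan bad. lreg k c (rreg k d (Q.emb k (qv Z))) = bop k (c * d) (Q.emb k (qv Z)) \<oplus>\<^bsub>Q.F\<^esub> n" for Z
  proof (intro bexI[of _ "\<zero>\<^bsub>Q.F\<^esub>"] aspan.aspan_zero)
    have "bop k (c * d) (Q.emb k (qv Z)) = Q.emb k (qv (c * d * Z))"
      by (rule bop_emb[OF k Q.bproj_emb[OF k qv_closed] cd])
    then show "lreg k c (rreg k d (Q.emb k (qv Z))) = bop k (c * d) (Q.emb k (qv Z)) \<oplus>\<^bsub>Q.F\<^esub> \<zero>\<^bsub>Q.F\<^esub>"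
      using pair_emb[OF k c d] Q.emb_closed[OF k qv_closed, of "c * d * Z"] by simp
  qed
  have "v \<in> carrier Q.F \<and> (\<exists>n\<in>Q.tspan bad. lreg k c (rreg k d v) = bop k (c * d) v \<oplus>\<^bsub>Q.F\<^esub> n)"
  proof (rule aspan_pred[OF v[unfolded gspan_def]])
    show "\<zero>\<^bsub>Q.F\<^esub> \<in> carrier Q.F \<and> (\<exists>n\<in>Q.tspan bad. lreg k c (rreg k d \<zero>\<^bsub>Q.F\<^esub>) = bop k (c * d) \<zero>\<^bsub>Q.F\<^esub> \<oplus>\<^bsub>Q.F\<^esub> n)"
      using e[of 0] by (simp add: emb_zero[OF k])
  next
    fix u v
    assume u: "u \<in> carrier Q.F \<and> (\<exists>n\<in>Q.tspan bad. lreg k c (rreg k d u) = bop k (c * d) u \<oplus>\<^bsub>Q.F\<^esub> n)"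
      and v: "v \<in> carrier Q.F \<and> (\<exists>n\<in>Q.tspan bad. lreg k c (rreg k d v) = bop k (c * d) v \<oplus>\<^bsub>Q.F\<^esub> n)"
    then obtain m n where mn: "m \<in> Q.tspan bad" "lreg k c (rreg k d u) = bop k (c * d) u \<oplus>\<^bsub>Q.F\<^esub> m"
      "n \<in> Q.tspan bad" "lreg k c (rreg k d v) = bop k (c * d) v \<oplus>\<^bsub>Q.F\<^esub> n" by blast
    have "lreg k c (rreg k d (u \<oplus>\<^bsub>Q.F\<^esub> v)) = bop k (c * d) (u \<oplus>\<^bsub>Q.F\<^esub> v) \<oplus>\<^bsub>Q.F\<^esub> (m \<oplus>\<^bsub>Q.F\<^esub> n)"
      using u v bad_closed[OF mn(1)] bad_closed[OF mn(3)] bop_closed[OF k cd]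
      by (simp add: pair_add[OF k c d] mn bop_add[OF k cd] Q.F.a_ac)
    then show "u \<oplus>\<^bsub>Q.F\<^esub> v \<in> carrier Q.F \<and> (\<exists>n\<in>Q.tspan bad. lreg k c (rreg k d (u \<oplus>\<^bsub>Q.F\<^esub> v)) = bop k (c * d) (u \<oplus>\<^bsub>Q.F\<^esub> v) \<oplus>\<^bsub>Q.F\<^esub> n)"
      using u v aspan.aspan_add[OF mn(1,3)] by blast
  next
    fix g assume "g \<in> range Q.scal \<union> Q.tvec ` gvec"
    then show "g \<in> carrier Q.F \<and> (\<exists>n\<in>Q.tspan bad. lreg k c (rreg k d g) = bop k (c * d) g \<oplus>\<^bsub>Q.F\<^esub> n)"
    proof (elim UnE rangeE imageE)
      fix b assume g: "g = Q.scal b"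
      then show ?thesis using e[of "L b"] by (simp add: scal_emb[OF k, symmetric] Q.scal_closed)
    next
      fix ps assume g: "g = Q.tvec ps" and p: "ps \<in> gvec"
      note gc = Q.tvec_closed[OF gvec_tens[OF p]]
      consider "ps = []" | "map fst ps = [k]" | "ps \<noteq> []" "map fst ps \<noteq> [k]" by blast
      then show ?thesis
      proof cases
        case 1
        then show ?thesis using e[of "L 1"] by (simp only: g Q.tvec_Nil scal_emb[OF k, symmetric]) (simp add: Q.scal_closed)
      next
        case 2
        obtain Z where Z: "Z \<in> good k" "Q.tvec ps = Q.emb k (qv Z)" by (rule gvec_single[OF p 2])
        then show ?thesis using gc e[of Z] by (simp add: g)
      next
        case 3
        have b: "lreg k c (rreg k d g) \<in> Q.tspan bad"
          unfolding g by (rule leading_left[OF leading_right[OF gvec_leading[OF p 3(1)] k d 3(2)] k c])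
        have "bop k (c * d) g = \<zero>\<^bsub>Q.F\<^esub>"
          using 3 by (simp add: bop_def g Q.bproj_tvec Q.left_reg_zero[OF k lmul_left_ops[OF cd]] Q.bproj_zero)
        then show ?thesis using b gc bad_closed[OF b] by (intro conjI bexI[OF _ b]) (simp_all add: g)
      qed
    qed
  qed
  then show ?thesis ..
qed

section \<open>Replacing pairs by Boolean operators\<close>

lemma letters_append: "letters (u @ w) \<longleftrightarrow> letters u \<and> letters w"
  by (simp add: letters_def)

lemma qrun_append: "qrun (u @ w) v = qrun u (qrun w v)"
  by (simp add: qrun_def)

lemma qrun_hom:
  assumes "letters u"
  shows "(v \<in> carrier Q.F \<longrightarrow> qrun u v \<in> carrier Q.F) \<and>
    (v \<in> carrier Q.F \<longrightarrow> w \<in> carrier Q.F \<longrightarrow> qrun u (v \<oplus>\<^bsub>Q.F\<^esub> w) = qrun u v \<oplus>\<^bsub>Q.F\<^esub> qrun u w)"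
  using assms
proof (induction u arbitrary: v w)
  case (Cons p u)
  show ?case
  proof (cases p rule: letter_cases)
    case p: (left i a)
    then have i: "i \<in> K" "a \<in> C i" "letters u" using Cons.prems by simp_all
    have c: "qrun u v \<in> carrier Q.F" if "v \<in> carrier Q.F" for v using Cons.IH[OF i(3)] that by blast
    have ad: "qrun u (v \<oplus>\<^bsub>Q.F\<^esub> w) = qrun u v \<oplus>\<^bsub>Q.F\<^esub> qrun u w" if "v \<in> carrier Q.F" "w \<in> carrier Q.F" for v w
      using Cons.IH[OF i(3)] that by blast
    show ?thesis
      by (simp add: p c ad Q.left_reg_closed[OF i(1) lmul_C[OF i(1,2)]] Q.left_reg_add[OF i(1) lmul_C[OF i(1,2)]])
  next
    case p: (right i a)
    then have i: "i \<in> K" "a \<in> D i" "letters u" using Cons.prems by simp_all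
    have c: "qrun u v \<in> carrier Q.F" if "v \<in> carrier Q.F" for v using Cons.IH[OF i(3)] that by blast
    have ad: "qrun u (v \<oplus>\<^bsub>Q.F\<^esub> w) = qrun u v \<oplus>\<^bsub>Q.F\<^esub> qrun u w" if "v \<in> carrier Q.F" "w \<in> carrier Q.F" for v w
      using Cons.IH[OF i(3)] that by blast
    show ?thesis
      by (simp add: p c ad Q.right_reg_closed[OF i(1) lmul_D[OF i(1,2)]] Q.right_reg_add[OF i(1) lmul_D[OF i(1,2)]])
  qed
qed simp

lemmas qrun_add = qrun_hom[THEN conjunct2, rule_format]

text \<open>Words of regular operators under which errors remain errors. The invariance itself is
  the definition, so that a pair can be appended as two letters although neither letter is claimed
  to preserve bad vectors by itself.\<close>

definition prefix :: "(('k + 'k) \<times> 'a) list \<Rightarrow> bool" where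
  "prefix u \<longleftrightarrow> letters u \<and> (\<forall>v\<in>Q.tspan bad. qrun u v \<in> Q.tspan bad)"

lemma prefix_Nil: "prefix []"
  by (simp add: prefix_def)

lemma prefix_left: "prefix u \<Longrightarrow> k \<in> K \<Longrightarrow> a \<in> Al k \<Longrightarrow> prefix (u @ [(Inl k, a)])"
  using Al_C[of k] bad_left by (auto simp: prefix_def letters_append qrun_append)

lemma prefix_right: "prefix u \<Longrightarrow> k \<in> K \<Longrightarrow> a \<in> Ar k \<Longrightarrow> prefix (u @ [(Inr k, a)])"
  using Ar_D[of k] bad_right by (auto simp: prefix_def letters_append qrun_append)

lemma prefix_pair: "prefix u \<Longrightarrow> k \<in> K \<Longrightarrow> c \<in> C' k \<Longrightarrow> d \<in> D' k \<Longrightarrow> prefix (u @ [(Inl k, c), (Inr k, d)])"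
  using C'_C[of k] D'_D[of k] bad_pair by (auto simp: prefix_def letters_append qrun_append)

text \<open>A hybrid moment formula: the part \<open>S\<close> of a product has already been
  translated, with Boolean operators for pairs, and has produced \<open>v\<close>; the letters of
  \<open>u\<close> still act by regular operators. Since all prefixes \<open>u\<close> are covered
  at once, a letter can be moved from \<open>u\<close> to \<open>S\<close>.\<close>

definition models :: "'a \<Rightarrow> ('b, 'k, 'a set) free_vec \<Rightarrow> bool" where
  "models S v \<longleftrightarrow> v \<in> gspan \<and> (\<forall>u. prefix u \<longrightarrow> E (prod_list (map snd u) * S) = fst (qrun u v))"

text \<open>Nothing has been translated yet, so this is the moment formula \<open>qrun_E\<close> on
  the copies of \<open>quot\<close>.\<close>

lemma models_vacuum: "models 1 (Q.scal 1)"
  using qrun_E by (auto simp: models_def gspan_scal prefix_def)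

lemma models_left:
  assumes m: "models S v" and k: "k \<in> K" and a: "a \<in> Al k"
  shows "models (a * S) (lreg k a v)"
  unfolding models_def
proof (intro conjI allI impI)
  show "lreg k a v \<in> gspan" using m k a by (simp add: models_def gspan_left)
  fix u assume "prefix u"
  then have "prefix (u @ [(Inl k, a)])" using k a by (rule prefix_left)
  then have "E (prod_list (map snd (u @ [(Inl k, a)])) * S) = fst (qrun (u @ [(Inl k, a)]) v)"
    using m unfolding models_def by blast
  then show "E (prod_list (map snd u) * (a * S)) = fst (qrun u (lreg k a v))"
    by (simp add: qrun_append mult.assoc)
qed

lemma models_right:
  assumes m: "models S v" and k: "k \<in> K" and a: "a \<in> Ar k"
  shows "models (a * S) (rreg k a v)"
  unfolding models_def
proof (intro conjI allI impI)
  show "rreg k a v \<in> gspan" using m k a by (simp add: models_def gspan_right)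
  fix u assume "prefix u"
  then have "prefix (u @ [(Inr k, a)])" using k a by (rule prefix_right)
  then have "E (prod_list (map snd (u @ [(Inr k, a)])) * S) = fst (qrun (u @ [(Inr k, a)]) v)"
    using m unfolding models_def by blast
  then show "E (prod_list (map snd u) * (a * S)) = fst (qrun u (rreg k a v))"
    by (simp add: qrun_append mult.assoc)
qed

lemma models_pair:
  assumes m: "models S v" and k: "k \<in> K" and c: "c \<in> C' k" and d: "d \<in> D' k"
  shows "models (c * d * S) (bop k (c * d) v)"
  unfolding models_def
proof (intro conjI allI impI)
  have v: "v \<in> gspan" using m by (simp add: models_def)
  note cd = C'D'_left[OF k c d]
  obtain Z where Z: "Z \<in> good k" "qproj k v = Q.emb k (qv Z)" using qproj_gspan[OF k v] by blast
  show "bop k (c * d) v \<in> gspan"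
    unfolding bop_emb[OF k Z(2) cd] by (rule gspan_emb[OF k good_pair[OF c d Z(1)]])
  \<comment> \<open>The pair is first attached to the prefix as two regular operators. These are
    then exchanged for the Boolean operator; the prefix keeps the error bad, so it has no vacuum
    part.\<close>
  fix u assume u: "prefix u"
  then have "prefix (u @ [(Inl k, c), (Inr k, d)])" using k c d by (rule prefix_pair)
  then have "E (prod_list (map snd (u @ [(Inl k, c), (Inr k, d)])) * S) = fst (qrun (u @ [(Inl k, c), (Inr k, d)]) v)"
    using m unfolding models_def by blast
  then have *: "E (prod_list (map snd u) * (c * d * S)) = fst (qrun u (lreg k c (rreg k d v)))"
    by (simp add: qrun_append mult.assoc)
  obtain n where n: "n \<in> Q.tspan bad" "lreg k c (rreg k d v) = bop k (c * d) v \<oplus>\<^bsub>Q.F\<^esub> n"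
    using pair_diff[OF k c d v] by blast
  have "qrun u n \<in> Q.tspan bad" using u n by (simp add: prefix_def)
  then have "fst (qrun u n) = 0" using Q.tspan_fst bad_ne by blast
  moreover have "letters u" using u by (simp add: prefix_def)
  ultimately show "E (prod_list (map snd u) * (c * d * S)) = fst (qrun u (bop k (c * d) v))"
    using * n qrun_add[OF \<open>letters u\<close> bop_closed[OF k cd gspan_closed[OF v]] bad_closed[OF n(1)]]
    by (simp add: Q.fst_add)
qed

text \<open>The elements with the desired property form a subalgebra containing the pairs. For
  products, the range of \<open>bop k Z\<close> on good vectors is fixed by the projection, so
  \<open>bop k Y\<close> after \<open>bop k Z\<close> is \<open>bop k (Y * Z)\<close>. Complex
  multiples are reached through the letter \<open>L (c *\<^sub>C 1)\<close> of
  \<open>Al k\<close>.\<close>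

lemma models_alg:
  assumes k: "k \<in> K" and Z: "Z \<in> alg (C' k * D' k)"
  shows "Z \<in> left_alg \<epsilon> \<and> (\<forall>S v. models S v \<longrightarrow> models (Z * S) (bop k Z v))"
proof -
  define G where "G = {Z \<in> left_alg \<epsilon>. (\<forall>S\<in>good k. Z * S \<in> good k) \<and>
    (\<forall>S v. models S v \<longrightarrow> models (Z * S) (bop k Z v))}"
  have "C' k * D' k \<subseteq> G"
  proof
    fix Z assume "Z \<in> C' k * D' k"
    then obtain c d where Z: "Z = c * d" "c \<in> C' k" "d \<in> D' k" by (rule set_times_elim)
    then show "Z \<in> G"
      using C'D'_left[OF k] good_pair models_pair[OF _ k] by (simp add: G_def)
  qed
  moreover have "subalg G"
    unfolding subalg_def
  proof (intro conjI ballI allI)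
    have zero: "models 0 \<zero>\<^bsub>Q.F\<^esub>"
      unfolding models_def
    proof (intro conjI allI impI)
      show "\<zero>\<^bsub>Q.F\<^esub> \<in> gspan" using gspan_scal[of 0] by (simp add: Q.F_zero)
      fix u assume "prefix u"
      then have "letters u" by (simp add: prefix_def)
      then have "qrun u \<zero>\<^bsub>Q.F\<^esub> = qrun u \<zero>\<^bsub>Q.F\<^esub> \<oplus>\<^bsub>Q.F\<^esub> qrun u \<zero>\<^bsub>Q.F\<^esub>"
        using qrun_add[of u "\<zero>\<^bsub>Q.F\<^esub>" "\<zero>\<^bsub>Q.F\<^esub>"] by simp
      then have "fst (qrun u \<zero>\<^bsub>Q.F\<^esub>) = fst (qrun u \<zero>\<^bsub>Q.F\<^esub>) + fst (qrun u \<zero>\<^bsub>Q.F\<^esub>)"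
        by (metis Q.fst_add)
      then show "E (prod_list (map snd u) * 0) = fst (qrun u \<zero>\<^bsub>Q.F\<^esub>)" by (simp add: E.zero)
    qed
    have z: "0 \<in> left_alg \<epsilon>" using left_alg_subalg by (simp add: subalg_def)
    show "0 \<in> G"
      unfolding G_def
    proof (intro CollectI conjI allI impI ballI z)
      show "0 * S \<in> good k" for S using good_L[OF k, of 0] by simp
      fix S v assume "models S v"
      then obtain W where "qproj k v = Q.emb k (qv W)" using qproj_gspan[OF k] unfolding models_def by blast
      then have "bop k 0 v = \<zero>\<^bsub>Q.F\<^esub>" using bop_emb[OF k _ z] emb_zero[OF k] by simp
      then show "models (0 * S) (bop k 0 v)" using zero by simp
    qed
  next
    fix Y Z assume YZ: "Y \<in> G" "Z \<in> G"
    then have l: "Y \<in> left_alg \<epsilon>" "Z \<in> left_alg \<epsilon>" by (auto simp: G_def)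
    have l': "Y + Z \<in> left_alg \<epsilon>" "Y * Z \<in> left_alg \<epsilon>" using l left_alg_subalg by (simp_all add: subalg_def)
    show "Y + Z \<in> G"
      unfolding G_def
    proof (intro CollectI conjI allI impI ballI l')
      show "(Y + Z) * S \<in> good k" if "S \<in> good k" for S
        using that YZ by (simp add: G_def distrib_right good_add)
      fix S v assume m: "models S v"
      then obtain W where W: "qproj k v = Q.emb k (qv W)" using qproj_gspan[OF k] unfolding models_def by blast
      have b: "bop k (Y + Z) v = bop k Y v \<oplus>\<^bsub>Q.F\<^esub> bop k Z v"
        using Q.emb_add[OF k qv_closed qv_closed, of "Y * W" "Z * W"]
        by (simp add: bop_emb[OF k W] l l' distrib_right qv_add)
      have m': "models (Y * S) (bop k Y v)" "models (Z * S) (bop k Z v)" using YZ m unfolding G_def by blast+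
      show "models ((Y + Z) * S) (bop k (Y + Z) v)"
        unfolding models_def b
      proof (intro conjI allI impI)
        show "bop k Y v \<oplus>\<^bsub>Q.F\<^esub> bop k Z v \<in> gspan" using m' by (simp add: models_def gspan_add)
        fix u assume u: "prefix u"
        then have "letters u" by (simp add: prefix_def)
        moreover have "bop k Y v \<in> carrier Q.F" "bop k Z v \<in> carrier Q.F"
          using m' gspan_closed unfolding models_def by blast+
        ultimately show "E (prod_list (map snd u) * ((Y + Z) * S)) = fst (qrun u (bop k Y v \<oplus>\<^bsub>Q.F\<^esub> bop k Z v))"
          using m' u by (simp add: qrun_add Q.fst_add models_def distrib_left distrib_right E.add)
      qed
    qed
    show "Y * Z \<in> G"
      unfolding G_def
    proof (intro CollectI conjI allI impI ballI l')
      show "Y * Z * S \<in> good k" if "S \<in> good k" for S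
        using that YZ by (simp add: G_def mult.assoc)
      fix S v assume m: "models S v"
      then obtain W where W: "qproj k v = Q.emb k (qv W)" using qproj_gspan[OF k] unfolding models_def by blast
      have "qproj k (bop k Z v) = Q.emb k (qv (Z * W))"
        by (simp only: bop_emb[OF k W l(2)] Q.bproj_emb[OF k qv_closed])
      then have "bop k (Y * Z) v = bop k Y (bop k Z v)"
        by (simp add: bop_emb[OF k] W l l' mult.assoc)
      moreover have "models (Y * (Z * S)) (bop k Y (bop k Z v))" using YZ m unfolding G_def by blast
      ultimately show "models (Y * Z * S) (bop k (Y * Z) v)" by (simp add: mult.assoc)
    qed
  next
    fix c Z assume Z: "Z \<in> G"
    then have l: "Z \<in> left_alg \<epsilon>" by (simp add: G_def)
    have l': "c *\<^sub>C Z \<in> left_alg \<epsilon>" using l left_alg_subalg by (simp add: subalg_def)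
    have c: "L (c *\<^sub>C 1) \<in> Al k" using sub_face[OF k] by (auto simp: face_pair_def)
    have Lc: "L (c *\<^sub>C 1) * S = c *\<^sub>C S" for S by (simp add: L_scale mult_scaleC_left)
    show "c *\<^sub>C Z \<in> G"
      unfolding G_def
    proof (intro CollectI conjI allI impI ballI l')
      show "c *\<^sub>C Z * S \<in> good k" if "S \<in> good k" for S
        using that Z good_smult[OF k, of "Z * S" "c *\<^sub>C 1"] by (simp add: G_def Lc mult_scaleC_left)
      fix S v assume m: "models S v"
      then obtain W where W: "qproj k v = Q.emb k (qv W)" using qproj_gspan[OF k] unfolding models_def by blast
      have "models (Z * S) (bop k Z v)" using Z m unfolding G_def by blast
      from models_left[OF this k c]
      have "models (c *\<^sub>C (Z * S)) (lreg k (L (c *\<^sub>C 1)) (bop k Z v))" by (simp add: Lc)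
      moreover have "lreg k (L (c *\<^sub>C 1)) (bop k Z v) = bop k (c *\<^sub>C Z) v"
        by (simp only: bop_emb[OF k W l] bop_emb[OF k W l'] Q.left_reg_emb[OF k lmul_Al[OF k c] qv_closed] lmul_qv Lc
            mult_scaleC_left)
      ultimately show "models (c *\<^sub>C Z * S) (bop k (c *\<^sub>C Z) v)" by (simp add: mult_scaleC_left)
    qed
  qed
  ultimately have "alg (C' k * D' k) \<subseteq> G" by (rule alg_minimal)
  then show ?thesis using Z by (auto simp: G_def)
qed

text \<open>Induction over the word from its right end, the order in which the operators meet the
  vacuum. When every letter has been translated, the remaining prefix is empty.\<close>

lemma ffb_distribution:
  "same_distribution E (free_expectation K (\<lambda>_. quot)) (K <+> (K <+> K))
     (case_sum Al (case_sum Ar (\<lambda>k. alg (C' k * D' k))))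
     (case_sum (\<lambda>k Z. lreg k Z) (case_sum (\<lambda>k Z. rreg k Z)
       (\<lambda>k Z. qproj k \<circ> lreg k Z \<circ> qproj k)))"
  unfolding same_distribution_def
proof (intro allI impI, elim conjE)
  let ?op = "case_sum (\<lambda>k Z. lreg k Z) (case_sum (\<lambda>k Z. rreg k Z) (\<lambda>k Z. qproj k \<circ> lreg k Z \<circ> qproj k))"
  fix w assume w: "set w \<subseteq> Sigma (K <+> (K <+> K)) (case_sum Al (case_sum Ar (\<lambda>k. alg (C' k * D' k))))"
  have "models (prod_list (map snd w)) (foldr (\<lambda>(j, Z) v. ?op j Z v) w (Q.scal 1))"
    using w
  proof (induction w)
    case Nil
    then show ?case using models_vacuum by simp
  next
    case (Cons p w)
    obtain j Z where p: "p = (j, Z)" by force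
    have IH: "models (prod_list (map snd w)) (foldr (\<lambda>(j, Z) v. ?op j Z v) w (Q.scal 1))"
      using Cons by simp
    consider k where "j = Inl k" "k \<in> K" "Z \<in> Al k" | k where "j = Inr (Inl k)" "k \<in> K" "Z \<in> Ar k"
      | k where "j = Inr (Inr k)" "k \<in> K" "Z \<in> alg (C' k * D' k)"
      using Cons.prems p by auto
    then show ?case
    proof cases
      case 1
      then show ?thesis using models_left[OF IH 1(2,3)] by (simp add: p)
    next
      case 2
      then show ?thesis using models_right[OF IH 2(2,3)] by (simp add: p)
    next
      case 3
      then show ?thesis using models_alg[OF 3(2,3), THEN conjunct2, rule_format, OF IH] 3(1) by (simp add: p bop_def)
    qed
  qed
  then show "E (prod_list (map snd w)) = free_expectation K (\<lambda>_. quot) (foldr (\<lambda>(j, Z) T. ?op j Z \<circ> T) w id)"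
    unfolding models_def free_expectation_def foldr_comp using prefix_Nil by force
qed

end

section \<open>Face conditions, unitality and conclusion\<close>

text \<open>Applied to \<open>b = L b'\<close>, which need not lie in the non-unital algebra
  \<open>alg P\<close>; stability is checked on generators and propagates because \<open>b\<close>
  meets only the leftmost factor.\<close>

lemma L_mult_alg:
  fixes P :: "'a::complex_algebra_1 set"
  assumes "\<And>p. p \<in> P \<Longrightarrow> b * p \<in> alg P"
  shows "Z \<in> alg P \<Longrightarrow> b * Z \<in> alg P"
proof -
  have s: "subalg (alg P)" by (rule subalg_alg)
  have "alg P \<subseteq> {Z \<in> alg P. b * Z \<in> alg P}"
  proof (rule alg_minimal)
    show "P \<subseteq> {Z \<in> alg P. b * Z \<in> alg P}" using assms alg_superset[of P] by blast
    show "subalg {Z \<in> alg P. b * Z \<in> alg P}"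
      using s by (auto simp: subalg_def distrib_left mult_scaleC_right simp flip: mult.assoc)
  qed
  then show "Z \<in> alg P \<Longrightarrow> b * Z \<in> alg P" by blast
qed

lemma R_mult_alg:
  fixes P :: "'a::complex_algebra_1 set"
  assumes "\<And>p. p \<in> P \<Longrightarrow> p * b \<in> alg P"
  shows "Z \<in> alg P \<Longrightarrow> Z * b \<in> alg P"
proof -
  have s: "subalg (alg P)" by (rule subalg_alg)
  have "alg P \<subseteq> {Z \<in> alg P. Z * b \<in> alg P}"
  proof (rule alg_minimal)
    show "P \<subseteq> {Z \<in> alg P. Z * b \<in> alg P}" using assms alg_superset[of P] by blast
    show "subalg {Z \<in> alg P. Z * b \<in> alg P}"
      using s by (auto simp: subalg_def distrib_right mult_scaleC_left mult.assoc)
  qed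
  then show "Z \<in> alg P \<Longrightarrow> Z * b \<in> alg P" by blast
qed

context ffb_system
begin

lemma alg_pairs_left: "k \<in> K \<Longrightarrow> alg (C' k * D' k) \<subseteq> left_alg \<epsilon>"
  using models_alg by blast

lemma lmul_faces:
  assumes k: "k \<in> K"
  shows "lmul ` Al k \<subseteq> left_ops (with_B quot)" and "lmul ` Ar k \<subseteq> right_ops (with_B quot)"
    and "lmul ` alg (C' k * D' k) \<subseteq> left_ops (with_B quot)"
  using lmul_Al[OF k] lmul_Ar[OF k] lmul_left_ops alg_pairs_left[OF k] by blast+

lemma face_triple_alg:
  assumes k: "k \<in> K" and LC: "\<And>b c. c \<in> C' k \<Longrightarrow> L b * c \<in> C' k" and CL: "\<And>b c. c \<in> C' k \<Longrightarrow> c * L b \<in> C' k"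
  shows "face_triple \<epsilon> (Al k) (Ar k) (alg (C' k * D' k))"
  unfolding face_triple_def
proof (intro conjI sub_face[OF k] subalg_alg alg_pairs_left[OF k])
  let ?S = "alg (C' k * D' k)"
  have LS: "L b * Z \<in> ?S" if "Z \<in> ?S" for b Z
  proof (rule L_mult_alg[OF _ that])
    fix p assume "p \<in> C' k * D' k"
    then obtain c d where "p = c * d" "c \<in> C' k" "d \<in> D' k" by (rule set_times_elim)
    then have "L b * p \<in> C' k * D' k" using LC[of c b] by (simp add: set_times_intro flip: mult.assoc)
    then show "L b * p \<in> ?S" using alg_superset by blast
  qed
  have SL: "Z * L b \<in> ?S" if "Z \<in> ?S" for b Z
  proof (rule R_mult_alg[OF _ that])
    fix p assume "p \<in> C' k * D' k"
    then obtain c d where p: "p = c * d" "c \<in> C' k" "d \<in> D' k" by (rule set_times_elim)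
    \<comment> \<open>\<open>d\<close> belongs to the right face and lets \<open>L b\<close> pass,
      which is then absorbed by \<open>C' k\<close> from the right.\<close>
    have "d * L b = L b * d"
      using D'_D[OF k] face[OF k] p(3) by (auto simp: face_pair_def right_alg_def)
    then have "p * L b = c * L b * d" using p(1) by (simp add: mult.assoc)
    then have "p * L b \<in> C' k * D' k" using CL[OF p(2)] p(3) by (simp add: set_times_intro)
    then show "p * L b \<in> ?S" using alg_superset by blast
  qed
  show "range L * ?S * range L \<subseteq> ?S"
  proof
    fix Z assume "Z \<in> range L * ?S * range L"
    then obtain b c S where "Z = L b * S * L c" "S \<in> ?S" by (elim set_times_elim rangeE) blast
    then show "Z \<in> ?S" using LS SL by simp
  qed
qed

lemma ffb_independence:
  assumes "\<And>k b c. k \<in> K \<Longrightarrow> c \<in> C' k \<Longrightarrow> L b * c \<in> C' k"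
    and "\<And>k b c. k \<in> K \<Longrightarrow> c \<in> C' k \<Longrightarrow> c * L b \<in> C' k"
  shows "ffb_independent TYPE('a set) E \<epsilon> K Al Ar (\<lambda>k. alg (C' k * D' k))"
  unfolding ffb_independent_def
proof (intro conjI ballI exI[of _ "\<lambda>_. quot"] exI[of _ "\<lambda>_. lmul"])
  fix k assume k: "k \<in> K"
  show "face_triple \<epsilon> (Al k) (Ar k) (alg (C' k * D' k))"
    using assms k by (intro face_triple_alg) blast+
  show "bimodule quot" by (rule quot_bimodule)
  show "unital_rep (Al k) (with_B quot) (left_ops (with_B quot)) lmul"
    "unital_rep (Ar k) (with_B quot) (right_ops (with_B quot)) lmul"
    "rep (alg (C' k * D' k)) (with_B quot) (left_ops (with_B quot)) lmul"
    using lmul_faces[OF k] by (simp_all add: lmul_unital_rep lmul_rep)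
qed (rule ffb_distribution)

end

text \<open>The moment of the one-letter word \<open>1\<close>: a unital representation fixes the
  vacuum vector, whose \<open>B\<close>-component is 1.\<close>

lemma bifree_E_one:
  fixes E :: "'a::complex_algebra_1 \<Rightarrow> 'b::complex_algebra_1" and K :: "'k set"
  assumes K: "k \<in> K" and free: "bifree TYPE('x) E \<epsilon> K C D"
  shows "E 1 = 1"
proof -
  obtain X :: "'k \<Rightarrow> ('b, 'x) bimodule" and l r where
    X: "\<And>k. k \<in> K \<Longrightarrow> bimodule (X k)" and
    l: "unital_rep (C k) (with_B (X k)) (left_ops (with_B (X k))) (l k)" and
    d: "same_distribution E (free_expectation K X) (K <+> K) (case_sum C D)
         (case_sum (\<lambda>k Z. left_reg K X k (l k Z)) (\<lambda>k Z. right_reg K X k (r k Z)))" and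
    f: "face_pair \<epsilon> (C k) (D k)"
    using free K unfolding bifree_def by blast
  interpret free_prod K X by (rule free_prod.intro) (rule X)
  interpret Xk: bimodule "X k" by (rule X[OF K])
  have one: "1 \<in> C k" using f by (simp add: face_pair_def)
  have la: "l k 1 \<in> left_ops (with_B (X k))" and u: "l k 1 (1, \<zero>\<^bsub>X k\<^esub>) = (1, \<zero>\<^bsub>X k\<^esub>)"
    using l one by (auto simp: unital_rep_def rep_def with_B_def)
  have "E (prod_list (map snd [(Inl k :: 'k + 'k, 1 :: 'a)])) =
      free_expectation K X (foldr (\<lambda>(j, Z) S. case_sum (\<lambda>k Z. left_reg K X k (l k Z))
        (\<lambda>k Z. right_reg K X k (r k Z)) j Z \<circ> S) [(Inl k, 1)] id)"
    by (rule d[unfolded same_distribution_def, rule_format]) (use K one in auto)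
  then have "E 1 = fst (left_reg K X k (l k 1) (scal 1))"
    by (simp add: free_expectation_def)
  also have "left_reg K X k (l k 1) (scal 1) = scal 1"
    using left_reg_emb[OF K la vacuum_closed[OF K], of 1] u emb_scalar[OF K, of 1] by simp
  finally show ?thesis by (simp add: free_scalar_def)
qed

theorem theorem5p11:
  fixes E :: "'a::complex_algebra_1 \<Rightarrow> 'b::complex_algebra_1"
    and \<epsilon> :: "('b, 'a) bbop_map"
    and K :: "'k set"
    and Al Ar C' D' :: "'k \<Rightarrow> 'a set"
  assumes "bb_prob_space E \<epsilon>"
    and "bifree_ffb_system TYPE('x) E \<epsilon> K Al Ar C' D'"
  shows "ffb_independent TYPE('a set) E \<epsilon> K Al Ar (\<lambda>k. alg (C' k * D' k))"
proof (cases "K = {}")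
  case True
  \<comment> \<open>Without a colour no realization can supply \<open>E 1 = 1\<close>, but then the
    equality of distributions ranges over no word at all.\<close>
  then have "w = []" if "set w \<subseteq> Sigma (K <+> (K <+> K)) S" for w :: "(('k + ('k + 'k)) \<times> 'a) list" and S
    using that by (cases w) auto
  then have "same_distribution E E' (K <+> (K <+> K)) S \<Phi>" for E' S
    and \<Phi> :: "'k + ('k + 'k) \<Rightarrow> 'a \<Rightarrow> ('b, 'k, 'a set) free_vec \<Rightarrow> ('b, 'k, 'a set) free_vec"
    unfolding same_distribution_def by blast
  then show ?thesis using True by (simp add: ffb_independent_def)
next
  case False
  then obtain k0 where k0: "k0 \<in> K" by blast
  from assms(2) obtain C D where
    CD: "\<forall>k\<in>K. subalg (C k) \<and> subalg (D k) \<and> face_pair \<epsilon> (Al k) (Ar k)"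
      "\<forall>k\<in>K. C' k \<subseteq> C k \<and> D' k \<subseteq> D k \<inter> left_alg \<epsilon> \<and>
        (\<forall>b. {L_op \<epsilon> b} * C' k \<subseteq> C' k \<and> C' k * {L_op \<epsilon> b} \<subseteq> C' k)" and
    free: "bifree TYPE('x) E \<epsilon> K (\<lambda>k. alg (Al k \<union> C k)) (\<lambda>k. alg (Ar k \<union> D k))"
    unfolding bifree_ffb_system_def by (elim conjE exE) (rule that; assumption)
  have null: "C' k * alg (Al k \<union> Ar k) * C' k = {0}"
    and E_null: "Z \<in> alg (Al k \<union> Ar k) * C' k * alg (Al k \<union> Ar k) *
      (D' k * alg (Al k \<union> Ar k) * C' k) ^ n * alg (Al k \<union> Ar k) \<Longrightarrow> E Z = 0" if "k \<in> K" for k n Z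
    using assms(2)[unfolded bifree_ffb_system_def Let_def, THEN conjunct2, rule_format, OF that] by simp_all
  from free obtain X :: "'k \<Rightarrow> ('b, 'x) bimodule" and l r where
    X: "\<forall>k\<in>K. bimodule (X k) \<and>
      unital_rep (alg (Al k \<union> C k)) (with_B (X k)) (left_ops (with_B (X k))) (l k) \<and>
      unital_rep (alg (Ar k \<union> D k)) (with_B (X k)) (right_ops (with_B (X k))) (r k)" and
    d: "same_distribution E (free_expectation K X) (K <+> K)
         (case_sum (\<lambda>k. alg (Al k \<union> C k)) (\<lambda>k. alg (Ar k \<union> D k)))
         (case_sum (\<lambda>k Z. left_reg K X k (l k Z)) (\<lambda>k Z. right_reg K X k (r k Z)))" and
    f: "\<forall>k\<in>K. face_pair \<epsilon> (alg (Al k \<union> C k)) (alg (Ar k \<union> D k))"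
    unfolding bifree_def by (elim conjE exE) (rule that; assumption)
  interpret unital_bb E \<epsilon>
    by (intro unital_bb.intro unital_bb_axioms.intro assms(1) bifree_E_one[OF k0 free])
  interpret free_prod K X by (rule free_prod.intro) (use X in blast)
  interpret ffb_system E \<epsilon> K X "\<lambda>k. alg (Al k \<union> C k)" "\<lambda>k. alg (Ar k \<union> D k)" l r Al Ar C' D'
  proof
    fix k assume k: "k \<in> K"
    show "face_pair \<epsilon> (alg (Al k \<union> C k)) (alg (Ar k \<union> D k))" "face_pair \<epsilon> (Al k) (Ar k)"
      using X f CD(1) k by simp_all
    show "l k a \<in> left_ops (with_B (X k))" if "a \<in> alg (Al k \<union> C k)" for a
      using bspec[OF X k] that unfolding unital_rep_def rep_def image_subset_iff by (elim conjE) (erule (1) bspec)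
    show "r k a \<in> right_ops (with_B (X k))" if "a \<in> alg (Ar k \<union> D k)" for a
      using bspec[OF X k] that unfolding unital_rep_def rep_def image_subset_iff by (elim conjE) (erule (1) bspec)
    show "Al k \<subseteq> alg (Al k \<union> C k)" "C' k \<subseteq> alg (Al k \<union> C k)"
      using alg_superset[of "Al k \<union> C k"] CD(2) k by blast+
    show "Ar k \<subseteq> alg (Ar k \<union> D k)" "D' k \<subseteq> alg (Ar k \<union> D k)"
      using alg_superset[of "Ar k \<union> D k"] CD(2) k by blast+
    show "D' k \<subseteq> left_alg \<epsilon>" using CD(2) k by blast
    show "c * a * c' = 0" if "c \<in> C' k" "a \<in> alg (Al k \<union> Ar k)" "c' \<in> C' k" for c a c'
    proof -
      have "c * a * c' \<in> C' k * alg (Al k \<union> Ar k) * C' k" using that by (intro set_times_intro)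
      then show ?thesis using null[OF k] by simp
    qed
    show "E Z = 0" if "Z \<in> alg (Al k \<union> Ar k) * C' k * alg (Al k \<union> Ar k) *
      (D' k * alg (Al k \<union> Ar k) * C' k) ^ n * alg (Al k \<union> Ar k)" for Z n
      by (rule E_null[OF k that])
  qed (rule d)
  show ?thesis
  proof (rule ffb_independence)
    fix k b c assume "k \<in> K" "c \<in> C' k"
    then show "L b * c \<in> C' k" "c * L b \<in> C' k"
      using CD(2) set_times_intro[of "L b" "{L b}" c "C' k"] set_times_intro[of c "C' k" "L b" "{L b}"] by blast+
  qed
qed

end
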